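(* The algebra $\mathcal U=U_{q,p}(\widehat{\mathfrak{gl}}_N)$ is an $H$-algebra with bigrading $\mathcal U=\bigoplus_{\alpha,\beta\in H^*}\mathcal U_{\alpha,\beta}$, $$\mathcal U_{\alpha\beta}=\{a\in\mathcal U\mid q^{P+h}aq^{-(P+h)}=q^{\langle\alpha,P+h\rangle}a,\ q^Paq^{-P}=q^{\langle\beta,P\rangle}a\ \ \forall\,P+h,P\in H\},$$ and moment maps $\mu_l,\mu_r:\mathbb F\to\mathcal U_{0,0}$ defined by $\mu_l(\hat f)=f(P+h,p)\in\mathbb F[[p]]$, $\mu_r(\hat f)=f(P,p^* )\in\mathbb F[[p]]$.
   Context: **Notation.** $N\ge2$; $\epsilon_1,\dots,\epsilon_N$ is an orthonormal basis of $\mathbb R^N$, $\bar\epsilon_j=\epsilon_j-\frac1N\sum_k\epsilon_k$, so $(\bar\epsilon_j,\bar\epsilon_k)=\delta_{jk}-\frac1N$; $\alpha_j=\bar\epsilon_j-\bar\epsilon_{j+1}$ $(1\le j\le N-1)$; $\bar{\mathfrak h}^*=\bigoplus_j\mathbb C\alpha_j$, with dual $\bar{\mathfrak h}$ spanned by $h_{\bar\epsilon_j}$, $\langle\bar\epsilon_i,h_{\bar\epsilon_j}\rangle=(\bar\epsilon_i,\bar\epsilon_j)$. Dynamical parameters $P_{\bar\epsilon_j}$ and duals $Q_{\bar\epsilon_j}$ satisfy $[P_{\bar\epsilon_j},Q_{\bar\epsilon_k}]=(\bar\epsilon_j,\bar\epsilon_k)$, all other commutators zero. $h_\alpha,P_\alpha,Q_\alpha$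 are linear in $\alpha$; $(P+h)_\alpha=P_\alpha+h_\alpha$. $H=\bar{\mathfrak h}\oplus\sum_j\mathbb CP_{\bar\epsilon_j}\oplus\mathbb Cc=\sum_j\mathbb C(P+h)_{\bar\epsilon_j}+\sum_j\mathbb CP_{\bar\epsilon_j}+\mathbb Cc$, $H^*=\bar{\mathfrak h}^*\oplus\sum_j\mathbb CQ_{\bar\epsilon_j}\oplus\mathbb C\Lambda_0$, pairing $\langle Q_\alpha,P_\beta\rangle=(\alpha,\beta)=\langle\alpha,h_\beta\rangle$, $\langle\Lambda_0,c\rangle=1$, others $0$. $\mathbb F=\mathcal M_{H^*}$ is the field of meromorphic functions on $H^*$, elements $f(P+h,P)$. In the grading, "$P+h$" ranges over linear combinations of the $(P+h)_{\bar\epsilon_j}$ and "$P$" over those of the $P_{\bar\epsilon_j}$; so the first degree matters only through its values on the $(P+h)_{\bar\epsilon_j}$ and the second through its values on the $P_{\bar\epsilon_j}$. In the moment maps, $\hat f$ is a function $f$ of one set of dynamical variables (possibly depending on the elliptic nome as a parameter), evaluated at $(P+h,p)$, respectively $(P,p^* )$. $g(P-\langle\mu,P\rangle)$ means each $P_\beta$ is replaced by $P_\beta-\langle\mu,P_\beta\rangle$, similarly for $P+h$. $q=e^\hbar$ and $p$ are indeterminates, $p^*=pq^{-2c}$. $(x;q_1,\dots,q_k)_\infty=\prod_{n_i\ge0}(1-xq_1^{n_1}\cdots q_k^{n_k})$, $\{z\}=(z;p,q^{2N})_\infty$, $\{z\}^*=(z;p^*,q^{2N})_\infty$, $[2]_q=q+q^{-1}$,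 $\delta(z)=\sum_{n\in\mathbb Z}z^n$. **$H$-algebra.** A unital associative algebra $A=\bigoplus_{\alpha,\beta\in H^*}A_{\alpha\beta}$ with algebra embeddings $\mu_l,\mu_r:\mathcal M_{H^*}\to A_{00}$ such that $\mu_l(\hat f)a=a\mu_l(T_\alpha\hat f)$, $\mu_r(\hat f)a=a\mu_r(T_\beta\hat f)$ for $a\in A_{\alpha\beta}$, $\hat f\in\mathcal M_{H^*}$, where $(T_\alpha\hat f)(\lambda)=\hat f(\lambda+\alpha)$. **$U_{q,p}(\widehat{\mathfrak{gl}}_N)$.** The topological ($p$-adic) algebra over $\mathbb F[[p]]$ generated by $e_{j,m},f_{j,m},k_{l,m}$ $(1\le j\le N-1,1\le l\le N,m\in\mathbb Z)$, $\widehat d$, and central $q^{\pm c/2}$. Put $e_j(z)=\sum_me_{j,m}z^{-m}$, $f_j(z)=\sum_mf_{j,m}z^{-m}$, $k^+_l(z)=\sum_{m\ge0}k_{l,-m}z^m+\sum_{m>0}k_{l,m}p^mz^{-m}$, $k^-_l(z)=q^{2h_{\bar\epsilon_l}}k^+_l(zp^*q^c)$. Relations (formal Laurent series; each structure function is expanded in $z_2/z_1$ or $z_1/z_2$ according to the order of the accompanying product of currents): for $g(P),g(P+h)\in\mathbb F$, - $g(P+h)e_j(z)=e_j(z)g(P+h)$, $g(P)e_j(z)=e_j(z)g(P-\langle Q_{\alpha_j},P\rangle)$; $g(P+h)f_j(z)=f_j(z)g(P+h-\langle\alpha_j,P+h\rangle)$, $g(P)f_j(z)=f_j(z)g(P)$;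 $g(P)k^+_l(z)=k^+_l(z)g(P-\langle Q_{\bar\epsilon_l},P\rangle)$, $g(P+h)k^+_l(z)=k^+_l(z)g(P+h-\langle Q_{\bar\epsilon_l},P\rangle)$; - $\widehat d$ commutes with $\mathbb F$, and $[\widehat d,X(z)]=-z\partial_zX(z)$ for $X=e_j,f_j,k^+_l$; - with $\rho^+_+(z)=\frac{\{q^2z\}^*\{q^{2N-2}z\}^*\{z\}\{q^{2N}z\}}{\{z\}^*\{q^{2N}z\}^*\{q^2z\}\{q^{2N-2}z\}}$: $\rho^+_+(z_2/z_1)k^+_l(z_1)k^+_l(z_2)=\rho^+_+(z_1/z_2)k^+_l(z_2)k^+_l(z_1)$, and for $j<l$ $\rho^+_+(\tfrac{z_2}{z_1})\frac{(p^*z_2/z_1;p^* )_\infty(pq^2z_2/z_1;p)_\infty}{(p^*q^2z_2/z_1;p^* )_\infty(pz_2/z_1;p)_\infty}k^+_j(z_1)k^+_l(z_2)=\rho^+_+(\tfrac{z_1}{z_2})\frac{(q^{-2}z_1/z_2;p^* )_\infty(z_1/z_2;p)_\infty}{(z_1/z_2;p^* )_\infty(q^{-2}z_1/z_2;p)_\infty}k^+_l(z_2)k^+_j(z_1)$; - $\frac{(p^*q^{c+2-j}z_2/z_1;p^* )_\infty}{(p^*q^{c-j}z_2/z_1;p^* )_\infty}k^+_j(z_1)e_j(z_2)=q^{-1}\frac{(q^{-c+j}z_1/z_2;p^* )_\infty}{(q^{-c-2+j}z_1/z_2;p^* )_\infty}e_j(z_2)k^+_j(z_1)$, $\frac{(p^*q^{c-2-j}z_2/z_1;p^*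 )_\infty}{(p^*q^{c-j}z_2/z_1;p^* )_\infty}k^+_{j+1}(z_1)e_j(z_2)=q\frac{(q^{-c+j}z_1/z_2;p^* )_\infty}{(q^{-c+2+j}z_1/z_2;p^* )_\infty}e_j(z_2)k^+_{j+1}(z_1)$, $\frac{(pq^{-j}z_2/z_1;p)_\infty}{(pq^{2-j}z_2/z_1;p)_\infty}k^+_j(z_1)f_j(z_2)=q\frac{(q^{-2+j}z_1/z_2;p)_\infty}{(q^jz_1/z_2;p)_\infty}f_j(z_2)k^+_j(z_1)$, $\frac{(pq^{-j}z_2/z_1;p)_\infty}{(pq^{-2-j}z_2/z_1;p)_\infty}k^+_{j+1}(z_1)f_j(z_2)=q^{-1}\frac{(q^{2+j}z_1/z_2;p)_\infty}{(q^jz_1/z_2;p)_\infty}f_j(z_2)k^+_{j+1}(z_1)$, and $k^+_l$ commutes with $e_j,f_j$ for $l\ne j,j+1$; - $z_1\frac{(q^2z_2/z_1;p^* )_\infty}{(p^*q^{-2}z_2/z_1;p^* )_\infty}e_j(z_1)e_j(z_2)=-z_2\frac{(q^2z_1/z_2;p^* )_\infty}{(p^*q^{-2}z_1/z_2;p^* )_\infty}e_j(z_2)e_j(z_1)$, $z_1\frac{(q^{-1}z_2/z_1;p^* )_\infty}{(p^*qz_2/z_1;p^* )_\infty}e_j(z_1)e_{j+1}(z_2)=-z_2\frac{(q^{-1}z_1/z_2;p^* )_\infty}{(p^*qz_1/z_2;p^* )_\infty}e_{j+1}(z_2)e_j(z_1)$, $z_1\frac{(q^{-2}z_2/z_1;p)_\infty}{(pq^2z_2/z_1;p)_\infty}f_j(z_1)f_j(z_2)=-z_2\frac{(q^{-2}z_1/z_2;p)_\infty}{(pq^2z_1/z_2;p)_\infty}f_j(z_2)f_j(z_1)$,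 $z_1\frac{(qz_2/z_1;p)_\infty}{(pq^{-1}z_2/z_1;p)_\infty}f_j(z_1)f_{j+1}(z_2)=-z_2\frac{(qz_1/z_2;p)_\infty}{(pq^{-1}z_1/z_2;p)_\infty}f_{j+1}(z_2)f_j(z_1)$, $e_je_l$ and $f_jf_l$ commute for $|j-l|>1$; - $[e_i(z_1),f_j(z_2)]=\frac{\delta_{ij}\kappa}{q-q^{-1}}\big(\delta(q^{-c}z_1/z_2)k^-_j(q^{-j}z_1)k^-_{j+1}(q^{-j}z_1)^{-1}-\delta(q^cz_1/z_2)k^+_j(q^{-j}z_2)k^+_{j+1}(q^{-j}z_2)^{-1}\big)$, $\kappa=\frac{(p;p)_\infty(p^*q^2;p^* )_\infty}{(p^*;p^* )_\infty(pq^2;p)_\infty}$; - Serre relations for $|i-j|=1$: with $A(x)=\frac{(p^*q^{-1}x;p^* )_\infty}{(p^*qx;p^* )_\infty}$, $\frac{(p^*q^2z_2/z_1;p^* )_\infty}{(p^*q^{-2}z_2/z_1;p^* )_\infty}\{A(\frac{z_1}w)A(\frac{z_2}w)e_j(w)e_i(z_1)e_i(z_2)-[2]_qA(\frac w{z_1})A(\frac{z_2}w)e_i(z_1)e_j(w)e_i(z_2)+A(\frac w{z_1})A(\frac w{z_2})e_i(z_1)e_i(z_2)e_j(w)\}+(z_1\leftrightarrow z_2)=0$; and the same identity for $f$ with $e\to f$, $p^*\to p$, $q\to q^{-1}$ in all infinite products.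
   Formalization: The direct sum is the p-adically completed one (the sum of p^n e_{1,0}^n has infinitely many components), and the relations are imposed on the modes after cancelling common powers of p, with the modes of the inverse of k^+_l(z) adjoined. *)

theory Defs
  imports "HOL-Complex_Analysis.Complex_Analysis" "HOL-Computational_Algebra.Computational_Algebra" "HOL-Library.Poly_Mapping" "HOL-Algebra.QuotRing" "HOL-Algebra.Module"
begin

no_notation fps_nth (infixl \<open>$\<close> 75)

section \<open>Meromorphic functions of dynamical variables\<close>

text \<open>
  A point of \<open>dyn_space\<close> consists of one or more sets of dynamical variables, indexed by \<open>'b\<close>; a set
  of dynamical variables is given by its values on the \<open>N\<close> weights \<open>\<epsilon>\<^sub>j - 1/N \<Sum>\<^sub>k \<epsilon>\<^sub>k\<close>, which sum to \<open>0\<close>.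
\<close>

definition cscale :: "complex \<Rightarrow> complex^'n^'b \<Rightarrow> complex^'n^'b"
  where "cscale c z = (\<chi> b i. c * z $ b $ i)"

definition zsum :: "(complex^'n) set"
  where "zsum = {v. (\<Sum>i\<in>UNIV. v $ i) = 0}"

definition dyn_space :: "(complex^'n^'b) set"
  where "dyn_space = {z. \<forall>b. z $ b \<in> zsum}"

abbreviation dyn_open :: "(complex^'n^'b) set \<Rightarrow> bool"
  where "dyn_open U \<equiv> openin (top_of_set dyn_space) U"

text \<open>Functions with a complex linear derivative along the subspace \<open>dyn_space\<close>\<close>

definition cholo :: "(complex^'n^'b) set \<Rightarrow> (complex^'n^'b \<Rightarrow> complex) \<Rightarrow> bool"
  where "cholo U f \<longleftrightarrow> (\<forall>z\<in>U. \<exists>L. (\<forall>c v. L (cscale c v) = c * L v) \<and> (f has_derivative L) (at z within U))"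

definition nonvan :: "(complex^'n^'b) set \<Rightarrow> (complex^'n^'b \<Rightarrow> complex) \<Rightarrow> bool"
  where "nonvan U h \<longleftrightarrow> (\<forall>W. dyn_open W \<and> W \<subseteq> U \<and> W \<noteq> {} \<longrightarrow> (\<exists>y\<in>W. h y \<noteq> 0))"

text \<open>
  Locally a quotient of holomorphic functions, off the zeros of the denominator. The values at these
  zeros are irrelevant: functions which agree on a dense open set (\<open>gen_eq\<close>) are identified below.
\<close>

definition meromorphic_rep :: "(complex^'n^'b \<Rightarrow> complex) \<Rightarrow> bool"
  where "meromorphic_rep f \<longleftrightarrow> (\<forall>x\<in>dyn_space. \<exists>U g h. dyn_open U \<and> x \<in> U \<and> cholo U g \<and> cholo U h \<and>
      nonvan U h \<and> (\<forall>y\<in>U. h y \<noteq> 0 \<longrightarrow> f y = g y / h y))"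

definition gen_eq :: "(complex^'n^'b \<Rightarrow> complex) \<Rightarrow> (complex^'n^'b \<Rightarrow> complex) \<Rightarrow> bool"
  where "gen_eq f g \<longleftrightarrow> (\<forall>W. dyn_open W \<and> W \<noteq> {} \<longrightarrow>
      (\<exists>W'. dyn_open W' \<and> W' \<noteq> {} \<and> W' \<subseteq> W \<and> (\<forall>y\<in>W'. f y = g y)))"

lemma zero_in_dyn: "0 \<in> dyn_space"
  by (simp add: dyn_space_def zsum_def)

lemma dyn_add: "x \<in> dyn_space \<Longrightarrow> y \<in> dyn_space \<Longrightarrow> x + y \<in> dyn_space"
  by (simp add: dyn_space_def zsum_def sum.distrib)

lemma dyn_diff: "x \<in> dyn_space \<Longrightarrow> y \<in> dyn_space \<Longrightarrow> x - y \<in> dyn_space"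
  by (simp add: dyn_space_def zsum_def sum_subtractf)

lemma dyn_cscale: "x \<in> dyn_space \<Longrightarrow> cscale c x \<in> dyn_space"
  by (simp add: dyn_space_def zsum_def cscale_def sum_distrib_left[symmetric])

lemma dyn_scaleR: "x \<in> dyn_space \<Longrightarrow> r *\<^sub>R x \<in> dyn_space"
  by (simp add: dyn_space_def zsum_def scaleR_sum_right[symmetric])

lemma convex_dyn: "convex dyn_space"
  unfolding convex_def by (auto intro!: dyn_add dyn_scaleR)

lemma cscale_of_real: "cscale (of_real r) x = r *\<^sub>R x"
  by (simp add: cscale_def vec_eq_iff scaleR_conv_of_real[where 'a=complex])

lemma bilinear_cscale: "bounded_bilinear (cscale :: complex \<Rightarrow> complex^'n^'b \<Rightarrow> complex^'n^'b)"
proof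
  show "\<exists>K. \<forall>a (b :: complex^'n^'b). norm (cscale a b) \<le> norm a * norm b * K"
  proof (intro exI allI)
    fix a :: complex and z :: "complex^'n^'b"
    have "norm (cscale a z) = norm a * norm z"
    proof -
      have "norm (cscale a z $ b) = norm a * norm (z $ b)" for b
        by (simp add: cscale_def norm_vec_def L2_set_def norm_mult power_mult_distrib sum_distrib_left[symmetric] real_sqrt_mult)
      then show ?thesis
        by (simp add: norm_vec_def[of "cscale a z"] norm_vec_def[of z] L2_set_def power_mult_distrib sum_distrib_left[symmetric] real_sqrt_mult)
    qed
    then show "norm (cscale a z) \<le> norm a * norm z * 1" by simp
  qed
qed (simp_all add: cscale_def vec_eq_iff algebra_simps scaleR_conv_of_real[where 'a=complex])

lemma cholo_subset: "cholo U f \<Longrightarrow> W \<subseteq> U \<Longrightarrow> cholo W f"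
  unfolding cholo_def by (meson has_derivative_subset subsetD)

lemma cholo_cont: "cholo U f \<Longrightarrow> continuous_on U f"
  unfolding cholo_def continuous_on_eq_continuous_within by (meson has_derivative_continuous)

lemma cholo_const: "cholo U (\<lambda>z. c)"
  unfolding cholo_def by (auto intro!: exI[of _ "\<lambda>v. 0"])

lemma cholo_add: assumes "cholo U f" "cholo U g" shows "cholo U (\<lambda>z. f z + g z)"
  unfolding cholo_def
proof
  fix z assume "z \<in> U"
  then obtain L M where "\<forall>c v. L (cscale c v) = c * L v" "(f has_derivative L) (at z within U)"
      "\<forall>c v. M (cscale c v) = c * M v" "(g has_derivative M) (at z within U)"
    using assms unfolding cholo_def by blast
  then show "\<exists>L. (\<forall>c v. L (cscale c v) = c * L v) \<and> ((\<lambda>z. f z + g z) has_derivative L) (at z within U)"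
    by (intro exI[of _ "\<lambda>v. L v + M v"]) (auto intro!: derivative_intros simp: algebra_simps)
qed

lemma cholo_mult: assumes "cholo U f" "cholo U g" shows "cholo U (\<lambda>z. f z * g z)"
  unfolding cholo_def
proof
  fix z assume "z \<in> U"
  then obtain L M where "\<forall>c v. L (cscale c v) = c * L v" "(f has_derivative L) (at z within U)"
      "\<forall>c v. M (cscale c v) = c * M v" "(g has_derivative M) (at z within U)"
    using assms unfolding cholo_def by blast
  then show "\<exists>L. (\<forall>c v. L (cscale c v) = c * L v) \<and> ((\<lambda>z. f z * g z) has_derivative L) (at z within U)"
    by (intro exI[of _ "\<lambda>v. f z * M v + L v * g z"] conjI has_derivative_mult) (auto simp: algebra_simps)
qed

lemma cholo_uminus: "cholo U f \<Longrightarrow> cholo U (\<lambda>z. - f z)"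
  using cholo_mult[OF cholo_const[of U "-1"], of f] by simp

lemma nonvan_subset: "nonvan U h \<Longrightarrow> W \<subseteq> U \<Longrightarrow> nonvan W h"
  unfolding nonvan_def by blast

lemma dyn_open_nz:
  assumes "dyn_open W" "continuous_on W h"
  shows "dyn_open {y\<in>W. h y \<noteq> (0::complex)}"
proof -
  have "openin (top_of_set W) (W \<inter> h -` (- {0}))"
    by (rule continuous_openin_preimage_gen[OF assms(2)]) (simp add: open_Compl)
  moreover have "W \<inter> h -` (- {0}) = {y\<in>W. h y \<noteq> 0}" by auto
  ultimately show ?thesis using openin_trans[OF _ assms(1)] by simp
qed

lemma nonvan_mult:
  assumes "continuous_on U f" "nonvan U f" "nonvan U g"
  shows "nonvan U (\<lambda>z. f z * g z)"
  unfolding nonvan_def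
proof (intro allI impI)
  fix W assume W: "dyn_open W \<and> W \<subseteq> U \<and> W \<noteq> {}"
  let ?W = "{y\<in>W. f y \<noteq> 0}"
  have "dyn_open ?W" using W by (intro dyn_open_nz) (auto intro: continuous_on_subset[OF assms(1)])
  moreover have "?W \<noteq> {}" using W assms(2) unfolding nonvan_def by blast
  moreover have "?W \<subseteq> U" using W by auto
  ultimately obtain y where "y \<in> ?W" "g y \<noteq> 0" using assms(3) unfolding nonvan_def by meson
  then show "\<exists>y\<in>W. f y * g y \<noteq> 0" by auto
qed

lemma gen_eq_refl: "gen_eq f f" unfolding gen_eq_def by blast
lemma gen_eq_sym: "gen_eq f g \<Longrightarrow> gen_eq g f" unfolding gen_eq_def by metis

lemma gen_eq_combine:
  assumes "gen_eq f g" "gen_eq f' g'"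
    and "\<And>y. f y = g y \<Longrightarrow> f' y = g' y \<Longrightarrow> F y = G y"
  shows "gen_eq F G"
  unfolding gen_eq_def
proof (intro allI impI)
  fix W :: "(complex^'a^'b) set" assume W: "dyn_open W \<and> W \<noteq> {}"
  obtain W1 where 1: "dyn_open W1" "W1 \<noteq> {}" "W1 \<subseteq> W" "\<forall>y\<in>W1. f y = g y"
    using assms(1) W unfolding gen_eq_def by meson
  obtain W2 where "dyn_open W2" "W2 \<noteq> {}" "W2 \<subseteq> W1" "\<forall>y\<in>W2. f' y = g' y"
    using assms(2) 1 unfolding gen_eq_def by meson
  then show "\<exists>W'. dyn_open W' \<and> W' \<noteq> {} \<and> W' \<subseteq> W \<and> (\<forall>y\<in>W'. F y = G y)"
    using 1 assms(3) by (intro exI[of _ W2]) auto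
qed

lemma gen_eq_trans: "gen_eq f g \<Longrightarrow> gen_eq g h \<Longrightarrow> gen_eq f h"
  by (erule gen_eq_combine) auto

lemma meromorphic_repE:
  assumes "meromorphic_rep f" "x \<in> dyn_space"
  obtains U g h where "dyn_open U" "x \<in> U" "cholo U g" "cholo U h" "nonvan U h"
    "\<And>y. y \<in> U \<Longrightarrow> h y \<noteq> 0 \<Longrightarrow> f y = g y / h y"
  using assms unfolding meromorphic_rep_def by meson

lemma cholo_meromorphic_rep: assumes "cholo dyn_space f" shows "meromorphic_rep f"
  unfolding meromorphic_rep_def
proof
  fix x :: "complex^'a^'b" assume "x \<in> dyn_space"
  then show "\<exists>U g h. dyn_open U \<and> x \<in> U \<and> cholo U g \<and> cholo U h \<and>
      nonvan U h \<and> (\<forall>y\<in>U. h y \<noteq> 0 \<longrightarrow> f y = g y / h y)"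
    using assms by (intro exI[of _ dyn_space] exI[of _ f] exI[of _ "\<lambda>_. 1"])
      (auto simp: nonvan_def intro: cholo_const)
qed

lemma meromorphic_rep_const: "meromorphic_rep (\<lambda>z. c)"
  by (intro cholo_meromorphic_rep cholo_const)

lemma meromorphic_rep_add: assumes "meromorphic_rep f" "meromorphic_rep f'"
  shows "meromorphic_rep (\<lambda>z. f z + f' z)"
  unfolding meromorphic_rep_def
proof
  fix x :: "complex^'a^'b" assume x: "x \<in> dyn_space"
  obtain U g h where U: "dyn_open U" "x \<in> U" "cholo U g" "cholo U h" "nonvan U h"
    "\<And>y. y \<in> U \<Longrightarrow> h y \<noteq> 0 \<Longrightarrow> f y = g y / h y"
    by (rule meromorphic_repE[OF assms(1) x]) blast
  obtain U' g' h' where U': "dyn_open U'" "x \<in> U'" "cholo U' g'" "cholo U' h'" "nonvan U' h'"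
    "\<And>y. y \<in> U' \<Longrightarrow> h' y \<noteq> 0 \<Longrightarrow> f' y = g' y / h' y"
    by (rule meromorphic_repE[OF assms(2) x]) blast
  have c: "cholo (U \<inter> U') g" "cholo (U \<inter> U') h" "cholo (U \<inter> U') g'" "cholo (U \<inter> U') h'"
    using U U' by (auto elim: cholo_subset)
  have n: "nonvan (U \<inter> U') h" "nonvan (U \<inter> U') h'"
    using U U' by (auto elim: nonvan_subset)
  show "\<exists>U g h. dyn_open U \<and> x \<in> U \<and> cholo U g \<and> cholo U h \<and>
      nonvan U h \<and> (\<forall>y\<in>U. h y \<noteq> 0 \<longrightarrow> f y + f' y = g y / h y)"
  proof (intro exI conjI ballI impI)
    show "dyn_open (U \<inter> U')" using U U' by auto
    show "x \<in> U \<inter> U'" using U U' by auto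
    show "cholo (U \<inter> U') (\<lambda>y. g y * h' y + g' y * h y)" by (intro cholo_add cholo_mult c)
    show "cholo (U \<inter> U') (\<lambda>y. h y * h' y)" by (intro cholo_mult c)
    show "nonvan (U \<inter> U') (\<lambda>y. h y * h' y)" by (intro nonvan_mult n cholo_cont c)
    fix y assume "y \<in> U \<inter> U'" "h y * h' y \<noteq> 0"
    then show "f y + f' y = (g y * h' y + g' y * h y) / (h y * h' y)"
      using U(6)[of y] U'(6)[of y] by (auto simp: field_simps)
  qed
qed

lemma meromorphic_rep_mult: assumes "meromorphic_rep f" "meromorphic_rep f'"
  shows "meromorphic_rep (\<lambda>z. f z * f' z)"
  unfolding meromorphic_rep_def
proof
  fix x :: "complex^'a^'b" assume x: "x \<in> dyn_space"
  obtain U g h where U: "dyn_open U" "x \<in> U" "cholo U g" "cholo U h" "nonvan U h"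
    "\<And>y. y \<in> U \<Longrightarrow> h y \<noteq> 0 \<Longrightarrow> f y = g y / h y"
    by (rule meromorphic_repE[OF assms(1) x]) blast
  obtain U' g' h' where U': "dyn_open U'" "x \<in> U'" "cholo U' g'" "cholo U' h'" "nonvan U' h'"
    "\<And>y. y \<in> U' \<Longrightarrow> h' y \<noteq> 0 \<Longrightarrow> f' y = g' y / h' y"
    by (rule meromorphic_repE[OF assms(2) x]) blast
  have c: "cholo (U \<inter> U') g" "cholo (U \<inter> U') h" "cholo (U \<inter> U') g'" "cholo (U \<inter> U') h'"
    using U U' by (auto elim: cholo_subset)
  have n: "nonvan (U \<inter> U') h" "nonvan (U \<inter> U') h'"
    using U U' by (auto elim: nonvan_subset)
  show "\<exists>U g h. dyn_open U \<and> x \<in> U \<and> cholo U g \<and> cholo U h \<and>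
      nonvan U h \<and> (\<forall>y\<in>U. h y \<noteq> 0 \<longrightarrow> f y * f' y = g y / h y)"
  proof (intro exI conjI ballI impI)
    show "dyn_open (U \<inter> U')" using U U' by auto
    show "x \<in> U \<inter> U'" using U U' by auto
    show "cholo (U \<inter> U') (\<lambda>y. g y * g' y)" by (intro cholo_mult c)
    show "cholo (U \<inter> U') (\<lambda>y. h y * h' y)" by (intro cholo_mult c)
    show "nonvan (U \<inter> U') (\<lambda>y. h y * h' y)" by (intro nonvan_mult n cholo_cont c)
    fix y assume "y \<in> U \<inter> U'" "h y * h' y \<noteq> 0"
    then show "f y * f' y = (g y * g' y) / (h y * h' y)"
      using U(6)[of y] U'(6)[of y] by simp
  qed
qed

text \<open>Identity theorem on convex relatively open sets, by restriction to complex lines.\<close>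

lemma cholo_identity:
  assumes U: "dyn_open U" "convex U" and g: "cholo U g"
    and W: "dyn_open W" "W \<noteq> {}" "W \<subseteq> U" "\<And>y. y \<in> W \<Longrightarrow> g y = 0" and b: "b \<in> U"
  shows "g b = 0"
proof -
  obtain a where a: "a \<in> W" using W by auto
  have ab: "a \<in> dyn_space" "b \<in> dyn_space"
    using a b W U openin_imp_subset by blast+
  define l where "l t = a + cscale t (b - a)" for t
  have l_dyn: "l t \<in> dyn_space" for t
    unfolding l_def by (intro dyn_add dyn_cscale dyn_diff ab)
  have l_der: "(l has_derivative (\<lambda>t. cscale t (b - a))) (at t within S)" for t S
    unfolding l_def
    by (auto intro!: derivative_eq_intros bounded_linear_imp_has_derivative
        bounded_bilinear.bounded_linear_left[OF bilinear_cscale])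
  have l_cont: "continuous_on UNIV l"
    using l_der by (meson continuous_at_imp_continuous_on has_derivative_continuous)
  obtain T where T: "open T" "U = dyn_space \<inter> T" using U(1) by (auto simp: openin_open)
  obtain T' where T': "open T'" "W = dyn_space \<inter> T'" using W(1) by (auto simp: openin_open)
  define D where "D = l -` U"
  have D_eq: "D = l -` T" using T l_dyn by (auto simp: D_def)
  have "open D" unfolding D_eq by (rule open_vimage[OF T(1)]) (use l_cont in auto)
  have D'_eq: "l -` W = l -` T'" using T' l_dyn by auto
  have "open (l -` W)" unfolding D'_eq by (rule open_vimage[OF T'(1)]) (use l_cont in auto)
  have "convex D"
    unfolding convex_def
  proof (intro ballI allI impI)
    fix s t :: complex and u v :: real assume st: "s \<in> D" "t \<in> D" and uv: "0 \<le> u" "0 \<le> v" "u + v = 1"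
    have "l (u *\<^sub>R s + v *\<^sub>R t) = (u + v) *\<^sub>R a + cscale (u *\<^sub>R s + v *\<^sub>R t) (b - a)"
      using uv by (simp add: l_def)
    also have "\<dots> = u *\<^sub>R l s + v *\<^sub>R l t"
      unfolding l_def by (simp add: cscale_def vec_eq_iff algebra_simps scaleR_conv_of_real[where 'a=complex])
    finally show "u *\<^sub>R s + v *\<^sub>R t \<in> D"
      using U(2) st uv unfolding D_def convex_def by auto
  qed
  have hol: "(\<lambda>t. g (l t)) holomorphic_on D"
    unfolding holomorphic_on_def field_differentiable_def
  proof
    fix t assume t: "t \<in> D"
    then obtain L where L: "\<forall>c v. L (cscale c v) = c * L v" "(g has_derivative L) (at (l t) within U)"
      using g unfolding cholo_def D_def by blast
    have "(g has_derivative L) (at (l t) within l ` D)"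
      using L(2) by (rule has_derivative_subset) (auto simp: D_def)
    from diff_chain_within[OF l_der this]
    have "(g \<circ> l has_derivative L \<circ> (\<lambda>s. cscale s (b - a))) (at t within D)" .
    moreover have "L \<circ> (\<lambda>s. cscale s (b - a)) = (*) (L (b - a))"
      using L(1) by (auto simp: fun_eq_iff)
    ultimately show "\<exists>f'. ((\<lambda>t. g (l t)) has_field_derivative f') (at t within D)"
      unfolding has_field_derivative_def by (auto simp: o_def)
  qed
  have l0: "l 0 = a" and l1: "l 1 = b"
    by (simp_all add: l_def cscale_def vec_eq_iff)
  have "0 \<in> l -` W" using l0 a by simp
  have lim: "0 islimpt (l -` W)"
    using \<open>open (l -` W)\<close> \<open>0 \<in> l -` W\<close> by (simp add: interior_limit_point interior_open)
  have "g (l 1) = 0"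
  proof (rule analytic_continuation[OF hol \<open>open D\<close> convex_connected[OF \<open>convex D\<close>] _ _ lim])
    show "l -` W \<subseteq> D" using W by (auto simp: D_def)
    show "0 \<in> D" using l0 a W by (auto simp: D_def)
    show "1 \<in> D" using l1 b by (simp add: D_def)
    fix z assume "z \<in> l -` W" then show "g (l z) = 0" using W by auto
  qed
  then show ?thesis using l1 by simp
qed

lemma convex_refine:
  assumes "dyn_open U" "x \<in> U"
  obtains C where "dyn_open C" "convex C" "x \<in> C" "C \<subseteq> U"
proof -
  obtain T where T: "open T" "U = dyn_space \<inter> T" using assms by (auto simp: openin_open)
  then obtain e where e: "e > 0" "ball x e \<subseteq> T" using assms(2) openE by blast
  show ?thesis
  proof (rule that[of "dyn_space \<inter> ball x e"])
    show "dyn_open (dyn_space \<inter> ball x e)" by (auto simp: openin_open)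
    show "convex (dyn_space \<inter> ball x e)" by (intro convex_Int convex_dyn convex_ball)
  qed (use assms T e in auto)
qed

lemma meromorphic_repE':
  assumes "meromorphic_rep f" "x \<in> dyn_space"
  obtains U g h where "dyn_open U" "convex U" "x \<in> U" "cholo U g" "cholo U h" "nonvan U h"
    "\<And>y. y \<in> U \<Longrightarrow> h y \<noteq> 0 \<Longrightarrow> f y = g y / h y"
proof -
  obtain U g h where U: "dyn_open U" "x \<in> U" "cholo U g" "cholo U h" "nonvan U h"
    "\<And>y. y \<in> U \<Longrightarrow> h y \<noteq> 0 \<Longrightarrow> f y = g y / h y"
    by (rule meromorphic_repE[OF assms]) blast
  obtain C where C: "dyn_open C" "convex C" "x \<in> C" "C \<subseteq> U"
    by (rule convex_refine[OF U(1,2)]) blast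
  show ?thesis
    by (rule that[OF C(1,2,3) cholo_subset[OF U(3) C(4)] cholo_subset[OF U(4) C(4)] nonvan_subset[OF U(5) C(4)]])
      (use U C in auto)
qed

lemma mero_zero_on_chart:
  assumes f: "meromorphic_rep f" and U: "dyn_open U" "convex U" "cholo U g" "cholo U h" "nonvan U h"
    "\<And>y. y \<in> U \<Longrightarrow> h y \<noteq> 0 \<Longrightarrow> f y = g y / h y"
    and W: "dyn_open W" "W \<noteq> {}" "W \<subseteq> U" "\<And>y. y \<in> W \<Longrightarrow> g y * h y = 0"
    and y: "y \<in> U"
  shows "g y = 0"
proof -
  let ?W = "{y\<in>W. h y \<noteq> 0}"
  have 1: "dyn_open ?W"
    by (rule dyn_open_nz[OF W(1) continuous_on_subset[OF cholo_cont[OF U(4)] W(3)]])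
  have 2: "?W \<noteq> {}" using U(5) W(1,2,3) unfolding nonvan_def by blast
  show ?thesis
    by (rule cholo_identity[OF U(1-3) 1 2]) (use W y in auto)
qed

lemma mero_zero_or_nonvan:
  assumes f: "meromorphic_rep f" and U: "dyn_open U" "convex U" "cholo U g" "cholo U h" "nonvan U h"
    "\<And>y. y \<in> U \<Longrightarrow> h y \<noteq> 0 \<Longrightarrow> f y = g y / h y" "U \<noteq> {}"
    and nz: "\<not> gen_eq f (\<lambda>_. 0)"
  shows "nonvan U g"
proof -
  define Z where "Z = {x\<in>dyn_space. \<exists>W. dyn_open W \<and> x \<in> W \<and>
     (\<forall>W'. dyn_open W' \<and> W' \<noteq> {} \<and> W' \<subseteq> W \<longrightarrow> (\<exists>W''. dyn_open W'' \<and> W'' \<noteq> {} \<and> W'' \<subseteq> W' \<and> (\<forall>y\<in>W''. f y = 0)))}"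
  have chart: "V \<subseteq> Z" if V: "dyn_open V" "convex V" "cholo V g'" "cholo V h'" "nonvan V h'"
    "\<And>y. y \<in> V \<Longrightarrow> h' y \<noteq> 0 \<Longrightarrow> f y = g' y / h' y"
    and W: "dyn_open W" "W \<noteq> {}" "W \<subseteq> V" "\<And>y. y \<in> W \<Longrightarrow> g' y * h' y = 0" for V W g' h'
  proof
    fix x assume x: "x \<in> V"
    have g0: "g' y = 0" if "y \<in> V" for y
      by (rule mero_zero_on_chart[OF f V W]) (use that in auto)
    show "x \<in> Z"
      unfolding Z_def
    proof (intro CollectI conjI exI allI impI)
      show "x \<in> dyn_space" using x V(1) openin_imp_subset by blast
      show "dyn_open V" "x \<in> V" using V x by auto
      fix W' assume W': "dyn_open W' \<and> W' \<noteq> {} \<and> W' \<subseteq> V"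
      let ?W = "{y\<in>W'. h' y \<noteq> 0}"
      show "dyn_open ?W"
        using W' by (intro dyn_open_nz) (auto intro: continuous_on_subset[OF cholo_cont[OF V(4)]])
      show "?W \<noteq> {}" using V(5) W' unfolding nonvan_def by blast
      show "?W \<subseteq> W'" by auto
      show "\<forall>y\<in>?W. f y = 0" using W' g0 V(6) by fastforce
    qed
  qed
  have opn: "dyn_open Z"
  proof (subst openin_subopen, intro ballI)
    fix x assume "x \<in> Z"
    then obtain W where W: "dyn_open W" "x \<in> W" 
      "\<forall>W'. dyn_open W' \<and> W' \<noteq> {} \<and> W' \<subseteq> W \<longrightarrow> (\<exists>W''. dyn_open W'' \<and> W'' \<noteq> {} \<and> W'' \<subseteq> W' \<and> (\<forall>y\<in>W''. f y = 0))"
      unfolding Z_def by auto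
    have "y \<in> Z" if "y \<in> W" for y
      unfolding Z_def
    proof (intro CollectI conjI exI)
      show "y \<in> dyn_space" using that W(1) openin_imp_subset by blast
    qed (fact W(1), fact that, fact W(3))
    then have "W \<subseteq> Z" by blast
    then show "\<exists>T. dyn_open T \<and> x \<in> T \<and> T \<subseteq> Z" using W by blast
  qed
  have cl: "dyn_open (dyn_space - Z)"
  proof (subst openin_subopen, intro ballI)
    fix x assume x: "x \<in> dyn_space - Z"
    obtain V g' h' where V: "dyn_open V" "convex V" "x \<in> V" "cholo V g'" "cholo V h'" "nonvan V h'"
      "\<And>y. y \<in> V \<Longrightarrow> h' y \<noteq> 0 \<Longrightarrow> f y = g' y / h' y"
      by (rule meromorphic_repE'[OF f, of x]) (use x in auto)
    have "V \<inter> Z = {}"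
    proof (rule ccontr)
      assume "V \<inter> Z \<noteq> {}"
      then obtain y where y: "y \<in> V" "y \<in> Z" by auto
      then obtain W where W: "dyn_open W" "y \<in> W" 
      "\<forall>W'. dyn_open W' \<and> W' \<noteq> {} \<and> W' \<subseteq> W \<longrightarrow> (\<exists>W''. dyn_open W'' \<and> W'' \<noteq> {} \<and> W'' \<subseteq> W' \<and> (\<forall>y\<in>W''. f y = 0))"
        unfolding Z_def by auto
      have "dyn_open (V \<inter> W)" "V \<inter> W \<noteq> {}" "V \<inter> W \<subseteq> W" using V W y by auto
      then obtain W'' where W'': "dyn_open W''" "W'' \<noteq> {}" "W'' \<subseteq> V \<inter> W" "\<forall>y\<in>W''. f y = 0"
        using W(3) by meson
      have "V \<subseteq> Z"
      proof (rule chart[OF V(1,2,4-7) W''(1,2)])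
        show "W'' \<subseteq> V" using W'' by auto
        fix z assume z: "z \<in> W''"
        then have "h' z \<noteq> 0 \<Longrightarrow> g' z / h' z = 0" using W'' V(7)[of z] by auto
        then show "g' z * h' z = 0" by auto
      qed
      then show False using V x by auto
    qed
    moreover have "V \<subseteq> dyn_space" using V openin_imp_subset by blast
    ultimately show "\<exists>T. dyn_open T \<and> x \<in> T \<and> T \<subseteq> dyn_space - Z" using V by blast
  qed
  have "Z \<subseteq> dyn_space" using opn openin_imp_subset by blast
  then have "closedin (top_of_set dyn_space) Z" using cl by (simp add: closedin_def)
  then have "Z = {} \<or> Z = dyn_space"
    using convex_connected[OF convex_dyn] opn unfolding connected_clopen by blast
  moreover have "Z \<noteq> dyn_space"
  proof
    assume Z: "Z = dyn_space"
    have "gen_eq f (\<lambda>_. 0)"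
      unfolding gen_eq_def
    proof (intro allI impI)
      fix W :: "(complex^'a^'b) set" assume W: "dyn_open W \<and> W \<noteq> {}"
      then obtain x where x: "x \<in> W" by auto
      then have "x \<in> Z" using Z W openin_imp_subset by blast
      then obtain V where V: "dyn_open V" "x \<in> V" 
        "\<forall>W'. dyn_open W' \<and> W' \<noteq> {} \<and> W' \<subseteq> V \<longrightarrow> (\<exists>W''. dyn_open W'' \<and> W'' \<noteq> {} \<and> W'' \<subseteq> W' \<and> (\<forall>y\<in>W''. f y = 0))"
        unfolding Z_def by auto
      have "dyn_open (V \<inter> W)" "V \<inter> W \<noteq> {}" "V \<inter> W \<subseteq> V" using V W x by auto
      then obtain W'' where "dyn_open W''" "W'' \<noteq> {}" "W'' \<subseteq> V \<inter> W" "\<forall>y\<in>W''. f y = 0"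
        using V(3) by meson
      then show "\<exists>W'. dyn_open W' \<and> W' \<noteq> {} \<and> W' \<subseteq> W \<and> (\<forall>y\<in>W'. f y = 0)" by blast
    qed
    then show False using nz by simp
  qed
  ultimately have Z: "Z = {}" by auto
  show ?thesis
    unfolding nonvan_def
  proof (intro allI impI, rule ccontr)
    fix W assume W: "dyn_open W \<and> W \<subseteq> U \<and> W \<noteq> {}" and *: "\<not> (\<exists>y\<in>W. g y \<noteq> 0)"
    have "U \<subseteq> Z" by (rule chart[OF U(1-6), of W]) (use W * in auto)
    then show False using Z U(7) by auto
  qed
qed

lemma meromorphic_rep_inverse:
  assumes f: "meromorphic_rep f"
  shows "meromorphic_rep (\<lambda>z. inverse (f z))"
  unfolding meromorphic_rep_def
proof
  fix x :: "complex^'a^'b" assume x: "x \<in> dyn_space"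
  obtain U g h where U: "dyn_open U" "convex U" "x \<in> U" "cholo U g" "cholo U h" "nonvan U h"
    "\<And>y. y \<in> U \<Longrightarrow> h y \<noteq> 0 \<Longrightarrow> f y = g y / h y"
    by (rule meromorphic_repE'[OF f x]) blast
  show "\<exists>U g h. dyn_open U \<and> x \<in> U \<and> cholo U g \<and> cholo U h \<and>
      nonvan U h \<and> (\<forall>y\<in>U. h y \<noteq> 0 \<longrightarrow> inverse (f y) = g y / h y)"
  proof (cases "nonvan U g")
    case True
    show ?thesis
    proof (intro exI conjI ballI impI)
      show "dyn_open U" "x \<in> U" using U by auto
      show "cholo U (\<lambda>y. h y * h y)" "cholo U (\<lambda>y. g y * h y)" by (intro cholo_mult U)+
      show "nonvan U (\<lambda>y. g y * h y)" by (intro nonvan_mult cholo_cont U True)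
      fix y assume "y \<in> U" "g y * h y \<noteq> 0"
      then show "inverse (f y) = (h y * h y) / (g y * h y)" using U(7)[of y] by simp
    qed
  next
    case False
    then obtain W where W: "dyn_open W" "W \<subseteq> U" "W \<noteq> {}" "\<And>y. y \<in> W \<Longrightarrow> g y = 0"
      unfolding nonvan_def by blast
    have g0: "g y = 0" if "y \<in> U" for y
      by (rule cholo_identity[OF U(1,2,4) W(1,3,2)]) (use W that in auto)
    show ?thesis
    proof (intro exI conjI ballI impI)
      show "dyn_open U" "x \<in> U" using U by auto
      show "cholo U (\<lambda>y. 0)" by (rule cholo_const)
      show "cholo U h" "nonvan U h" by fact+
      fix y assume "y \<in> U" "h y \<noteq> 0"
      then show "inverse (f y) = 0 / h y" using U(7)[of y] g0 by auto
    qed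
  qed
qed

lemma gen_eq_inverse:
  assumes f: "meromorphic_rep f" and nz: "\<not> gen_eq f (\<lambda>_. 0)"
  shows "gen_eq (\<lambda>z. inverse (f z) * f z) (\<lambda>_. 1)"
  unfolding gen_eq_def
proof (intro allI impI)
  fix W :: "(complex^'a^'b) set" assume W: "dyn_open W \<and> W \<noteq> {}"
  then obtain x where x: "x \<in> W" by auto
  then have "x \<in> dyn_space" using W openin_imp_subset by blast
  then obtain U g h where U: "dyn_open U" "convex U" "x \<in> U" "cholo U g" "cholo U h" "nonvan U h"
    "\<And>y. y \<in> U \<Longrightarrow> h y \<noteq> 0 \<Longrightarrow> f y = g y / h y"
    by (rule meromorphic_repE'[OF f]) blast
  have ng: "nonvan U g" by (rule mero_zero_or_nonvan[OF f U(1,2,4-7) _ nz]) (use U in auto)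
  have n: "nonvan U (\<lambda>y. g y * h y)" by (intro nonvan_mult cholo_cont U ng)
  let ?W = "{y\<in>U \<inter> W. g y * h y \<noteq> 0}"
  have c: "cholo (U \<inter> W) (\<lambda>y. g y * h y)" by (rule cholo_subset[OF cholo_mult[OF U(4,5)]]) auto
  have UW: "dyn_open (U \<inter> W)" "U \<inter> W \<noteq> {}" using U W x by auto
  have "dyn_open ?W" by (rule dyn_open_nz[OF UW(1) cholo_cont[OF c]])
  moreover have "?W \<noteq> {}" using n UW unfolding nonvan_def by blast
  moreover have "\<forall>y\<in>?W. inverse (f y) * f y = 1" using U(7) by auto
  ultimately show "\<exists>W'. dyn_open W' \<and> W' \<noteq> {} \<and> W' \<subseteq> W \<and> (\<forall>y\<in>W'. inverse (f y) * f y = 1)"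
    by (intro exI[of _ ?W]) auto
qed

definition mero_rel where "mero_rel f g \<longleftrightarrow> meromorphic_rep f \<and> meromorphic_rep g \<and> gen_eq f g"

quotient_type ('b, 'n) mero = "complex^('n::finite)^('b::finite) \<Rightarrow> complex" / partial: mero_rel
proof (rule part_equivpI)
  show "\<exists>x. mero_rel x x" using meromorphic_rep_const gen_eq_refl unfolding mero_rel_def by blast
  show "symp mero_rel" unfolding mero_rel_def symp_def using gen_eq_sym by blast
  show "transp mero_rel" unfolding mero_rel_def transp_def using gen_eq_trans by blast
qed

lemma gen_eq_const: "gen_eq (\<lambda>_. c) (\<lambda>_::complex^'n^'b. d) \<longleftrightarrow> c = d"
proof
  assume "gen_eq (\<lambda>_. c) (\<lambda>_::complex^'n^'b. d)"
  moreover have "dyn_open (dyn_space :: (complex^'n^'b) set)" by simp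
  ultimately show "c = d" unfolding gen_eq_def using zero_in_dyn by blast
qed (simp add: gen_eq_refl)

instantiation mero :: (finite, finite) field
begin

lift_definition zero_mero :: "('a, 'b) mero" is "\<lambda>_. 0"
  by (simp add: mero_rel_def meromorphic_rep_const gen_eq_refl)
lift_definition one_mero :: "('a, 'b) mero" is "\<lambda>_. 1"
  by (simp add: mero_rel_def meromorphic_rep_const gen_eq_refl)
lift_definition plus_mero :: "('a, 'b) mero \<Rightarrow> ('a, 'b) mero \<Rightarrow> ('a, 'b) mero" is "\<lambda>f g z. f z + g z"
  by (auto simp: mero_rel_def meromorphic_rep_add elim: gen_eq_combine)
lift_definition times_mero :: "('a, 'b) mero \<Rightarrow> ('a, 'b) mero \<Rightarrow> ('a, 'b) mero" is "\<lambda>f g z. f z * g z"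
  by (auto simp: mero_rel_def meromorphic_rep_mult elim: gen_eq_combine)
lift_definition uminus_mero :: "('a, 'b) mero \<Rightarrow> ('a, 'b) mero" is "\<lambda>f z. (-1) * f z"
  by (auto simp: mero_rel_def intro: meromorphic_rep_mult[OF meromorphic_rep_const, of _ "-1", simplified] elim: gen_eq_combine[OF _ gen_eq_refl])
lift_definition inverse_mero :: "('a, 'b) mero \<Rightarrow> ('a, 'b) mero" is "\<lambda>f z. inverse (f z)"
  by (auto simp: mero_rel_def meromorphic_rep_inverse elim: gen_eq_combine[OF _ gen_eq_refl])
definition minus_mero :: "('a, 'b) mero \<Rightarrow> ('a, 'b) mero \<Rightarrow> ('a, 'b) mero" where "minus_mero f g = f + - g"
definition divide_mero :: "('a, 'b) mero \<Rightarrow> ('a, 'b) mero \<Rightarrow> ('a, 'b) mero" where "divide_mero f g = f * inverse g"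

instance
proof
  fix a b c :: "('a, 'b) mero"
  have eqI: "gen_eq f g" if "f = g" for f g :: "complex^'b^'a \<Rightarrow> complex" using that gen_eq_refl by simp
  note reps = meromorphic_rep_const meromorphic_rep_add meromorphic_rep_mult meromorphic_rep_inverse
  show "a + b + c = a + (b + c)"
    by transfer (auto simp: mero_rel_def intro!: reps eqI)
  show "a + b = b + a"
    by transfer (auto simp: mero_rel_def intro!: reps eqI)
  show "0 + a = a"
    by transfer (auto simp: mero_rel_def intro!: reps eqI)
  show "- a + a = 0"
    by transfer (auto simp: mero_rel_def intro!: reps(2) reps eqI intro: reps(3)[OF reps(1), of _ "-1", simplified])
  show "a - b = a + - b" by (simp add: minus_mero_def)
  show "a * b * c = a * (b * c)"
    by transfer (auto simp: mero_rel_def intro!: reps eqI)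
  show "a * b = b * a"
    by transfer (auto simp: mero_rel_def intro!: reps eqI)
  show "1 * a = a"
    by transfer (auto simp: mero_rel_def intro!: reps eqI)
  show "(a + b) * c = a * c + b * c"
    by transfer (auto simp: mero_rel_def algebra_simps intro!: reps eqI)
  show "(0::('a, 'b) mero) \<noteq> 1"
    by transfer (auto simp: mero_rel_def dest: gen_eq_const[THEN iffD1])
  show "a \<noteq> 0 \<Longrightarrow> inverse a * a = 1"
    by transfer (auto simp: mero_rel_def intro!: gen_eq_inverse reps)
  show "a div b = a * inverse b" by (simp add: divide_mero_def)
  show "inverse (0::('a, 'b) mero) = 0"
    by transfer (auto simp: mero_rel_def gen_eq_const intro!: reps)
qed

end

instance mero :: (finite, finite) field_char_0
proof
  show "inj (of_nat :: nat \<Rightarrow> ('a, 'b) mero)"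
  proof (rule injI)
    have of_nat: "(of_nat k :: ('a, 'b) mero) = abs_mero (\<lambda>_::complex^'b^'a. of_nat k)" for k
    proof (induction k)
      case 0 show ?case by (simp add: zero_mero_def)
    next
      case (Suc k)
      have "abs_mero (\<lambda>_::complex^'b^'a. of_nat (Suc k)) = 1 + abs_mero (\<lambda>_::complex^'b^'a. of_nat k)"
        unfolding one_mero_def
        by (subst plus_mero.abs_eq) (auto simp: mero_rel_def intro: meromorphic_rep_const gen_eq_refl)
      then show ?case using Suc by simp
    qed
    fix k m :: nat assume "(of_nat k :: ('a, 'b) mero) = of_nat m"
    then have "mero_rel (\<lambda>_::complex^'b^'a. of_nat k) (\<lambda>_. of_nat m)"
      unfolding of_nat
      by (subst Quotient3_rel[OF Quotient3_mero, symmetric])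
        (auto simp: mero_rel_def intro: meromorphic_rep_const gen_eq_refl)
    then show "k = m" by (simp add: mero_rel_def gen_eq_const)
  qed
qed


subsection \<open>Constants, linear functions, shifts and pullbacks\<close>

lemma cholo_compose:
  assumes U: "cholo U g" and \<phi>: "\<phi> ` W \<subseteq> U"
    and A: "\<And>z S. (\<phi> has_derivative A) (at z within S)" "\<And>c v. A (cscale c v) = cscale c (A v)"
  shows "cholo W (\<lambda>z. g (\<phi> z))"
  unfolding cholo_def
proof
  fix z assume z: "z \<in> W"
  then obtain L where L: "\<forall>c v. L (cscale c v) = c * L v" "(g has_derivative L) (at (\<phi> z) within U)"
    using U \<phi> unfolding cholo_def by blast
  have "(g has_derivative L) (at (\<phi> z) within \<phi> ` W)"
    using L(2) \<phi> by (rule has_derivative_subset)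
  from diff_chain_within[OF A(1) this]
  show "\<exists>L. (\<forall>c v. L (cscale c v) = c * L v) \<and> ((\<lambda>z. g (\<phi> z)) has_derivative L) (at z within W)"
    using L(1) A(2) by (intro exI[of _ "L \<circ> A"]) (auto simp: o_def)
qed

lemma mero_rel_compose:
  fixes \<phi> :: "complex^'n^'b \<Rightarrow> complex^'n^'c"
  assumes f: "mero_rel f g"
    and \<phi>: "\<phi> ` dyn_space \<subseteq> dyn_space" "\<And>W. dyn_open W \<Longrightarrow> dyn_open (\<phi> ` W)"
    and A: "\<And>z S. (\<phi> has_derivative A) (at z within S)" "\<And>c v. A (cscale c v) = cscale c (A v)"
  shows "mero_rel (\<lambda>z. f (\<phi> z)) (\<lambda>z. g (\<phi> z))"
proof -
  have cont: "continuous_on dyn_space \<phi>"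
    using A(1) by (meson continuous_on_eq_continuous_within has_derivative_continuous)
  have pre: "dyn_open (dyn_space \<inter> \<phi> -` U)" if "dyn_open U" for U
    using cont \<phi>(1) that by (meson continuous_openin_preimage image_subset_iff_funcset)
  have rep: "meromorphic_rep (\<lambda>z. f (\<phi> z))" if f: "meromorphic_rep f" for f
    unfolding meromorphic_rep_def
  proof
    fix x :: "complex^'n^'b" assume x: "x \<in> dyn_space"
    then have "\<phi> x \<in> dyn_space" using \<phi>(1) by auto
    then obtain U g h where U: "dyn_open U" "\<phi> x \<in> U" "cholo U g" "cholo U h" "nonvan U h"
      "\<And>y. y \<in> U \<Longrightarrow> h y \<noteq> 0 \<Longrightarrow> f y = g y / h y"
      by (rule meromorphic_repE[OF f]) blast
    let ?V = "dyn_space \<inter> \<phi> -` U"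
    show "\<exists>U g h. dyn_open U \<and> x \<in> U \<and> cholo U g \<and> cholo U h \<and>
      nonvan U h \<and> (\<forall>y\<in>U. h y \<noteq> 0 \<longrightarrow> f (\<phi> y) = g y / h y)"
    proof (intro exI conjI)
      show "dyn_open ?V" using pre U by blast
      show "x \<in> ?V" using x U by auto
      show "cholo ?V (\<lambda>z. g (\<phi> z))" by (rule cholo_compose[OF U(3) _ A]) auto
      show "cholo ?V (\<lambda>z. h (\<phi> z))" by (rule cholo_compose[OF U(4) _ A]) auto
      show "nonvan ?V (\<lambda>z. h (\<phi> z))"
        unfolding nonvan_def
      proof (intro allI impI)
        fix W assume W: "dyn_open W \<and> W \<subseteq> ?V \<and> W \<noteq> {}"
        then have "dyn_open (\<phi> ` W)" "\<phi> ` W \<subseteq> U" "\<phi> ` W \<noteq> {}" using \<phi>(2) by auto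
        then have "\<exists>y\<in>\<phi> ` W. h y \<noteq> 0" using U(5) unfolding nonvan_def by blast
        then show "\<exists>y\<in>W. h (\<phi> y) \<noteq> 0" by blast
      qed
    qed (use U in auto)
  qed
  have "gen_eq (\<lambda>z. f (\<phi> z)) (\<lambda>z. g (\<phi> z))"
    unfolding gen_eq_def
  proof (intro allI impI)
    fix W :: "(complex^'n^'b) set" assume W: "dyn_open W \<and> W \<noteq> {}"
    then have "dyn_open (\<phi> ` W)" "\<phi> ` W \<noteq> {}" using \<phi>(2) by auto
    then obtain W0 where W0: "dyn_open W0" "W0 \<noteq> {}" "W0 \<subseteq> \<phi> ` W" "\<forall>y\<in>W0. f y = g y"
      using f unfolding mero_rel_def gen_eq_def by meson
    show "\<exists>W'. dyn_open W' \<and> W' \<noteq> {} \<and> W' \<subseteq> W \<and> (\<forall>y\<in>W'. f (\<phi> y) = g (\<phi> y))"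
    proof (intro exI conjI)
      show "dyn_open (W \<inter> (dyn_space \<inter> \<phi> -` W0))" using W pre[OF W0(1)] by blast
      have "W \<subseteq> dyn_space" using W openin_imp_subset by blast
      then show "W \<inter> (dyn_space \<inter> \<phi> -` W0) \<noteq> {}" using W0(2,3) by blast
    qed (use W0 in auto)
  qed
  then show ?thesis using f rep unfolding mero_rel_def by blast
qed

lift_definition mero_const :: "complex \<Rightarrow> ('b::finite, 'n::finite) mero" is "\<lambda>c _. c"
  by (simp add: mero_rel_def meromorphic_rep_const gen_eq_refl)

lift_definition mero_lin :: "'b::finite \<Rightarrow> complex^'n::finite \<Rightarrow> ('b, 'n) mero"
  is "\<lambda>b v z. \<Sum>i\<in>UNIV. v $ i * z $ b $ i"
proof -
  fix b :: 'b and v :: "complex^'n"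
  have "cholo dyn_space (\<lambda>z :: complex^'n^'b. \<Sum>i\<in>UNIV. v $ i * z $ b $ i)"
    unfolding cholo_def
  proof (intro ballI exI conjI allI)
    fix z :: "complex^'n^'b"
    have "bounded_linear (\<lambda>z :: complex^'n^'b. z $ b $ i)" for i
      using bounded_linear_compose[OF bounded_linear_vec_nth bounded_linear_vec_nth] .
    then have "bounded_linear (\<lambda>z :: complex^'n^'b. \<Sum>i\<in>UNIV. v $ i * z $ b $ i)"
      by (intro bounded_linear_sum bounded_linear_const_mult)
    then show "((\<lambda>z. \<Sum>i\<in>UNIV. v $ i * z $ b $ i) has_derivative (\<lambda>z. \<Sum>i\<in>UNIV. v $ i * z $ b $ i)) (at z within dyn_space)"
      by (rule bounded_linear_imp_has_derivative)
  qed (simp add: cscale_def sum_distrib_left mult_ac)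
  then show "mero_rel (\<lambda>z :: complex^'n^'b. \<Sum>i\<in>UNIV. v $ i * z $ b $ i) (\<lambda>z. \<Sum>i\<in>UNIV. v $ i * z $ b $ i)"
    by (simp add: mero_rel_def cholo_meromorphic_rep gen_eq_refl)
qed

text \<open>Translation by a vector of \<^term>\<open>dyn_space\<close> (other vectors are ignored).\<close>

lift_definition mero_shift :: "complex^'n::finite^'b::finite \<Rightarrow> ('b, 'n) mero \<Rightarrow> ('b, 'n) mero"
  is "\<lambda>a f z. f (z + (if a \<in> dyn_space then a else 0))"
proof -
  fix a :: "complex^'n^'b" and f g :: "complex^'n^'b \<Rightarrow> complex"
  assume fg: "mero_rel f g"
  define a' where "a' = (if a \<in> dyn_space then a else 0)"
  have a': "a' \<in> dyn_space" by (simp add: a'_def zero_in_dyn)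
  have "mero_rel (\<lambda>z. f (z + a')) (\<lambda>z. g (z + a'))"
  proof (rule mero_rel_compose[OF fg, where A = "\<lambda>v. v"])
    show "(\<lambda>z. z + a') ` dyn_space \<subseteq> dyn_space" using a' dyn_add by blast
    fix W :: "(complex^'n^'b) set" assume "dyn_open W"
    then obtain T where T: "open T" "W = dyn_space \<inter> T" by (auto simp: openin_open)
    have "(\<lambda>z. z + a') ` W = dyn_space \<inter> (\<lambda>z. z + a') ` T"
    proof (intro equalityI subsetI)
      fix y assume y: "y \<in> dyn_space \<inter> (\<lambda>z. z + a') ` T"
      then obtain t where t: "t \<in> T" "y = t + a'" by auto
      then have "t \<in> dyn_space" using y dyn_diff[OF _ a', of y] by auto
      then show "y \<in> (\<lambda>z. z + a') ` W" using t T by auto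
    qed (use T a' dyn_add in auto)
    moreover have "open ((\<lambda>z. z + a') ` T)"
      using open_translation[OF T(1), of a'] by (simp add: add.commute)
    ultimately show "dyn_open ((\<lambda>z. z + a') ` W)" by (auto simp: openin_open)
  qed (auto intro!: derivative_eq_intros)
  then show "mero_rel (\<lambda>z. f (z + (if a \<in> dyn_space then a else 0))) (\<lambda>z. g (z + (if a \<in> dyn_space then a else 0)))"
    by (simp add: a'_def)
qed

text \<open>A function of one set of dynamical variables, evaluated at the \<open>b\<close>-th set.\<close>

lift_definition mero_at :: "'b::finite \<Rightarrow> (unit, 'n::finite) mero \<Rightarrow> ('b, 'n) mero"
  is "\<lambda>b f z. f (\<chi> u. z $ b)"
proof -
  fix b :: 'b and f g :: "complex^'n^unit \<Rightarrow> complex"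
  assume fg: "mero_rel f g"
  let ?\<phi> = "\<lambda>z :: complex^'n^'b. (\<chi> u. z $ b) :: complex^'n^unit"
  have lin: "bounded_linear ?\<phi>"
  proof (rule bounded_linear_intro[where K = 1])
    fix x :: "complex^'n^'b"
    have "norm (?\<phi> x) = norm (x $ b)" by (simp add: norm_vec_def[of "?\<phi> x"] UNIV_unit)
    also have "\<dots> \<le> norm x" by (rule Finite_Cartesian_Product.norm_nth_le)
    finally show "norm (?\<phi> x) \<le> norm x * 1" by simp
  qed (simp_all add: vec_eq_iff)
  show "mero_rel (\<lambda>z. f (?\<phi> z)) (\<lambda>z. g (?\<phi> z))"
  proof (rule mero_rel_compose[OF fg, where A = ?\<phi>])
    show "?\<phi> ` dyn_space \<subseteq> dyn_space" by (auto simp: dyn_space_def)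
    show "(?\<phi> has_derivative ?\<phi>) (at z within S)" for z S
      by (rule bounded_linear_imp_has_derivative[OF lin])
    show "?\<phi> (cscale c v) = cscale c (?\<phi> v)" for c v by (simp add: cscale_def vec_eq_iff)
    fix W :: "(complex^'n^'b) set" assume W: "dyn_open W"
    show "dyn_open (?\<phi> ` W)"
    proof (subst openin_subopen, intro ballI)
      fix y assume "y \<in> ?\<phi> ` W"
      then obtain z where z: "z \<in> W" "y = ?\<phi> z" by auto
      have z': "z \<in> dyn_space" using z W openin_imp_subset by blast
      let ?j = "\<lambda>w :: complex^'n^unit. (\<chi> c. if c = b then w $ () else z $ c) :: complex^'n^'b"
      have "continuous_on dyn_space ?j"
      proof (rule continuous_on_vec_lambda)
        show "continuous_on dyn_space (\<lambda>w :: complex^'n^unit. if c = b then w $ () else z $ c)" for c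
          by (cases "c = b") (auto intro!: continuous_intros)
      qed
      moreover have "?j \<in> dyn_space \<rightarrow> dyn_space" using z' by (auto simp: dyn_space_def)
      ultimately have "dyn_open (dyn_space \<inter> ?j -` W)"
        using W by (rule continuous_openin_preimage)
      moreover have "y \<in> dyn_space \<inter> ?j -` W"
      proof -
        have "?j y = z" using z by (simp add: vec_eq_iff)
        then show ?thesis using z z' by (auto simp: dyn_space_def)
      qed
      moreover have "dyn_space \<inter> ?j -` W \<subseteq> ?\<phi> ` W"
      proof
        fix w assume "w \<in> dyn_space \<inter> ?j -` W"
        moreover have "w = ?\<phi> (?j w)" by (simp add: vec_eq_iff)
        ultimately show "w \<in> ?\<phi> ` W" by blast
      qed
      ultimately show "\<exists>T. dyn_open T \<and> y \<in> T \<and> T \<subseteq> ?\<phi> ` W" by blast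
    qed
  qed
qed

section \<open>Scalars\<close>

text \<open>
  The indeterminate \<open>\<hbar>\<close> is the variable of \<^typ>\<open>'a fls\<close>, so that \<open>q = e\<^sup>\<hbar>\<close> is
  \<open>qpow 1\<close> in \<^typ>\<open>complex fls\<close>, and \<open>q\<^sup>x = e\<^sup>\<hbar>\<^sup>x\<close> makes sense also for a meromorphic function \<open>x\<close>.
\<close>

definition qpow :: "'a::field_char_0 \<Rightarrow> 'a fls"
  where "qpow x = fps_to_fls (fps_exp x)"

definition map_fls :: "('a::zero \<Rightarrow> 'b::zero) \<Rightarrow> 'a fls \<Rightarrow> 'b fls"
  where "map_fls f F = Abs_fls (\<lambda>n. f (fls_nth F n))"

datatype dynvar = P_plus_h | P_var

instance dynvar :: finite
proof
  have "(UNIV :: dynvar set) = {P_plus_h, P_var}" using dynvar.exhaust by auto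
  then show "finite (UNIV :: dynvar set)" by (metis finite.emptyI finite_insert)
qed

text \<open>
  \<open>'n dynfun\<close> is the field \<open>\<F>\<close> of functions \<open>f(P+h, P)\<close>; \<open>'n dynfun1\<close> consists of the functions
  of one set of dynamical variables. The coefficients of the powers of \<open>\<hbar>\<close> are meromorphic functions.
\<close>

type_synonym 'n dynfun = "(dynvar, 'n) mero fls"
type_synonym 'n dynfun1 = "(unit, 'n) mero fls"

definition shift1 :: "complex^'n \<Rightarrow> 'n::finite dynfun1 \<Rightarrow> 'n dynfun1"
  where "shift1 v = map_fls (mero_shift (\<chi> u. v))"

text \<open>Laurent polynomials in the central \<open>q\<^sup>c\<^sup>/\<^sup>2\<close>; \<open>qmon n m\<close> is \<open>q\<^sup>n (q\<^sup>c\<^sup>/\<^sup>2)\<^sup>m\<close>.\<close>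

type_synonym scal = "int \<Rightarrow>\<^sub>0 complex fls"

definition qmon :: "int \<Rightarrow> int \<Rightarrow> scal fps"
  where "qmon n m = fps_const (Poly_Mapping.single m (qpow (of_int n)))"

definition nome :: "scal fps"
  where "nome = fps_X"

definition nome_star :: "scal fps"
  where "nome_star = nome * qmon 0 (-4)"

subsection \<open>Infinite products\<close>

text \<open>
  Structure functions are power series in \<open>x\<close> (standing for \<open>z\<^sub>2/z\<^sub>1\<close> or \<open>z\<^sub>1/z\<^sub>2\<close>) over power series in
  the nome; infinite products with base \<open>p\<close> or \<open>p\<^sup>*\<close> are \<open>p\<close>-adic limits, coefficientwise in \<open>x\<close>.
\<close>

definition qpoch :: "scal fps \<Rightarrow> scal fps \<Rightarrow> scal fps"
  where "qpoch a t = lim (\<lambda>m. \<Prod>n<m. 1 - a * t ^ n)"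

definition coeff_lim :: "(nat \<Rightarrow> scal fps fps) \<Rightarrow> scal fps fps"
  where "coeff_lim u = Abs_fps (\<lambda>k. lim (\<lambda>m. fps_nth (u m) k))"

text \<open>\<open>(a x; t)\<^sub>\<infinity>\<close>\<close>

definition qpoch_ser :: "scal fps \<Rightarrow> scal fps \<Rightarrow> scal fps fps"
  where "qpoch_ser a t = coeff_lim (\<lambda>m. \<Prod>n<m. 1 - fps_const (a * t ^ n) * fps_X)"

text \<open>
  \<open>(x; t)\<^sub>\<infinity>\<close> for a base \<open>t\<close> in the coefficient field, by Euler's expansion; the coefficients of the
  product are rational functions of \<open>t\<close>, which are then evaluated at \<open>t = q\<^sup>2\<^sup>N\<close>.
\<close>

definition fps_dilate :: "'a::comm_ring_1 \<Rightarrow> 'a fps \<Rightarrow> 'a fps"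
  where "fps_dilate c G = Abs_fps (\<lambda>k. c ^ k * fps_nth G k)"

definition euler_ser :: "'a::field \<Rightarrow> 'a fps"
  where "euler_ser t = Abs_fps (\<lambda>k. \<Prod>i<k. - (t ^ i) / (1 - t ^ Suc i))"

lemma euler_ser_functional_equation:
  assumes "\<And>k. t ^ Suc k \<noteq> 1"
  shows "euler_ser t = (1 - fps_X) * fps_dilate t (euler_ser t)"
proof (rule fps_ext)
  fix n show "fps_nth (euler_ser t) n = fps_nth ((1 - fps_X) * fps_dilate t (euler_ser t)) n"
  proof (cases n)
    case (Suc k)
    have "(1 - t ^ Suc k) * fps_nth (euler_ser t) (Suc k) = - (t ^ k) * fps_nth (euler_ser t) k"
      using assms[of k] by (simp add: euler_ser_def)
    moreover have "a = b * a - c" if "(1 - b) * a = - c" for a b c :: 'a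
    proof -
      have "a = (1 - b) * a + b * a" by (simp add: left_diff_distrib)
      then show ?thesis using that by simp
    qed
    ultimately have "fps_nth (euler_ser t) (Suc k) = t ^ Suc k * fps_nth (euler_ser t) (Suc k) - t ^ k * fps_nth (euler_ser t) k"
      by (metis minus_mult_left)
    then show ?thesis
      unfolding Suc by (simp add: fps_dilate_def left_diff_distrib)
  qed (simp add: euler_ser_def fps_dilate_def left_diff_distrib)
qed

text \<open>\<open>(a x; t, q\<^sup>2\<^sup>N)\<^sub>\<infinity>\<close>, so that \<open>{a x}\<close> is \<open>qpoch2_ser N a nome\<close> and \<open>{a x}\<^sup>*\<close> is \<open>qpoch2_ser N a nome_star\<close>\<close>

definition qpoch2_ser :: "nat \<Rightarrow> scal fps \<Rightarrow> scal fps \<Rightarrow> scal fps fps"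
  where "qpoch2_ser N a t = coeff_lim (\<lambda>m. \<Prod>n<m. fps_dilate (a * t ^ n)
    (Abs_fps (\<lambda>k. fps_const (Poly_Mapping.single 0 (fps_nth (euler_ser (qpow (of_nat (2 * N)))) k)))))"

text \<open>Quotient of series with constant coefficient \<open>1\<close>\<close>

definition fps_quot :: "'a::comm_ring_1 fps \<Rightarrow> 'a fps \<Rightarrow> 'a fps"
  where "fps_quot u v = u * fps_right_inverse v 1"

text \<open>\<open>(a x; t)\<^sub>\<infinity> / (b x; t)\<^sub>\<infinity>\<close>\<close>

definition qfrac :: "scal fps \<Rightarrow> scal fps \<Rightarrow> scal fps \<Rightarrow> scal fps fps"
  where "qfrac a b t = fps_quot (qpoch_ser a t) (qpoch_ser b t)"

definition rho :: "nat \<Rightarrow> scal fps fps"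
  where "rho N = fps_quot
    (qpoch2_ser N (qmon 2 0) nome_star * qpoch2_ser N (qmon (2 * int N - 2) 0) nome_star *
     qpoch2_ser N (qmon 0 0) nome * qpoch2_ser N (qmon (2 * int N) 0) nome)
    (qpoch2_ser N (qmon 0 0) nome_star * qpoch2_ser N (qmon (2 * int N) 0) nome_star *
     qpoch2_ser N (qmon 2 0) nome * qpoch2_ser N (qmon (2 * int N - 2) 0) nome)"

definition kappa :: "scal fps"
  where "kappa = fps_quot (qpoch nome nome * qpoch (nome_star * qmon 2 0) nome_star)
    (qpoch nome_star nome_star * qpoch (nome * qmon 2 0) nome)"

section \<open>The free topological algebra\<close>

datatype 'g fmon = Fmon "'g list"

instantiation fmon :: (type) monoid_add
begin

definition zero_fmon :: "'a fmon" where "zero_fmon = Fmon []"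
fun plus_fmon :: "'a fmon \<Rightarrow> 'a fmon \<Rightarrow> 'a fmon" where "plus_fmon (Fmon u) (Fmon v) = Fmon (u @ v)"

instance
proof
  fix a b c :: "'a fmon"
  show "a + b + c = a + (b + c)" by (cases a; cases b; cases c) simp
  show "0 + a = a" "a + 0 = a" by (cases a; simp add: zero_fmon_def)+
qed

end

text \<open>
  \<open>Fun g\<close> stands for \<open>g \<in> \<F>\<close>. The inverse currents \<open>k\<^sup>+\<^sub>l(z)\<^sup>-\<^sup>1\<close> enter the commutator of \<open>e\<^sub>j\<close> and \<open>f\<^sub>j\<close>;
  their modes are the generators \<open>Kinv l m\<close> (equivalently, \<open>k\<^sub>l\<^sub>,\<^sub>0\<close> is made invertible).
\<close>

datatype 'f gen = Fun 'f | Egen nat int | Fgen nat int | Kgen nat int | Kinv nat int | Dgen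

text \<open>
  Power series in \<open>p\<close>, with the \<open>p\<close>-adic topology of \<^typ>\<open>'a fps\<close>, over the free associative algebra
  on the generators with coefficients in \<^typ>\<open>scal\<close>; thus \<open>p\<close> and \<open>q\<^sup>\<plusminus>\<^sup>c\<^sup>/\<^sup>2\<close> are central.
\<close>

type_synonym 'n alg = "('n dynfun gen fmon \<Rightarrow>\<^sub>0 scal) fps"

definition letter :: "'n::finite dynfun gen \<Rightarrow> 'n alg"
  where "letter g = fps_const (Poly_Mapping.single (Fmon [g]) 1)"

definition coe :: "scal fps \<Rightarrow> 'n::finite alg"
  where "coe y = Abs_fps (\<lambda>n. Poly_Mapping.single 0 (fps_nth y n))"

definition fn :: "'n::finite dynfun \<Rightarrow> 'n alg"
  where "fn g = letter (Fun g)"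

definition fn_Ph :: "'n::finite dynfun1 \<Rightarrow> 'n alg"
  where "fn_Ph g = fn (map_fls (mero_at P_plus_h) g)"

definition fn_P :: "'n::finite dynfun1 \<Rightarrow> 'n alg"
  where "fn_P g = fn (map_fls (mero_at P_var) g)"

section \<open>Dynamical variables\<close>

text \<open>
  \<open>\<epsilon>\<^sub>1, \<dots>, \<epsilon>\<^sub>N\<close> is the standard basis, labelled by \<open>1, \<dots>, N\<close> through an arbitrary bijection \<open>idx\<close>.
\<close>

definition idx :: "nat \<Rightarrow> 'n::finite"
  where "idx = (SOME f. bij_betw f {1..CARD('n)} UNIV)"

definition eps_bar :: "'n::finite \<Rightarrow> complex^'n"
  where "eps_bar i = axis i 1 - (\<chi> k. 1 / of_nat CARD('n))"

definition eps :: "nat \<Rightarrow> complex^'n::finite"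
  where "eps j = eps_bar (idx j)"

definition alpha :: "nat \<Rightarrow> complex^'n::finite"
  where "alpha j = eps j - eps (Suc j)"

definition bil :: "complex^'n \<Rightarrow> complex^'n::finite \<Rightarrow> complex"
  where "bil u v = (\<Sum>i\<in>UNIV. u $ i * v $ i)"

text \<open>
  \<open>(\<alpha>, \<beta>, s)\<close> represents \<open>\<alpha> + Q\<^sub>\<beta> + s \<Lambda>\<^sub>0 \<in> H\<^sup>*\<close>, respectively \<open>h\<^sub>\<alpha> + P\<^sub>\<beta> + s c \<in> H\<close>.
\<close>

type_synonym 'n hvec = "(complex^'n) \<times> (complex^'n) \<times> complex"

definition Hstar :: "'n::finite hvec set"
  where "Hstar = zsum \<times> zsum \<times> UNIV"

definition pairing :: "'n::finite hvec \<Rightarrow> 'n hvec \<Rightarrow> complex"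
  where "pairing = (\<lambda>(\<alpha>, \<beta>, s) (u, v, t). bil \<alpha> u + bil \<beta> v + s * t)"

definition Qel :: "complex^'n::finite \<Rightarrow> 'n hvec" where "Qel \<alpha> = (0, \<alpha>, 0)"
definition hstar_el :: "complex^'n::finite \<Rightarrow> 'n hvec" where "hstar_el \<alpha> = (\<alpha>, 0, 0)"
definition P_el :: "complex^'n::finite \<Rightarrow> 'n hvec" where "P_el \<beta> = (0, \<beta>, 0)"
definition Ph_el :: "complex^'n::finite \<Rightarrow> 'n hvec" where "Ph_el \<beta> = (\<beta>, \<beta>, 0)"

text \<open>The values of \<open>\<mu> \<in> H\<^sup>*\<close> on the \<open>(P+h)\<^bsub>\<epsilon>\<^sub>i\<^esub>\<close>, respectively on the \<open>P\<^bsub>\<epsilon>\<^sub>i\<^esub>\<close>.\<close>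

definition res_Ph :: "'n::finite hvec \<Rightarrow> complex^'n"
  where "res_Ph \<mu> = (\<chi> i. pairing \<mu> (Ph_el (eps_bar i)))"

definition res_P :: "'n::finite hvec \<Rightarrow> complex^'n"
  where "res_P \<mu> = (\<chi> i. pairing \<mu> (P_el (eps_bar i)))"

text \<open>\<open>(P+h)\<^sub>\<beta>\<close>, \<open>P\<^sub>\<beta>\<close> and \<open>h\<^sub>\<beta>\<close> as functions\<close>

definition Ph_fun :: "complex^'n::finite \<Rightarrow> (dynvar, 'n) mero" where "Ph_fun \<beta> = mero_lin P_plus_h \<beta>"
definition P_fun :: "complex^'n::finite \<Rightarrow> (dynvar, 'n) mero" where "P_fun \<beta> = mero_lin P_var \<beta>"
definition h_fun :: "complex^'n::finite \<Rightarrow> (dynvar, 'n) mero" where "h_fun \<beta> = Ph_fun \<beta> - P_fun \<beta>"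

section \<open>Currents\<close>

text \<open>A current is given by its coefficient at \<open>z\<^sup>n\<close>, for \<open>n\<close> an integer.\<close>

definition e_cur :: "nat \<Rightarrow> int \<Rightarrow> 'n::finite alg"
  where "e_cur j n = letter (Egen j (- n))"

definition f_cur :: "nat \<Rightarrow> int \<Rightarrow> 'n::finite alg"
  where "f_cur j n = letter (Fgen j (- n))"

definition kplus :: "nat \<Rightarrow> int \<Rightarrow> 'n::finite alg"
  where "kplus l n = coe (nome ^ nat (- n)) * letter (Kgen l (- n))"

definition kplus_inv :: "nat \<Rightarrow> int \<Rightarrow> 'n::finite alg"
  where "kplus_inv l n = coe (nome ^ nat (- n)) * letter (Kinv l (- n))"

text \<open>
  In \<open>k\<^sup>-\<^sub>l(z) = q\<^sup>2\<^sup>h k\<^sup>+\<^sub>l(z p\<^sup>* q\<^sup>c)\<close> the coefficient of \<open>k\<^sup>+\<^sub>l\<close> at \<open>z\<^sup>n\<close> gets multiplied by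
  \<open>(p\<^sup>* q\<^sup>c)\<^sup>n = p\<^sup>n q\<^sup>-\<^sup>c\<^sup>n\<close>; for negative \<open>n\<close> the power of \<open>p\<close> cancels.
\<close>

definition kminus :: "nat \<Rightarrow> int \<Rightarrow> 'n::finite alg"
  where "kminus l n = fn (qpow (2 * h_fun (eps l))) * coe (nome ^ nat n * qmon 0 (- 2 * n)) * letter (Kgen l (- n))"

definition kminus_inv :: "nat \<Rightarrow> int \<Rightarrow> 'n::finite alg"
  where "kminus_inv l n = coe (nome ^ nat n * qmon 0 (- 2 * n)) * letter (Kinv l (- n)) * fn (qpow (- (2 * h_fun (eps l))))"

definition int_suminf :: "(int \<Rightarrow> 'n::finite alg) \<Rightarrow> 'n alg"
  where "int_suminf g = suminf (\<lambda>r. g (int r)) + suminf (\<lambda>r. g (- int (Suc r)))"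

text \<open>Product of two currents in the same variable\<close>

definition cur_prod :: "(int \<Rightarrow> 'n::finite alg) \<Rightarrow> (int \<Rightarrow> 'n alg) \<Rightarrow> int \<Rightarrow> 'n alg"
  where "cur_prod X Y n = int_suminf (\<lambda>r. X r * Y (n - r))"

text \<open>
  Series in \<open>z\<^sub>1, z\<^sub>2\<close> and in \<open>z\<^sub>1, z\<^sub>2, w\<close>, given by their coefficients. \<open>act2 Y d\<close> multiplies by
  \<open>Y(z\<^sub>1\<^bsup>d\<^sub>1\<^esup> z\<^sub>2\<^bsup>d\<^sub>2\<^esup>)\<close>, and similarly for \<open>act3\<close>.
\<close>

definition act2 :: "scal fps fps \<Rightarrow> int \<times> int \<Rightarrow> (int \<Rightarrow> int \<Rightarrow> 'n::finite alg) \<Rightarrow> int \<Rightarrow> int \<Rightarrow> 'n alg"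
  where "act2 Y = (\<lambda>(d1, d2) \<Phi> a b. suminf (\<lambda>n. coe (fps_nth Y n) * \<Phi> (a - int n * d1) (b - int n * d2)))"

definition act3 :: "scal fps fps \<Rightarrow> int \<times> int \<times> int \<Rightarrow> (int \<Rightarrow> int \<Rightarrow> int \<Rightarrow> 'n::finite alg) \<Rightarrow>
    int \<Rightarrow> int \<Rightarrow> int \<Rightarrow> 'n alg"
  where "act3 Y = (\<lambda>(d1, d2, d3) \<Phi> a b c.
    suminf (\<lambda>n. coe (fps_nth Y n) * \<Phi> (a - int n * d1) (b - int n * d2) (c - int n * d3)))"

definition z21 :: "int \<times> int" where "z21 = (-1, 1)"
definition z12 :: "int \<times> int" where "z12 = (1, -1)"

text \<open>Coefficients of \<open>X(z\<^sub>1) Y(z\<^sub>2)\<close> and of \<open>Y(z\<^sub>2) X(z\<^sub>1)\<close>\<close>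

definition ordered :: "(int \<Rightarrow> 'n::finite alg) \<Rightarrow> (int \<Rightarrow> 'n alg) \<Rightarrow> int \<Rightarrow> int \<Rightarrow> 'n alg"
  where "ordered X Y a b = X a * Y b"

definition swapped :: "(int \<Rightarrow> 'n::finite alg) \<Rightarrow> (int \<Rightarrow> 'n alg) \<Rightarrow> int \<Rightarrow> int \<Rightarrow> 'n alg"
  where "swapped X Y a b = Y b * X a"

text \<open>
  The Serre expression with prefactor \<open>G(z\<^sub>2/z\<^sub>1)\<close>, before adding the term with \<open>z\<^sub>1, z\<^sub>2\<close> exchanged;
  \<open>X\<close> is the current occurring twice.
\<close>

definition serre :: "scal fps fps \<Rightarrow> scal fps fps \<Rightarrow> (int \<Rightarrow> 'n::finite alg) \<Rightarrow> (int \<Rightarrow> 'n alg) \<Rightarrow>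
    int \<Rightarrow> int \<Rightarrow> int \<Rightarrow> 'n alg"
  where "serre G A X Y = act3 G (-1, 1, 0) (\<lambda>a b c.
      act3 A (1, 0, -1) (act3 A (0, 1, -1) (\<lambda>a b c. Y c * X a * X b)) a b c
    - coe (qmon 1 0 + qmon (-1) 0) *
      act3 A (-1, 0, 1) (act3 A (0, 1, -1) (\<lambda>a b c. X a * Y c * X b)) a b c
    + act3 A (-1, 0, 1) (act3 A (0, -1, 1) (\<lambda>a b c. X a * X b * Y c)) a b c)"

section \<open>Relations\<close>

text \<open>
  \<open>uqp_rel u v\<close> states that \<open>u = v\<close> is one of the defining relations; relations between series are
  stated coefficientwise. Generators whose index is out of range are set to \<open>0\<close>.
\<close>

inductive uqp_rel :: "'n::finite alg \<Rightarrow> 'n alg \<Rightarrow> bool"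
where
  e_range: "j \<notin> {1..<CARD('n)} \<Longrightarrow> uqp_rel (letter (Egen j m)) (0 :: 'n alg)"
| f_range: "j \<notin> {1..<CARD('n)} \<Longrightarrow> uqp_rel (letter (Fgen j m)) (0 :: 'n alg)"
| k_range: "l \<notin> {1..CARD('n)} \<Longrightarrow> uqp_rel (letter (Kgen l m)) (0 :: 'n alg)"
| kinv_range: "l \<notin> {1..CARD('n)} \<Longrightarrow> uqp_rel (letter (Kinv l m)) (0 :: 'n alg)"

| fn_add: "uqp_rel (fn (f + g)) (fn f + fn g)"
| fn_mult: "uqp_rel (fn (f * g)) (fn f * fn g)"
| fn_const: "uqp_rel (fn (map_fls mero_const a)) (coe (fps_const (Poly_Mapping.single 0 a)))"

| kk_inv: "l \<in> {1..CARD('n)} \<Longrightarrow>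
    uqp_rel (cur_prod (kplus l) (kplus_inv l) n) (if n = 0 then 1 else (0 :: 'n alg))"
| inv_kk: "l \<in> {1..CARD('n)} \<Longrightarrow>
    uqp_rel (cur_prod (kplus_inv l) (kplus l) n) (if n = 0 then 1 else (0 :: 'n alg))"

| Ph_e: "uqp_rel (fn_Ph g * e_cur j n) (e_cur j n * fn_Ph g)"
| P_e: "uqp_rel (fn_P g * e_cur j n) (e_cur j n * fn_P (shift1 (- res_P (Qel (alpha j))) g))"
| Ph_f: "uqp_rel (fn_Ph g * f_cur j n) (f_cur j n * fn_Ph (shift1 (- res_Ph (hstar_el (alpha j))) g))"
| P_f: "uqp_rel (fn_P g * f_cur j n) (f_cur j n * fn_P g)"
| P_k: "uqp_rel (fn_P g * kplus l n) (kplus l n * fn_P (shift1 (- res_P (Qel (eps l))) g))"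
| Ph_k: "uqp_rel (fn_Ph g * kplus l n) (kplus l n * fn_Ph (shift1 (- res_P (Qel (eps l))) g))"

| d_fn: "uqp_rel (letter Dgen * fn g) (fn g * letter Dgen)"
| d_e: "uqp_rel (letter Dgen * e_cur j n - e_cur j n * letter Dgen) (- of_int n * e_cur j n)"
| d_f: "uqp_rel (letter Dgen * f_cur j n - f_cur j n * letter Dgen) (- of_int n * f_cur j n)"
| d_k: "uqp_rel (letter Dgen * kplus l n - kplus l n * letter Dgen) (- of_int n * kplus l n)"

| k_k: "l \<in> {1..CARD('n)} \<Longrightarrow> uqp_rel
    (act2 (rho CARD('n)) z21 (ordered (kplus l) (kplus l)) a b)
    (act2 (rho CARD('n)) z12 (swapped (kplus l) (kplus l)) a b :: 'n alg)"
| k_k': "1 \<le> j \<Longrightarrow> j < l \<Longrightarrow> l \<le> CARD('n) \<Longrightarrow> uqp_rel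
    (act2 (rho CARD('n) * (qfrac nome_star (nome_star * qmon 2 0) nome_star *
        qfrac (nome * qmon 2 0) nome nome))
      z21 (ordered (kplus j) (kplus l)) a b)
    (act2 (rho CARD('n) * (qfrac (qmon (-2) 0) 1 nome_star * qfrac 1 (qmon (-2) 0) nome))
      z12 (swapped (kplus j) (kplus l)) a b :: 'n alg)"

| k_e: "j \<in> {1..<CARD('n)} \<Longrightarrow> uqp_rel
    (act2 (qfrac (nome_star * qmon (2 - int j) 2) (nome_star * qmon (- int j) 2) nome_star)
      z21 (ordered (kplus j) (e_cur j)) a b)
    (coe (qmon (-1) 0) * act2 (qfrac (qmon (int j) (-2)) (qmon (int j - 2) (-2)) nome_star)
      z12 (swapped (kplus j) (e_cur j)) a b :: 'n alg)"
| k_e': "j \<in> {1..<CARD('n)} \<Longrightarrow> uqp_rel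
    (act2 (qfrac (nome_star * qmon (- 2 - int j) 2) (nome_star * qmon (- int j) 2) nome_star)
      z21 (ordered (kplus (Suc j)) (e_cur j)) a b)
    (coe (qmon 1 0) * act2 (qfrac (qmon (int j) (-2)) (qmon (int j + 2) (-2)) nome_star)
      z12 (swapped (kplus (Suc j)) (e_cur j)) a b :: 'n alg)"
| k_f: "j \<in> {1..<CARD('n)} \<Longrightarrow> uqp_rel
    (act2 (qfrac (nome * qmon (- int j) 0) (nome * qmon (2 - int j) 0) nome)
      z21 (ordered (kplus j) (f_cur j)) a b)
    (coe (qmon 1 0) * act2 (qfrac (qmon (int j - 2) 0) (qmon (int j) 0) nome)
      z12 (swapped (kplus j) (f_cur j)) a b :: 'n alg)"
| k_f': "j \<in> {1..<CARD('n)} \<Longrightarrow> uqp_rel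
    (act2 (qfrac (nome * qmon (- int j) 0) (nome * qmon (- 2 - int j) 0) nome)
      z21 (ordered (kplus (Suc j)) (f_cur j)) a b)
    (coe (qmon (-1) 0) * act2 (qfrac (qmon (2 + int j) 0) (qmon (int j) 0) nome)
      z12 (swapped (kplus (Suc j)) (f_cur j)) a b :: 'n alg)"
| k_e_comm: "l \<noteq> j \<Longrightarrow> l \<noteq> Suc j \<Longrightarrow> uqp_rel (kplus l a * e_cur j b) (e_cur j b * kplus l a)"
| k_f_comm: "l \<noteq> j \<Longrightarrow> l \<noteq> Suc j \<Longrightarrow> uqp_rel (kplus l a * f_cur j b) (f_cur j b * kplus l a)"

| e_e: "j \<in> {1..<CARD('n)} \<Longrightarrow> uqp_rel
    (act2 (qfrac (qmon 2 0) (nome_star * qmon (-2) 0) nome_star) z21 (ordered (e_cur j) (e_cur j)) (a - 1) b)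
    (- act2 (qfrac (qmon 2 0) (nome_star * qmon (-2) 0) nome_star) z12 (swapped (e_cur j) (e_cur j)) a (b - 1) :: 'n alg)"
| e_e': "j \<in> {1..<CARD('n)} \<Longrightarrow> Suc j \<in> {1..<CARD('n)} \<Longrightarrow> uqp_rel
    (act2 (qfrac (qmon (-1) 0) (nome_star * qmon 1 0) nome_star) z21 (ordered (e_cur j) (e_cur (Suc j))) (a - 1) b)
    (- act2 (qfrac (qmon (-1) 0) (nome_star * qmon 1 0) nome_star) z12 (swapped (e_cur j) (e_cur (Suc j))) a (b - 1) :: 'n alg)"
| f_f: "j \<in> {1..<CARD('n)} \<Longrightarrow> uqp_rel
    (act2 (qfrac (qmon (-2) 0) (nome * qmon 2 0) nome) z21 (ordered (f_cur j) (f_cur j)) (a - 1) b)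
    (- act2 (qfrac (qmon (-2) 0) (nome * qmon 2 0) nome) z12 (swapped (f_cur j) (f_cur j)) a (b - 1) :: 'n alg)"
| f_f': "j \<in> {1..<CARD('n)} \<Longrightarrow> Suc j \<in> {1..<CARD('n)} \<Longrightarrow> uqp_rel
    (act2 (qfrac (qmon 1 0) (nome * qmon (-1) 0) nome) z21 (ordered (f_cur j) (f_cur (Suc j))) (a - 1) b)
    (- act2 (qfrac (qmon 1 0) (nome * qmon (-1) 0) nome) z12 (swapped (f_cur j) (f_cur (Suc j))) a (b - 1) :: 'n alg)"
| e_e_comm: "\<bar>int j - int l\<bar> > 1 \<Longrightarrow> uqp_rel (e_cur j a * e_cur l b) (e_cur l b * e_cur j a)"
| f_f_comm: "\<bar>int j - int l\<bar> > 1 \<Longrightarrow> uqp_rel (f_cur j a * f_cur l b) (f_cur l b * f_cur j a)"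

| e_f: "i \<in> {1..<CARD('n)} \<Longrightarrow> j \<in> {1..<CARD('n)} \<Longrightarrow> uqp_rel
    (e_cur i a * f_cur j b - f_cur j b * e_cur i a)
    (if i = j then
       coe (fps_const (Poly_Mapping.single 0 (1 / (qpow 1 - qpow (-1)))) * kappa) *
       (coe (qmon (- int j * (a + b)) (2 * b)) * cur_prod (kminus j) (kminus_inv (Suc j)) (a + b)
        - coe (qmon (- int j * (a + b)) (2 * a)) * cur_prod (kplus j) (kplus_inv (Suc j)) (a + b))
     else (0 :: 'n alg))"

| serre_e: "i \<in> {1..<CARD('n)} \<Longrightarrow> j \<in> {1..<CARD('n)} \<Longrightarrow> \<bar>int i - int j\<bar> = 1 \<Longrightarrow>
    S = serre (qfrac (nome_star * qmon 2 0) (nome_star * qmon (-2) 0) nome_star)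
      (qfrac (nome_star * qmon (-1) 0) (nome_star * qmon 1 0) nome_star) (e_cur i) (e_cur j) \<Longrightarrow>
    uqp_rel (S a b c + S b a c) (0 :: 'n alg)"
| serre_f: "i \<in> {1..<CARD('n)} \<Longrightarrow> j \<in> {1..<CARD('n)} \<Longrightarrow> \<bar>int i - int j\<bar> = 1 \<Longrightarrow>
    S = serre (qfrac (nome * qmon (-2) 0) (nome * qmon 2 0) nome)
      (qfrac (nome * qmon 1 0) (nome * qmon (-1) 0) nome) (f_cur i) (f_cur j) \<Longrightarrow>
    uqp_rel (S a b c + S b a c) (0 :: 'n alg)"

section \<open>The algebra\<close>

definition type_ring :: "'a::ring_1 ring"
  where "type_ring = \<lparr>carrier = UNIV, mult = (*), one = 1, zero = 0, add = (+)\<rparr>"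

text \<open>
  The modes \<open>k\<^sub>l\<^sub>,\<^sub>m\<close> with \<open>m > 0\<close> occur in \<open>k\<^sup>+\<^sub>l(z)\<close> only as \<open>p\<^sup>m k\<^sub>l\<^sub>,\<^sub>m\<close>, but without the factor
  \<open>p\<^sup>m\<close> in \<open>k\<^sup>-\<^sub>l(z) = q\<^sup>2\<^sup>h k\<^sup>+\<^sub>l(z p\<^sup>* q\<^sup>c)\<close>. Accordingly a common power of \<open>p\<close> in a coefficient of a
  relation is cancelled (\<open>p\<close> is not a zero divisor in \<^typ>\<open>'n alg\<close>).
\<close>

definition uqp_relators :: "'n::finite alg set"
  where "uqp_relators = {y. \<exists>n u v. uqp_rel u v \<and> coe nome ^ n * y = u - v}"

definition uqp_ideal :: "'n::finite alg set"
  where "uqp_ideal = closure (genideal type_ring uqp_relators)"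

definition to_uqp :: "'n::finite alg \<Rightarrow> 'n alg set"
  where "to_uqp a = uqp_ideal +>\<^bsub>type_ring\<^esub> a"

definition uqp :: "(complex fls, 'n::finite alg set) module"
  where "uqp = (let R = type_ring Quot uqp_ideal in
    \<lparr>carrier = carrier R, mult = mult R, one = one R, zero = zero R, add = add R,
     smult = (\<lambda>a x. mult R (to_uqp (coe (fps_const (Poly_Mapping.single 0 a)))) x)\<rparr>)"

text \<open>
  The homogeneous components; \<open>X\<close> runs over the linear combinations of the \<open>(P+h)\<^bsub>\<epsilon>\<^sub>j\<^esub>\<close>, respectively
  of the \<open>P\<^bsub>\<epsilon>\<^sub>j\<^esub>\<close>.
\<close>

definition uqp_comp :: "'n::finite hvec \<Rightarrow> 'n hvec \<Rightarrow> 'n alg set set"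
  where "uqp_comp \<alpha> \<beta> = {a \<in> carrier uqp.
    (\<forall>v\<in>zsum. to_uqp (fn (qpow (Ph_fun v))) \<otimes>\<^bsub>uqp\<^esub> a \<otimes>\<^bsub>uqp\<^esub> to_uqp (fn (qpow (- Ph_fun v)))
        = qpow (pairing \<alpha> (Ph_el v)) \<odot>\<^bsub>uqp\<^esub> a) \<and>
    (\<forall>v\<in>zsum. to_uqp (fn (qpow (P_fun v))) \<otimes>\<^bsub>uqp\<^esub> a \<otimes>\<^bsub>uqp\<^esub> to_uqp (fn (qpow (- P_fun v)))
        = qpow (pairing \<beta> (P_el v)) \<odot>\<^bsub>uqp\<^esub> a)}"

text \<open>
  Arguments of the moment maps: functions of one set of dynamical variables depending on the elliptic
  nome as a formal parameter. The shift does not affect the nome.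
\<close>

type_synonym 'n momfun = "'n dynfun1 fps"

definition mom_const :: "complex fls \<Rightarrow> 'n::finite momfun"
  where "mom_const a = fps_const (map_fls mero_const a)"

definition mom_shift :: "complex^'n \<Rightarrow> 'n::finite momfun \<Rightarrow> 'n momfun"
  where "mom_shift v f = Abs_fps (\<lambda>n. shift1 v (fps_nth f n))"

definition mu_l :: "'n::finite momfun \<Rightarrow> 'n alg set"
  where "mu_l f = to_uqp (suminf (\<lambda>n. fn_Ph (fps_nth f n) * coe (nome ^ n)))"

definition mu_r :: "'n::finite momfun \<Rightarrow> 'n alg set"
  where "mu_r f = to_uqp (suminf (\<lambda>n. fn_P (fps_nth f n) * coe (nome_star ^ n)))"

section \<open>Topological \<open>H\<close>-algebras\<close>

text \<open>Unconditional convergence of \<open>\<Sum>\<^bsub>i \<in> I\<^esub> x\<^sub>i\<close> to \<open>a\<close> in the \<open>\<pi>\<close>-adic topology\<close>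

definition adic_has_sum :: "('a, 'm) ring_scheme \<Rightarrow> 'a \<Rightarrow> ('i \<Rightarrow> 'a) \<Rightarrow> 'i set \<Rightarrow> 'a \<Rightarrow> bool"
  where "adic_has_sum A \<pi> x I a \<longleftrightarrow>
    (\<forall>n::nat. \<exists>S0. finite S0 \<and> S0 \<subseteq> I \<and> (\<forall>S. finite S \<and> S0 \<subseteq> S \<and> S \<subseteq> I \<longrightarrow>
       (\<exists>b\<in>carrier A. a \<ominus>\<^bsub>A\<^esub> finsum A x S = (\<pi> [^]\<^bsub>A\<^esub> n) \<otimes>\<^bsub>A\<^esub> b)))"

text \<open>
  A \<open>\<pi>\<close>-adic \<open>H\<close>-algebra over the field \<open>'k\<close>, bigraded by \<open>Hs = H\<^sup>*\<close>. A left degree \<open>\<alpha>\<close> matters only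
  through \<open>dl \<alpha>\<close> and a right degree \<open>\<beta>\<close> only through \<open>dr \<beta>\<close>: the (topological) direct sum has one
  summand for each pair \<open>(dl \<alpha>, dr \<beta>)\<close>, and these are the vectors by which the moment map arguments
  in \<open>'m\<close> are shifted. In a \<open>p\<close>-adically complete algebra a sum such as \<open>\<Sum>\<^sub>n p\<^sup>n e\<^sup>n\<close> has infinitely many
  homogeneous components, so the direct sum is the completed one.
\<close>

locale adic_H_algebra =
  fixes A :: "('k::field, 'a) module" and \<pi> :: 'a
    and Hs :: "'h::ab_group_add set" and dl dr :: "'h \<Rightarrow> 'v"
    and comp :: "'h \<Rightarrow> 'h \<Rightarrow> 'a set"
    and const :: "'k \<Rightarrow> 'm::comm_ring_1" and T :: "'v \<Rightarrow> 'm \<Rightarrow> 'm"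
    and \<mu>l \<mu>r :: "'m \<Rightarrow> 'a"
  assumes ring: "ring A"
    and module: "module type_ring A"
    and smult_mult: "\<And>a x y. x \<in> carrier A \<Longrightarrow> y \<in> carrier A \<Longrightarrow>
      (a \<odot>\<^bsub>A\<^esub> x) \<otimes>\<^bsub>A\<^esub> y = a \<odot>\<^bsub>A\<^esub> (x \<otimes>\<^bsub>A\<^esub> y) \<and> x \<otimes>\<^bsub>A\<^esub> (a \<odot>\<^bsub>A\<^esub> y) = a \<odot>\<^bsub>A\<^esub> (x \<otimes>\<^bsub>A\<^esub> y)"
    and adic_central: "\<pi> \<in> carrier A" "\<And>x. x \<in> carrier A \<Longrightarrow> \<pi> \<otimes>\<^bsub>A\<^esub> x = x \<otimes>\<^bsub>A\<^esub> \<pi>"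
    and comp_submodule: "\<And>\<alpha> \<beta>. \<alpha> \<in> Hs \<Longrightarrow> \<beta> \<in> Hs \<Longrightarrow> submodule (comp \<alpha> \<beta>) type_ring A"
    and comp_one: "\<one>\<^bsub>A\<^esub> \<in> comp 0 0"
    and comp_mult: "\<And>\<alpha> \<beta> \<gamma> \<delta> x y. \<alpha> \<in> Hs \<Longrightarrow> \<beta> \<in> Hs \<Longrightarrow> \<gamma> \<in> Hs \<Longrightarrow> \<delta> \<in> Hs \<Longrightarrow>
      x \<in> comp \<alpha> \<beta> \<Longrightarrow> y \<in> comp \<gamma> \<delta> \<Longrightarrow> x \<otimes>\<^bsub>A\<^esub> y \<in> comp (\<alpha> + \<gamma>) (\<beta> + \<delta>)"
    and direct_sum: "\<And>a. a \<in> carrier A \<Longrightarrow>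
      \<exists>!x. x \<in> dl ` Hs \<times> dr ` Hs \<rightarrow>\<^sub>E carrier A \<and>
        (\<forall>\<alpha>\<in>Hs. \<forall>\<beta>\<in>Hs. x (dl \<alpha>, dr \<beta>) \<in> comp \<alpha> \<beta>) \<and>
        adic_has_sum A \<pi> x (dl ` Hs \<times> dr ` Hs) a"
    and moment_hom: "\<mu>l \<in> ring_hom type_ring A" "\<mu>r \<in> ring_hom type_ring A"
    and moment_linear: "\<And>a f. \<mu>l (const a * f) = a \<odot>\<^bsub>A\<^esub> \<mu>l f" "\<And>a f. \<mu>r (const a * f) = a \<odot>\<^bsub>A\<^esub> \<mu>r f"
    and moment_inj: "inj \<mu>l" "inj \<mu>r"
    and moment_comp: "range \<mu>l \<subseteq> comp 0 0" "range \<mu>r \<subseteq> comp 0 0"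
    and moment_l: "\<And>\<alpha> \<beta> a f. \<alpha> \<in> Hs \<Longrightarrow> \<beta> \<in> Hs \<Longrightarrow> a \<in> comp \<alpha> \<beta> \<Longrightarrow>
      \<mu>l f \<otimes>\<^bsub>A\<^esub> a = a \<otimes>\<^bsub>A\<^esub> \<mu>l (T (dl \<alpha>) f)"
    and moment_r: "\<And>\<alpha> \<beta> a f. \<alpha> \<in> Hs \<Longrightarrow> \<beta> \<in> Hs \<Longrightarrow> a \<in> comp \<alpha> \<beta> \<Longrightarrow>
      \<mu>r f \<otimes>\<^bsub>A\<^esub> a = a \<otimes>\<^bsub>A\<^esub> \<mu>r (T (dr \<beta>) f)"

end

theory Submission
  imports Defs
begin

text \<open>
  Modulo the relations every generator is homogeneous in a strong sense: commuting it past an arbitrary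
  function of the dynamical variables, not just past an exponential, shifts the argument of that function.
  For the modes of the inverse currents this follows from the uniqueness of inverses of two-sided series.
  Hence every element is a convergent sum of homogeneous components, and the sum is direct because
  eigenvectors with different eigenvalues are linearly independent modulo every power of \<open>p\<close>.

  The moment maps are injective because there is a representation in which functions act faithfully. At
  \<open>c = 0\<close> the algebra acts on loops with values in \<open>\<F>[[p]]\<close> by weighted shifts of the dynamical variables:
  \<open>e\<^sub>j\<close> and \<open>f\<^sub>j\<close> are supported at one point of the loop, which depends on the dynamical variables, and
  \<open>k\<^sub>l(z)\<close> is a quotient of two theta functions. The commutator of \<open>e\<^sub>j\<close> and \<open>f\<^sub>j\<close> is a difference of expansions
  of a quotient of theta functions in two regions, hence the sum of its residues at the two poles in between.
\<close>

section \<open>Adically convergent families of power series\<close>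

text \<open>The components \<open>uqp_comp\<close> are cut out by exponentials, whereas the moment
  map axioms move arbitrary functions. Uniqueness of the decomposition closes this gap: an
  eigenvector of the exponentials must equal its own component, which is built from words and
  therefore moves every function.

  The value \<open>c = 0\<close> is chosen because \<open>p\<^sup>* = p\<close> there: the factors
  \<open>rho\<close> and \<open>kappa\<close> become 1 and the \<open>k_l\<close> can be made to
  commute. A current with coefficient \<open>C q^(-n x)\<close> at \<open>z^n\<close> is a multiple
  of the delta function at \<open>z = q^x\<close>, so multiplication by a structure function merely
  evaluates it, and the exchange and Serre relations become identities between infinite products at
  special arguments. Loops, rather than functions alone, are needed because the modes of a current
  differ by a degree, which the derivation measures.

  The data are matched to the relations: the theta functions in \<open>k_l\<close> to its exchange
  with \<open>e\<close> and \<open>f\<close>, the weights of \<open>e\<close> and \<open>f\<close>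
  to the exchange of neighbours, and the one remaining constant \<open>gam\<close> to the
  commutator.\<close>

definition psummable :: "('i \<Rightarrow> 'a::comm_monoid_add fps) \<Rightarrow> bool"
  where "psummable x \<longleftrightarrow> (\<forall>k. finite {r. fps_nth (x r) k \<noteq> 0})"

text \<open>Every power of \<open>p\<close> sees only finitely many members of a
  \<open>psummable\<close> family, so the sum does not depend on an order of the index set.
  Arbitrary index types are therefore allowed, which makes Fubini and reindexing available for
  two-sided and for double families alike.\<close>

definition psum :: "('i \<Rightarrow> 'a::comm_monoid_add fps) \<Rightarrow> 'a fps"
  where "psum x = Abs_fps (\<lambda>k. Sum_any (\<lambda>r. fps_nth (x r) k))"

lemma psum_nth:
  assumes "finite S" "\<And>r. r \<notin> S \<Longrightarrow> fps_nth (x r) k = 0"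
  shows "fps_nth (psum x) k = (\<Sum>r\<in>S. fps_nth (x r) k)"
proof -
  have "{r. fps_nth (x r) k \<noteq> 0} \<subseteq> S" using assms(2) by auto
  then show ?thesis by (simp add: psum_def Sum_any.expand_superset[OF assms(1)])
qed

lemma psummableI_finite:
  assumes "\<And>k. finite (S k)" "\<And>k r. r \<notin> S k \<Longrightarrow> fps_nth (x r) k = 0"
  shows "psummable x"
  unfolding psummable_def
proof
  fix k show "finite {r. fps_nth (x r) k \<noteq> 0}"
    by (rule finite_subset[OF _ assms(1)[of k]]) (use assms(2) in auto)
qed

lemma psummable_finite_le:
  assumes "psummable x" shows "finite {r. \<exists>k\<le>n. fps_nth (x r) k \<noteq> 0}"
proof -
  have "{r. \<exists>k\<le>n. fps_nth (x r) k \<noteq> 0} = (\<Union>k\<in>{..n}. {r. fps_nth (x r) k \<noteq> 0})" by auto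
  then show ?thesis using assms by (simp add: psummable_def)
qed

lemma psum_add:
  assumes "psummable x" "psummable y"
  shows "psummable (\<lambda>r. x r + y r)" "psum (\<lambda>r. x r + y r) = psum x + psum y"
proof -
  show "psummable (\<lambda>r. x r + y r)"
    by (rule psummableI_finite[where S = "\<lambda>k. {r. fps_nth (x r) k \<noteq> 0} \<union> {r. fps_nth (y r) k \<noteq> 0}"])
      (use assms in \<open>auto simp: psummable_def\<close>)
  show "psum (\<lambda>r. x r + y r) = psum x + psum y"
    by (rule fps_ext) (use assms in \<open>simp add: psum_def psummable_def Sum_any.distrib\<close>)
qed

lemma psum_uminus:
  fixes x :: "'i \<Rightarrow> 'a::ab_group_add fps"
  shows "psummable x \<Longrightarrow> psummable (\<lambda>r. - x r)" "psum (\<lambda>r. - x r) = - psum x"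
proof -
  show "psummable x \<Longrightarrow> psummable (\<lambda>r. - x r)" by (simp add: psummable_def)
  show "psum (\<lambda>r. - x r) = - psum x"
    by (rule fps_ext) (simp add: psum_def Sum_any.expand_set sum_negf)
qed

lemma psum_diff:
  fixes x :: "'i \<Rightarrow> 'a::ab_group_add fps"
  assumes "psummable x" "psummable y"
  shows "psummable (\<lambda>r. x r - y r)" "psum (\<lambda>r. x r - y r) = psum x - psum y"
  using psum_add[OF assms(1) psum_uminus(1)[OF assms(2)]] by (simp_all add: psum_uminus)

lemma psum_mult_left:
  fixes x :: "'i \<Rightarrow> 'a::ring_1 fps"
  assumes "psummable x"
  shows "psummable (\<lambda>r. c * x r)" "psum (\<lambda>r. c * x r) = c * psum x"
proof -
  show 1: "psummable (\<lambda>r. c * x r)"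
  proof (rule psummableI_finite[where S = "\<lambda>n. {r. \<exists>k\<le>n. fps_nth (x r) k \<noteq> 0}"])
    fix k r assume "r \<notin> {r. \<exists>j\<le>k. fps_nth (x r) j \<noteq> 0}"
    then show "fps_nth (c * x r) k = 0" by (auto simp: fps_mult_nth intro!: sum.neutral)
  qed (rule psummable_finite_le[OF assms])
  show "psum (\<lambda>r. c * x r) = c * psum x"
  proof (rule fps_ext)
    fix n
    let ?S = "{r. \<exists>k\<le>n. fps_nth (x r) k \<noteq> 0}"
    have fin: "finite ?S" by (rule psummable_finite_le[OF assms])
    have "fps_nth (psum (\<lambda>r. c * x r)) n = (\<Sum>r\<in>?S. fps_nth (c * x r) n)"
      by (rule psum_nth[OF fin]) (auto simp: fps_mult_nth intro!: sum.neutral)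
    also have "\<dots> = (\<Sum>i=0..n. \<Sum>r\<in>?S. fps_nth c i * fps_nth (x r) (n - i))"
      unfolding fps_mult_nth by (rule sum.swap)
    also have "\<dots> = (\<Sum>i=0..n. fps_nth c i * fps_nth (psum x) (n - i))"
    proof (rule sum.cong[OF refl])
      fix i assume "i \<in> {0..n}"
      have "fps_nth (psum x) (n - i) = (\<Sum>r\<in>?S. fps_nth (x r) (n - i))"
        by (rule psum_nth[OF fin]) auto
      then show "(\<Sum>r\<in>?S. fps_nth c i * fps_nth (x r) (n - i)) = fps_nth c i * fps_nth (psum x) (n - i)"
        by (simp add: sum_distrib_left)
    qed
    finally show "fps_nth (psum (\<lambda>r. c * x r)) n = fps_nth (c * psum x) n" by (simp add: fps_mult_nth)
  qed
qed

lemma psum_mult_right: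
  fixes x :: "'i \<Rightarrow> 'a::ring_1 fps"
  assumes "psummable x"
  shows "psummable (\<lambda>r. x r * c)" "psum (\<lambda>r. x r * c) = psum x * c"
proof -
  show 1: "psummable (\<lambda>r. x r * c)"
  proof (rule psummableI_finite[where S = "\<lambda>n. {r. \<exists>k\<le>n. fps_nth (x r) k \<noteq> 0}"])
    fix k r assume "r \<notin> {r. \<exists>j\<le>k. fps_nth (x r) j \<noteq> 0}"
    then show "fps_nth (x r * c) k = 0" by (auto simp: fps_mult_nth intro!: sum.neutral)
  qed (rule psummable_finite_le[OF assms])
  show "psum (\<lambda>r. x r * c) = psum x * c"
  proof (rule fps_ext)
    fix n
    let ?S = "{r. \<exists>k\<le>n. fps_nth (x r) k \<noteq> 0}"
    have fin: "finite ?S" by (rule psummable_finite_le[OF assms])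
    have "fps_nth (psum (\<lambda>r. x r * c)) n = (\<Sum>r\<in>?S. fps_nth (x r * c) n)"
      by (rule psum_nth[OF fin]) (auto simp: fps_mult_nth intro!: sum.neutral)
    also have "\<dots> = (\<Sum>i=0..n. \<Sum>r\<in>?S. fps_nth (x r) i * fps_nth c (n - i))"
      unfolding fps_mult_nth by (rule sum.swap)
    also have "\<dots> = (\<Sum>i=0..n. fps_nth (psum x) i * fps_nth c (n - i))"
    proof (rule sum.cong[OF refl])
      fix i assume "i \<in> {0..n}"
      then have "fps_nth (psum x) i = (\<Sum>r\<in>?S. fps_nth (x r) i)"
        by (intro psum_nth[OF fin]) auto
      then show "(\<Sum>r\<in>?S. fps_nth (x r) i * fps_nth c (n - i)) = fps_nth (psum x) i * fps_nth c (n - i)"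
        by (simp add: sum_distrib_right)
    qed
    finally show "fps_nth (psum (\<lambda>r. x r * c)) n = fps_nth (psum x * c) n" by (simp add: fps_mult_nth)
  qed
qed

lemma psum_reindex:
  assumes "bij f"
  shows "psummable (\<lambda>r. x (f r)) \<longleftrightarrow> psummable x" "psum (\<lambda>r. x (f r)) = psum x"
proof -
  have "{r. fps_nth (x r) k \<noteq> 0} = f ` {r. fps_nth (x (f r)) k \<noteq> 0}" for k
  proof (intro equalityI subsetI)
    fix s assume "s \<in> {r. fps_nth (x r) k \<noteq> 0}"
    moreover obtain r where "s = f r" using assms by (metis bij_pointE)
    ultimately show "s \<in> f ` {r. fps_nth (x (f r)) k \<noteq> 0}" by auto
  qed auto
  moreover have "inj_on f S" for S using assms by (meson bij_is_inj inj_on_subset subset_UNIV)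
  ultimately show "psummable (\<lambda>r. x (f r)) \<longleftrightarrow> psummable x"
    by (simp add: psummable_def finite_image_iff)
  show "psum (\<lambda>r. x (f r)) = psum x"
    by (rule fps_ext) (auto simp: psum_def o_def intro!: Sum_any.reindex_cong[OF assms, symmetric])
qed

lemma psum_inj:
  assumes "inj f" "\<And>s. s \<notin> range f \<Longrightarrow> x s = 0"
  shows "psummable (\<lambda>r. x (f r)) \<longleftrightarrow> psummable x" "psum (\<lambda>r. x (f r)) = psum x"
proof -
  have eq: "{r. fps_nth (x r) k \<noteq> 0} = f ` {r. fps_nth (x (f r)) k \<noteq> 0}" for k
  proof (intro equalityI subsetI)
    fix s assume s: "s \<in> {r. fps_nth (x r) k \<noteq> 0}"
    have "s \<in> range f"
    proof (rule ccontr)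
      assume "s \<notin> range f"
      then have "x s = 0" by (rule assms(2))
      then show False using s by simp
    qed
    then obtain r where "s = f r" by blast
    then show "s \<in> f ` {r. fps_nth (x (f r)) k \<noteq> 0}" using s by simp
  qed auto
  have inj: "inj_on f S" for S using assms(1) by (meson inj_on_subset subset_UNIV)
  show "psummable (\<lambda>r. x (f r)) \<longleftrightarrow> psummable x"
    by (simp add: psummable_def eq finite_image_iff inj)
  show "psum (\<lambda>r. x (f r)) = psum x"
    by (rule fps_ext) (simp add: psum_def Sum_any.expand_set eq sum.reindex[OF inj] o_def)
qed

lemma psum_nat_int:
  fixes x :: "int \<Rightarrow> 'a::comm_monoid_add fps"
  assumes "\<And>r. r < 0 \<Longrightarrow> x r = 0"
  shows "psummable (\<lambda>n. x (int n)) \<longleftrightarrow> psummable x" "psum (\<lambda>n. x (int n)) = psum x"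
proof -
  have *: "x s = 0" if "s \<notin> range int" for s
    using assms[of s] that by (metis not_less rangeI zero_le_imp_eq_int)
  show "psummable (\<lambda>n. x (int n)) \<longleftrightarrow> psummable x"
    by (rule psum_inj(1)[OF inj_of_nat]) (rule *)
  show "psum (\<lambda>n. x (int n)) = psum x"
    by (rule psum_inj(2)[OF inj_of_nat]) (rule *)
qed

lemma psum_sum:
  assumes "finite S" "\<And>r. r \<notin> S \<Longrightarrow> x r = 0"
  shows "psummable x" "psum x = (\<Sum>r\<in>S. x r)"
proof -
  show "psummable x" by (rule psummableI_finite[where S = "\<lambda>_. S"]) (use assms in auto)
  show "psum x = (\<Sum>r\<in>S. x r)"
    by (rule fps_ext, subst psum_nth[OF assms(1)]) (simp_all add: assms fps_sum_nth)
qed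

text \<open>Fubini: for a fixed power of \<open>p\<close> the support projects to finite sets in
  both coordinates, so the iterated sum is a finite sum over their rectangle.\<close>

lemma psum_Sigma:
  fixes x :: "'i \<times> 'j \<Rightarrow> 'a::comm_monoid_add fps"
  assumes "psummable x"
  shows "psummable (\<lambda>j. x (i, j))" "psummable (\<lambda>i. psum (\<lambda>j. x (i, j)))"
    "psum (\<lambda>i. psum (\<lambda>j. x (i, j))) = psum x"
proof -
  define T where "T k = {r. fps_nth (x r) k \<noteq> 0}" for k
  have T: "finite (T k)" for k using assms by (simp add: T_def psummable_def)
  have in_T: "fps_nth (x (i, j)) k = 0" if "i \<notin> fst ` T k \<or> j \<notin> snd ` T k" for i j k
    using that by (force simp: T_def)
  show "psummable (\<lambda>j. x (i, j))" for i
    by (rule psummableI_finite[where S = "\<lambda>k. snd ` T k"]) (auto simp: T in_T)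
  have inner: "fps_nth (psum (\<lambda>j. x (i, j))) k = (\<Sum>j\<in>snd ` T k. fps_nth (x (i, j)) k)" for i k
    by (rule psum_nth) (auto simp: T in_T)
  show "psummable (\<lambda>i. psum (\<lambda>j. x (i, j)))"
    by (rule psummableI_finite[where S = "\<lambda>k. fst ` T k"]) (auto simp: T inner in_T)
  show "psum (\<lambda>i. psum (\<lambda>j. x (i, j))) = psum x"
  proof (rule fps_ext)
    fix k
    have "fps_nth (psum (\<lambda>i. psum (\<lambda>j. x (i, j)))) k = (\<Sum>i\<in>fst ` T k. \<Sum>j\<in>snd ` T k. fps_nth (x (i, j)) k)"
      by (subst psum_nth[where S = "fst ` T k"]) (auto simp: T inner in_T)
    also have "\<dots> = (\<Sum>r\<in>fst ` T k \<times> snd ` T k. fps_nth (x r) k)"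
      by (simp add: sum.cartesian_product)
    also have "\<dots> = fps_nth (psum x) k"
      by (rule psum_nth[symmetric]) (use T in_T in \<open>auto simp: mem_Times_iff\<close>)
    finally show "fps_nth (psum (\<lambda>i. psum (\<lambda>j. x (i, j)))) k = fps_nth (psum x) k" .
  qed
qed

text \<open>The map \<open>(i, j) \<mapsto> (i + j, i)\<close> is injective; after extension by zero
  off its range, Fubini sums over \<open>i\<close> for fixed \<open>n = i + j\<close>.\<close>

lemma psum_diag:
  fixes y :: "nat \<times> nat \<Rightarrow> 'a::comm_monoid_add fps"
  assumes y: "psummable y"
  shows "psummable (\<lambda>n. \<Sum>i\<le>n. y (i, n - i))" "psum (\<lambda>n. \<Sum>i\<le>n. y (i, n - i)) = psum y"
proof -
  let ?z = "\<lambda>(n, i). if i \<le> n then y (i, n - i) else 0"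
  let ?f = "\<lambda>(i, j). (i + j, i :: nat)"
  have inj: "inj ?f" by (auto simp: inj_def)
  have zf: "(\<lambda>r. ?z (?f r)) = y" by (auto simp: fun_eq_iff)
  have z0: "?z s = 0" if "s \<notin> range ?f" for s
  proof (cases s)
    case (Pair n i)
    show ?thesis
    proof (cases "i \<le> n")
      case True
      then have "s = ?f (i, n - i)" by (simp add: Pair)
      then have "s \<in> range ?f" by (rule range_eqI)
      with that show ?thesis by (rule notE)
    qed (simp add: Pair)
  qed
  have "psummable (\<lambda>r. ?z (?f r)) \<longleftrightarrow> psummable ?z"
    by (rule psum_inj(1)[OF inj]) (rule z0)
  then have sz1: "psummable ?z" unfolding zf using y by blast
  have "psum (\<lambda>r. ?z (?f r)) = psum ?z"
    by (rule psum_inj(2)[OF inj]) (rule z0)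
  then have sz2: "psum ?z = psum y" unfolding zf by (rule sym)
  have in_z: "psum (\<lambda>i. ?z (n, i)) = (\<Sum>i\<le>n. y (i, n - i))" for n
  proof -
    have "psum (\<lambda>i. ?z (n, i)) = (\<Sum>i\<in>{..n}. ?z (n, i))" by (rule psum_sum) auto
    then show ?thesis by simp
  qed
  show "psummable (\<lambda>n. \<Sum>i\<le>n. y (i, n - i))"
    using psum_Sigma(2)[OF sz1] unfolding in_z .
  show "psum (\<lambda>n. \<Sum>i\<le>n. y (i, n - i)) = psum y"
    using psum_Sigma(3)[OF sz1] unfolding in_z sz2 .
qed

lemma psum_Cauchy:
  fixes x y :: "nat \<Rightarrow> 'a::ring_1 fps"
  assumes "psummable x" "psummable y"
  shows "psummable (\<lambda>n. \<Sum>i\<le>n. x i * y (n - i))" "psum (\<lambda>n. \<Sum>i\<le>n. x i * y (n - i)) = psum x * psum y"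
proof -
  let ?w = "\<lambda>(i, j). x i * y j"
  have sw: "psummable ?w"
  proof (rule psummableI_finite)
    fix k
    show "finite ({r. \<exists>j\<le>k. fps_nth (x r) j \<noteq> 0} \<times> {r. \<exists>j\<le>k. fps_nth (y r) j \<noteq> 0})"
      by (intro finite_cartesian_product psummable_finite_le assms)
    fix r assume "r \<notin> {r. \<exists>j\<le>k. fps_nth (x r) j \<noteq> 0} \<times> {r. \<exists>j\<le>k. fps_nth (y r) j \<noteq> 0}"
    then show "fps_nth (?w r) k = 0"
      by (cases r) (auto simp: fps_mult_nth intro!: sum.neutral)
  qed
  show "psummable (\<lambda>n. \<Sum>i\<le>n. x i * y (n - i))"
    using psum_diag(1)[OF sw] by simp
  have "psum (\<lambda>n. \<Sum>i\<le>n. x i * y (n - i)) = psum ?w"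
    using psum_diag(2)[OF sw] by simp
  also have "\<dots> = psum (\<lambda>i. psum (\<lambda>j. x i * y j))"
    using psum_Sigma(3)[OF sw] by simp
  also have "\<dots> = psum x * psum y"
    by (simp add: psum_mult_left assms psum_mult_right)
  finally show "psum (\<lambda>n. \<Sum>i\<le>n. x i * y (n - i)) = psum x * psum y" .
qed

lemma psum_approx:
  fixes x :: "'i \<Rightarrow> 'a::comm_monoid_add fps"
  assumes "psummable x"
  shows "\<exists>S. finite S \<and> (\<forall>S'. finite S' \<and> S \<subseteq> S' \<longrightarrow> (\<forall>k\<le>n. fps_nth (psum x) k = fps_nth (\<Sum>r\<in>S'. x r) k))"
proof (intro exI conjI allI impI)
  let ?S = "{r. \<exists>k\<le>n. fps_nth (x r) k \<noteq> 0}"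
  show "finite ?S" by (rule psummable_finite_le[OF assms])
  fix S' k assume "finite S' \<and> ?S \<subseteq> S'" "k \<le> n"
  then show "fps_nth (psum x) k = fps_nth (\<Sum>r\<in>S'. x r) k"
    by (subst psum_nth[where S = S']) (auto simp: fps_sum_nth)
qed

lemma psum_sums:
  fixes x :: "nat \<Rightarrow> 'a::ab_group_add fps"
  assumes "psummable x"
  shows "x sums psum x"
  unfolding sums_def
proof (rule tendsto_fpsI)
  fix k
  obtain S where S: "finite S" "\<forall>S'. finite S' \<and> S \<subseteq> S' \<longrightarrow> (\<forall>j\<le>k. fps_nth (psum x) j = fps_nth (\<Sum>r\<in>S'. x r) j)"
    using psum_approx[OF assms, of k] by (elim exE conjE)
  obtain N where N: "S \<subseteq> {..<N}" using finite_nat_bounded[OF S(1)] by (elim exE)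
  show "\<forall>\<^sub>F m in sequentially. fps_nth (\<Sum>r<m. x r) k = fps_nth (psum x) k"
  proof (rule eventually_sequentiallyI[of N])
    fix m assume "N \<le> m"
    with N have "S \<subseteq> {..<m}" by (meson lessThan_subset_iff order_trans)
    then show "fps_nth (\<Sum>r<m. x r) k = fps_nth (psum x) k" using S(2)[rule_format, of "{..<m}" k] by simp
  qed
qed

lemma psum_suminf:
  fixes x :: "nat \<Rightarrow> 'a::ab_group_add fps"
  shows "psummable x \<Longrightarrow> suminf x = psum x"
  using psum_sums sums_unique by metis

text \<open>The partial sums over the members visible up to \<open>p^n\<close> converge to the sum.
  With the closed ideal of relations as \<open>I\<close>, this is how relations between members pass
  to infinite sums.\<close>

lemma psum_closed:
  fixes x :: "'i \<Rightarrow> 'a::ab_group_add fps"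
  assumes I: "closed I" "0 \<in> I" "\<And>a b. a \<in> I \<Longrightarrow> b \<in> I \<Longrightarrow> a + b \<in> I"
    and x: "psummable x" "\<And>r. x r \<in> I"
  shows "psum x \<in> I"
proof -
  define S where "S n = {r. \<exists>k\<le>n. fps_nth (x r) k \<noteq> 0}" for n
  have fin: "finite (S n)" for n unfolding S_def by (rule psummable_finite_le[OF x(1)])
  have "(\<Sum>r\<in>S n. x r) \<in> I" for n
    using fin[of n] by induction (simp_all add: I x)
  moreover have "(\<lambda>n. \<Sum>r\<in>S n. x r) \<longlonglongrightarrow> psum x"
  proof (rule tendsto_fpsI)
    fix k
    show "\<forall>\<^sub>F n in sequentially. fps_nth (\<Sum>r\<in>S n. x r) k = fps_nth (psum x) k"
    proof (rule eventually_sequentiallyI[of k])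
      fix n assume "k \<le> n"
      then show "fps_nth (\<Sum>r\<in>S n. x r) k = fps_nth (psum x) k"
        by (subst psum_nth[OF fin[of n]]) (auto simp: S_def fps_sum_nth)
    qed
  qed
  ultimately show ?thesis by (rule closed_sequentially[OF I(1)])
qed

lemma inj_neg_Suc: "inj (\<lambda>r. - int (Suc r))"
  by (auto simp: inj_def)

text \<open>The definition adds two one-sided limits; for an adically convergent family both are
  unconditional and together give the sum over all integers.\<close>

lemma int_suminf_psum:
  fixes x :: "int \<Rightarrow> 'n::finite alg"
  assumes "psummable x"
  shows "int_suminf x = psum x"
proof -
  let ?p = "\<lambda>r. if r \<ge> 0 then x r else 0" and ?m = "\<lambda>r. if r \<ge> 0 then 0 else x r"
  have s: "psummable ?p" "psummable ?m"
    by (rule psummableI_finite[where S = "\<lambda>k. {r. fps_nth (x r) k \<noteq> 0}"];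
        use assms in \<open>auto simp: psummable_def\<close>)+
  have m0: "?m s = 0" if "s \<notin> range (\<lambda>r. - int (Suc r))" for s
  proof (rule ccontr)
    assume "?m s \<noteq> 0"
    then have "s = - int (Suc (nat (- s - 1)))" by (auto split: if_splits)
    then show False using that by blast
  qed
  have "psummable (\<lambda>n. ?p (int n)) \<longleftrightarrow> psummable ?p" "psum (\<lambda>n. ?p (int n)) = psum ?p"
    by (rule psum_nat_int(1), simp, rule psum_nat_int(2), simp)
  then have p: "psummable (\<lambda>n. x (int n))" "psum (\<lambda>n. x (int n)) = psum ?p"
    using s(1) by simp_all
  have "psummable (\<lambda>n. ?m (- int (Suc n))) \<longleftrightarrow> psummable ?m" "psum (\<lambda>n. ?m (- int (Suc n))) = psum ?m"
    by (rule psum_inj(1)[OF inj_neg_Suc], rule m0, simp, rule psum_inj(2)[OF inj_neg_Suc], rule m0, simp)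
  moreover have "(\<lambda>n. ?m (- int (Suc n))) = (\<lambda>n. x (- int (Suc n)))" by auto
  ultimately have m: "psummable (\<lambda>n. x (- int (Suc n)))" "psum (\<lambda>n. x (- int (Suc n))) = psum ?m"
    using s(2) by metis+
  have "psum x = psum (\<lambda>r. ?p r + ?m r)" by (rule arg_cong[where f = psum]) auto
  also have "\<dots> = psum ?p + psum ?m" by (rule psum_add[OF s])
  finally have e: "psum x = psum ?p + psum ?m" .
  show ?thesis
    unfolding e int_suminf_def psum_suminf[OF p(1)] psum_suminf[OF m(1)] p(2) m(2) by (rule refl)
qed

section \<open>Two-sided series in one variable\<close>

text \<open>
  A series \<open>\<Sum>\<^sub>n g\<^sub>n z\<^sup>n\<close> over \<open>n \<in> \<int>\<close> with coefficients in \<open>A[[p]]\<close> and \<open>g\<^sub>-\<^sub>n\<close> divisible by \<open>p\<^sup>n\<close> is the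
  same as a power series over \<open>A\<close> in \<open>z\<close> and \<open>y = p/z\<close>; the inner variable of \<^typ>\<open>'a fps fps\<close> is \<open>y\<close>.
\<close>

definition ann_coeff :: "'a::zero fps fps \<Rightarrow> int \<Rightarrow> 'a fps"
  where "ann_coeff G n = Abs_fps (\<lambda>k. if n + int k \<ge> 0 then fps_nth (fps_nth G (nat (n + int k))) k else 0)"

text \<open>\<open>ann_coeff G n\<close> divided by \<open>p\<^sup>m\<^sup>a\<^sup>x\<^sup>(\<^sup>0\<^sup>,\<^sup>-\<^sup>n\<^sup>)\<close>\<close>

definition ann_red :: "'a::zero fps fps \<Rightarrow> int \<Rightarrow> 'a fps"
  where "ann_red G n = Abs_fps (\<lambda>i. fps_nth (fps_nth G (nat n + i)) (nat (- n) + i))"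

text \<open>The substitution \<open>z \<mapsto> p/z\<close>. It relates the two expansions of a
  quasi-periodic function; at \<open>c = 0\<close> the currents \<open>k\<^sup>-\<close> arise from
  \<open>k\<^sup>+\<close> through it, up to the factor \<open>q^(2h)\<close>.\<close>

definition ann_swap :: "'a::zero fps fps \<Rightarrow> 'a fps fps"
  where "ann_swap G = Abs_fps (\<lambda>a. Abs_fps (\<lambda>b. fps_nth (fps_nth G b) a))"

text \<open>The monomial \<open>z^a y^b\<close> is \<open>p^b z^(a-b)\<close>; once
  \<open>p^max(0,b-a)\<close> is removed, \<open>p^min(a,b)\<close> is left.\<close>

definition ann_of :: "(int \<Rightarrow> 'a::zero fps) \<Rightarrow> 'a fps fps"
  where "ann_of X = Abs_fps (\<lambda>a. Abs_fps (\<lambda>b. fps_nth (X (int a - int b)) (min a b)))"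

lemma ann_red_of: "ann_red (ann_of X) n = X n"
  by (rule fps_ext) (simp add: ann_red_def ann_of_def)

lemma ann_coeff_red: "ann_coeff G n = fps_X ^ nat (- n) * ann_red (G :: 'a::ring_1 fps fps) n"
proof (rule fps_ext)
  fix k
  show "fps_nth (ann_coeff G n) k = fps_nth (fps_X ^ nat (- n) * ann_red G n) k"
  proof (cases "n + int k \<ge> 0")
    case True
    then have "nat n + (k - nat (- n)) = nat (n + int k)" "nat (- n) + (k - nat (- n)) = k" "\<not> k < nat (- n)" by auto
    then show ?thesis using True by (simp add: ann_coeff_def ann_red_def fps_X_power_mult_nth)
  next
    case False
    then have "k < nat (- n)" by linarith
    then show ?thesis using False by (simp add: ann_coeff_def fps_X_power_mult_nth)
  qed
qed

lemma ann_coeff_swap: "ann_coeff (ann_swap G) n = fps_X ^ nat (- n) * ann_red (G :: 'a::ring_1 fps fps) (- n)"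
  by (simp add: ann_coeff_red) (simp add: ann_red_def ann_swap_def add.commute)

lemma fps_mult_nth_nth:
  fixes G H :: "'a::ring_1 fps fps"
  shows "fps_nth (fps_nth (G * H) a) b = (\<Sum>i\<le>a. \<Sum>j\<le>b. fps_nth (fps_nth G i) j * fps_nth (fps_nth H (a - i)) (b - j))"
  by (simp add: fps_mult_nth fps_sum_nth atLeast0AtMost)

lemma ann_swap_mult: "ann_swap (G * H) = ann_swap G * ann_swap (H :: 'a::ring_1 fps fps)"
proof (rule fps_ext, rule fps_ext)
  fix a b
  have "fps_nth (fps_nth (ann_swap G * ann_swap H) a) b =
      (\<Sum>i\<le>a. \<Sum>j\<le>b. fps_nth (fps_nth G j) i * fps_nth (fps_nth H (b - j)) (a - i))"
    by (simp add: fps_mult_nth_nth) (simp add: ann_swap_def)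
  also have "\<dots> = (\<Sum>j\<le>b. \<Sum>i\<le>a. fps_nth (fps_nth G j) i * fps_nth (fps_nth H (b - j)) (a - i))"
    by (rule sum.swap)
  also have "\<dots> = fps_nth (fps_nth (ann_swap (G * H)) a) b"
    by (simp add: ann_swap_def fps_mult_nth_nth)
  finally show "fps_nth (fps_nth (ann_swap (G * H)) a) b = fps_nth (fps_nth (ann_swap G * ann_swap H) a) b" by simp
qed

lemma ann_eqI:
  assumes "\<And>n. ann_coeff G n = ann_coeff H n" shows "G = H"
proof (rule fps_ext, rule fps_ext)
  fix a b
  have "fps_nth (ann_coeff G (int a - int b)) b = fps_nth (ann_coeff H (int a - int b)) b"
    by (simp add: assms)
  then show "fps_nth (fps_nth G a) b = fps_nth (fps_nth H a) b" by (simp add: ann_coeff_def)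
qed

text \<open>The reason for the encoding: convolution of two-sided series is the product of power
  series in \<open>z\<close> and \<open>y\<close>, so associativity, inverses and cancellation are
  inherited. At order \<open>p^k\<close> only the indices \<open>-k \<le> r \<le> n + k\<close>
  contribute, hence the convolution converges.\<close>

lemma ann_coeff_mult:
  fixes G H :: "'a::ring_1 fps fps"
  shows "psummable (\<lambda>r. ann_coeff G r * ann_coeff H (n - r))"
    and "psum (\<lambda>r. ann_coeff G r * ann_coeff H (n - r)) = ann_coeff (G * H) n"
proof -
  let ?S = "\<lambda>k. {- int k..n + int k}"
  have zero: "fps_nth (ann_coeff G r * ann_coeff H (n - r)) k = 0" if "r \<notin> ?S k" for r k
    unfolding fps_mult_nth
  proof (rule sum.neutral, intro ballI)
    fix i assume "i \<in> {0..k}"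
    with that have "r + int i < 0 \<or> n - r + int (k - i) < 0" by auto
    then show "fps_nth (ann_coeff G r) i * fps_nth (ann_coeff H (n - r)) (k - i) = 0"
      by (auto simp: ann_coeff_def)
  qed
  show "psummable (\<lambda>r. ann_coeff G r * ann_coeff H (n - r))"
    by (rule psummableI_finite[where S = ?S]) (simp_all add: zero)
  show "psum (\<lambda>r. ann_coeff G r * ann_coeff H (n - r)) = ann_coeff (G * H) n"
  proof (rule fps_ext)
    fix k
    have "fps_nth (psum (\<lambda>r. ann_coeff G r * ann_coeff H (n - r))) k =
        (\<Sum>r\<in>?S k. fps_nth (ann_coeff G r * ann_coeff H (n - r)) k)"
      by (rule psum_nth) (simp_all add: zero)
    also have "\<dots> = (\<Sum>j\<le>k. \<Sum>r\<in>?S k. fps_nth (ann_coeff G r) j * fps_nth (ann_coeff H (n - r)) (k - j))"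
      unfolding fps_mult_nth atLeast0AtMost by (rule sum.swap)
    also have "\<dots> = (\<Sum>j\<le>k. if n + int k \<ge> 0 then \<Sum>i\<le>nat (n + int k). fps_nth (fps_nth G i) j * fps_nth (fps_nth H (nat (n + int k) - i)) (k - j) else 0)"
    proof (rule sum.cong[OF refl])
      fix j assume j: "j \<in> {..k}"
      show "(\<Sum>r\<in>?S k. fps_nth (ann_coeff G r) j * fps_nth (ann_coeff H (n - r)) (k - j)) =
        (if n + int k \<ge> 0 then \<Sum>i\<le>nat (n + int k). fps_nth (fps_nth G i) j * fps_nth (fps_nth H (nat (n + int k) - i)) (k - j) else 0)"
      proof (cases "n + int k \<ge> 0")
        case True
        \<comment> \<open>\<open>j\<close> is the power of \<open>p\<close> taken from the left
          factor, and \<open>i = r + j\<close> its exponent of \<open>z\<close>. The exponents in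
          both factors are nonnegative exactly for the \<open>r\<close> kept here.\<close>
        have "(\<Sum>i\<le>nat (n + int k). fps_nth (fps_nth G i) j * fps_nth (fps_nth H (nat (n + int k) - i)) (k - j)) =
          (\<Sum>r\<in>{- int j..n + int k - int j}. fps_nth (ann_coeff G r) j * fps_nth (ann_coeff H (n - r)) (k - j))"
        proof (rule sum.reindex_bij_witness[where i = "\<lambda>r. nat (r + int j)" and j = "\<lambda>i. int i - int j"])
          fix i assume i: "i \<in> {..nat (n + int k)}"
          then have "nat (n - (int i - int j) + int (k - j)) = nat (n + int k) - i" "n - (int i - int j) + int (k - j) \<ge> 0"
            using j True by auto
          then show "fps_nth (ann_coeff G (int i - int j)) j * fps_nth (ann_coeff H (n - (int i - int j))) (k - j) =
            fps_nth (fps_nth G i) j * fps_nth (fps_nth H (nat (n + int k) - i)) (k - j)"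
            by (simp add: ann_coeff_def)
        qed (use j True in auto)
        also have "\<dots> = (\<Sum>r\<in>?S k. fps_nth (ann_coeff G r) j * fps_nth (ann_coeff H (n - r)) (k - j))"
        proof (rule sum.mono_neutral_left)
          show "\<forall>r\<in>?S k - {- int j..n + int k - int j}. fps_nth (ann_coeff G r) j * fps_nth (ann_coeff H (n - r)) (k - j) = 0"
          proof
            fix r assume "r \<in> ?S k - {- int j..n + int k - int j}"
            then have "r + int j < 0 \<or> n - r + int (k - j) < 0" using j by auto
            then show "fps_nth (ann_coeff G r) j * fps_nth (ann_coeff H (n - r)) (k - j) = 0"
              by (auto simp: ann_coeff_def)
          qed
        qed (use j in auto)
        finally show ?thesis using True by simp
      next
        case False
        have "fps_nth (ann_coeff G r) j * fps_nth (ann_coeff H (n - r)) (k - j) = 0" for r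
        proof -
          have "r + int j < 0 \<or> n - r + int (k - j) < 0" using False j by auto
          then show ?thesis by (auto simp: ann_coeff_def)
        qed
        then show ?thesis using False by simp
      qed
    qed
    also have "\<dots> = fps_nth (ann_coeff (G * H) n) k"
    proof (cases "n + int k \<ge> 0")
      case True
      then show ?thesis
        by (simp add: ann_coeff_def fps_mult_nth_nth) (rule sum.swap)
    qed (simp add: ann_coeff_def)
    finally show "fps_nth (psum (\<lambda>r. ann_coeff G r * ann_coeff H (n - r))) k = fps_nth (ann_coeff (G * H) n) k" .
  qed
qed

lemma ann_coeff_1: "ann_coeff (1 :: 'a::ring_1 fps fps) n = (if n = 0 then 1 else 0)"
  by (rule fps_ext) (auto simp: ann_coeff_def nat_eq_iff)

lemma ann_coeff_diff: "ann_coeff (G - H) n = ann_coeff G n - ann_coeff (H :: 'a::ring_1 fps fps) n"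
  by (rule fps_ext) (simp add: ann_coeff_def)

lemma ann_red_diff: "ann_red (G - H) n = ann_red G n - ann_red (H :: 'a::ring_1 fps fps) n"
  by (rule fps_ext) (simp add: ann_red_def)

lemma ann_red_const:
  fixes G :: "'a::ring_1 fps fps"
  shows "ann_red (fps_const (fps_const c) * G) n = fps_const c * ann_red G n"
    and "ann_red (G * fps_const (fps_const c)) n = ann_red G n * fps_const c"
  by (rule fps_ext, simp add: ann_red_def)+

lemma ann_coeff_const:
  fixes G :: "'a::ring_1 fps fps"
  shows "ann_coeff (fps_const (fps_const c) * G) n = fps_const c * ann_coeff G n"
  by (rule fps_ext) (simp add: ann_coeff_def)

lemma ann_coeff_X: "ann_coeff (fps_X * G) n = ann_coeff (G :: 'a::ring_1 fps fps) (n - 1)"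
proof (rule fps_ext)
  fix k
  have "nat (n - 1 + int k) = nat (n + int k) - 1" by linarith
  then show "fps_nth (ann_coeff (fps_X * G) n) k = fps_nth (ann_coeff G (n - 1)) k"
    by (auto simp: ann_coeff_def)
qed

section \<open>Series in \<open>z\<close> and series in \<open>p/z\<close>\<close>

text \<open>Since \<open>p = z y\<close>, the term \<open>p^b z^m\<close> becomes
  \<open>z^(m+b) y^b\<close>.\<close>

definition ann_z :: "'a::zero fps fps \<Rightarrow> 'a fps fps"
  where "ann_z U = Abs_fps (\<lambda>a. Abs_fps (\<lambda>b. if b \<le> a then fps_nth (fps_nth U (a - b)) b else 0))"

definition ann_y :: "'a::zero fps fps \<Rightarrow> 'a fps fps"
  where "ann_y U = ann_swap (ann_z U)"

lemma ann_coeff_z: "ann_coeff (ann_z U) n = (if n \<ge> 0 then fps_nth U (nat n) else (0 :: 'a::ring_1 fps))"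
  by (rule fps_ext) (auto simp: ann_coeff_def ann_z_def nat_add_distrib)

lemma ann_coeff_y: "ann_coeff (ann_y U) n = (if n \<le> 0 then fps_X ^ nat (- n) * fps_nth U (nat (- n)) else (0 :: 'a::ring_1 fps))"
proof -
  have "Abs_fps (fps_nth u) = u" for u :: "'a fps" by (rule fps_ext) simp
  then show ?thesis
    by (simp add: ann_y_def ann_coeff_swap) (auto simp: ann_red_def ann_z_def intro!: fps_ext)
qed

lemma ann_z_mult: "ann_z (U * V) = ann_z U * ann_z (V :: 'a::ring_1 fps fps)"
proof (rule ann_eqI)
  fix n
  have "ann_coeff (ann_z U * ann_z V) n = psum (\<lambda>r. ann_coeff (ann_z U) r * ann_coeff (ann_z V) (n - r))"
    by (simp add: ann_coeff_mult)
  also have "\<dots> = (\<Sum>r\<in>{0..n}. ann_coeff (ann_z U) r * ann_coeff (ann_z V) (n - r))"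
    by (rule psum_sum) (auto simp: ann_coeff_z)
  also have "\<dots> = ann_coeff (ann_z (U * V)) n"
  proof (cases "n \<ge> 0")
    case True
    then have "(\<Sum>r\<in>{0..n}. ann_coeff (ann_z U) r * ann_coeff (ann_z V) (n - r)) = (\<Sum>i\<in>{0..nat n}. fps_nth U i * fps_nth V (nat n - i))"
      by (intro sum.reindex_bij_witness[where i = int and j = nat]) (auto simp: ann_coeff_z nat_diff_distrib)
    then show ?thesis using True by (simp add: ann_coeff_z fps_mult_nth)
  qed (simp add: ann_coeff_z)
  finally show "ann_coeff (ann_z (U * V)) n = ann_coeff (ann_z U * ann_z V) n" by simp
qed

lemma ann_y_mult: "ann_y (U * V) = ann_y U * ann_y (V :: 'a::ring_1 fps fps)"
  by (simp add: ann_y_def ann_z_mult ann_swap_mult)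

lemma ann_swap_swap: "ann_swap (ann_swap G) = G"
  by (rule fps_ext, rule fps_ext) (simp add: ann_swap_def)

lemma ann_swap_z: "ann_swap (ann_z U) = ann_y U" and ann_swap_y: "ann_swap (ann_y U) = ann_z U"
  by (simp_all add: ann_y_def ann_swap_swap)

lemma dil_mult: "fps_dilate c (U * V) = fps_dilate c U * fps_dilate c V"
  by (rule fps_ext) (auto simp: fps_dilate_def fps_mult_nth sum_distrib_left power_add[symmetric] mult_ac intro!: sum.cong simp flip: power_add)

lemma dil_1: "fps_dilate c 1 = 1"
  by (rule fps_ext) (simp add: fps_dilate_def)

text \<open>\<open>z \<mapsto> p z\<close> turns the expansion in \<open>z, p/z\<close> into one in \<open>p z, 1/z\<close>.\<close>

lemma ann_coeff_dil:
  fixes U V :: "'a::comm_ring_1 fps fps"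
  shows "ann_coeff (ann_z (fps_dilate fps_X U) * ann_y V) n = ann_coeff (ann_y U * ann_z (fps_dilate fps_X V)) (- n)"
proof -
  have "ann_coeff (ann_z (fps_dilate fps_X U) * ann_y V) n =
      psum (\<lambda>r. ann_coeff (ann_z (fps_dilate fps_X U)) r * ann_coeff (ann_y V) (n - r))"
    by (simp add: ann_coeff_mult)
  also have "\<dots> = psum (\<lambda>r. ann_coeff (ann_y U) (- r) * ann_coeff (ann_z (fps_dilate fps_X V)) (- n - - r))"
    by (rule arg_cong[where f = psum]) (auto simp: ann_coeff_z ann_coeff_y fps_dilate_def fun_eq_iff)
  also have "\<dots> = psum (\<lambda>r. ann_coeff (ann_y U) r * ann_coeff (ann_z (fps_dilate fps_X V)) (- n - r))"
    by (rule psum_reindex(2)[where x = "\<lambda>r. ann_coeff (ann_y U) r * ann_coeff (ann_z (fps_dilate fps_X V)) (- n - r)"])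
      (rule bij_uminus)
  also have "\<dots> = ann_coeff (ann_y U * ann_z (fps_dilate fps_X V)) (- n)"
    by (simp add: ann_coeff_mult)
  finally show ?thesis .
qed

section \<open>Infinite products\<close>

definition agree :: "nat \<Rightarrow> 'a::zero fps fps \<Rightarrow> 'a fps fps \<Rightarrow> bool"
  where "agree m F G \<longleftrightarrow> (\<forall>k. \<forall>i<m. fps_nth (fps_nth F k) i = fps_nth (fps_nth G k) i)"

lemma agree_refl: "agree m F F" by (simp add: agree_def)

lemma agree_sym: "agree m F G \<Longrightarrow> agree m G F" by (simp add: agree_def)

lemma agree_trans: "agree m F G \<Longrightarrow> agree m G H \<Longrightarrow> agree m F H" by (simp add: agree_def)

lemma agree_mono: "agree m F G \<Longrightarrow> j \<le> m \<Longrightarrow> agree j F G" by (simp add: agree_def)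

lemma agree_all: "(\<And>m. agree m F G) \<Longrightarrow> F = G"
  by (rule fps_ext, rule fps_ext) (metis agree_def lessI)

lemma agree_mult:
  fixes F G :: "'a::ring_1 fps fps"
  assumes "agree m F F'" "agree m G G'" shows "agree m (F * G) (F' * G')"
  unfolding agree_def
proof (intro allI impI)
  fix k i assume "i < m"
  then show "fps_nth (fps_nth (F * G) k) i = fps_nth (fps_nth (F' * G') k) i"
    unfolding fps_mult_nth_nth using assms by (intro sum.cong refl) (simp add: agree_def)
qed

lemma agree_dil:
  fixes F G :: "'a::comm_ring_1 fps fps"
  assumes "agree m F G" shows "agree m (fps_dilate c F) (fps_dilate c G)"
  unfolding agree_def
proof (intro allI impI)
  fix k i assume "i < m"
  then show "fps_nth (fps_nth (fps_dilate c F) k) i = fps_nth (fps_nth (fps_dilate c G) k) i"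
    using assms by (simp add: fps_dilate_def fps_mult_nth agree_def)
qed

text \<open>The limit of the partial products when the \<open>n\<close>-th factor is \<open>1\<close> modulo \<open>p\<^sup>n\<close>\<close>

definition plim :: "(nat \<Rightarrow> 'a::comm_ring_1 fps fps) \<Rightarrow> 'a fps fps"
  where "plim v = Abs_fps (\<lambda>k. Abs_fps (\<lambda>i. fps_nth (fps_nth (\<Prod>n<Suc i. v n) k) i))"

lemma agree_prod_mono:
  fixes v :: "nat \<Rightarrow> 'a::comm_ring_1 fps fps"
  assumes "\<And>n. agree n (v n) 1" "m \<le> j"
  shows "agree m (\<Prod>n<j. v n) (\<Prod>n<m. v n)"
  using assms(2)
proof (induction j rule: dec_induct)
  case (step j)
  have "agree m ((\<Prod>n<j. v n) * v j) ((\<Prod>n<m. v n) * 1)"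
    by (rule agree_mult[OF step.IH agree_mono[OF assms(1) step.hyps(1)]])
  then show ?case by simp
qed (simp add: agree_refl)

lemma agree_plim:
  assumes "\<And>n. agree n (v n) 1"
  shows "agree m (plim v) (\<Prod>n<m. v n)"
  unfolding agree_def
proof (intro allI impI)
  fix k i assume "i < m"
  then have "agree (Suc i) (\<Prod>n<m. v n) (\<Prod>n<Suc i. v n)"
    by (intro agree_prod_mono assms) simp
  then show "fps_nth (fps_nth (plim v) k) i = fps_nth (fps_nth (\<Prod>n<m. v n) k) i"
    by (simp add: plim_def agree_def del: prod.lessThan_Suc)
qed

lemma plim_unique:
  assumes "\<And>n. agree n (v n) 1" "\<And>m. agree m F (\<Prod>n<m. v n)"
  shows "F = plim v"
  by (rule agree_all, rule agree_trans[OF assms(2)], rule agree_sym, rule agree_plim, rule assms(1))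

text \<open>Ties the limits in the definitions of the structure functions to an explicit formula:
  the coefficient of \<open>p^i\<close> no longer changes from the partial product with
  \<open>i + 1\<close> factors on.\<close>

lemma coeff_lim_plim:
  assumes "\<And>n. agree n (v n) 1"
  shows "coeff_lim (\<lambda>m. \<Prod>n<m. v n) = plim v"
proof (rule fps_ext)
  fix k
  have "(\<lambda>m. fps_nth (\<Prod>n<m. v n) k) \<longlonglongrightarrow> fps_nth (plim v) k"
  proof (rule tendsto_fpsI)
    fix i
    show "\<forall>\<^sub>F m in sequentially. fps_nth (fps_nth (\<Prod>n<m. v n) k) i = fps_nth (fps_nth (plim v) k) i"
    proof (rule eventually_sequentiallyI[of "Suc i"])
      fix m assume "Suc i \<le> m"
      then show "fps_nth (fps_nth (\<Prod>n<m. v n) k) i = fps_nth (fps_nth (plim v) k) i"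
        using agree_plim[OF assms, of m] by (simp add: agree_def)
    qed
  qed
  then show "fps_nth (coeff_lim (\<lambda>m. \<Prod>n<m. v n)) k = fps_nth (plim v) k"
    by (simp add: coeff_lim_def limI)
qed

lemma power_nth_eq_0:
  fixes t :: "'a::comm_ring_1 fps"
  assumes "fps_nth t 0 = 0" "i < n" shows "fps_nth (a * t ^ n) i = 0"
proof -
  have "fps_nth (t ^ n) j = 0" if "j < n" for j using startsby_zero_power_prefix[OF assms(1)] that by blast
  then show ?thesis using assms(2) by (auto simp: fps_mult_nth intro!: sum.neutral)
qed

text \<open>\<open>(a x; t)\<^sub>\<infinity>\<close>\<close>

definition poch :: "'a::comm_ring_1 fps \<Rightarrow> 'a fps \<Rightarrow> 'a fps fps"
  where "poch a t = plim (\<lambda>n. 1 - fps_const (a * t ^ n) * fps_X)"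

lemma agree_poch_factor:
  assumes "fps_nth t 0 = (0 :: 'a::comm_ring_1)"
  shows "agree n (1 - fps_const (a * t ^ n) * fps_X) 1"
  unfolding agree_def
proof (intro allI impI)
  fix k i assume "i < n"
  then show "fps_nth (fps_nth (1 - fps_const (a * t ^ n) * fps_X) k) i = fps_nth (fps_nth 1 k) i"
    using power_nth_eq_0[OF assms, of i n a] by (cases k) (auto simp: fps_X_def)
qed

lemma qpoch_ser_poch: "fps_nth t 0 = 0 \<Longrightarrow> qpoch_ser a t = poch a t"
  unfolding qpoch_ser_def poch_def by (rule coeff_lim_plim) (rule agree_poch_factor)

lemma poch_rec:
  assumes t: "fps_nth t 0 = (0 :: 'a::comm_ring_1)"
  shows "poch a t = (1 - fps_const a * fps_X) * poch (a * t) t"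
proof (rule agree_all)
  fix m
  have "agree m ((1 - fps_const a * fps_X) * poch (a * t) t)
      ((1 - fps_const a * fps_X) * (\<Prod>n<m. 1 - fps_const (a * t * t ^ n) * fps_X))"
    unfolding poch_def by (intro agree_mult agree_refl agree_plim agree_poch_factor t)
  also have "(1 - fps_const a * fps_X) * (\<Prod>n<m. 1 - fps_const (a * t * t ^ n) * fps_X) =
      (\<Prod>n<Suc m. 1 - fps_const (a * t ^ n) * fps_X)"
    by (subst prod.lessThan_Suc_shift) (simp add: mult.assoc)
  finally have "agree m ((1 - fps_const a * fps_X) * poch (a * t) t) (\<Prod>n<Suc m. 1 - fps_const (a * t ^ n) * fps_X)" .
  moreover have "agree m (poch a t) (\<Prod>n<Suc m. 1 - fps_const (a * t ^ n) * fps_X)"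
    unfolding poch_def by (rule agree_mono[OF agree_plim[OF agree_poch_factor[OF t]]]) simp
  ultimately show "agree m (poch a t) ((1 - fps_const a * fps_X) * poch (a * t) t)"
    by (meson agree_sym agree_trans)
qed

lemma dil_prod: "fps_dilate c (\<Prod>n\<in>S. v n) = (\<Prod>n\<in>S. fps_dilate c (v n))"
  by (induction S rule: infinite_finite_induct) (simp_all add: dil_1 dil_mult)

lemma dil_poch:
  assumes t: "fps_nth t 0 = (0 :: 'a::comm_ring_1)"
  shows "fps_dilate c (poch a t) = poch (a * c) t"
  unfolding poch_def
proof (rule plim_unique)
  show "agree n (1 - fps_const (a * c * t ^ n) * fps_X) 1" for n by (rule agree_poch_factor[OF t])
  fix m
  have "fps_dilate c (1 - fps_const (a * t ^ n) * fps_X) = 1 - fps_const (a * c * t ^ n) * fps_X" for n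
    by (rule fps_ext) (simp add: fps_dilate_def fps_X_def algebra_simps)
  then have "fps_dilate c (\<Prod>n<m. 1 - fps_const (a * t ^ n) * fps_X) = (\<Prod>n<m. 1 - fps_const (a * c * t ^ n) * fps_X)"
    by (simp add: dil_prod)
  then show "agree m (fps_dilate c (plim (\<lambda>n. 1 - fps_const (a * t ^ n) * fps_X))) (\<Prod>n<m. 1 - fps_const (a * c * t ^ n) * fps_X)"
    using agree_dil[OF agree_plim[of "\<lambda>n. 1 - fps_const (a * t ^ n) * fps_X" m, OF agree_poch_factor[OF t]], of c] by simp
qed

lemma poch_nth_0:
  assumes t: "fps_nth t 0 = (0 :: 'a::comm_ring_1)" shows "fps_nth (poch a t) 0 = 1"
proof (rule fps_ext)
  fix i
  have "fps_nth (fps_nth (poch a t) 0) i = fps_nth (fps_nth (\<Prod>n<Suc i. 1 - fps_const (a * t ^ n) * fps_X) 0) i"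
    using agree_plim[of "\<lambda>n. 1 - fps_const (a * t ^ n) * fps_X" "Suc i", OF agree_poch_factor[OF t]] by (simp add: agree_def poch_def del: prod.lessThan_Suc)
  also have "fps_nth (\<Prod>n<Suc i. 1 - fps_const (a * t ^ n) * fps_X) 0 = 1"
    by (induction i) simp_all
  finally show "fps_nth (fps_nth (poch a t) 0) i = fps_nth 1 i" .
qed

text \<open>The coefficient of \<open>x^k\<close> is divisible by \<open>p^(k-d)\<close>. Such
  series can be evaluated at a unit, as currents supported at one point require. The value
  \<open>d = 1\<close> leaves room for one factor \<open>1 - a x\<close> with \<open>a\<close> not
  divisible by \<open>p\<close>.\<close>

definition cdiv :: "nat \<Rightarrow> 'a::zero fps fps \<Rightarrow> bool"
  where "cdiv d F \<longleftrightarrow> (\<forall>k i. i + d < k \<longrightarrow> fps_nth (fps_nth F k) i = 0)"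

lemma cdiv_mult:
  fixes F G :: "'a::ring_1 fps fps"
  assumes "cdiv d F" "cdiv e G" shows "cdiv (d + e) (F * G)"
  unfolding cdiv_def
proof (intro allI impI)
  fix k i assume ki: "i + (d + e) < k"
  have "fps_nth (fps_nth F a) j * fps_nth (fps_nth G (k - a)) (i - j) = 0" if "a \<le> k" "j \<le> i" for a j
  proof -
    have "j + d < a \<or> (i - j) + e < k - a" using ki that by auto
    then show ?thesis using assms by (auto simp: cdiv_def)
  qed
  then show "fps_nth (fps_nth (F * G) k) i = 0"
    unfolding fps_mult_nth_nth by (intro sum.neutral ballI) simp
qed

lemma cdiv_dil:
  assumes "fps_nth t 0 = (0 :: 'a::comm_ring_1)" shows "cdiv 0 (fps_dilate t F)"
proof -
  have "fps_nth (t ^ k * fps_nth F k) i = 0" if "i < k" for i k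
    using power_nth_eq_0[OF assms that, of "fps_nth F k"] by (simp add: mult.commute)
  then show ?thesis by (simp add: cdiv_def fps_dilate_def)
qed

lemma cdiv_lin: "cdiv 1 (1 - fps_const a * fps_X :: 'a::comm_ring_1 fps fps)"
  by (auto simp: cdiv_def fps_X_def)

lemma cdiv_lin0: "fps_nth a 0 = 0 \<Longrightarrow> cdiv 0 (1 - fps_const a * fps_X :: 'a::comm_ring_1 fps fps)"
  by (auto simp: cdiv_def fps_X_def)

text \<open>By the functional equation the product is a linear factor times its own dilation by
  \<open>t\<close>, and this dilation multiplies the coefficient of \<open>x^k\<close> by
  \<open>t^k\<close>.\<close>

lemma cdiv_poch:
  assumes t: "fps_nth t 0 = (0 :: 'a::comm_ring_1)" shows "cdiv 1 (poch a t)"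
proof -
  have "(1 - fps_const a * fps_X) * fps_dilate t (poch a t) = poch a t"
    by (simp only: dil_poch[OF t] poch_rec[OF t, of a, symmetric])
  then show ?thesis using cdiv_mult[OF cdiv_lin cdiv_dil[OF t], of a "poch a t"] by simp
qed

lemma cdiv_poch0:
  assumes t: "fps_nth t 0 = (0 :: 'a::comm_ring_1)" and a: "fps_nth a 0 = 0" shows "cdiv 0 (poch a t)"
proof -
  have "(1 - fps_const a * fps_X) * fps_dilate t (poch a t) = poch a t"
    by (simp only: dil_poch[OF t] poch_rec[OF t, of a, symmetric])
  then show ?thesis using cdiv_mult[OF cdiv_lin0[OF a] cdiv_dil[OF t], of "poch a t"] by simp
qed

text \<open>Induction on \<open>k\<close>: in the coefficient of \<open>p^i x^k\<close> in
  \<open>U V = 1\<close> with \<open>i < k\<close>, every term with \<open>a > 0\<close> vanishes,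
  because either the power of \<open>p\<close> taken from \<open>U\<close> is too small or, by
  induction, the one taken from \<open>V\<close> is.\<close>

lemma cdiv_inverse:
  fixes U V :: "'a::comm_ring_1 fps fps"
  assumes UV: "U * V = 1" and U: "cdiv 0 U" "fps_nth U 0 = 1" shows "cdiv 0 V"
proof -
  have "\<forall>i<k. fps_nth (fps_nth V k) i = 0" for k
  proof (induction k rule: less_induct)
    case (less k)
    show ?case
    proof (intro allI impI)
      fix i assume i: "i < k"
      have "0 = fps_nth (fps_nth (U * V) k) i" using UV i by simp
      also have "\<dots> = (\<Sum>a\<le>k. \<Sum>j\<le>i. fps_nth (fps_nth U a) j * fps_nth (fps_nth V (k - a)) (i - j))"
        by (rule fps_mult_nth_nth)
      also have "\<dots> = (\<Sum>a\<in>{0}. \<Sum>j\<le>i. fps_nth (fps_nth U a) j * fps_nth (fps_nth V (k - a)) (i - j))"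
      proof (rule sum.mono_neutral_right)
        show "\<forall>a\<in>{..k} - {0}. (\<Sum>j\<le>i. fps_nth (fps_nth U a) j * fps_nth (fps_nth V (k - a)) (i - j)) = 0"
        proof (intro ballI sum.neutral)
          fix a j assume "a \<in> {..k} - {0}" "j \<in> {..i}"
          then have "j < a \<or> (i - j < k - a \<and> k - a < k)" using i by auto
          then show "fps_nth (fps_nth U a) j * fps_nth (fps_nth V (k - a)) (i - j) = 0"
            using U(1) less.IH by (auto simp: cdiv_def)
        qed
      qed auto
      also have "\<dots> = fps_nth (fps_nth U 0 * fps_nth V k) i"
        by (simp add: fps_mult_nth atLeast0AtMost)
      finally show "fps_nth (fps_nth V k) i = 0" using U(2) by simp
    qed
  qed
  then show ?thesis by (simp add: cdiv_def)
qed

lemma fps_quot_mult: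
  fixes u v :: "'a::comm_ring_1 fps"
  assumes "fps_nth v 0 = 1" shows "v * fps_quot u v = u"
proof -
  have "v * fps_right_inverse v 1 = 1" by (rule fps_right_inverse) (simp add: assms)
  then show ?thesis by (simp add: fps_quot_def mult.left_commute[of v])
qed

text \<open>Identities between quotients are later proved through this equation, by multiplying with
  the denominators and cancelling them.\<close>

lemma qfrac_poch:
  assumes t: "fps_nth t 0 = 0"
  shows "poch b t * qfrac a b t = poch a t"
  by (simp add: qfrac_def qpoch_ser_poch[OF t] fps_quot_mult poch_nth_0[OF t])

lemma qfrac_cdiv:
  assumes t: "fps_nth t 0 = 0" and b: "fps_nth b 0 = 0"
  shows "cdiv 1 (qfrac a b t)" "fps_nth a 0 = 0 \<Longrightarrow> cdiv 0 (qfrac a b t)"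
proof -
  have "poch b t * fps_right_inverse (poch b t) 1 = 1"
    by (rule fps_right_inverse) (simp add: poch_nth_0[OF t])
  then have inv: "cdiv 0 (fps_right_inverse (poch b t) 1)"
    by (rule cdiv_inverse) (simp_all add: cdiv_poch0 t b poch_nth_0)
  show "cdiv 1 (qfrac a b t)"
    using cdiv_mult[OF cdiv_poch[OF t] inv] by (simp add: qfrac_def qpoch_ser_poch[OF t] fps_quot_def)
  assume "fps_nth a 0 = 0"
  then show "cdiv 0 (qfrac a b t)"
    using cdiv_mult[OF cdiv_poch0[OF t] inv, of a] by (simp add: qfrac_def qpoch_ser_poch[OF t] fps_quot_def)
qed

subsection \<open>Evaluation\<close>

text \<open>The value at \<open>x = t\<close>. As \<open>t\<close> may be a unit such as a power of
  \<open>q\<close>, convergence comes from the \<open>cdiv\<close> property of \<open>F\<close> and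
  not from \<open>t\<close>.\<close>

definition seval :: "'a::comm_ring_1 fps fps \<Rightarrow> 'a fps \<Rightarrow> 'a fps"
  where "seval F t = psum (\<lambda>n. fps_nth F n * t ^ n)"

lemma psummable_cdiv:
  fixes F :: "'a::comm_ring_1 fps fps"
  assumes "cdiv d F" shows "psummable (\<lambda>n. fps_nth F n * c n)"
proof (rule psummableI_finite[where S = "\<lambda>i. {..i + d}"])
  fix i n assume "n \<notin> {..i + d}"
  then show "fps_nth (fps_nth F n * c n) i = 0"
    using assms by (auto simp: fps_mult_nth cdiv_def intro!: sum.neutral)
qed simp

lemma seval_mult:
  fixes F G :: "'a::comm_ring_1 fps fps"
  assumes "cdiv d F" "cdiv e G" shows "seval (F * G) t = seval F t * seval G t"
proof -
  have "seval F t * seval G t = psum (\<lambda>n. \<Sum>i\<le>n. (fps_nth F i * t ^ i) * (fps_nth G (n - i) * t ^ (n - i)))"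
    unfolding seval_def by (rule psum_Cauchy(2)[symmetric]) (rule psummable_cdiv assms)+
  also have "\<dots> = psum (\<lambda>n. fps_nth (F * G) n * t ^ n)"
  proof (rule arg_cong[where f = psum], rule ext)
    fix n
    have "(fps_nth F i * t ^ i) * (fps_nth G (n - i) * t ^ (n - i)) = fps_nth F i * fps_nth G (n - i) * t ^ n" if "i \<le> n" for i
    proof -
      have "t ^ n = t ^ i * t ^ (n - i)" using that by (simp flip: power_add)
      then show ?thesis by (simp add: mult_ac)
    qed
    then show "(\<Sum>i\<le>n. (fps_nth F i * t ^ i) * (fps_nth G (n - i) * t ^ (n - i))) = fps_nth (F * G) n * t ^ n"
      by (simp add: fps_mult_nth atLeast0AtMost sum_distrib_right)
  qed
  finally show ?thesis by (simp add: seval_def)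
qed

lemma seval_lin: "seval (1 - fps_const a * fps_X) t = 1 - a * (t :: 'a::comm_ring_1 fps)"
proof -
  have "seval (1 - fps_const a * fps_X) t = (\<Sum>n\<in>{0, 1}. fps_nth (1 - fps_const a * fps_X) n * t ^ n)"
    unfolding seval_def by (rule psum_sum) (auto simp: fps_X_def)
  then show ?thesis by simp
qed

text \<open>\<open>(a; p)\<^sub>\<infinity>\<close>\<close>

definition qp :: "'a::comm_ring_1 fps \<Rightarrow> 'a fps"
  where "qp a = seval (poch a fps_X) 1"

lemma seval_poch: "seval (poch a fps_X) t = qp (a * t)"
  by (simp add: seval_def qp_def dil_poch[symmetric] fps_dilate_def mult.commute)

lemma qp_rec: "qp a = (1 - a) * qp (a * fps_X)"
proof -
  have "qp a = seval ((1 - fps_const a * fps_X) * poch (a * fps_X) fps_X) 1"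
    by (simp add: qp_def flip: poch_rec)
  also have "\<dots> = seval (1 - fps_const a * fps_X) 1 * qp (a * fps_X)"
    unfolding qp_def by (rule seval_mult[OF cdiv_lin cdiv_poch]) simp
  finally show ?thesis by (simp add: seval_lin)
qed

lemma qp_nth_0:
  assumes "fps_nth a 0 = 0" shows "fps_nth (qp a) 0 = (1 :: 'a::comm_ring_1)"
proof -
  have "fps_nth (qp a) 0 = (\<Sum>n\<in>{0}. fps_nth (fps_nth (poch a fps_X) n * 1 ^ n) 0)"
    unfolding qp_def seval_def
    by (rule psum_nth) (use cdiv_poch0[of fps_X a] assms in \<open>auto simp: cdiv_def\<close>)
  then show ?thesis by (simp add: poch_nth_0)
qed

text \<open>The factor \<open>n = 0\<close> vanishes. This zero is what makes the relations of
  \<open>e_j\<close> with itself and of \<open>f_j\<close> with itself hold in the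
  representation.\<close>

lemma qp_1: "qp (1 :: 'a::comm_ring_1 fps) = 0"
  by (subst qp_rec) simp

subsection \<open>Coefficientwise ring homomorphisms\<close>

definition rhom :: "('a::ring_1 \<Rightarrow> 'b::ring_1) \<Rightarrow> bool"
  where "rhom h \<longleftrightarrow> h 1 = 1 \<and> (\<forall>a b. h (a + b) = h a + h b) \<and> (\<forall>a b. h (a * b) = h a * h b)"

definition fps_map :: "('a \<Rightarrow> 'b) \<Rightarrow> 'a fps \<Rightarrow> 'b fps"
  where "fps_map h F = Abs_fps (\<lambda>n. h (fps_nth F n))"

lemma fps_map_nth [simp]: "fps_nth (fps_map h F) n = h (fps_nth F n)"
  by (simp add: fps_map_def)

context
  fixes h :: "'a::ring_1 \<Rightarrow> 'b::ring_1"
  assumes h: "rhom h"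
begin

lemma rhom_1: "h 1 = 1" and rhom_add: "h (a + b) = h a + h b" and rhom_mult: "h (a * b) = h a * h b"
  using h by (auto simp: rhom_def)

lemma rhom_0: "h 0 = 0" using rhom_add[of 0 0] by simp

lemma rhom_uminus: "h (- a) = - h a" using rhom_add[of a "- a"] rhom_0 by (simp add: eq_neg_iff_add_eq_0 add.commute)

lemma rhom_diff: "h (a - b) = h a - h b" using rhom_add[of a "- b"] rhom_uminus by simp

lemma rhom_sum: "h (\<Sum>x\<in>S. f x) = (\<Sum>x\<in>S. h (f x))"
  by (induction S rule: infinite_finite_induct) (simp_all add: rhom_0 rhom_add)

lemma rhom_power: "h (a ^ n) = h a ^ n"
  by (induction n) (simp_all add: rhom_1 rhom_mult)

lemma rhom_fps_map: "rhom (fps_map h)"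
  unfolding rhom_def by (auto simp: fps_eq_iff fps_mult_nth rhom_add rhom_sum rhom_mult rhom_1 rhom_0)

lemma fps_map_const: "fps_map h (fps_const c) = fps_const (h c)"
  by (simp add: fps_eq_iff rhom_0)

lemma fps_map_X: "fps_map h fps_X = fps_X"
  by (simp add: fps_eq_iff fps_X_def rhom_0 rhom_1)

lemma fps_map_psum:
  assumes "psummable x"
  shows "psummable (\<lambda>r. fps_map h (x r))" "fps_map h (psum x) = psum (\<lambda>r. fps_map h (x r))"
proof -
  have fin: "finite {r. fps_nth (x r) k \<noteq> 0}" for k using assms by (simp add: psummable_def)
  show "psummable (\<lambda>r. fps_map h (x r))"
    by (rule psummableI_finite[where S = "\<lambda>k. {r. fps_nth (x r) k \<noteq> 0}"]) (simp_all add: rhom_0 fin)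
  show "fps_map h (psum x) = psum (\<lambda>r. fps_map h (x r))"
  proof (rule fps_ext)
    fix k
    show "fps_nth (fps_map h (psum x)) k = fps_nth (psum (\<lambda>r. fps_map h (x r))) k"
      using psum_nth[OF fin[of k], where x = x] psum_nth[OF fin[of k], where x = "\<lambda>r. fps_map h (x r)"]
      by (simp add: rhom_0 rhom_sum)
  qed
qed

end

lemma rhom_prod: "rhom (h :: 'a::comm_ring_1 \<Rightarrow> 'b::comm_ring_1) \<Longrightarrow> h (\<Prod>x\<in>S. f x) = (\<Prod>x\<in>S. h (f x))"
  by (induction S rule: infinite_finite_induct) (simp_all add: rhom_1 rhom_mult)

text \<open>Each coefficient of \<open>plim\<close> is taken from a finite product, so no continuity
  of \<open>h\<close> enters.\<close>

lemma fps_map_plim: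
  fixes h :: "'a::comm_ring_1 \<Rightarrow> 'b::comm_ring_1"
  assumes "rhom h"
  shows "fps_map (fps_map h) (plim v) = plim (\<lambda>n. fps_map (fps_map h) (v n))"
  unfolding plim_def rhom_prod[OF rhom_fps_map[OF rhom_fps_map[OF assms]], symmetric]
  by (simp add: fps_eq_iff)

lemma fps_map_poch:
  fixes h :: "'a::comm_ring_1 \<Rightarrow> 'b::comm_ring_1"
  assumes h: "rhom h"
  shows "fps_map (fps_map h) (poch a t) = poch (fps_map h a) (fps_map h t)"
proof -
  note h1 = rhom_fps_map[OF h]
  note h2 = rhom_fps_map[OF h1]
  show ?thesis
    unfolding poch_def fps_map_plim[OF h]
    by (simp add: rhom_diff[OF h2] rhom_1[OF h2] rhom_mult[OF h2] fps_map_const[OF h1] fps_map_X[OF h1]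
        rhom_mult[OF h1] rhom_power[OF h1])
qed

lemma fps_map_qp:
  fixes h :: "'a::comm_ring_1 \<Rightarrow> 'b::comm_ring_1"
  assumes h: "rhom h"
  shows "fps_map h (qp a) = qp (fps_map h a)"
proof -
  have "fps_map h (qp a) = psum (\<lambda>n. fps_map h (fps_nth (poch a fps_X) n * 1 ^ n))"
    unfolding qp_def seval_def by (intro fps_map_psum h psummable_cdiv[OF cdiv_poch]) simp
  also have "\<dots> = psum (\<lambda>n. fps_nth (fps_map (fps_map h) (poch a fps_X)) n)" by simp
  finally show ?thesis by (simp add: fps_map_poch[OF h] fps_map_X[OF h] qp_def seval_def)
qed

section \<open>Homomorphisms of meromorphic functions\<close>

lemma mero_rel_refl_iff: "mero_rel f f \<longleftrightarrow> meromorphic_rep f"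
  by (auto simp: mero_rel_def gen_eq_refl)

text \<open>Respectfulness of the lifted operation, applied to a function paired with itself,
  already contains the preservation of meromorphy.\<close>

lemma meromorphic_rep_shift:
  assumes "meromorphic_rep f" shows "meromorphic_rep (\<lambda>z. f (z + (if a \<in> dyn_space then a else 0)))"
  using mero_shift.rsp assms unfolding rel_fun_def mero_rel_refl_iff[symmetric] by blast

lemma meromorphic_rep_at:
  fixes f :: "complex^'n::finite^unit \<Rightarrow> complex"
  assumes "meromorphic_rep f" shows "meromorphic_rep (\<lambda>z :: complex^'n^'b::finite. f (\<chi> u. z $ b))"
proof -
  have "\<forall>x y. x = y \<longrightarrow> (\<forall>f g :: complex^'n^unit \<Rightarrow> complex. mero_rel f g \<longrightarrow>
      mero_rel (\<lambda>z :: complex^'n^'b. f (\<chi> u. z $ x)) (\<lambda>z. g (\<chi> u. z $ y)))"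
    using mero_at.rsp unfolding rel_fun_def .
  then show ?thesis using assms unfolding mero_rel_refl_iff[symmetric] by blast
qed

lemma meromorphic_rep_lin:
  "meromorphic_rep (\<lambda>z :: complex^'n::finite^'b::finite. \<Sum>i\<in>UNIV. v $ i * z $ b $ i)"
proof -
  have "\<forall>x y. x = y \<longrightarrow> (\<forall>v w. v = w \<longrightarrow>
      mero_rel (\<lambda>z :: complex^'n^'b. \<Sum>i\<in>UNIV. v $ i * z $ x $ i) (\<lambda>z. \<Sum>i\<in>UNIV. w $ i * z $ y $ i))"
    using mero_lin.rsp unfolding rel_fun_def .
  then show ?thesis unfolding mero_rel_refl_iff[symmetric] by blast
qed

lemmas meromorphic_intros = meromorphic_rep_const meromorphic_rep_add meromorphic_rep_mult
  meromorphic_rep_shift meromorphic_rep_at meromorphic_rep_lin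

lemma mero_rel_eqI: "meromorphic_rep f \<Longrightarrow> (\<And>z. f z = g z) \<Longrightarrow> mero_rel f g"
proof -
  assume "meromorphic_rep f" "\<And>z. f z = g z"
  then have "f = g" "mero_rel f f" by (auto simp: mero_rel_refl_iff)
  then show ?thesis by simp
qed

lemma rhom_mero_const: "rhom (mero_const :: complex \<Rightarrow> ('b::finite, 'n::finite) mero)"
proof -
  have "(mero_const 1 :: ('b, 'n) mero) = 1" by transfer (simp add: mero_rel_refl_iff meromorphic_intros)
  moreover have "(mero_const (a + b) :: ('b, 'n) mero) = mero_const a + mero_const b" for a b
    by transfer (simp add: mero_rel_refl_iff meromorphic_intros)
  moreover have "(mero_const (a * b) :: ('b, 'n) mero) = mero_const a * mero_const b" for a b
    by transfer (simp add: mero_rel_refl_iff meromorphic_intros)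
  ultimately show ?thesis unfolding rhom_def by blast
qed

lemma rhom_mero_shift: "rhom (mero_shift a :: ('b::finite, 'n::finite) mero \<Rightarrow> _)"
proof -
  have "mero_shift a (1 :: ('b, 'n) mero) = 1" by transfer (simp add: mero_rel_refl_iff meromorphic_intros)
  moreover have "mero_shift a (f + g) = mero_shift a f + mero_shift a g" for f g :: "('b, 'n) mero"
    by transfer (unfold mero_rel_refl_iff, intro meromorphic_intros)
  moreover have "mero_shift a (f * g) = mero_shift a f * mero_shift a g" for f g :: "('b, 'n) mero"
    by transfer (unfold mero_rel_refl_iff, intro meromorphic_intros)
  ultimately show ?thesis unfolding rhom_def by blast
qed

lemma rhom_mero_at: "rhom (mero_at b :: (unit, 'n::finite) mero \<Rightarrow> ('b::finite, 'n) mero)"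
proof -
  have "(mero_at b 1 :: ('b, 'n) mero) = 1" by transfer (simp add: mero_rel_refl_iff meromorphic_intros)
  moreover have "(mero_at b (f + g) :: ('b, 'n) mero) = mero_at b f + mero_at b g" for f g :: "(unit, 'n) mero"
    by transfer (unfold mero_rel_refl_iff, intro meromorphic_intros)
  moreover have "(mero_at b (f * g) :: ('b, 'n) mero) = mero_at b f * mero_at b g" for f g :: "(unit, 'n) mero"
    by transfer (unfold mero_rel_refl_iff, intro meromorphic_intros)
  ultimately show ?thesis unfolding rhom_def by blast
qed

lemma mero_shift_shift:
  assumes "a \<in> dyn_space" "b \<in> dyn_space"
  shows "mero_shift a (mero_shift b f) = mero_shift (a + b) (f :: ('b::finite, 'n::finite) mero)"
  using assms
  by transfer (rule mero_rel_eqI, intro meromorphic_intros, assumption?, simp_all add: mero_rel_refl_iff dyn_add add.assoc meromorphic_intros)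

lemma mero_shift_0: "mero_shift 0 f = (f :: ('b::finite, 'n::finite) mero)"
  by transfer (simp add: zero_in_dyn)

lemma mero_shift_const: "mero_shift a (mero_const c) = (mero_const c :: ('b::finite, 'n::finite) mero)"
  by transfer (simp add: mero_rel_refl_iff meromorphic_intros)

lemma mero_at_const: "mero_at b (mero_const c) = (mero_const c :: ('b::finite, 'n::finite) mero)"
  by transfer (simp add: mero_rel_refl_iff meromorphic_intros)

lemma mero_at_lin: "mero_at b (mero_lin () v) = (mero_lin b v :: ('b::finite, 'n::finite) mero)"
  by transfer (simp add: mero_rel_refl_iff meromorphic_intros)

lemma mero_shift_at:
  assumes "a \<in> dyn_space"
  shows "mero_shift a (mero_at b f) = (mero_at b (mero_shift (\<chi> u. a $ b) f) :: ('b::finite, 'n::finite) mero)"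
proof -
  have b: "(\<chi> u::unit. a $ b) \<in> dyn_space" using assms by (simp add: dyn_space_def)
  have e: "(\<chi> u::unit. (z + a) $ b) = (\<chi> u. z $ b) + (\<chi> u. a $ b)" for z
    by (simp add: vec_eq_iff)
  show ?thesis
    using assms b e
  proof (transfer, goal_cases)
    case (1 a b f)
    have m: "meromorphic_rep (\<lambda>z. f (\<chi> u. (z + (if a \<in> dyn_space then a else 0)) $ b))"
      using 1(4) by (intro meromorphic_rep_shift[of "\<lambda>z. f (\<chi> u. z $ b)"] meromorphic_rep_at)
        (simp add: mero_rel_refl_iff)
    show ?case by (rule mero_rel_eqI[OF m]) (use 1 in simp)
  qed
qed

lemma mero_shift_lin:
  assumes "a \<in> dyn_space"
  shows "mero_shift a (mero_lin b v) = (mero_lin b v + mero_const (bil v (a $ b)) :: ('b::finite, 'n::finite) mero)"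
  using assms unfolding bil_def
proof (transfer, goal_cases)
  case (1 a b v)
  have m: "meromorphic_rep (\<lambda>z. \<Sum>i\<in>UNIV. v $ i * (z + (if a \<in> dyn_space then a else 0)) $ b $ i)"
    by (rule meromorphic_rep_shift[of "\<lambda>z. \<Sum>i\<in>UNIV. v $ i * z $ b $ i"]) (rule meromorphic_rep_lin)
  show ?case by (rule mero_rel_eqI[OF m]) (use 1 in \<open>simp add: algebra_simps sum.distrib\<close>)
qed

lemma mero_lin_add: "mero_lin b (v + w) = (mero_lin b v + mero_lin b w :: ('b::finite, 'n::finite) mero)"
proof (transfer, goal_cases)
  case (1 b v w)
  show ?case by (rule mero_rel_eqI[OF meromorphic_rep_lin]) (simp add: algebra_simps sum.distrib)
qed

lemma mero_lin_0: "mero_lin b 0 = (0 :: ('b::finite, 'n::finite) mero)"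
  using mero_lin_add[of b 0 0] by simp

lemma mero_lin_uminus: "mero_lin b (- v) = (- mero_lin b v :: ('b::finite, 'n::finite) mero)"
  using mero_lin_add[of b v "- v"] by (simp add: mero_lin_0 eq_neg_iff_add_eq_0 add.commute)

lemma rhom_inj:
  fixes h :: "'a::field \<Rightarrow> 'b::field"
  assumes h: "rhom h" shows "inj h"
proof (rule injI, rule ccontr)
  fix x y assume xy: "h x = h y" "x \<noteq> y"
  then have "h ((x - y) * inverse (x - y)) = 0" by (simp only: rhom_mult[OF h] rhom_diff[OF h]) simp
  then show False using xy by (simp add: rhom_1[OF h])
qed

lemma rhom_eq_0:
  fixes h :: "'a::field \<Rightarrow> 'b::field"
  assumes h: "rhom h" shows "h x = 0 \<longleftrightarrow> x = 0"
  using rhom_inj[OF h] rhom_0[OF h] by (metis injD)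

lemma rhom_divide:
  fixes h :: "'a::field \<Rightarrow> 'b::field"
  assumes h: "rhom h" shows "h (x / y) = h x / h y"
proof (cases "y = 0")
  case False
  then have "h (x / y) * h y = h x" by (simp flip: rhom_mult[OF h])
  then show ?thesis using False rhom_eq_0[OF h] by (simp add: field_simps)
qed (simp add: rhom_0[OF h])

lemma rhom_of_nat: "rhom h \<Longrightarrow> h (of_nat n) = of_nat n"
  by (induction n) (simp_all add: rhom_0 rhom_add rhom_1)

lemma rhom_of_int: "rhom h \<Longrightarrow> h (of_int n) = of_int n"
  by (cases n rule: int_cases2) (simp_all add: rhom_of_nat rhom_uminus)

subsection \<open>Laurent series\<close>

lemma map_fls_nth: "h 0 = 0 \<Longrightarrow> fls_nth (map_fls h F) n = h (fls_nth F n)"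
  unfolding map_fls_def
  by (subst nth_Abs_fls_lower_bound[of "fls_subdegree F"]) auto

text \<open>The product formula for Laurent series starts at the subdegrees; a homomorphism of
  fields is injective and so preserves them.\<close>

lemma rhom_map_fls:
  fixes h :: "'a::field \<Rightarrow> 'b::field"
  assumes h: "rhom h" shows "rhom (map_fls h)"
proof -
  note nth = map_fls_nth[of h, OF rhom_0[OF h]]
  have eq0: "map_fls h F = 0 \<longleftrightarrow> F = 0" for F
    by (auto simp: fls_eq_iff nth rhom_eq_0[OF h])
  have sub: "fls_subdegree (map_fls h F) = fls_subdegree F" for F
  proof (cases "F = 0")
    case False
    then have "fls_nth F (fls_subdegree F) \<noteq> 0" by simp
    then show ?thesis by (intro fls_subdegree_eqI) (simp_all add: nth rhom_eq_0[OF h])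
  next
    case True
    then have "map_fls h F = 0" using eq0 by blast
    then show ?thesis using True by simp
  qed
  have "map_fls h (F * G) = map_fls h F * map_fls h G" for F G
    by (rule fls_eqI) (simp add: nth fls_times_nth(1) sub rhom_sum[OF h] rhom_mult[OF h])
  then show ?thesis
    unfolding rhom_def by (auto simp: fls_eq_iff nth rhom_add[OF h] rhom_1[OF h] rhom_0[OF h])
qed

lemma map_fls_comp:
  assumes "f 0 = 0" "g 0 = 0" shows "map_fls f (map_fls g F) = map_fls (\<lambda>x. f (g x)) F"
  by (rule fls_eqI) (simp add: map_fls_nth assms)

lemma qpow_add: "qpow (x + y) = qpow x * qpow (y :: 'a::field_char_0)"
  by (simp add: qpow_def fps_exp_add_mult fls_times_fps_to_fls)

lemma qpow_0: "qpow 0 = (1 :: 'a::field_char_0 fls)"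
  by (simp add: qpow_def)

lemma qpow_minus: "qpow x * qpow (- x) = (1 :: 'a::field_char_0 fls)" "qpow (- x) * qpow x = (1 :: 'a::field_char_0 fls)"
  by (simp_all add: qpow_0 flip: qpow_add)

lemma qpow_nonzero: "qpow x \<noteq> (0 :: 'a::field_char_0 fls)"
  using qpow_minus(1)[of x] by auto

text \<open>The coefficient of \<open>\<hbar>\<close> recovers the exponent.\<close>

lemma qpow_inj: "qpow x = qpow y \<longleftrightarrow> x = (y :: 'a::field_char_0)"
proof
  assume "qpow x = qpow y"
  then have "fls_nth (qpow x) 1 = fls_nth (qpow y) 1" by simp
  then show "x = y" by (simp add: qpow_def)
qed simp

lemma map_fls_qpow:
  fixes h :: "'a::field_char_0 \<Rightarrow> 'b::field_char_0"
  assumes h: "rhom h" shows "map_fls h (qpow x) = qpow (h x)"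
proof (rule fls_eqI)
  fix n
  have "h (fact k) = fact k" for k using rhom_of_nat[OF h, of "fact k"] by simp
  then show "fls_nth (map_fls h (qpow x)) n = fls_nth (qpow (h x)) n"
    by (simp add: map_fls_nth rhom_0[OF h] qpow_def rhom_divide[OF h] rhom_power[OF h])
qed

section \<open>Weights\<close>

lemma zsum_add: "v \<in> zsum \<Longrightarrow> w \<in> zsum \<Longrightarrow> v + w \<in> zsum"
  by (simp add: zsum_def sum.distrib)

lemma zsum_uminus: "v \<in> zsum \<Longrightarrow> - v \<in> zsum"
  by (simp add: zsum_def sum_negf)

lemma zsum_diff: "v \<in> zsum \<Longrightarrow> w \<in> zsum \<Longrightarrow> v - w \<in> zsum"
  by (simp add: zsum_def sum_subtractf)

lemma zsum_0: "0 \<in> zsum" by (simp add: zsum_def)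

lemma eps_bar_zsum: "eps_bar i \<in> zsum"
  by (simp add: zsum_def eps_bar_def sum_subtractf axis_def)

lemma eps_zsum: "eps j \<in> zsum" by (simp add: eps_def eps_bar_zsum)

lemma alpha_zsum: "alpha j \<in> zsum" by (simp add: alpha_def zsum_diff eps_zsum)

lemma bil_commute: "bil u v = bil v u" by (simp add: bil_def mult.commute)

lemma bil_add: "bil (u + u') v = bil u v + bil u' v" "bil u (v + v') = bil u v + bil u v'"
  by (simp_all add: bil_def algebra_simps sum.distrib)

lemma bil_diff: "bil (u - u') v = bil u v - bil u' v" "bil u (v - v') = bil u v - bil u v'"
  by (simp_all add: bil_def algebra_simps sum_subtractf)

lemma bil_uminus: "bil (- u) v = - bil u v" "bil u (- v) = - bil u v"
  by (simp_all add: bil_def sum_negf)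

lemma bil_0: "bil 0 v = 0" "bil v 0 = 0" by (simp_all add: bil_def)

lemma bil_sum: "bil (\<Sum>i\<in>S. f i) v = (\<Sum>i\<in>S. bil (f i) v)"
  by (induction S rule: infinite_finite_induct) (simp_all add: bil_0 bil_add)

text \<open>The correction \<open>-1/N\<close> in \<open>eps_bar\<close> is paired with the
  coordinate sum of \<open>v\<close>, which is 0.\<close>

lemma bil_eps_bar: "v \<in> zsum \<Longrightarrow> bil v (eps_bar i) = v $ i"
proof -
  assume "v \<in> zsum"
  then have "(\<Sum>k\<in>UNIV. v $ k * (1 / of_nat CARD('a))) = 0"
    unfolding sum_distrib_right[symmetric] by (simp add: zsum_def)
  then show ?thesis
    by (simp add: bil_def eps_bar_def axis_def algebra_simps sum_subtractf if_distrib[of "\<lambda>x. _ * x"] cong: if_cong)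
qed

lemma res_P_eq: "\<mu> \<in> Hstar \<Longrightarrow> res_P \<mu> = fst (snd \<mu>)"
  by (auto simp: Hstar_def res_P_def pairing_def P_el_def bil_0 bil_eps_bar vec_eq_iff)

lemma res_Ph_eq: "\<mu> \<in> Hstar \<Longrightarrow> res_Ph \<mu> = fst \<mu> + fst (snd \<mu>)"
  by (auto simp: Hstar_def res_Ph_def pairing_def Ph_el_def bil_0 bil_eps_bar vec_eq_iff)

lemma res_P_Qel: "v \<in> zsum \<Longrightarrow> res_P (Qel v) = v"
  by (simp add: res_P_eq Qel_def Hstar_def zsum_0)

lemma res_Ph_hstar_el: "v \<in> zsum \<Longrightarrow> res_Ph (hstar_el v) = v"
  by (simp add: res_Ph_eq hstar_el_def Hstar_def zsum_0)

lemma pairing_P_el: "\<mu> \<in> Hstar \<Longrightarrow> pairing \<mu> (P_el v) = bil (res_P \<mu>) v"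
  by (cases \<mu>) (simp add: res_P_eq pairing_def P_el_def bil_0)

lemma pairing_Ph_el: "\<mu> \<in> Hstar \<Longrightarrow> pairing \<mu> (Ph_el v) = bil (res_Ph \<mu>) v"
  by (cases \<mu>) (simp add: res_Ph_eq pairing_def Ph_el_def bil_0 bil_add)

text \<open>Identifies the index set of the direct sum: every zero-sum vector is a degree, attained
  on \<open>Qel\<close> and on \<open>hstar_el\<close>.\<close>

lemma res_image: "res_Ph ` (Hstar :: 'n::finite hvec set) = zsum" "res_P ` (Hstar :: 'n::finite hvec set) = zsum"
proof -
  show "res_P ` (Hstar :: 'n hvec set) = zsum"
  proof (intro equalityI subsetI)
    fix v :: "complex^'n" assume "v \<in> zsum"
    then show "v \<in> res_P ` Hstar" by (intro image_eqI[of _ _ "Qel v"]) (simp_all add: res_P_Qel, simp add: Qel_def Hstar_def zsum_0)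
  qed (auto simp: res_P_eq Hstar_def)
  show "res_Ph ` (Hstar :: 'n hvec set) = zsum"
  proof (intro equalityI subsetI)
    fix v :: "complex^'n" assume "v \<in> zsum"
    then show "v \<in> res_Ph ` Hstar" by (intro image_eqI[of _ _ "hstar_el v"]) (simp_all add: res_Ph_hstar_el, simp add: hstar_el_def Hstar_def zsum_0)
  qed (auto simp: res_Ph_eq Hstar_def zsum_add)
qed

lemma res_0: "res_P 0 = 0" "res_Ph 0 = 0"
  by (simp_all add: res_P_def res_Ph_def pairing_def zero_prod_def P_el_def Ph_el_def bil_0 vec_eq_iff)

lemma res_add:
  assumes "\<mu> \<in> Hstar" "\<nu> \<in> Hstar"
  shows "res_P (\<mu> + \<nu>) = res_P \<mu> + res_P \<nu>" "res_Ph (\<mu> + \<nu>) = res_Ph \<mu> + res_Ph \<nu>" "\<mu> + \<nu> \<in> Hstar"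
proof -
  show *: "\<mu> + \<nu> \<in> Hstar" using assms by (auto simp: Hstar_def zsum_add)
  show "res_P (\<mu> + \<nu>) = res_P \<mu> + res_P \<nu>" "res_Ph (\<mu> + \<nu>) = res_Ph \<mu> + res_Ph \<nu>"
    using assms * by (simp_all add: res_P_eq res_Ph_eq)
qed

section \<open>The quotient by the closed ideal of relations\<close>

lemma type_ring_simps [simp]:
  "carrier type_ring = UNIV" "x \<otimes>\<^bsub>type_ring\<^esub> y = x * y" "\<one>\<^bsub>type_ring\<^esub> = 1"
  "\<zero>\<^bsub>type_ring\<^esub> = 0" "x \<oplus>\<^bsub>type_ring\<^esub> y = x + y"
  by (simp_all add: type_ring_def)

lemma ring_type_ring: "ring (type_ring :: 'a::ring_1 ring)"
proof (rule ringI)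
  show "abelian_group (type_ring :: 'a ring)"
    by (rule abelian_groupI) (auto simp: algebra_simps intro: exI[of _ "- x" for x])
  show "monoid (type_ring :: 'a ring)" by (rule monoidI) (auto simp: algebra_simps)
qed (auto simp: algebra_simps)

lemma cring_type_ring: "cring (type_ring :: 'a::comm_ring_1 ring)"
proof (rule cringI)
  show "abelian_group (type_ring :: 'a ring)" using ring_type_ring by (rule ring.is_abelian_group)
  show "comm_monoid (type_ring :: 'a ring)" by (rule comm_monoidI) (auto simp: algebra_simps)
qed (auto simp: algebra_simps)

lemma type_ring_uminus: "\<ominus>\<^bsub>type_ring\<^esub> x = - (x :: 'a::ring_1)"
  using abelian_group.minus_equality[OF ring.is_abelian_group[OF ring_type_ring], of "- x" x] by simp

lemma type_ring_minus: "x \<ominus>\<^bsub>type_ring\<^esub> y = x - (y :: 'a::ring_1)"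
  by (simp add: a_minus_def type_ring_uminus)

definition is_ideal :: "'a::ring_1 set \<Rightarrow> bool"
  where "is_ideal J \<longleftrightarrow> 0 \<in> J \<and> (\<forall>a\<in>J. \<forall>b\<in>J. a + b \<in> J) \<and> (\<forall>a\<in>J. \<forall>x. x * a \<in> J \<and> a * x \<in> J)"

lemma ideal_iff_is_ideal: "ideal J type_ring \<longleftrightarrow> is_ideal (J :: 'a::ring_1 set)"
proof
  assume J: "ideal J (type_ring :: 'a ring)"
  then interpret ideal J type_ring .
  have "0 \<in> J" using additive_subgroup.zero_closed[OF is_additive_subgroup] by simp
  moreover have "a + b \<in> J" if "a \<in> J" "b \<in> J" for a b using additive_subgroup.a_closed[OF is_additive_subgroup that] by simp
  moreover have "x * a \<in> J" "a * x \<in> J" if "a \<in> J" for a x using I_l_closed[OF that, of x] I_r_closed[OF that, of x] by simp_all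
  ultimately show "is_ideal J" by (simp add: is_ideal_def)
next
  assume J: "is_ideal J"
  have neg: "- a \<in> J" if "a \<in> J" for a
  proof -
    have "(- 1) * a \<in> J" using J that unfolding is_ideal_def by blast
    then show ?thesis by simp
  qed
  show "ideal J (type_ring :: 'a ring)"
  proof (rule idealI[OF ring_type_ring])
    show "subgroup J (add_monoid (type_ring :: 'a ring))"
    proof (rule subgroup.intro)
      fix a assume "a \<in> J"
      then show "inv\<^bsub>add_monoid type_ring\<^esub> a \<in> J"
        using neg type_ring_uminus[of a] by (simp add: a_inv_def)
    qed (use J in \<open>auto simp: is_ideal_def\<close>)
  qed (use J in \<open>auto simp: is_ideal_def\<close>)
qed

lemma fps_tendsto_mult:
  fixes c :: "'a::ring_1 fps"
  assumes "(x \<longlongrightarrow> l) F"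
  shows "((\<lambda>n. c * x n) \<longlongrightarrow> c * l) F" "((\<lambda>n. x n * c) \<longlongrightarrow> l * c) F"
proof -
  have ev: "\<forall>\<^sub>F n in F. \<forall>j\<in>{..k}. fps_nth (x n) j = fps_nth l j" for k
    using assms by (subst eventually_ball_finite_distrib) (auto simp: tendsto_fps_iff)
  show "((\<lambda>n. c * x n) \<longlongrightarrow> c * l) F"
  proof (rule tendsto_fpsI)
    fix k show "\<forall>\<^sub>F n in F. fps_nth (c * x n) k = fps_nth (c * l) k"
      using ev[of k] by eventually_elim (simp add: fps_mult_nth)
  qed
  show "((\<lambda>n. x n * c) \<longlongrightarrow> l * c) F"
  proof (rule tendsto_fpsI)
    fix k show "\<forall>\<^sub>F n in F. fps_nth (x n * c) k = fps_nth (l * c) k"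
      using ev[of k] by eventually_elim (simp add: fps_mult_nth)
  qed
qed

lemma fps_tendsto_add:
  fixes x y :: "'b \<Rightarrow> 'a::ring_1 fps"
  assumes "(x \<longlongrightarrow> l) F" "(y \<longlongrightarrow> m) F"
  shows "((\<lambda>n. x n + y n) \<longlongrightarrow> l + m) F"
proof (rule tendsto_fpsI)
  fix k
  have "\<forall>\<^sub>F n in F. fps_nth (x n) k = fps_nth l k" "\<forall>\<^sub>F n in F. fps_nth (y n) k = fps_nth m k"
    using assms by (auto simp: tendsto_fps_iff)
  then show "\<forall>\<^sub>F n in F. fps_nth (x n + y n) k = fps_nth (l + m) k"
    by eventually_elim simp
qed

lemma is_ideal_closure:
  assumes J: "is_ideal (J :: 'a::ring_1 fps set)" shows "is_ideal (closure J)"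
  unfolding is_ideal_def
proof (intro conjI ballI allI)
  show "0 \<in> closure J" using J closure_subset by (auto simp: is_ideal_def)
  fix a assume "a \<in> closure J"
  then obtain x where x: "\<And>n. x n \<in> J" "x \<longlonglongrightarrow> a" unfolding closure_sequential by blast
  show "c * a \<in> closure J" for c
    unfolding closure_sequential
    using x J by (intro exI[of _ "\<lambda>n. c * x n"]) (auto simp: is_ideal_def intro: fps_tendsto_mult)
  show "a * c \<in> closure J" for c
    unfolding closure_sequential
    using x J by (intro exI[of _ "\<lambda>n. x n * c"]) (auto simp: is_ideal_def intro: fps_tendsto_mult)
  fix b assume "b \<in> closure J"
  then obtain y where y: "\<And>n. y n \<in> J" "y \<longlonglongrightarrow> b" unfolding closure_sequential by blast
  show "a + b \<in> closure J"
    unfolding closure_sequential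
    using x y J by (intro exI[of _ "\<lambda>n. x n + y n"]) (auto simp: is_ideal_def intro: fps_tendsto_add)
qed

lemma is_ideal_uqp: "is_ideal (uqp_ideal :: 'n::finite alg set)"
  unfolding uqp_ideal_def
  by (rule is_ideal_closure, subst ideal_iff_is_ideal[symmetric]) (rule ring.genideal_ideal[OF ring_type_ring], simp)

text \<open>Used with \<open>J\<close> the kernel of a representation, to show that the relations do
  not collapse too much.\<close>

lemma uqp_ideal_minimal:
  assumes "is_ideal J" "closed J" "uqp_relators \<subseteq> J"
  shows "uqp_ideal \<subseteq> (J :: 'n::finite alg set)"
  unfolding uqp_ideal_def
  by (rule closure_minimal[OF ring.genideal_minimal[OF ring_type_ring]]) (simp_all add: assms ideal_iff_is_ideal)

text \<open>Equality in the quotient, for representatives. Most computations thus stay in the free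
  algebra with its ordinary sums and products, and cosets appear only where the statement of the
  axioms needs them.\<close>

definition eqv :: "'n::finite alg \<Rightarrow> 'n alg \<Rightarrow> bool" (infix "\<doteq>" 50)
  where "a \<doteq> b \<longleftrightarrow> a - b \<in> uqp_ideal"

lemma uqp_ideal_0: "0 \<in> uqp_ideal" and uqp_ideal_add: "a \<in> uqp_ideal \<Longrightarrow> b \<in> uqp_ideal \<Longrightarrow> a + b \<in> uqp_ideal"
  and uqp_ideal_mult: "a \<in> uqp_ideal \<Longrightarrow> x * a \<in> uqp_ideal" "a \<in> uqp_ideal \<Longrightarrow> a * x \<in> uqp_ideal"
  using is_ideal_uqp unfolding is_ideal_def by blast+

lemma uqp_ideal_uminus: "a \<in> uqp_ideal \<Longrightarrow> - a \<in> uqp_ideal"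
  using uqp_ideal_mult(1)[of a "- 1"] by simp

lemma uqp_ideal_closed: "closed uqp_ideal" by (simp add: uqp_ideal_def)

lemma eqv_refl: "a \<doteq> a" by (simp add: eqv_def uqp_ideal_0)

lemma eqv_eq: "a = b \<Longrightarrow> a \<doteq> b" by (simp add: eqv_refl)

lemma eqv_sym: "a \<doteq> b \<Longrightarrow> b \<doteq> a"
  unfolding eqv_def using uqp_ideal_uminus[of "a - b"] by simp

lemma eqv_trans [trans]: "a \<doteq> b \<Longrightarrow> b \<doteq> c \<Longrightarrow> a \<doteq> c"
  unfolding eqv_def using uqp_ideal_add[of "a - b" "b - c"] by simp

lemma eqv_add: "a \<doteq> b \<Longrightarrow> c \<doteq> d \<Longrightarrow> a + c \<doteq> b + d"
  unfolding eqv_def using uqp_ideal_add[of "a - b" "c - d"] by (simp add: algebra_simps)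

lemma eqv_uminus: "a \<doteq> b \<Longrightarrow> - a \<doteq> - b"
  unfolding eqv_def using uqp_ideal_uminus[of "a - b"] by simp

lemma eqv_diff: "a \<doteq> b \<Longrightarrow> c \<doteq> d \<Longrightarrow> a - c \<doteq> b - d"
  using eqv_add[OF _ eqv_uminus] by fastforce

lemma eqv_mult: assumes "a \<doteq> b" "c \<doteq> d" shows "a * c \<doteq> b * d"
proof -
  have "(a - b) * c + b * (c - d) \<in> uqp_ideal"
    using assms unfolding eqv_def by (intro uqp_ideal_add uqp_ideal_mult)
  then show ?thesis by (simp add: eqv_def algebra_simps)
qed

lemma eqv_mult_l: "c \<doteq> d \<Longrightarrow> a * c \<doteq> a * d" and eqv_mult_r: "c \<doteq> d \<Longrightarrow> c * a \<doteq> d * a"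
  by (auto intro: eqv_mult eqv_refl)

lemma eqv_psum:
  assumes "psummable x" "psummable y" "\<And>r. x r \<doteq> y r" shows "psum x \<doteq> psum y"
proof -
  have "psum (\<lambda>r. x r - y r) \<in> uqp_ideal"
    by (rule psum_closed[OF uqp_ideal_closed uqp_ideal_0 uqp_ideal_add psum_diff(1)])
      (use assms in \<open>auto simp: eqv_def\<close>)
  then show ?thesis by (simp add: eqv_def psum_diff assms)
qed

subsection \<open>Scalars\<close>

lemma poly_mapping_sum_single: "x = (\<Sum>k\<in>Poly_Mapping.keys x. Poly_Mapping.single k (poly_mapping.lookup x k))"
  by (rule poly_mapping_eqI) (auto simp: lookup_sum lookup_single when_def in_keys_iff)

lemma single_0_comm:
  fixes c :: "'b::comm_ring_1" and x :: "'a::monoid_add \<Rightarrow>\<^sub>0 'b"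
  shows "Poly_Mapping.single 0 c * x = x * Poly_Mapping.single 0 c"
proof -
  have "Poly_Mapping.single 0 c * (\<Sum>k\<in>S. Poly_Mapping.single k (f k)) = (\<Sum>k\<in>S. Poly_Mapping.single k (f k)) * Poly_Mapping.single 0 c"
    for S and f :: "'a \<Rightarrow> 'b"
    unfolding sum_distrib_left sum_distrib_right by (simp add: mult_single mult.commute)
  then show ?thesis using poly_mapping_sum_single[of x] by metis
qed

lemma rhom_single_0: "rhom (Poly_Mapping.single 0 :: 'b::comm_ring_1 \<Rightarrow> 'a::monoid_add \<Rightarrow>\<^sub>0 'b)"
  by (simp add: rhom_def single_add mult_single)

lemma coe_fps_map: "coe = fps_map (Poly_Mapping.single 0)"
  by (simp add: coe_def fps_map_def fun_eq_iff)

lemma rhom_coe: "rhom coe"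
  unfolding coe_fps_map by (rule rhom_fps_map[OF rhom_single_0])

lemmas coe_hom = rhom_0[OF rhom_coe] rhom_1[OF rhom_coe] rhom_add[OF rhom_coe] rhom_mult[OF rhom_coe]
  rhom_diff[OF rhom_coe] rhom_power[OF rhom_coe] rhom_uminus[OF rhom_coe]

text \<open>A scalar sits on the empty word, and the coefficients of words commute.\<close>

lemma coe_comm: "coe y * a = a * coe y"
proof (rule fps_ext)
  fix n
  have "(\<Sum>i=0..n. fps_nth a (n - i) * Poly_Mapping.single 0 (fps_nth y i)) =
      (\<Sum>i=0..n. fps_nth a i * Poly_Mapping.single 0 (fps_nth y (n - i)))"
    by (rule sum.reindex_bij_witness[of _ "\<lambda>i. n - i" "\<lambda>i. n - i"]) auto
  then show "fps_nth (coe y * a) n = fps_nth (a * coe y) n"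
    by (simp add: fps_mult_nth coe_def single_0_comm)
qed

lemma coe_nome: "coe nome = fps_X"
  by (simp add: nome_def coe_fps_map fps_map_X rhom_single_0)

lemma coe_const: "coe (fps_const c) = fps_const (Poly_Mapping.single 0 c)"
  by (simp add: coe_fps_map fps_map_const rhom_single_0)

definition sca :: "complex fls \<Rightarrow> 'n::finite alg"
  where "sca a = coe (fps_const (Poly_Mapping.single 0 a))"

lemma rhom_sca: "rhom sca"
  using rhom_coe rhom_single_0[where ?'b = "complex fls" and ?'a = int]
  by (auto simp: sca_def rhom_def simp flip: fps_const_add fps_const_mult)

lemmas sca_hom = rhom_0[OF rhom_sca] rhom_1[OF rhom_sca] rhom_add[OF rhom_sca] rhom_mult[OF rhom_sca]
  rhom_diff[OF rhom_sca] rhom_uminus[OF rhom_sca]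

lemma sca_comm: "sca y * a = a * sca y" by (simp add: sca_def coe_comm)

subsection \<open>The quotient ring\<close>

lemma ideal_uqp: "ideal uqp_ideal (type_ring :: 'n::finite alg ring)"
  by (simp add: ideal_iff_is_ideal is_ideal_uqp)

lemma to_uqp_eq: "to_uqp a = to_uqp b \<longleftrightarrow> a \<doteq> b"
  unfolding to_uqp_def eqv_def
  using ring.quotient_eq_iff_same_a_r_cos[OF ring_type_ring ideal_uqp, of a b] by (simp add: type_ring_minus)

lemma carrier_uqp: "carrier (uqp :: (complex fls, 'n::finite alg set) module) = range to_uqp"
  by (auto simp: uqp_def Let_def FactRing_def A_RCOSETS_def' to_uqp_def)

lemma uqp_ops:
  fixes a b :: "'n::finite alg"
  shows "to_uqp a \<otimes>\<^bsub>uqp\<^esub> to_uqp b = to_uqp (a * b)" "to_uqp a \<oplus>\<^bsub>uqp\<^esub> to_uqp b = to_uqp (a + b)"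
    "\<one>\<^bsub>uqp\<^esub> = (to_uqp 1 :: 'n alg set)" "c \<odot>\<^bsub>uqp\<^esub> to_uqp b = to_uqp (sca c * b)"
proof -
  have hom: "to_uqp \<in> ring_hom type_ring (type_ring Quot (uqp_ideal :: 'n alg set))"
    using ideal.rcos_ring_hom[OF ideal_uqp[where ?'n = 'n]] by (simp add: to_uqp_def[abs_def])
  show 1: "to_uqp a \<otimes>\<^bsub>uqp\<^esub> to_uqp b = to_uqp (a * b)" for a b :: "'n alg"
    using ring_hom_mult[OF hom, of a b] by (simp add: uqp_def Let_def)
  show "to_uqp a \<oplus>\<^bsub>uqp\<^esub> to_uqp b = to_uqp (a + b)"
    using ring_hom_add[OF hom, of a b] by (simp add: uqp_def Let_def)
  show "\<one>\<^bsub>uqp\<^esub> = (to_uqp 1 :: 'n alg set)"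
    using ring_hom_one[OF hom] by (simp add: uqp_def Let_def)
  show "c \<odot>\<^bsub>uqp\<^esub> to_uqp b = to_uqp (sca c * b)"
    using 1[of "sca c" b] by (simp add: uqp_def Let_def sca_def)
qed

lemma uqp_zero: "\<zero>\<^bsub>uqp\<^esub> = (to_uqp 0 :: 'n::finite alg set)"
proof -
  interpret Q: ring "type_ring Quot (uqp_ideal :: 'n alg set)"
    by (rule ideal.quotient_is_ring[OF ideal_uqp])
  have "to_uqp (0 :: 'n alg) \<in> carrier (type_ring Quot uqp_ideal)"
    using carrier_uqp[where ?'n = 'n] by (auto simp: uqp_def Let_def)
  moreover have "to_uqp (0 :: 'n alg) \<oplus>\<^bsub>type_ring Quot uqp_ideal\<^esub> to_uqp 0 = to_uqp 0"
    using uqp_ops(2)[of "0 :: 'n alg" 0] by (simp add: uqp_def Let_def)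
  \<comment> \<open>An additive idempotent of a ring is its zero.\<close>
  ultimately have "to_uqp (0 :: 'n alg) = \<zero>\<^bsub>type_ring Quot uqp_ideal\<^esub>"
    using Q.add.l_cancel_one by blast
  then show ?thesis by (simp add: uqp_def Let_def)
qed

lemma uqpE:
  assumes "x \<in> carrier (uqp :: (complex fls, 'n::finite alg set) module)"
  obtains a where "x = to_uqp a"
  using assms unfolding carrier_uqp by blast

lemma to_uqp_carrier [simp]: "to_uqp a \<in> carrier uqp" by (simp add: carrier_uqp)

lemmas uqp_simps = uqp_ops uqp_zero

lemma ring_uqp: "ring (uqp :: (complex fls, 'n::finite alg set) module)" (is "ring ?A")
proof (rule ringI)
  show "abelian_group ?A"
  proof (rule abelian_groupI)
    fix x assume "x \<in> carrier ?A"
    then obtain a where "x = to_uqp a" by (rule uqpE)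
    then show "\<exists>y\<in>carrier ?A. y \<oplus>\<^bsub>?A\<^esub> x = \<zero>\<^bsub>?A\<^esub>"
      by (intro bexI[of _ "to_uqp (- a)"]) (simp_all add: uqp_simps)
  qed (auto elim!: uqpE simp: uqp_simps algebra_simps)
  show "monoid ?A" by (rule monoidI) (auto elim!: uqpE simp: uqp_simps algebra_simps)
qed (auto elim!: uqpE simp: uqp_simps algebra_simps)

lemma module_uqp: "module type_ring (uqp :: (complex fls, 'n::finite alg set) module)"
  by (rule moduleI[OF cring_type_ring ring.is_abelian_group[OF ring_uqp]])
    (auto elim!: uqpE simp: uqp_simps algebra_simps sca_hom)

lemma uqp_uminus: "\<ominus>\<^bsub>uqp\<^esub> to_uqp a = to_uqp (- a :: 'n::finite alg)"
  using abelian_group.minus_equality[OF ring.is_abelian_group[OF ring_uqp], of "to_uqp (- a)" "to_uqp a"]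
  by (simp add: uqp_simps)

lemma uqp_minus: "to_uqp a \<ominus>\<^bsub>uqp\<^esub> to_uqp b = to_uqp (a - b :: 'n::finite alg)"
  by (simp add: a_minus_def uqp_uminus uqp_simps)

lemma uqp_pow: "to_uqp a [^]\<^bsub>uqp\<^esub> (n :: nat) = to_uqp (a ^ n :: 'n::finite alg)"
proof -
  interpret ring "uqp :: (complex fls, 'n alg set) module" by (rule ring_uqp)
  show ?thesis by (induction n) (simp_all add: uqp_simps power_commutes)
qed

lemma uqp_finsum:
  fixes f :: "'i \<Rightarrow> 'n::finite alg"
  shows "finite S \<Longrightarrow> finsum uqp (\<lambda>i. to_uqp (f i)) S = to_uqp (\<Sum>i\<in>S. f i)"
proof -
  interpret ring "uqp :: (complex fls, 'n alg set) module" by (rule ring_uqp)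
  show "finite S \<Longrightarrow> ?thesis"
    by (induction S rule: finite_induct) (simp_all add: uqp_simps Pi_def)
qed

subsection \<open>Relations in the quotient\<close>

lemma relator_mem:
  assumes "uqp_rel u v" "fps_X ^ n * y = u - v" shows "(y :: 'n::finite alg) \<in> uqp_ideal"
proof -
  have "y \<in> uqp_relators"
    using assms by (auto simp: uqp_relators_def coe_nome)
  then show ?thesis
    unfolding uqp_ideal_def
    using ring.genideal_self[OF ring_type_ring, of "uqp_relators :: 'n alg set"] closure_subset by auto
qed

lemma rel_eqv: "uqp_rel u v \<Longrightarrow> u \<doteq> v"
  unfolding eqv_def by (rule relator_mem[of u v 0]) simp_all

text \<open>Needed for the modes \<open>k_(l,m)\<close> with \<open>m > 0\<close>, which the current
  contains only as \<open>p^m k_(l,m)\<close>.\<close>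

lemma rel_eqv_cancel:
  assumes "uqp_rel (fps_X ^ n * a) (fps_X ^ n * b)" shows "a \<doteq> (b :: 'n::finite alg)"
  unfolding eqv_def by (rule relator_mem[OF assms, of n]) (simp add: algebra_simps)

lemma fn_sca: "fn (map_fls mero_const a) \<doteq> sca a"
  unfolding sca_def by (rule rel_eqv[OF fn_const])

lemma fn_comm: "fn f * fn g \<doteq> fn g * fn f"
proof -
  have "fn f * fn g \<doteq> fn (f * g)" by (rule eqv_sym[OF rel_eqv[OF fn_mult]])
  also have "fn (f * g) = fn (g * f)" by (simp add: mult.commute)
  also have "fn (g * f) \<doteq> fn g * fn f" by (rule rel_eqv[OF fn_mult])
  finally show ?thesis .
qed

lemma fn_1: "fn 1 \<doteq> 1" and fn_0: "fn 0 \<doteq> 0"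
  using fn_sca[of 1] fn_sca[of 0]
  by (simp_all add: rhom_1[OF rhom_map_fls[OF rhom_mero_const]] rhom_0[OF rhom_map_fls[OF rhom_mero_const]] sca_hom)

text \<open>The index \<open>b\<close> lets functions of \<open>P + h\<close> and functions of
  \<open>P\<close> be treated together, so that the left and the right grading need one argument
  only.\<close>

definition fn_at :: "dynvar \<Rightarrow> 'n::finite dynfun1 \<Rightarrow> 'n alg"
  where "fn_at b g = fn (map_fls (mero_at b) g)"

lemma fn_Ph_at: "fn_Ph = fn_at P_plus_h" and fn_P_at: "fn_P = fn_at P_var"
  by (simp_all add: fn_at_def fn_Ph_def fn_P_def fun_eq_iff)

lemmas rhom_at = rhom_map_fls[OF rhom_mero_at]

lemma fn_at_mult: "fn_at b (f * g) \<doteq> fn_at b f * fn_at b g"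
  unfolding fn_at_def rhom_mult[OF rhom_at] by (rule rel_eqv[OF fn_mult])

lemma fn_at_add: "fn_at b (f + g) \<doteq> fn_at b f + fn_at b g"
  unfolding fn_at_def rhom_add[OF rhom_at] by (rule rel_eqv[OF fn_add])

lemma fn_at_1: "fn_at b 1 \<doteq> 1" and fn_at_0: "fn_at b 0 \<doteq> 0"
  unfolding fn_at_def rhom_1[OF rhom_at] rhom_0[OF rhom_at] by (rule fn_1 fn_0)+

lemma map_fls_at_const: "map_fls (mero_at b) (map_fls mero_const a) = map_fls mero_const a"
  by (simp add: map_fls_comp rhom_0 rhom_mero_const rhom_mero_at mero_at_const)

lemma fn_at_sca: "fn_at b (map_fls mero_const a) \<doteq> sca a"
  unfolding fn_at_def map_fls_at_const by (rule fn_sca)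

lemma chi_dyn: "v \<in> zsum \<Longrightarrow> (\<chi> u. v) \<in> dyn_space"
  by (simp add: dyn_space_def)

lemma shift1_shift1: "u \<in> zsum \<Longrightarrow> v \<in> zsum \<Longrightarrow> shift1 u (shift1 v g) = shift1 (u + v) g"
proof -
  assume "u \<in> zsum" "v \<in> zsum"
  moreover have "(\<chi> i::unit. u) + (\<chi> i. v) = (\<chi> i. u + v)" by (simp add: vec_eq_iff)
  ultimately show ?thesis
    by (simp add: shift1_def map_fls_comp rhom_0 rhom_mero_shift mero_shift_shift chi_dyn)
qed

lemma shift1_0: "shift1 0 g = g"
proof -
  have "(\<chi> u. (0 :: complex^'a)) = (0 :: complex^'a^unit)" by (simp add: vec_eq_iff)
  then show ?thesis by (simp add: shift1_def mero_shift_0 map_fls_nth fls_eq_iff)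
qed

section \<open>Homogeneous elements\<close>

text \<open>A strong form of homogeneity, with arbitrary functions in place of exponentials\<close>

definition shom :: "(dynvar \<Rightarrow> complex^'n) \<Rightarrow> 'n::finite alg \<Rightarrow> bool"
  where "shom d a \<longleftrightarrow> (\<forall>b g. fn_at b g * a \<doteq> a * fn_at b (shift1 (d b) g))"

lemma shomD: "shom d a \<Longrightarrow> fn_at b g * a \<doteq> a * fn_at b (shift1 (d b) g)"
  by (simp add: shom_def)

lemma shom_eqv: assumes "a \<doteq> a'" "shom d a" shows "shom d a'"
  unfolding shom_def
proof (intro allI)
  fix b g
  have "fn_at b g * a' \<doteq> fn_at b g * a" by (rule eqv_mult_l[OF eqv_sym[OF assms(1)]])
  also have "\<dots> \<doteq> a * fn_at b (shift1 (d b) g)" by (rule shomD[OF assms(2)])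
  also have "\<dots> \<doteq> a' * fn_at b (shift1 (d b) g)" by (rule eqv_mult_r[OF assms(1)])
  finally show "fn_at b g * a' \<doteq> a' * fn_at b (shift1 (d b) g)" .
qed

lemma shom_0: "shom d 0" by (simp add: shom_def eqv_refl)

lemma shom_1: "shom (\<lambda>_. 0) 1" by (simp add: shom_def eqv_refl shift1_0)

lemma shom_add: "shom d a \<Longrightarrow> shom d a' \<Longrightarrow> shom d (a + a')"
  unfolding shom_def distrib_left distrib_right by (blast intro: eqv_add)

lemma shom_sum: "(\<And>i. i \<in> S \<Longrightarrow> shom d (f i)) \<Longrightarrow> shom d (\<Sum>i\<in>S. f i)"
  by (induction S rule: infinite_finite_induct) (auto intro: shom_0 shom_add)

lemma shom_central:
  assumes c: "\<And>x. c * x = x * c" and a: "shom d a" shows "shom d (c * a)"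
  unfolding shom_def
proof (intro allI)
  fix b g
  have "fn_at b g * (c * a) = c * (fn_at b g * a)"
    by (simp only: mult.assoc[symmetric] c[of "fn_at b g"])
  also have "\<dots> \<doteq> c * (a * fn_at b (shift1 (d b) g))" by (rule eqv_mult_l[OF shomD[OF a]])
  finally show "fn_at b g * (c * a) \<doteq> c * a * fn_at b (shift1 (d b) g)" by (simp add: mult.assoc)
qed

lemma shom_mult:
  assumes a: "shom d a" and a': "shom d' a'" and d: "\<And>b. d b \<in> zsum" "\<And>b. d' b \<in> zsum"
  shows "shom (\<lambda>b. d b + d' b) (a * a')"
  unfolding shom_def
proof (intro allI)
  fix b g
  have "fn_at b g * (a * a') \<doteq> a * fn_at b (shift1 (d b) g) * a'"
    unfolding mult.assoc[symmetric] by (rule eqv_mult_r[OF shomD[OF a]])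
  also have "\<dots> \<doteq> a * (a' * fn_at b (shift1 (d' b) (shift1 (d b) g)))"
    unfolding mult.assoc by (rule eqv_mult_l[OF shomD[OF a']])
  also have "\<dots> = a * a' * fn_at b (shift1 (d b + d' b) g)"
    by (simp add: shift1_shift1 d add.commute mult.assoc)
  finally show "fn_at b g * (a * a') \<doteq> a * a' * fn_at b (shift1 (d b + d' b) g)" .
qed

lemma shom_psum:
  assumes x: "psummable x" "\<And>r. shom d (x r)" shows "shom d (psum x)"
  unfolding shom_def
proof (intro allI)
  fix b g
  show "fn_at b g * psum x \<doteq> psum x * fn_at b (shift1 (d b) g)"
    unfolding psum_mult_left(2)[OF x(1), symmetric] psum_mult_right(2)[OF x(1), symmetric]
    by (rule eqv_psum[OF psum_mult_left(1)[OF x(1)] psum_mult_right(1)[OF x(1)] shomD[OF x(2)]])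
qed

text \<open>The translation a function undergoes when it is moved past the generator from left to
  right. For \<open>Kinv\<close> the value is forced by that for \<open>Kgen\<close>.\<close>

fun gdeg :: "'n::finite dynfun gen \<Rightarrow> dynvar \<Rightarrow> complex^'n"
where
  "gdeg (Egen j m) b = (if b = P_var then - alpha j else 0)"
| "gdeg (Fgen j m) b = (if b = P_plus_h then - alpha j else 0)"
| "gdeg (Kgen l m) b = - eps l"
| "gdeg (Kinv l m) b = eps l"
| "gdeg _ b = 0"

lemma gdeg_zsum: "gdeg g b \<in> zsum"
  by (cases g) (auto simp: zsum_0 zsum_uminus alpha_zsum eps_zsum)

section \<open>Two-sided series modulo the relations, and the inverse currents\<close>

lemma psum_X_cancel:
  fixes x :: "'i \<Rightarrow> 'a::ring_1 fps"
  assumes "psummable (\<lambda>r. fps_X ^ k * x r)"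
  shows "psummable x" "psum (\<lambda>r. fps_X ^ k * x r) = fps_X ^ k * psum x"
proof -
  have "{r. fps_nth (x r) i \<noteq> 0} = {r. fps_nth (fps_X ^ k * x r) (i + k) \<noteq> 0}" for i
    by (simp add: fps_X_power_mult_nth)
  then show 1: "psummable x" using assms by (simp add: psummable_def)
  show "psum (\<lambda>r. fps_X ^ k * x r) = fps_X ^ k * psum x" by (rule psum_mult_left(2)[OF 1])
qed

lemma fps_X_power_cancel: "fps_X ^ k * a = fps_X ^ k * b \<longleftrightarrow> a = (b :: 'a::ring_1 fps)"
proof
  assume *: "fps_X ^ k * a = fps_X ^ k * b"
  show "a = b"
  proof (rule fps_ext)
    fix i
    have "fps_nth (fps_X ^ k * a) (i + k) = fps_nth (fps_X ^ k * b) (i + k)" by (simp add: *)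
    then show "fps_nth a i = fps_nth b i" by (simp add: fps_X_power_mult_nth)
  qed
qed simp

text \<open>The exponent \<open>c n r\<close> is \<open>max(0,-r) + max(0,r-n) - max(0,-n)\<close>,
  which is never negative since \<open>n = r + (n - r)\<close>. Hence dividing each coefficient by
  its forced power of \<open>p\<close> is compatible with products.\<close>

lemma ann_red_mult:
  fixes G H :: "'a::ring_1 fps fps"
  defines "c n r \<equiv> nat (- r) + nat (r - n) - nat (- n)"
  shows "psummable (\<lambda>r. fps_X ^ c n r * (ann_red G r * ann_red H (n - r)))"
    "psum (\<lambda>r. fps_X ^ c n r * (ann_red G r * ann_red H (n - r))) = ann_red (G * H) n"
proof -
  have eq: "ann_coeff G r * ann_coeff H (n - r) = fps_X ^ nat (- n) * (fps_X ^ c n r * (ann_red G r * ann_red H (n - r)))" for r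
  proof -
    have "ann_coeff G r * ann_coeff H (n - r) = fps_X ^ nat (- r) * (ann_red G r * fps_X ^ nat (r - n)) * ann_red H (n - r)"
      by (simp add: ann_coeff_red mult.assoc)
    also have "ann_red G r * fps_X ^ nat (r - n) = fps_X ^ nat (r - n) * ann_red G r"
      by (simp add: fps_mult_fps_X_power_commute)
    also have "fps_X ^ nat (- r) * (fps_X ^ nat (r - n) * ann_red G r) * ann_red H (n - r) =
        fps_X ^ (nat (- r) + nat (r - n)) * (ann_red G r * ann_red H (n - r))"
      by (simp add: power_add mult.assoc)
    also have "nat (- r) + nat (r - n) = nat (- n) + c n r" by (auto simp: c_def)
    finally show ?thesis by (simp add: power_add mult.assoc)
  qed
  show "psummable (\<lambda>r. fps_X ^ c n r * (ann_red G r * ann_red H (n - r)))"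
    using ann_coeff_mult(1)[of G H n] unfolding eq by (rule psum_X_cancel(1))
  have "psum (\<lambda>r. fps_X ^ nat (- n) * (fps_X ^ c n r * (ann_red G r * ann_red H (n - r)))) = fps_X ^ nat (- n) * ann_red (G * H) n"
    by (rule trans[OF ann_coeff_mult(2)[of G H n, unfolded eq] ann_coeff_red])
  then have "fps_X ^ nat (- n) * psum (\<lambda>r. fps_X ^ c n r * (ann_red G r * ann_red H (n - r))) = fps_X ^ nat (- n) * ann_red (G * H) n"
    using psum_X_cancel(2)[OF ann_coeff_mult(1)[of G H n, unfolded eq]] by simp
  then show "psum (\<lambda>r. fps_X ^ c n r * (ann_red G r * ann_red H (n - r))) = ann_red (G * H) n"
    by (simp only: fps_X_power_cancel)
qed

text \<open>Membership is asked of the reduced coefficients, so that it reaches the modes themselves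
  and not only their multiples by powers of \<open>p\<close>. By \<open>ann_red_mult\<close> the
  condition is stable under multiplication from both sides.\<close>

definition ann_ideal :: "('n::finite dynfun gen fmon \<Rightarrow>\<^sub>0 scal) fps fps set"
  where "ann_ideal = {G. \<forall>n. ann_red G n \<in> uqp_ideal}"

lemma ann_ideal_mult:
  assumes "G \<in> ann_ideal" shows "G * H \<in> ann_ideal" "H * G \<in> ann_ideal"
  using assms unfolding ann_ideal_def mem_Collect_eq ann_red_mult(2)[symmetric]
  by (intro allI psum_closed[OF uqp_ideal_closed uqp_ideal_0 uqp_ideal_add] ann_red_mult(1) uqp_ideal_mult; simp)+

lemma ann_ideal_add: "G \<in> ann_ideal \<Longrightarrow> H \<in> ann_ideal \<Longrightarrow> G + H \<in> ann_ideal"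
proof -
  have "ann_red (G + H) n = ann_red G n + ann_red H n" for n
    by (rule fps_ext) (simp add: ann_red_def)
  then show "G \<in> ann_ideal \<Longrightarrow> H \<in> ann_ideal \<Longrightarrow> G + H \<in> ann_ideal"
    by (simp add: ann_ideal_def uqp_ideal_add)
qed

definition Kser :: "nat \<Rightarrow> ('n::finite dynfun gen fmon \<Rightarrow>\<^sub>0 scal) fps fps"
  where "Kser l = ann_of (\<lambda>n. letter (Kgen l (- n)))"

definition Lser :: "nat \<Rightarrow> ('n::finite dynfun gen fmon \<Rightarrow>\<^sub>0 scal) fps fps"
  where "Lser l = ann_of (\<lambda>n. letter (Kinv l (- n)))"

lemma kplus_coeff: "kplus l n = ann_coeff (Kser l) n" and kplus_inv_coeff: "kplus_inv l n = ann_coeff (Lser l) n"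
  by (simp_all add: kplus_def kplus_inv_def ann_coeff_red Kser_def Lser_def ann_red_of coe_nome coe_hom)

lemma cur_prod_coeff:
  "cur_prod (ann_coeff G) (ann_coeff H) n = (ann_coeff (G * H) n :: 'n::finite alg)"
  unfolding cur_prod_def by (simp add: int_suminf_psum ann_coeff_mult)

text \<open>The relations speak of the coefficients of \<open>K L - 1\<close> and
  \<open>L K - 1\<close>, which carry a power of \<open>p\<close>; relators may be divided by
  it.\<close>

lemma KL_ideal:
  assumes l: "l \<in> {1..CARD('n)}"
  shows "Kser l * Lser l - 1 \<in> (ann_ideal :: ('n::finite dynfun gen fmon \<Rightarrow>\<^sub>0 scal) fps fps set)"
    "Lser l * Kser l - 1 \<in> (ann_ideal :: ('n::finite dynfun gen fmon \<Rightarrow>\<^sub>0 scal) fps fps set)"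
proof -
  have K: "kplus l = ann_coeff (Kser l)" "kplus_inv l = ann_coeff (Lser l)"
    by (simp_all add: fun_eq_iff kplus_coeff kplus_inv_coeff)
  have rel: "G - 1 \<in> ann_ideal" if "\<And>n. uqp_rel (ann_coeff G n) (if n = 0 then 1 else (0 :: 'n alg))" for G
  proof -
    have "ann_red (G - 1) n \<in> uqp_ideal" for n
      by (rule relator_mem[OF that[of n], of "nat (- n)"])
        (simp add: ann_coeff_red[symmetric] ann_coeff_diff ann_coeff_1)
    then show ?thesis by (simp add: ann_ideal_def)
  qed
  show "Kser l * Lser l - 1 \<in> (ann_ideal :: ('n dynfun gen fmon \<Rightarrow>\<^sub>0 scal) fps fps set)"
    using kk_inv[OF l] unfolding K cur_prod_coeff by (rule rel)
  show "Lser l * Kser l - 1 \<in> (ann_ideal :: ('n dynfun gen fmon \<Rightarrow>\<^sub>0 scal) fps fps set)"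
    using inv_kk[OF l] unfolding K cur_prod_coeff by (rule rel)
qed

lemma shom_Kgen: "shom (gdeg (Kgen l m)) (letter (Kgen l m))"
  unfolding shom_def
proof (intro allI)
  fix b and g :: "'a dynfun1"
  have "uqp_rel (fn_at b g * kplus l (- m)) (kplus l (- m) * fn_at b (shift1 (- res_P (Qel (eps l))) g))"
    by (cases b) (simp_all add: fn_Ph_at[symmetric] fn_P_at[symmetric] P_k Ph_k)
  then have "uqp_rel (fps_X ^ nat m * (fn_at b g * letter (Kgen l m)))
      (fps_X ^ nat m * (letter (Kgen l m) * fn_at b (shift1 (- eps l) g)))"
    by (simp add: kplus_def coe_nome coe_hom res_P_Qel eps_zsum mult.assoc fps_mult_fps_X_power_commute)
  then show "fn_at b g * letter (Kgen l m) \<doteq> letter (Kgen l m) * fn_at b (shift1 (gdeg (Kgen l m) b) g)"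
    using rel_eqv_cancel by simp
qed

lemma fn_at_fps_const: "fn_at b g = fps_const (Poly_Mapping.single (Fmon [Fun (map_fls (mero_at b) g)]) 1)"
  by (simp add: fn_at_def fn_def letter_def)

text \<open>Moving a function through \<open>k\<^sup>+(z)\<close> shifts it by
  \<open>- eps l\<close>, and a two-sided inverse must undo this. The argument is made for whole
  currents because the inverse relations couple all modes.\<close>

lemma shom_Kinv:
  assumes l: "l \<in> {1..CARD('n)}"
  shows "shom (gdeg (Kinv l m)) (letter (Kinv l m) :: 'n::finite alg)"
  unfolding shom_def
proof (intro allI)
  fix b and g :: "'n dynfun1"
  define C where "C g = (fps_const (fps_const (Poly_Mapping.single (Fmon [Fun (map_fls (mero_at b) g)]) 1)) :: ('n dynfun gen fmon \<Rightarrow>\<^sub>0 scal) fps fps)"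
    for g :: "'n dynfun1"
  let ?g = "shift1 (eps l) g"
  let ?K = "Kser l :: ('n dynfun gen fmon \<Rightarrow>\<^sub>0 scal) fps fps" and ?L = "Lser l :: ('n dynfun gen fmon \<Rightarrow>\<^sub>0 scal) fps fps"
  have KC: "?K * C g - C ?g * ?K \<in> ann_ideal"
  proof -
    have "ann_red (?K * C g - C ?g * ?K) n = letter (Kgen l (- n)) * fn_at b g - fn_at b ?g * letter (Kgen l (- n))" for n
      by (simp add: ann_red_diff C_def ann_red_const Kser_def ann_red_of fn_at_fps_const)
    moreover have "letter (Kgen l (- n)) * fn_at b g \<doteq> fn_at b ?g * letter (Kgen l (- n))" for n
      using shomD[OF shom_Kgen, of b ?g l "- n"] by (simp add: shift1_shift1 eps_zsum zsum_uminus shift1_0 eqv_sym)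
    ultimately show ?thesis by (simp add: ann_ideal_def eqv_def)
  qed
  \<comment> \<open>For exact inverses this would be \<open>C L - L C' = L (K C - C' K) L\<close>;
    the two other terms account for \<open>K L\<close> and \<open>L K\<close> being 1 only modulo
    the ideal.\<close>
  have "C g * ?L - ?L * C ?g = - (?L * ?K - 1) * (C g * ?L) + ?L * (?K * C g - C ?g * ?K) * ?L + ?L * C ?g * (?K * ?L - 1)"
    by (simp add: algebra_simps)
  also have "\<dots> = (?L * ?K - 1) * (- (C g * ?L)) + ?L * (?K * C g - C ?g * ?K) * ?L + ?L * C ?g * (?K * ?L - 1)"
    by (simp add: algebra_simps)
  also have "\<dots> \<in> ann_ideal"
    by (intro ann_ideal_add ann_ideal_mult KL_ideal[OF l] KC)
  finally have *: "C g * ?L - ?L * C ?g \<in> ann_ideal" .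
  have "ann_red (C g * ?L - ?L * C ?g) (- m) = fn_at b g * letter (Kinv l m) - letter (Kinv l m) * fn_at b ?g"
    by (simp add: ann_red_diff C_def ann_red_const Lser_def ann_red_of fn_at_fps_const)
  then show "fn_at b g * letter (Kinv l m) \<doteq> letter (Kinv l m) * fn_at b (shift1 (gdeg (Kinv l m) b) g)"
    using * by (simp add: ann_ideal_def eqv_def) metis
qed

lemma shom_letter: "shom (gdeg g) (letter g :: 'n::finite alg)"
proof (cases g)
  case (Fun f)
  show ?thesis
    unfolding shom_def Fun fn_def[symmetric] fn_at_def gdeg.simps shift1_0 by (intro allI fn_comm)
next
  case (Egen j m)
  have "uqp_rel (fn_at b h * e_cur j (- m)) (e_cur j (- m) * fn_at b (shift1 (gdeg g b) h) :: 'n alg)" for b h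
    by (cases b) (simp_all add: Egen fn_Ph_at[symmetric] fn_P_at[symmetric] shift1_0 Ph_e P_e[where j = j, unfolded res_P_Qel[OF alpha_zsum]])
  then show ?thesis unfolding shom_def Egen e_cur_def minus_minus by (intro allI rel_eqv)
next
  case (Fgen j m)
  have "uqp_rel (fn_at b h * f_cur j (- m)) (f_cur j (- m) * fn_at b (shift1 (gdeg g b) h) :: 'n alg)" for b h
    by (cases b) (simp_all add: Fgen fn_Ph_at[symmetric] fn_P_at[symmetric] shift1_0 P_f Ph_f[where j = j, unfolded res_Ph_hstar_el[OF alpha_zsum]])
  then show ?thesis unfolding shom_def Fgen f_cur_def minus_minus by (intro allI rel_eqv)
next
  case (Kgen l m)
  then show ?thesis using shom_Kgen by simp
next
  case (Kinv l m)
  show ?thesis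
  proof (cases "l \<in> {1..CARD('n)}")
    case True
    then show ?thesis unfolding Kinv by (rule shom_Kinv)
  next
    case False
    \<comment> \<open>Out of range the generator is zero in the quotient, and zero is homogeneous of
      every degree.\<close>
    have "letter g \<doteq> (0 :: 'n alg)" unfolding Kinv by (rule rel_eqv[OF kinv_range[OF False]])
    then show ?thesis by (rule shom_eqv[OF eqv_sym shom_0])
  qed
next
  case Dgen
  show ?thesis
    unfolding shom_def Dgen fn_at_def gdeg.simps shift1_0 by (intro allI eqv_sym[OF rel_eqv[OF d_fn]])
qed

section \<open>Homogeneous components of words and of power series\<close>

fun wdeg :: "'n::finite dynfun gen fmon \<Rightarrow> dynvar \<Rightarrow> complex^'n"
  where "wdeg (Fmon w) b = (\<Sum>g\<leftarrow>w. gdeg g b)"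

lemma wdeg_zsum: "wdeg k b \<in> zsum"
proof (cases k)
  case (Fmon w)
  then show ?thesis by (induction w arbitrary: k) (auto simp: zsum_0 zsum_add gdeg_zsum)
qed

lemma shom_word: "shom (wdeg k) (fps_const (Poly_Mapping.single k c) :: 'n::finite alg)"
proof (cases k)
  case (Fmon w)
  have "shom (wdeg (Fmon w)) (fps_const (Poly_Mapping.single (Fmon w) 1) :: 'n alg)"
  proof (induction w)
    case Nil
    have "Fmon [] = (0 :: 'n dynfun gen fmon)" by (simp add: zero_fmon_def)
    moreover have "wdeg (Fmon [] :: 'n dynfun gen fmon) = (\<lambda>_. 0)" by (simp add: fun_eq_iff)
    ultimately show ?case using shom_1 by simp
  next
    case (Cons g w)
    have "fps_const (Poly_Mapping.single (Fmon (g # w)) 1) = letter g * (fps_const (Poly_Mapping.single (Fmon w) 1) :: 'n alg)"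
      by (simp add: letter_def mult_single)
    moreover have "wdeg (Fmon (g # w)) = (\<lambda>b. gdeg g b + wdeg (Fmon w) b)" by (simp add: fun_eq_iff)
    ultimately show ?case
      using shom_mult[OF shom_letter Cons.IH gdeg_zsum wdeg_zsum] by simp
  qed
  then have "shom (wdeg k) (coe (fps_const c) * (fps_const (Poly_Mapping.single k 1) :: 'n alg))"
    unfolding Fmon by (rule shom_central[OF coe_comm])
  then show ?thesis by (simp add: coe_const mult_single)
qed

text \<open>The component is taken in the free algebra, word by word in each power of
  \<open>p\<close>. Its uniqueness in the quotient is a separate matter, settled later through
  eigenvalues.\<close>

definition hcomp :: "(dynvar \<Rightarrow> complex^'n) \<Rightarrow> 'n::finite alg \<Rightarrow> 'n alg"
  where "hcomp d a = Abs_fps (\<lambda>n. \<Sum>k\<in>{k \<in> Poly_Mapping.keys (fps_nth a n). wdeg k = d}.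
    Poly_Mapping.single k (poly_mapping.lookup (fps_nth a n) k))"

lemma psum_const_X:
  fixes a :: "'a::ring_1 fps"
  shows "psummable (\<lambda>n. fps_X ^ n * fps_const (fps_nth a n))" "psum (\<lambda>n. fps_X ^ n * fps_const (fps_nth a n)) = a"
proof -
  have nth: "fps_nth (fps_X ^ n * fps_const (fps_nth a n)) k = (if k = n then fps_nth a n else 0)" for n k
    by (auto simp: fps_X_power_mult_nth)
  show "psummable (\<lambda>n. fps_X ^ n * fps_const (fps_nth a n))"
    by (rule psummableI_finite[where S = "\<lambda>k. {k}"]) (auto simp: nth)
  show "psum (\<lambda>n. fps_X ^ n * fps_const (fps_nth a n)) = a"
  proof (rule fps_ext)
    fix k
    have "fps_nth (psum (\<lambda>n. fps_X ^ n * fps_const (fps_nth a n))) k = (\<Sum>n\<in>{k}. fps_nth (fps_X ^ n * fps_const (fps_nth a n)) k)"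
      by (rule psum_nth) (auto simp: nth)
    then show "fps_nth (psum (\<lambda>n. fps_X ^ n * fps_const (fps_nth a n))) k = fps_nth a k" by (simp add: nth)
  qed
qed

lemma shom_hcomp: "shom d (hcomp d a)"
proof -
  have "shom d (fps_X ^ n * fps_const (fps_nth (hcomp d a) n))" for n
  proof (rule shom_central)
    show "fps_X ^ n * x = x * fps_X ^ n" for x :: "'a alg" by (rule fps_mult_fps_X_power_commute)
    have "fps_const (fps_nth (hcomp d a) n) = (\<Sum>k\<in>{k \<in> Poly_Mapping.keys (fps_nth a n). wdeg k = d}.
      fps_const (Poly_Mapping.single k (poly_mapping.lookup (fps_nth a n) k)))"
      by (rule fps_ext) (simp add: hcomp_def fps_sum_nth)
    moreover have "shom d (fps_const (Poly_Mapping.single k c) :: 'a alg)" if "wdeg k = d" for k c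
      using shom_word that by blast
    ultimately show "shom d (fps_const (fps_nth (hcomp d a) n))" by (auto intro: shom_sum)
  qed
  then have "shom d (psum (\<lambda>n. fps_X ^ n * fps_const (fps_nth (hcomp d a) n)))"
    by (rule shom_psum[OF psum_const_X(1)])
  then show ?thesis by (simp only: psum_const_X(2))
qed

lemma fps_X_power_dvd: "(\<exists>b. a = fps_X ^ n * b) \<longleftrightarrow> (\<forall>i<n. fps_nth a i = (0 :: 'a::ring_1))"
proof
  assume "\<forall>i<n. fps_nth a i = 0"
  then have "a = fps_X ^ n * Abs_fps (\<lambda>i. fps_nth a (i + n))"
    by (intro fps_ext) (simp add: fps_X_power_mult_nth)
  then show "\<exists>b. a = fps_X ^ n * b" by blast
qed (auto simp: fps_X_power_mult_nth)

text \<open>Modulo \<open>p^n\<close> only the finitely many words in the first \<open>n\<close>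
  coefficients matter, so finitely many degrees suffice.\<close>

lemma hcomp_sum:
  fixes a :: "'n::finite alg"
  shows "\<exists>S0. finite S0 \<and> S0 \<subseteq> {d. \<forall>b. d b \<in> zsum} \<and>
    (\<forall>S. finite S \<and> S0 \<subseteq> S \<longrightarrow> (\<exists>b. a - (\<Sum>d\<in>S. hcomp d a) = fps_X ^ n * b))"
proof -
  let ?S0 = "\<Union>i<n. wdeg ` Poly_Mapping.keys (fps_nth a i)"
  show ?thesis
  proof (rule exI[of _ ?S0], intro conjI allI impI)
  show "finite ?S0" by simp
  show "?S0 \<subseteq> {d. \<forall>b. d b \<in> zsum}" by (auto simp: wdeg_zsum)
  fix S assume S: "finite S \<and> ?S0 \<subseteq> S"
  have "fps_nth (\<Sum>d\<in>S. hcomp d a) i = fps_nth a i" if "i < n" for i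
  proof -
    let ?f = "\<lambda>k. Poly_Mapping.single k (poly_mapping.lookup (fps_nth a i) k)"
    have "fps_nth (\<Sum>d\<in>S. hcomp d a) i = (\<Sum>d\<in>S. sum ?f {k \<in> Poly_Mapping.keys (fps_nth a i). wdeg k = d})"
      by (simp add: fps_sum_nth hcomp_def)
    also have "\<dots> = sum ?f (Poly_Mapping.keys (fps_nth a i))"
      by (rule sum.group) (use S that in auto)
    finally show ?thesis by (simp only: poly_mapping_sum_single[symmetric])
  qed
  then show "\<exists>b. a - (\<Sum>d\<in>S. hcomp d a) = fps_X ^ n * b"
    unfolding fps_X_power_dvd by simp
  qed
qed

subsection \<open>Eigenvectors\<close>

definition expn :: "dynvar \<Rightarrow> complex^'n \<Rightarrow> 'n::finite alg"
  where "expn b v = fn (qpow (mero_lin b v))"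

lemma expn_at: "expn b v = fn_at b (qpow (mero_lin () v))"
  by (simp add: expn_def fn_at_def map_fls_qpow rhom_mero_at mero_at_lin)

lemma expn_minus: "expn b v * expn b (- v) \<doteq> 1"
proof -
  have "expn b v * expn b (- v) \<doteq> fn (qpow (mero_lin b v) * qpow (mero_lin b (- v)))"
    unfolding expn_def by (rule eqv_sym[OF rel_eqv[OF fn_mult]])
  also have "\<dots> = fn 1" by (simp add: mero_lin_uminus qpow_minus)
  finally show ?thesis using fn_1 eqv_trans by blast
qed

lemma shift1_qpow:
  assumes "u \<in> zsum"
  shows "shift1 u (qpow (mero_lin () v)) = map_fls mero_const (qpow (bil u v)) * qpow (mero_lin () v)"
  using assms
  by (simp add: shift1_def map_fls_qpow rhom_mero_shift mero_shift_lin chi_dyn rhom_mero_const qpow_add bil_commute)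

text \<open>The homogeneity used in the bigrading, with exponentials only, for
  representatives.\<close>

definition eig :: "(dynvar \<Rightarrow> complex^'n) \<Rightarrow> 'n::finite alg \<Rightarrow> bool"
  where "eig d a \<longleftrightarrow> (\<forall>b. \<forall>v\<in>zsum. expn b v * a * expn b (- v) \<doteq> sca (qpow (bil (d b) v)) * a)"

lemma eigD: "eig d a \<Longrightarrow> v \<in> zsum \<Longrightarrow> expn b v * a * expn b (- v) \<doteq> sca (qpow (bil (d b) v)) * a"
  by (simp add: eig_def)

lemma shom_eig:
  assumes a: "shom d a" and d: "\<And>b. d b \<in> zsum" shows "eig d a"
  unfolding eig_def
proof (intro allI ballI)
  fix b v
  have "expn b v * a * expn b (- v) \<doteq> a * fn_at b (shift1 (d b) (qpow (mero_lin () v))) * expn b (- v)"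
    unfolding expn_at by (rule eqv_mult_r[OF shomD[OF a]])
  also have "\<dots> \<doteq> a * (fn_at b (map_fls mero_const (qpow (bil (d b) v))) * expn b v) * expn b (- v)"
    unfolding shift1_qpow[OF d] expn_at[of b v] by (intro eqv_mult_r eqv_mult_l fn_at_mult)
  also have "\<dots> \<doteq> a * (sca (qpow (bil (d b) v)) * expn b v) * expn b (- v)"
    by (intro eqv_mult_r eqv_mult_l fn_at_sca)
  also have "\<dots> = a * sca (qpow (bil (d b) v)) * (expn b v * expn b (- v))" by (simp add: mult.assoc)
  also have "\<dots> \<doteq> a * sca (qpow (bil (d b) v)) * 1" by (rule eqv_mult_l[OF expn_minus])
  also have "\<dots> = sca (qpow (bil (d b) v)) * a" by (simp add: sca_comm)
  finally show "expn b v * a * expn b (- v) \<doteq> sca (qpow (bil (d b) v)) * a" .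
qed

lemma eig_sca: assumes "eig d a" shows "eig d (sca c * a)"
  unfolding eig_def
proof (intro allI ballI)
  fix b and v :: "complex^'a" assume v: "v \<in> zsum"
  have "expn b v * (sca c * a) * expn b (- v) = sca c * (expn b v * a * expn b (- v))"
    by (simp only: mult.assoc[symmetric] sca_comm[of c "expn b v"])
  also have "\<dots> \<doteq> sca c * (sca (qpow (bil (d b) v)) * a)" by (rule eqv_mult_l[OF eigD[OF assms v]])
  also have "\<dots> = sca (qpow (bil (d b) v)) * (sca c * a)"
    by (simp only: mult.assoc[symmetric] sca_comm[of c "sca _"])
  finally show "expn b v * (sca c * a) * expn b (- v) \<doteq> sca (qpow (bil (d b) v)) * (sca c * a)" .
qed

lemma eig_add: "eig d a \<Longrightarrow> eig d a' \<Longrightarrow> eig d (a + a')"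
  unfolding eig_def distrib_left distrib_right by (blast intro: eqv_add)

lemma eig_uminus: "eig d a \<Longrightarrow> eig d (- a)"
  using eig_sca[of d a "- 1"] by (simp add: sca_hom)

lemma eig_mult:
  assumes a: "eig d a" and a': "eig d' a'" shows "eig (\<lambda>b. d b + d' b) (a * a')"
  unfolding eig_def
proof (intro allI ballI)
  fix b and v :: "complex^'a" assume v: "v \<in> zsum"
  have 1: "1 \<doteq> expn b (- v) * expn b v" using expn_minus[of b "- v"] by (simp add: eqv_sym)
  have "expn b v * (a * a') * expn b (- v) = expn b v * a * 1 * a' * expn b (- v)" by (simp add: mult.assoc)
  also have "\<dots> \<doteq> expn b v * a * (expn b (- v) * expn b v) * a' * expn b (- v)"
    by (intro eqv_mult_r eqv_mult_l 1)
  also have "\<dots> = (expn b v * a * expn b (- v)) * (expn b v * a' * expn b (- v))" by (simp add: mult.assoc)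
  also have "\<dots> \<doteq> (sca (qpow (bil (d b) v)) * a) * (sca (qpow (bil (d' b) v)) * a')"
    by (intro eqv_mult eigD a a' v)
  also have "\<dots> = sca (qpow (bil (d b) v)) * (a * sca (qpow (bil (d' b) v))) * a'" by (simp only: mult.assoc)
  also have "\<dots> = sca (qpow (bil (d b) v)) * (sca (qpow (bil (d' b) v)) * a) * a'"
    by (simp only: sca_comm[of "qpow (bil (d' b) v)" a])
  also have "\<dots> = sca (qpow (bil (d b + d' b) v)) * (a * a')"
    by (simp add: bil_add qpow_add sca_hom mult.assoc)
  finally show "expn b v * (a * a') * expn b (- v) \<doteq> sca (qpow (bil (d b + d' b) v)) * (a * a')" .
qed

section \<open>Congruences modulo powers of \<open>p\<close>, and independence of
  eigenvectors\<close>

definition eqm :: "nat \<Rightarrow> 'n::finite alg set"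
  where "eqm n = {a. \<exists>b. a \<doteq> fps_X ^ n * b}"

lemma eqm_add: "a \<in> eqm n \<Longrightarrow> a' \<in> eqm n \<Longrightarrow> a + a' \<in> eqm n"
proof -
  assume "a \<in> eqm n" "a' \<in> eqm n"
  then obtain b b' where "a \<doteq> fps_X ^ n * b" "a' \<doteq> fps_X ^ n * b'" by (auto simp: eqm_def)
  then have "a + a' \<doteq> fps_X ^ n * (b + b')" unfolding distrib_left by (rule eqv_add)
  then show ?thesis by (auto simp: eqm_def)
qed

lemma eqm_mult: assumes "a \<in> eqm n" shows "x * a \<in> eqm n" "a * x \<in> eqm n"
proof -
  obtain b where b: "a \<doteq> fps_X ^ n * b" using assms by (auto simp: eqm_def)
  have "x * a \<doteq> fps_X ^ n * (x * b)"
    using eqv_mult_l[OF b, of x] by (simp only: mult.assoc[symmetric] fps_mult_fps_X_power_commute[symmetric, of x])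
  then show "x * a \<in> eqm n" by (auto simp: eqm_def)
  show "a * x \<in> eqm n" using eqv_mult_r[OF b, of x] by (auto simp: eqm_def mult.assoc)
qed

lemma eqm_eqv: "a \<doteq> a' \<Longrightarrow> a \<in> eqm n \<Longrightarrow> a' \<in> eqm n"
  unfolding eqm_def using eqv_sym eqv_trans by blast

lemma eqm_0: "0 \<in> eqm n" unfolding eqm_def using eqv_refl[of 0] by (auto intro: exI[of _ 0])

text \<open>Certain elements \<open>a - p^n b_n\<close> of the ideal converge to \<open>a\<close>,
  and the ideal is closed.\<close>

lemma eqm_separated: assumes "\<And>n. a \<in> eqm n" shows "a \<doteq> 0"
proof -
  have "\<exists>b. a - fps_X ^ n * b \<in> uqp_ideal" for n using assms[of n] by (auto simp: eqm_def eqv_def)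
  then obtain b where b: "\<And>n. a - fps_X ^ n * b n \<in> uqp_ideal" by metis
  have "(\<lambda>n. a - fps_X ^ n * b n) \<longlonglongrightarrow> a"
  proof (rule tendsto_fpsI)
    fix k
    show "\<forall>\<^sub>F n in sequentially. fps_nth (a - fps_X ^ n * b n) k = fps_nth a k"
      by (rule eventually_sequentiallyI[of "Suc k"]) (simp add: fps_X_power_mult_nth)
  qed
  then have "a \<in> uqp_ideal" using closed_sequentially[OF uqp_ideal_closed, of "\<lambda>n. a - fps_X ^ n * b n" a] b by simp
  then show ?thesis by (simp add: eqv_def)
qed

lemma bil_separates:
  assumes "d \<noteq> d'" "\<And>b. d b \<in> zsum" "\<And>b. d' b \<in> (zsum :: (complex^'n::finite) set)"
  obtains b v where "v \<in> zsum" "bil (d b) v \<noteq> bil (d' b) v"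
proof -
  obtain b i where "d b $ i \<noteq> d' b $ i" using assms(1) by (auto simp: fun_eq_iff vec_eq_iff)
  then have "bil (d b) (eps_bar i) \<noteq> bil (d' b) (eps_bar i)" by (simp add: bil_eps_bar assms)
  then show ?thesis using that eps_bar_zsum by blast
qed

text \<open>The usual induction: conjugation by a separating exponential minus the eigenvalue of
  \<open>d'\<close> removes the summand \<open>f d'\<close> and multiplies \<open>y\<close> by a
  nonzero element of the field of scalars, which can be inverted. It is carried out modulo
  \<open>p^n\<close> because the expansions to be compared are finite only there.\<close>

lemma eig_independent:
  assumes "finite S"
  shows "d \<notin> S \<Longrightarrow> (\<And>b. d b \<in> zsum) \<Longrightarrow> (\<And>d' b. d' \<in> S \<Longrightarrow> d' b \<in> zsum) \<Longrightarrow>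
    eig d y \<Longrightarrow> (\<And>d'. d' \<in> S \<Longrightarrow> eig d' (f d')) \<Longrightarrow> y + (\<Sum>d'\<in>S. f d') \<in> eqm n \<Longrightarrow> y \<in> eqm n"
  using assms
proof (induction S arbitrary: y f rule: finite_induct)
  case empty
  then show ?case by simp
next
  case (insert d' S)
  obtain b v where v: "v \<in> zsum" "bil (d b) v \<noteq> bil (d' b) v"
    by (rule bil_separates[of d d']) (use insert.prems in auto)
  define c where "c d'' = qpow (bil (d'' b) v) - qpow (bil (d' b) v)" for d'' :: "dynvar \<Rightarrow> complex^'a"
  let ?T = "\<lambda>a. expn b v * a * expn b (- v) - sca (qpow (bil (d' b) v)) * a"
  have T: "?T a \<doteq> sca (c d'') * a" if "eig d'' a" for d'' a
    using eqv_diff[OF eigD[OF that v(1), of b] eqv_refl] by (simp add: c_def sca_hom left_diff_distrib)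
  have T_sum: "?T (\<Sum>i\<in>S. f i) \<doteq> (\<Sum>i\<in>S. sca (c i) * f i)"
    using insert.prems(5) insert.hyps(1)
  proof (induction S rule: infinite_finite_induct)
    case (insert i S)
    have "?T (\<Sum>i\<in>insert i S. f i) = ?T (f i) + ?T (\<Sum>i\<in>S. f i)"
      using insert.hyps by (simp add: algebra_simps)
    also have "\<dots> \<doteq> sca (c i) * f i + (\<Sum>i\<in>S. sca (c i) * f i)"
      using insert by (intro eqv_add T) auto
    finally show ?case using insert.hyps by simp
  qed (simp_all add: eqv_refl)
  let ?s = "y + (\<Sum>d'\<in>insert d' S. f d')"
  have "?T ?s = ?T y + (?T (f d') + ?T (\<Sum>i\<in>S. f i))" using insert.hyps by (simp add: algebra_simps)
  also have "\<dots> \<doteq> sca (c d) * y + (sca (c d') * f d' + (\<Sum>i\<in>S. sca (c i) * f i))"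
    using insert.prems by (intro eqv_add T T_sum) auto
  finally have "?T ?s \<doteq> sca (c d) * y + (\<Sum>i\<in>S. sca (c i) * f i)" by (simp add: c_def sca_hom)
  moreover have "?T ?s \<in> eqm n"
  proof -
    have "expn b v * ?s * expn b (- v) + (- sca (qpow (bil (d' b) v))) * ?s \<in> eqm n"
      by (rule eqm_add[OF eqm_mult(2)[OF eqm_mult(1)[OF insert.prems(6)]] eqm_mult(1)[OF insert.prems(6)]])
    then show ?thesis by simp
  qed
  ultimately have "sca (c d) * y + (\<Sum>i\<in>S. sca (c i) * f i) \<in> eqm n" by (rule eqm_eqv)
  then have "sca (c d) * y \<in> eqm n"
    using insert.prems by (intro insert.IH[of "sca (c d) * y" "\<lambda>i. sca (c i) * f i"]) (auto intro: eig_sca)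
  then have "sca (inverse (c d)) * (sca (c d) * y) \<in> eqm n" by (rule eqm_mult)
  moreover have "sca (inverse (c d)) * (sca (c d) * y) = y"
  proof -
    have "c d \<noteq> 0" using v(2) by (simp add: c_def qpow_inj)
    then have "sca (inverse (c d) * c d) * y = y" by (simp add: sca_hom)
    then show ?thesis by (simp add: rhom_mult[OF rhom_sca] mult.assoc)
  qed
  ultimately show ?case by simp
qed

section \<open>The completed direct sum of the components\<close>

abbreviation degs :: "(dynvar \<Rightarrow> complex^'n::finite) set"
  where "degs \<equiv> {d. \<forall>b. d b \<in> zsum}"

definition asum :: "((dynvar \<Rightarrow> complex^'n) \<Rightarrow> 'n::finite alg) \<Rightarrow> 'n alg \<Rightarrow> bool"
  where "asum Y a \<longleftrightarrow> (\<forall>n. \<exists>S0. finite S0 \<and> S0 \<subseteq> degs \<and>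
    (\<forall>S. finite S \<and> S0 \<subseteq> S \<and> S \<subseteq> degs \<longrightarrow> a - (\<Sum>d\<in>S. Y d) \<in> eqm n))"

lemma asum_hcomp: "asum (\<lambda>d. hcomp d a) a"
  unfolding asum_def
proof
  fix n
  obtain S0 where S0: "finite S0" "S0 \<subseteq> degs"
    "\<forall>S. finite S \<and> S0 \<subseteq> S \<longrightarrow> (\<exists>b. a - (\<Sum>d\<in>S. hcomp d a) = fps_X ^ n * b)"
    using hcomp_sum[of a n] by (elim exE conjE)
  show "\<exists>S0. finite S0 \<and> S0 \<subseteq> degs \<and>
    (\<forall>S. finite S \<and> S0 \<subseteq> S \<and> S \<subseteq> degs \<longrightarrow> a - (\<Sum>d\<in>S. hcomp d a) \<in> eqm n)"
  proof (intro exI[of _ S0] conjI allI impI S0(1,2))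
    fix S assume "finite S \<and> S0 \<subseteq> S \<and> S \<subseteq> degs"
    then obtain b where "a - (\<Sum>d\<in>S. hcomp d a) = fps_X ^ n * b" using S0(3) by blast
    then show "a - (\<Sum>d\<in>S. hcomp d a) \<in> eqm n" unfolding eqm_def using eqv_eq by blast
  qed
qed

lemma eig_hcomp: "d \<in> degs \<Longrightarrow> eig d (hcomp d a)"
  by (rule shom_eig[OF shom_hcomp]) simp

text \<open>Modulo \<open>p^n\<close> the two expansions differ by a finite sum of eigenvectors, to
  which independence applies; separatedness combines all \<open>n\<close>.\<close>

lemma asum_unique:
  assumes Y: "asum Y a" "\<And>d. d \<in> degs \<Longrightarrow> eig d (Y d)" and Z: "asum Z a" "\<And>d. d \<in> degs \<Longrightarrow> eig d (Z d)"
    and d: "d \<in> degs"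
  shows "Y d \<doteq> Z d"
proof -
  have "Y d - Z d \<in> eqm n" for n
  proof -
    obtain S1 where S1: "finite S1" "S1 \<subseteq> degs"
      "\<And>S. finite S \<Longrightarrow> S1 \<subseteq> S \<Longrightarrow> S \<subseteq> degs \<Longrightarrow> a - (\<Sum>d\<in>S. Y d) \<in> eqm n"
      using Y(1) unfolding asum_def by meson
    obtain S2 where S2: "finite S2" "S2 \<subseteq> degs"
      "\<And>S. finite S \<Longrightarrow> S2 \<subseteq> S \<Longrightarrow> S \<subseteq> degs \<Longrightarrow> a - (\<Sum>d\<in>S. Z d) \<in> eqm n"
      using Z(1) unfolding asum_def by meson
    define T where "T = S1 \<union> S2 - {d}"
    have T: "finite T" "insert d T \<subseteq> degs" "S1 \<subseteq> insert d T" "S2 \<subseteq> insert d T" "d \<notin> T"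
      using S1 S2 d by (auto simp: T_def)
    have "(a - (\<Sum>d\<in>insert d T. Z d)) + (- 1) * (a - (\<Sum>d\<in>insert d T. Y d)) \<in> eqm n"
      using T by (intro eqm_add eqm_mult(1) S1(3) S2(3)) auto
    also have "(a - (\<Sum>d\<in>insert d T. Z d)) + (- 1) * (a - (\<Sum>d\<in>insert d T. Y d)) =
      (Y d - Z d) + (\<Sum>d\<in>T. Y d - Z d)"
      using T by (simp add: sum_subtractf)
    finally have s: "(Y d - Z d) + (\<Sum>d\<in>T. Y d - Z d) \<in> eqm n" .
    have e: "eig d' (Y d' - Z d')" if "d' \<in> degs" for d'
      using eig_add[OF Y(2)[OF that] eig_uminus[OF Z(2)[OF that]]] by simp
    show ?thesis
      by (rule eig_independent[OF T(1) T(5) _ _ e e s]) (use T d in auto)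
  qed
  then have "Y d - Z d \<doteq> 0" by (rule eqm_separated)
  then show ?thesis by (simp add: eqv_def)
qed

lemma eig_0: "eig d 0" by (simp add: eig_def eqv_refl)

text \<open>The bridge from exponentials to arbitrary functions. An eigenvector is its own expansion
  with a single term; by uniqueness it equals its component \<open>hcomp d a\<close>, and that is
  built from words, for which strong homogeneity is known.\<close>

lemma eig_shom:
  assumes "eig d a" "d \<in> degs" shows "shom d a"
proof -
  have "asum (\<lambda>d'. if d' = d then a else 0) a"
    unfolding asum_def
  proof
    fix n
    show "\<exists>S0. finite S0 \<and> S0 \<subseteq> degs \<and>
      (\<forall>S. finite S \<and> S0 \<subseteq> S \<and> S \<subseteq> degs \<longrightarrow> a - (\<Sum>d'\<in>S. if d' = d then a else 0) \<in> eqm n)"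
      using assms by (intro exI[of _ "{d}"]) (auto simp: eqm_0)
  qed
  then have "(\<lambda>d'. if d' = d then a else 0) d \<doteq> hcomp d a"
    by (rule asum_unique[OF _ _ asum_hcomp]) (use assms in \<open>auto intro: eig_hcomp eig_0\<close>)
  then have "a \<doteq> hcomp d a" by simp
  then show ?thesis by (rule shom_eqv[OF eqv_sym shom_hcomp])
qed

definition dpair :: "(complex^'n) \<times> (complex^'n) \<Rightarrow> dynvar \<Rightarrow> complex^'n::finite"
  where "dpair uv b = (case b of P_plus_h \<Rightarrow> fst uv | P_var \<Rightarrow> snd uv)"

lemma dynvar_all: "(\<forall>b. Q b) \<longleftrightarrow> Q P_plus_h \<and> Q P_var"
  by (metis dynvar.exhaust)

lemma dpair_degs: "dpair uv \<in> degs \<longleftrightarrow> uv \<in> zsum \<times> zsum"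
  by (cases uv) (simp add: dynvar_all dpair_def)

lemma bij_dpair: "bij_betw dpair (zsum \<times> zsum) degs"
proof (rule bij_betw_byWitness[where f' = "\<lambda>d. (d P_plus_h, d P_var)"])
  show "\<forall>d\<in>degs. dpair (d P_plus_h, d P_var) = d"
    by (auto simp: dpair_def fun_eq_iff split: dynvar.split)
  show "dpair ` (zsum \<times> zsum) \<subseteq> degs" using dpair_degs by blast
qed (auto simp: dpair_def)

lemma uqp_comp_eig:
  assumes "\<alpha> \<in> Hstar" "\<beta> \<in> Hstar"
  shows "to_uqp a \<in> uqp_comp \<alpha> \<beta> \<longleftrightarrow> eig (dpair (res_Ph \<alpha>, res_P \<beta>)) (a :: 'n::finite alg)"
proof -
  have e: "fn (qpow (Ph_fun v)) = expn P_plus_h v" "fn (qpow (- Ph_fun v)) = expn P_plus_h (- v)"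
    "fn (qpow (P_fun v)) = expn P_var v" "fn (qpow (- P_fun v)) = expn P_var (- v)" for v :: "complex^'n"
    by (simp_all add: expn_def Ph_fun_def P_fun_def mero_lin_uminus)
  show ?thesis
    unfolding uqp_comp_def eig_def dynvar_all
    by (simp add: e uqp_simps to_uqp_eq pairing_P_el pairing_Ph_el assms dpair_def)
qed

lemma dpair_res_degs: "\<alpha> \<in> Hstar \<Longrightarrow> \<beta> \<in> Hstar \<Longrightarrow> dpair (res_Ph \<alpha>, res_P \<beta>) \<in> degs"
  unfolding dpair_degs using res_image by blast

lemma uqp_comp_carrier: "x \<in> uqp_comp \<alpha> \<beta> \<Longrightarrow> x \<in> carrier uqp"
  by (simp add: uqp_comp_def)

lemma uqp_direct_sum:
  assumes "a \<in> carrier (uqp :: (complex fls, 'n::finite alg set) module)"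
  shows "\<exists>!x. x \<in> res_Ph ` Hstar \<times> res_P ` Hstar \<rightarrow>\<^sub>E carrier uqp \<and>
        (\<forall>\<alpha>\<in>Hstar. \<forall>\<beta>\<in>Hstar. x (res_Ph \<alpha>, res_P \<beta>) \<in> uqp_comp \<alpha> \<beta>) \<and>
        adic_has_sum uqp (to_uqp (coe nome)) x (res_Ph ` (Hstar :: 'n hvec set) \<times> res_P ` (Hstar :: 'n hvec set)) a"
    (is "\<exists>!x. ?P x")
proof -
  obtain a' where a': "a = to_uqp a'" by (rule uqpE[OF assms])
  let ?D = "zsum \<times> zsum :: ((complex^'n) \<times> (complex^'n)) set"
  have D: "res_Ph ` (Hstar :: 'n hvec set) \<times> res_P ` (Hstar :: 'n hvec set) = ?D" by (simp add: res_image)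
  have ad: "adic_has_sum uqp (to_uqp (coe nome)) x ?D a \<longleftrightarrow> asum (\<lambda>d. Y (d P_plus_h, d P_var)) a'"
    if x: "\<And>i. i \<in> ?D \<Longrightarrow> x i = to_uqp (Y i)" for x Y
  proof -
    let ?Q = "\<lambda>(n :: nat) S. \<exists>b\<in>carrier uqp. a \<ominus>\<^bsub>uqp\<^esub> finsum uqp x S = (to_uqp (coe nome) [^]\<^bsub>uqp\<^esub> n) \<otimes>\<^bsub>uqp\<^esub> b"
    \<comment> \<open>Divisibility by \<open>p^n\<close> in the quotient, translated to
      representatives.\<close>
    have Q: "?Q n S \<longleftrightarrow> a' - (\<Sum>d\<in>dpair ` S. Y (d P_plus_h, d P_var)) \<in> eqm n" if S: "finite S" "S \<subseteq> ?D" for n :: nat and S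
    proof -
      interpret ring "uqp :: (complex fls, 'n alg set) module" by (rule ring_uqp)
      have "finsum uqp x S = finsum uqp (\<lambda>i. to_uqp (Y i)) S"
        using S x by (intro finsum_cong') auto
      also have "\<dots> = to_uqp (\<Sum>i\<in>S. Y i)" by (rule uqp_finsum[OF S(1)])
      also have "(\<Sum>i\<in>S. Y i) = (\<Sum>d\<in>dpair ` S. Y (d P_plus_h, d P_var))"
      proof -
        have "inj_on dpair S" using S(2) by (rule inj_on_subset[OF bij_betw_imp_inj_on[OF bij_dpair]])
        then show ?thesis by (simp add: sum.reindex dpair_def)
      qed
      finally show ?thesis
        by (simp add: a' uqp_minus uqp_pow carrier_uqp uqp_simps to_uqp_eq eqm_def coe_nome)
    qed
    show ?thesis
    proof
      assume L: "adic_has_sum uqp (to_uqp (coe nome)) x ?D a"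
      show "asum (\<lambda>d. Y (d P_plus_h, d P_var)) a'"
        unfolding asum_def
      proof
        fix n :: nat
        obtain S0 where S0: "finite S0" "S0 \<subseteq> ?D" "\<forall>S. finite S \<and> S0 \<subseteq> S \<and> S \<subseteq> ?D \<longrightarrow> ?Q n S"
          using spec[OF L[unfolded adic_has_sum_def], of n] by (elim exE conjE)
        show "\<exists>S0. finite S0 \<and> S0 \<subseteq> degs \<and> (\<forall>S. finite S \<and> S0 \<subseteq> S \<and> S \<subseteq> degs \<longrightarrow>
            a' - (\<Sum>d\<in>S. Y (d P_plus_h, d P_var)) \<in> eqm n)"
        proof (intro exI[of _ "dpair ` S0"] conjI allI impI)
          show "dpair ` S0 \<subseteq> degs" using S0(2) dpair_degs by blast
          fix S assume S: "finite S \<and> dpair ` S0 \<subseteq> S \<and> S \<subseteq> degs"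
          define R where "R = (\<lambda>d. (d P_plus_h, d P_var)) ` S"
          have dR: "dpair (d P_plus_h, d P_var) = d" for d :: "dynvar \<Rightarrow> complex^'n"
            by (auto simp: dpair_def fun_eq_iff split: dynvar.split)
          have "S = dpair ` R" by (simp add: R_def image_image dR)
          moreover have "finite R" "R \<subseteq> ?D" using S by (auto simp: R_def)
          moreover have "S0 \<subseteq> R"
          proof
            fix i assume "i \<in> S0"
            then have "dpair i \<in> S" using S by blast
            then have "(dpair i P_plus_h, dpair i P_var) \<in> R" unfolding R_def by blast
            then show "i \<in> R" by (simp add: dpair_def)
          qed
          ultimately show "a' - (\<Sum>d\<in>S. Y (d P_plus_h, d P_var)) \<in> eqm n"
            using Q[of R n] S0(3)[rule_format, of R] by simp
        qed (use S0 in simp)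
      qed
    next
      assume R: "asum (\<lambda>d. Y (d P_plus_h, d P_var)) a'"
      show "adic_has_sum uqp (to_uqp (coe nome)) x ?D a"
        unfolding adic_has_sum_def
      proof
        fix n :: nat
        obtain S0 where S0: "finite S0" "S0 \<subseteq> degs" "\<forall>S. finite S \<and> S0 \<subseteq> S \<and> S \<subseteq> degs \<longrightarrow>
            a' - (\<Sum>d\<in>S. Y (d P_plus_h, d P_var)) \<in> eqm n"
          using spec[OF R[unfolded asum_def], of n] by (elim exE conjE)
        let ?T = "(\<lambda>d. (d P_plus_h, d P_var)) ` S0"
        have *: "?Q n S" if S: "finite S" "?T \<subseteq> S" "S \<subseteq> ?D" for S
        proof -
          have "S0 \<subseteq> dpair ` S"
          proof
            fix d assume d: "d \<in> S0"
            have "dpair (d P_plus_h, d P_var) = d" by (auto simp: dpair_def fun_eq_iff split: dynvar.split)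
            then show "d \<in> dpair ` S" using d S(2) by (metis (mono_tags, lifting) image_eqI image_subset_iff)
          qed
          moreover have "dpair ` S \<subseteq> degs" using S(3) dpair_degs by blast
          ultimately show ?thesis using Q[of S n] S S0(3)[rule_format, of "dpair ` S"] by simp
        qed
        have **: "finite ?T" "?T \<subseteq> ?D" using S0 by auto
        show "\<exists>S0. finite S0 \<and> S0 \<subseteq> ?D \<and> (\<forall>S. finite S \<and> S0 \<subseteq> S \<and> S \<subseteq> ?D \<longrightarrow>
          (\<exists>b\<in>carrier uqp. a \<ominus>\<^bsub>uqp\<^esub> finsum uqp x S = to_uqp (coe nome) [^]\<^bsub>uqp\<^esub> n \<otimes>\<^bsub>uqp\<^esub> b))"
          by (intro exI[of _ ?T] conjI allI impI **, elim conjE) (rule *)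
      qed
    qed
  qed
  let ?x = "\<lambda>i\<in>?D. to_uqp (hcomp (dpair i) a')"
  have pd: "dpair (d P_plus_h, d P_var) = d" for d :: "dynvar \<Rightarrow> complex^'n"
    by (auto simp: dpair_def fun_eq_iff split: dynvar.split)
  have P: "?P ?x"
  proof (intro conjI ballI)
    show "?x \<in> res_Ph ` Hstar \<times> res_P ` Hstar \<rightarrow>\<^sub>E carrier uqp" by (auto simp: res_image)
    show "?x (res_Ph \<alpha>, res_P \<beta>) \<in> uqp_comp \<alpha> \<beta>" if "\<alpha> \<in> Hstar" "\<beta> \<in> Hstar" for \<alpha> \<beta> :: "'n hvec"
    proof -
      have "(res_Ph \<alpha>, res_P \<beta>) \<in> ?D" using that by (metis D SigmaI imageI)
      then show ?thesis
        using that eig_hcomp[OF dpair_res_degs[OF that], of a'] by (simp add: uqp_comp_eig del: mem_Sigma_iff)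
    qed
    show "adic_has_sum uqp (to_uqp (coe nome)) ?x (res_Ph ` (Hstar :: 'n hvec set) \<times> res_P ` (Hstar :: 'n hvec set)) a"
      unfolding D by (subst ad[where Y = "\<lambda>i. hcomp (dpair i) a'"]) (simp_all add: pd asum_hcomp)
  qed
  have U: "y = ?x" if y: "?P y" for y
  proof
    fix i
    show "y i = ?x i"
    proof (cases "i \<in> ?D")
      case True
      have "\<forall>i\<in>?D. \<exists>b. y i = to_uqp b"
      proof
        fix i assume "i \<in> ?D"
        then have "y i \<in> carrier uqp" using y unfolding D by (auto simp: PiE_iff)
        then show "\<exists>b. y i = to_uqp b" unfolding carrier_uqp by blast
      qed
      then obtain Y where Y: "\<And>i. i \<in> ?D \<Longrightarrow> y i = to_uqp (Y i)" by metis
      have "asum (\<lambda>d. Y (d P_plus_h, d P_var)) a'"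
        by (rule iffD1[OF ad[OF Y] conjunct2[OF conjunct2[OF y], unfolded D]])
      moreover have "eig d (Y (d P_plus_h, d P_var))" if d: "d \<in> degs" for d
      proof -
        have i: "(d P_plus_h, d P_var) \<in> ?D" using d by simp
        have "d P_plus_h \<in> res_Ph ` Hstar" "d P_var \<in> res_P ` Hstar" using d by (simp_all add: res_image)
        then obtain \<alpha> \<beta> :: "'n hvec" where ab: "\<alpha> \<in> Hstar" "\<beta> \<in> Hstar" "res_Ph \<alpha> = d P_plus_h" "res_P \<beta> = d P_var"
          by (elim imageE) simp
        have "y (res_Ph \<alpha>, res_P \<beta>) \<in> uqp_comp \<alpha> \<beta>" using conjunct1[OF conjunct2[OF y]] ab(1,2) by blast
        then have "y (d P_plus_h, d P_var) \<in> uqp_comp \<alpha> \<beta>" by (simp only: ab(3,4))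
        then have "to_uqp (Y (d P_plus_h, d P_var)) \<in> uqp_comp \<alpha> \<beta>" using Y[OF i] by simp
        then show ?thesis using ab by (simp add: uqp_comp_eig pd)
      qed
      moreover have "dpair i \<in> degs" using True dpair_degs by blast
      ultimately have "Y (dpair i P_plus_h, dpair i P_var) \<doteq> hcomp (dpair i) a'"
        by (intro asum_unique[OF _ _ asum_hcomp]) (auto intro: eig_hcomp)
      then show ?thesis using True Y[OF True] by (simp add: to_uqp_eq dpair_def)
    next
      case False
      have "y \<in> ?D \<rightarrow>\<^sub>E carrier uqp" by (rule conjunct1[OF y, unfolded D])
      then show ?thesis using PiE_arb[OF _ False, of y] False by (simp del: mem_Sigma_iff)
    qed
  qed
  show ?thesis by (rule ex1I[of ?P ?x, OF P U])
qed

section \<open>Moment maps\<close>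

definition mnome :: "dynvar \<Rightarrow> scal fps"
  where "mnome b = (case b of P_plus_h \<Rightarrow> nome | P_var \<Rightarrow> nome_star)"

definition mom :: "dynvar \<Rightarrow> 'n::finite momfun \<Rightarrow> 'n alg"
  where "mom b f = psum (\<lambda>n. fn_at b (fps_nth f n) * coe (mnome b ^ n))"

lemma coe_mnome_nth:
  fixes x :: "'n::finite alg"
  assumes kn: "k < n" shows "fps_nth (x * coe (mnome b ^ n)) k = 0"
proof -
  have "fps_nth (mnome b) 0 = 0" by (cases b) (simp_all add: mnome_def nome_def nome_star_def)
  then have "fps_nth (mnome b ^ n) j = 0" if "j < n" for j using startsby_zero_power_prefix that by blast
  then have "fps_nth (coe (mnome b ^ n) :: 'n alg) (k - i) = 0" for i using kn by (simp add: coe_def)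
  then show ?thesis by (simp add: fps_mult_nth)
qed

lemma psummable_mom: "psummable (\<lambda>n. x n * coe (mnome b ^ n))"
  by (rule psummableI_finite[where S = "\<lambda>k. {..k}"]) (simp_all add: coe_mnome_nth)

lemma mu_mom: "mu_l f = to_uqp (mom P_plus_h f)" "mu_r f = to_uqp (mom P_var f)"
  unfolding mu_l_def mu_r_def fn_Ph_at fn_P_at mom_def
  using psum_suminf[OF psummable_mom[of "\<lambda>n. fn_at P_plus_h (fps_nth f n)" P_plus_h]]
    psum_suminf[OF psummable_mom[of "\<lambda>n. fn_at P_var (fps_nth f n)" P_var]]
  by (simp_all add: mnome_def)

lemma fn_at_sum: "fn_at b (\<Sum>i\<in>S. f i) \<doteq> (\<Sum>i\<in>S. fn_at b (f i))"
proof (induction S rule: infinite_finite_induct)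
  case (insert i S)
  have "fn_at b (f i + (\<Sum>i\<in>S. f i)) \<doteq> fn_at b (f i) + fn_at b (\<Sum>i\<in>S. f i)" by (rule fn_at_add)
  also have "\<dots> \<doteq> fn_at b (f i) + (\<Sum>i\<in>S. fn_at b (f i))" by (rule eqv_add[OF eqv_refl insert.IH])
  finally show ?case using insert.hyps by simp
qed (simp_all add: fn_at_0)

lemma eqv_sum: "(\<And>i. i \<in> S \<Longrightarrow> f i \<doteq> g i) \<Longrightarrow> (\<Sum>i\<in>S. f i) \<doteq> (\<Sum>i\<in>S. g i)"
  by (induction S rule: infinite_finite_induct) (auto intro: eqv_refl eqv_add)

lemma mom_add: "mom b (f + g) \<doteq> mom b f + mom b g"
proof -
  have "mom b (f + g) \<doteq> psum (\<lambda>n. (fn_at b (fps_nth f n) + fn_at b (fps_nth g n)) * coe (mnome b ^ n))"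
    unfolding mom_def by (intro eqv_psum psummable_mom eqv_mult_r) (simp add: fn_at_add)
  also have "\<dots> = mom b f + mom b g"
    unfolding mom_def distrib_right by (rule psum_add[OF psummable_mom psummable_mom])
  finally show ?thesis .
qed

lemma mom_mult: "mom b (f * g) \<doteq> mom b f * mom b g"
proof -
  let ?x = "\<lambda>f n. fn_at b (fps_nth f n) * coe (mnome b ^ n)"
  have "fn_at b (fps_nth (f * g) n) * coe (mnome b ^ n) \<doteq> (\<Sum>i\<le>n. ?x f i * ?x g (n - i))" for n
  proof -
    have "fn_at b (fps_nth (f * g) n) \<doteq> (\<Sum>i\<le>n. fn_at b (fps_nth f i * fps_nth g (n - i)))"
      unfolding fps_mult_nth atLeast0AtMost by (rule fn_at_sum)
    also have "\<dots> \<doteq> (\<Sum>i\<le>n. fn_at b (fps_nth f i) * fn_at b (fps_nth g (n - i)))"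
      by (rule eqv_sum) (rule fn_at_mult)
    finally have "fn_at b (fps_nth (f * g) n) * coe (mnome b ^ n) \<doteq>
        (\<Sum>i\<le>n. fn_at b (fps_nth f i) * fn_at b (fps_nth g (n - i))) * coe (mnome b ^ n)"
      by (rule eqv_mult_r)
    also have "\<dots> = (\<Sum>i\<le>n. ?x f i * ?x g (n - i))"
      unfolding sum_distrib_right
    proof (rule sum.cong[OF refl])
      fix i assume "i \<in> {..n}"
      then have c: "coe (mnome b ^ n) = (coe (mnome b ^ i) * coe (mnome b ^ (n - i)) :: 'a alg)"
        by (simp flip: power_add coe_hom(4))
      have "?x f i * ?x g (n - i) = fn_at b (fps_nth f i) * (coe (mnome b ^ i) * fn_at b (fps_nth g (n - i))) * coe (mnome b ^ (n - i))"
        by (simp only: mult.assoc)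
      also have "\<dots> = fn_at b (fps_nth f i) * (fn_at b (fps_nth g (n - i)) * coe (mnome b ^ i)) * coe (mnome b ^ (n - i))"
        by (simp only: coe_comm[of _ "fn_at b (fps_nth g (n - i))"])
      finally show "fn_at b (fps_nth f i) * fn_at b (fps_nth g (n - i)) * coe (mnome b ^ n) = ?x f i * ?x g (n - i)"
        unfolding c by (simp only: mult.assoc)
    qed
    finally show ?thesis .
  qed
  then have "mom b (f * g) \<doteq> psum (\<lambda>n. \<Sum>i\<le>n. ?x f i * ?x g (n - i))"
    unfolding mom_def by (intro eqv_psum psummable_mom psum_Cauchy(1))
  also have "\<dots> = mom b f * mom b g"
    unfolding mom_def by (rule psum_Cauchy(2)[OF psummable_mom psummable_mom])
  finally show ?thesis .
qed

text \<open>\<open>fn_at b 0\<close> is a nonzero word of the free algebra and vanishes only modulo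
  the relations; hence the second sum.\<close>

lemma mom_const_fn: "mom b (fps_const g) = fn_at b g + psum (\<lambda>n. (if n = 0 then 0 else fn_at b 0) * coe (mnome b ^ n))"
proof -
  have "mom b (fps_const g) = psum (\<lambda>n. (if n = 0 then fn_at b g else 0) * coe (mnome b ^ n) + (if n = 0 then 0 else fn_at b 0) * coe (mnome b ^ n))"
    unfolding mom_def by (rule arg_cong[where f = psum]) (auto simp: fun_eq_iff)
  also have "\<dots> = psum (\<lambda>n. (if n = 0 then fn_at b g else 0) * coe (mnome b ^ n)) + psum (\<lambda>n. (if n = 0 then 0 else fn_at b 0) * coe (mnome b ^ n))"
    by (rule psum_add[OF psummable_mom psummable_mom])
  also have "psum (\<lambda>n. (if n = 0 then fn_at b g else 0) * coe (mnome b ^ n)) = (\<Sum>n\<in>{0}. (if n = 0 then fn_at b g else 0) * coe (mnome b ^ n))"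
    by (rule psum_sum) auto
  finally show ?thesis by (simp add: coe_hom)
qed

lemma mom_fps_const: "mom b (fps_const g) \<doteq> fn_at b g"
proof -
  have "psum (\<lambda>n. (if n = 0 then 0 else fn_at b 0) * coe (mnome b ^ n)) \<doteq> psum (\<lambda>n. 0 * coe (mnome b ^ n))"
    by (intro eqv_psum psummable_mom eqv_mult_r) (auto simp: fn_at_0 eqv_refl)
  also have "psum (\<lambda>n. 0 * coe (mnome b ^ n)) = 0" using psum_sum(2)[of "{}" "\<lambda>n. 0 * coe (mnome b ^ n)"] by simp
  finally show ?thesis unfolding mom_const_fn using eqv_add[OF eqv_refl, of _ 0 "fn_at b g"] by simp
qed

lemma mom_1: "mom b 1 \<doteq> 1"
  using eqv_trans[OF mom_fps_const fn_at_1, of b] by (simp add: fps_const_1_eq_1)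

lemma mom_linear: "mom b (mom_const a * f) \<doteq> sca a * mom b f"
proof -
  have "mom b (mom_const a * f) \<doteq> mom b (mom_const a) * mom b f" by (rule mom_mult)
  also have "\<dots> \<doteq> sca a * mom b f"
    unfolding mom_const_def by (intro eqv_mult_r eqv_trans[OF mom_fps_const fn_at_sca])
  finally show ?thesis .
qed

lemma shom_mom: "shom (\<lambda>_. 0) (mom b f)"
  unfolding mom_def
proof (rule shom_psum[OF psummable_mom])
  fix n
  have "shom (\<lambda>_. 0) (fn_at b (fps_nth f n))"
    using shom_letter[of "Fun (map_fls (mero_at b) (fps_nth f n))"] by (simp add: fn_at_def fn_def gdeg.simps[abs_def] cong: if_cong)
  then have "shom (\<lambda>_. 0) (coe (mnome b ^ n) * fn_at b (fps_nth f n))" by (rule shom_central[OF coe_comm])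
  then show "shom (\<lambda>_. 0) (fn_at b (fps_nth f n) * coe (mnome b ^ n))" by (simp only: coe_comm)
qed

text \<open>The powers of the nome are central, so the translation acts on each coefficient of
  \<open>f\<close> separately.\<close>

lemma mom_shom:
  assumes "shom d a" shows "mom b f * a \<doteq> a * mom b (mom_shift (d b) f)"
proof -
  have "mom b f * a = psum (\<lambda>n. fn_at b (fps_nth f n) * coe (mnome b ^ n) * a)"
    unfolding mom_def by (rule psum_mult_right(2)[OF psummable_mom, symmetric])
  also have "\<dots> = psum (\<lambda>n. fn_at b (fps_nth f n) * a * coe (mnome b ^ n))"
    by (simp only: mult.assoc coe_comm[of _ a])
  also have "\<dots> \<doteq> psum (\<lambda>n. a * fn_at b (fps_nth (mom_shift (d b) f) n) * coe (mnome b ^ n))"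
    by (intro eqv_psum psummable_mom eqv_mult_r) (simp add: mom_shift_def shomD[OF assms])
  also have "\<dots> = a * mom b (mom_shift (d b) f)"
    unfolding mom_def mult.assoc by (rule psum_mult_left(2)[OF psummable_mom])
  finally show ?thesis .
qed

lemma shom_comp_0: "shom (\<lambda>_. 0) a \<Longrightarrow> to_uqp a \<in> uqp_comp 0 0"
proof -
  assume a: "shom (\<lambda>_. 0) a"
  have 0: "(0 :: 'a hvec) \<in> Hstar" by (simp add: Hstar_def zero_prod_def zsum_0)
  have "dpair (res_Ph (0 :: 'a hvec), res_P (0 :: 'a hvec)) = (\<lambda>_. 0)"
    by (auto simp: dpair_def res_0 fun_eq_iff split: dynvar.split)
  then show ?thesis using shom_eig[OF a] by (simp add: uqp_comp_eig[OF 0 0] zsum_0)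
qed

text \<open>The axioms other than injectivity of the moment maps follow from the relations.
  Injectivity says that the relations do not identify different functions; it is isolated as a
  hypothesis, to be supplied by a representation.\<close>

lemma adic_H_algebra_uqp:
  assumes inj: "\<And>b f. mom b f \<in> uqp_ideal \<Longrightarrow> f = (0 :: 'n::finite momfun)"
  shows "adic_H_algebra (uqp :: (complex fls, 'n alg set) module) (to_uqp (coe nome))
    Hstar res_Ph res_P uqp_comp mom_const mom_shift mu_l mu_r"
proof (rule adic_H_algebra.intro)
  show "ring (uqp :: (complex fls, 'n alg set) module)" by (rule ring_uqp)
  show "module type_ring (uqp :: (complex fls, 'n alg set) module)" by (rule module_uqp)
  show "(a \<odot>\<^bsub>uqp\<^esub> x) \<otimes>\<^bsub>uqp\<^esub> y = a \<odot>\<^bsub>uqp\<^esub> (x \<otimes>\<^bsub>uqp\<^esub> y) \<and> x \<otimes>\<^bsub>uqp\<^esub> (a \<odot>\<^bsub>uqp\<^esub> y) = a \<odot>\<^bsub>uqp\<^esub> (x \<otimes>\<^bsub>uqp\<^esub> y)"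
    if xy: "x \<in> carrier uqp" "y \<in> carrier uqp" for a and x y :: "'n alg set"
  proof -
    obtain x' y' where e: "x = to_uqp x'" "y = to_uqp y'" using xy by (auto elim!: uqpE)
    have "x' * (sca a * y') = sca a * (x' * y')" by (simp only: mult.assoc[symmetric] sca_comm[of a x'])
    then show ?thesis by (simp add: e uqp_simps mult.assoc)
  qed
  show "to_uqp (coe nome) \<in> carrier (uqp :: (complex fls, 'n alg set) module)" by simp
  show "to_uqp (coe nome) \<otimes>\<^bsub>uqp\<^esub> x = x \<otimes>\<^bsub>uqp\<^esub> to_uqp (coe nome)" if "x \<in> carrier uqp" for x :: "'n alg set"
    using that by (auto elim!: uqpE simp: uqp_simps coe_comm)
  show "submodule (uqp_comp \<alpha> \<beta>) type_ring (uqp :: (complex fls, 'n alg set) module)"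
    if ab: "\<alpha> \<in> Hstar" "\<beta> \<in> Hstar" for \<alpha> \<beta> :: "'n hvec"
  proof (rule module.submoduleI[OF module_uqp])
    show "uqp_comp \<alpha> \<beta> \<subseteq> carrier uqp" using uqp_comp_carrier by blast
    show "\<zero>\<^bsub>uqp\<^esub> \<in> uqp_comp \<alpha> \<beta>" by (simp add: uqp_simps uqp_comp_eig ab eig_0)
    fix x assume x: "x \<in> uqp_comp \<alpha> \<beta>"
    then obtain x' where x': "x = to_uqp x'" by (auto dest: uqp_comp_carrier elim: uqpE)
    show "\<ominus>\<^bsub>uqp\<^esub> x \<in> uqp_comp \<alpha> \<beta>" using x by (simp add: x' uqp_uminus uqp_comp_eig ab eig_uminus)
    show "a \<odot>\<^bsub>uqp\<^esub> x \<in> uqp_comp \<alpha> \<beta>" for a using x by (simp add: x' uqp_simps uqp_comp_eig ab eig_sca)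
    fix y assume y: "y \<in> uqp_comp \<alpha> \<beta>"
    then obtain y' where y': "y = to_uqp y'" by (auto dest: uqp_comp_carrier elim: uqpE)
    show "x \<oplus>\<^bsub>uqp\<^esub> y \<in> uqp_comp \<alpha> \<beta>" using x y by (simp add: x' y' uqp_simps uqp_comp_eig ab eig_add)
  qed
  show "\<one>\<^bsub>uqp\<^esub> \<in> (uqp_comp 0 0 :: 'n alg set set)" unfolding uqp_simps by (rule shom_comp_0[OF shom_1])
  show "x \<otimes>\<^bsub>uqp\<^esub> y \<in> uqp_comp (\<alpha> + \<gamma>) (\<beta> + \<delta>)"
    if H: "\<alpha> \<in> Hstar" "\<beta> \<in> Hstar" "\<gamma> \<in> Hstar" "\<delta> \<in> Hstar" and xy: "x \<in> uqp_comp \<alpha> \<beta>" "y \<in> uqp_comp \<gamma> \<delta>"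
    for \<alpha> \<beta> \<gamma> \<delta> :: "'n hvec" and x y
  proof -
    obtain x' y' where e: "x = to_uqp x'" "y = to_uqp y'"
      using xy by (auto dest!: uqp_comp_carrier elim!: uqpE)
    have "dpair (res_Ph (\<alpha> + \<gamma>), res_P (\<beta> + \<delta>)) = (\<lambda>b. dpair (res_Ph \<alpha>, res_P \<beta>) b + dpair (res_Ph \<gamma>, res_P \<delta>) b)"
      by (auto simp: dpair_def res_add H fun_eq_iff split: dynvar.split)
    then show ?thesis
      using xy eig_mult by (simp add: e uqp_simps uqp_comp_eig H res_add)
  qed
  show "\<exists>!x. x \<in> res_Ph ` Hstar \<times> res_P ` Hstar \<rightarrow>\<^sub>E carrier uqp \<and>
        (\<forall>\<alpha>\<in>Hstar. \<forall>\<beta>\<in>Hstar. x (res_Ph \<alpha>, res_P \<beta>) \<in> uqp_comp \<alpha> \<beta>) \<and>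
        adic_has_sum uqp (to_uqp (coe nome)) x (res_Ph ` (Hstar :: 'n hvec set) \<times> res_P ` (Hstar :: 'n hvec set)) a"
    if "a \<in> carrier uqp" for a
    using that by (rule uqp_direct_sum)
  show "mu_l \<in> ring_hom type_ring (uqp :: (complex fls, 'n alg set) module)"
    "mu_r \<in> ring_hom type_ring (uqp :: (complex fls, 'n alg set) module)"
    by (rule ring_hom_memI; simp add: mu_mom uqp_simps to_uqp_eq mom_mult mom_add mom_1)+
  show "mu_l (mom_const a * f) = a \<odot>\<^bsub>uqp\<^esub> mu_l f" "mu_r (mom_const a * f) = a \<odot>\<^bsub>uqp\<^esub> mu_r f" for a and f :: "'n momfun"
    by (simp_all add: mu_mom uqp_simps to_uqp_eq mom_linear)
  have inj': "f = g" if "mom b f \<doteq> mom b g" for b and f g :: "'n momfun"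
  proof -
    have "mom b (g + (f - g)) \<doteq> mom b g + mom b (f - g)" by (rule mom_add)
    then have "mom b f \<doteq> mom b g + mom b (f - g)" by simp
    then have "mom b g + mom b (f - g) \<doteq> mom b g" using that eqv_sym eqv_trans by blast
    then have "mom b (f - g) \<in> uqp_ideal" by (simp add: eqv_def)
    then show ?thesis using inj by (metis eq_iff_diff_eq_0)
  qed
  show "inj (mu_l :: 'n momfun \<Rightarrow> _)" "inj (mu_r :: 'n momfun \<Rightarrow> _)"
    by (rule injI; simp add: mu_mom to_uqp_eq inj')+
  show "range mu_l \<subseteq> (uqp_comp 0 0 :: 'n alg set set)" "range mu_r \<subseteq> (uqp_comp 0 0 :: 'n alg set set)"
    using shom_comp_0[OF shom_mom] by (auto simp: mu_mom)
  show "mu_l f \<otimes>\<^bsub>uqp\<^esub> a = a \<otimes>\<^bsub>uqp\<^esub> mu_l (mom_shift (res_Ph \<alpha>) f)"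
    "mu_r f \<otimes>\<^bsub>uqp\<^esub> a = a \<otimes>\<^bsub>uqp\<^esub> mu_r (mom_shift (res_P \<beta>) f)"
    if H: "\<alpha> \<in> Hstar" "\<beta> \<in> Hstar" and a: "a \<in> uqp_comp \<alpha> \<beta>" for \<alpha> \<beta> a and f :: "'n momfun"
  proof -
    obtain a' where e: "a = to_uqp a'" using a by (auto dest!: uqp_comp_carrier elim!: uqpE)
    have s: "shom (dpair (res_Ph \<alpha>, res_P \<beta>)) a'"
      using a by (intro eig_shom dpair_res_degs H) (simp add: e uqp_comp_eig H)
    show "mu_l f \<otimes>\<^bsub>uqp\<^esub> a = a \<otimes>\<^bsub>uqp\<^esub> mu_l (mom_shift (res_Ph \<alpha>) f)"
      using mom_shom[OF s, of P_plus_h f] by (simp add: e mu_mom uqp_simps to_uqp_eq dpair_def)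
    show "mu_r f \<otimes>\<^bsub>uqp\<^esub> a = a \<otimes>\<^bsub>uqp\<^esub> mu_r (mom_shift (res_P \<beta>) f)"
      using mom_shom[OF s, of P_var f] by (simp add: e mu_mom uqp_simps to_uqp_eq dpair_def)
  qed
qed

section \<open>Representations on loops\<close>

lemma psummable_X: "psummable (\<lambda>n. fps_X ^ n * (x n :: 'a::ring_1 fps))"
  by (rule psummableI_finite[where S = "\<lambda>k. {..k}"]) (auto simp: fps_X_power_mult_nth)

subsection \<open>Scalars at \<open>c = 0\<close>\<close>

definition pm_lin :: "('k \<Rightarrow> 'b::zero \<Rightarrow> 'c::comm_monoid_add) \<Rightarrow> ('k \<Rightarrow>\<^sub>0 'b) \<Rightarrow> 'c"
  where "pm_lin f x = (\<Sum>k\<in>Poly_Mapping.keys x. f k (poly_mapping.lookup x k))"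

lemma pm_lin_add:
  fixes f :: "'k \<Rightarrow> 'b::comm_monoid_add \<Rightarrow> 'c::comm_monoid_add"
  assumes f: "\<And>k. f k 0 = 0" "\<And>k a b. f k (a + b) = f k a + f k b"
  shows "pm_lin f (x + y) = pm_lin f x + pm_lin f y"
proof -
  let ?S = "Poly_Mapping.keys x \<union> Poly_Mapping.keys y"
  have sup: "pm_lin f z = (\<Sum>k\<in>?S. f k (poly_mapping.lookup z k))" if "Poly_Mapping.keys z \<subseteq> ?S" for z
    unfolding pm_lin_def using that f(1)
    by (intro sum.mono_neutral_left) (auto simp: in_keys_iff)
  show ?thesis
    using keys_add[of x y] by (subst (1 2 3) sup) (auto simp: lookup_add f sum.distrib)
qed

lemma pm_lin_single: "(\<And>k. f k 0 = 0) \<Longrightarrow> pm_lin f (Poly_Mapping.single k c) = f k c"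
  by (cases "c = 0") (simp_all add: pm_lin_def)

lemma pm_lin_0: "pm_lin f 0 = 0" by (simp add: pm_lin_def)

lemma additive_sum:
  assumes "F 0 = (0 :: 'c::comm_monoid_add)" "\<And>x y. F (x + y) = F x + F y"
  shows "F (\<Sum>i\<in>S. g i) = (\<Sum>i\<in>S. F (g i))"
  by (induction S rule: infinite_finite_induct) (simp_all add: assms)

text \<open>Reduces multiplicativity and compatibility statements to single words and single
  monomials.\<close>

lemma pm_additive_eqI:
  fixes F G :: "('k \<Rightarrow>\<^sub>0 'b::comm_monoid_add) \<Rightarrow> 'c::comm_monoid_add"
  assumes "F 0 = 0" "\<And>x y. F (x + y) = F x + F y"
    "G 0 = 0" "\<And>x y. G (x + y) = G x + G y"
    and "\<And>k c. F (Poly_Mapping.single k c) = G (Poly_Mapping.single k c)"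
  shows "F x = G x"
proof -
  have "F (\<Sum>k\<in>S. Poly_Mapping.single k (g k)) = G (\<Sum>k\<in>S. Poly_Mapping.single k (g k))" for S g
    by (simp only: additive_sum[of F, OF assms(1,2)] additive_sum[of G, OF assms(3,4)] assms(5))
  then show ?thesis using poly_mapping_sum_single[of x] by metis
qed

text \<open>Specialisation at \<open>c = 0\<close>: every power of \<open>q^(c/2)\<close> is sent to
  1, so the exponent is ignored.\<close>

definition ev0 :: "scal \<Rightarrow> 'n::finite dynfun"
  where "ev0 = pm_lin (\<lambda>_. map_fls mero_const)"

lemmas rhom_mc = rhom_map_fls[OF rhom_mero_const]

lemma ev0_simps:
  "ev0 0 = 0" "ev0 (x + y) = ev0 x + ev0 y" "ev0 (Poly_Mapping.single k c) = map_fls mero_const c"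
  unfolding ev0_def
  by (rule pm_lin_0, rule pm_lin_add, simp_all add: rhom_0[OF rhom_mc] rhom_add[OF rhom_mc] pm_lin_single)

lemma rhom_ev0: "rhom ev0"
proof -
  have 1: "ev0 (Poly_Mapping.single k c * y) = ev0 (Poly_Mapping.single k c) * ev0 y" for k c y
    by (rule pm_additive_eqI[of "\<lambda>y. ev0 (Poly_Mapping.single k c * y)"])
      (simp_all add: ev0_simps distrib_left mult_single rhom_mult[OF rhom_mc])
  have "ev0 (x * y) = ev0 x * ev0 y" for x y
    by (rule pm_additive_eqI[of "\<lambda>x. ev0 (x * y)"]) (simp_all add: ev0_simps(1,2) distrib_right 1)
  moreover have "ev0 1 = 1"
    using ev0_simps(3)[of 0 1] by (simp add: rhom_1[OF rhom_mc])
  ultimately show ?thesis unfolding rhom_def using ev0_simps(2) by blast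
qed

definition ev :: "scal fps \<Rightarrow> 'n::finite dynfun fps"
  where "ev = fps_map ev0"

lemma rhom_ev: "rhom ev" unfolding ev_def by (rule rhom_fps_map[OF rhom_ev0])

lemmas ev_hom = rhom_0[OF rhom_ev] rhom_1[OF rhom_ev] rhom_add[OF rhom_ev] rhom_mult[OF rhom_ev]
  rhom_diff[OF rhom_ev] rhom_power[OF rhom_ev] rhom_uminus[OF rhom_ev]

lemma ev_nome: "ev nome = fps_X"
  by (simp add: ev_def nome_def fps_map_X rhom_ev0)

definition cq :: "(dynvar, 'n::finite) mero \<Rightarrow> 'n dynfun fps"
  where "cq x = fps_const (qpow x)"

lemma ev_qmon: "ev (qmon n m) = cq (of_int n)"
  by (simp add: ev_def qmon_def fps_map_const rhom_ev0 ev0_simps map_fls_qpow rhom_mero_const rhom_of_int cq_def)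

lemma cq_add: "cq (x + y) = cq x * cq y" by (simp add: cq_def qpow_add)

lemma cq_0: "cq 0 = 1" by (simp add: cq_def qpow_0)

lemma cq_minus: "cq x * cq (- x) = 1" by (simp add: cq_0 flip: cq_add)

text \<open>At \<open>c = 0\<close> the two nomes coincide, and starred and unstarred structure
  functions become the same series.\<close>

lemma ev_nome_star: "ev nome_star = fps_X"
  using ev_qmon[of 0 "-4"] by (simp add: nome_star_def ev_hom ev_nome cq_0)

definition sh :: "complex^'n^dynvar \<Rightarrow> 'n::finite dynfun fps \<Rightarrow> 'n dynfun fps"
  where "sh a = fps_map (map_fls (mero_shift a))"

lemmas rhom_sh0 = rhom_map_fls[OF rhom_mero_shift]

lemma rhom_sh: "rhom (sh a)" unfolding sh_def by (rule rhom_fps_map[OF rhom_sh0])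

lemmas sh_hom = rhom_0[OF rhom_sh] rhom_1[OF rhom_sh] rhom_add[OF rhom_sh] rhom_mult[OF rhom_sh]
  rhom_diff[OF rhom_sh] rhom_power[OF rhom_sh] rhom_uminus[OF rhom_sh]

lemma sh_sh: "a \<in> dyn_space \<Longrightarrow> b \<in> dyn_space \<Longrightarrow> sh a (sh b x) = sh (a + b) x"
  by (simp add: sh_def fps_eq_iff map_fls_comp rhom_0 rhom_mero_shift mero_shift_shift)

lemma sh_0: "sh 0 x = x"
  by (simp add: sh_def fps_eq_iff fls_eq_iff map_fls_nth mero_shift_0)

lemma sh_inverse: "a \<in> dyn_space \<Longrightarrow> sh a (sh (- a) x) = x" "a \<in> dyn_space \<Longrightarrow> sh (- a) (sh a x) = x"
  using dyn_diff[OF zero_in_dyn, of a] by (simp_all add: sh_sh sh_0)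

lemma dyn_uminus: "a \<in> dyn_space \<Longrightarrow> - a \<in> dyn_space"
  using dyn_diff[OF zero_in_dyn, of a] by simp

lemma sh_X: "sh a fps_X = fps_X" by (simp add: sh_def fps_map_X rhom_sh0)

lemma sh_ev: "sh a (ev y) = ev y"
proof -
  have 0: "map_fls (mero_shift a) (ev0 x) = ev0 x" for x
    by (rule pm_additive_eqI[of "\<lambda>x. map_fls (mero_shift a) (ev0 x)"])
      (simp_all add: ev0_simps rhom_0[OF rhom_sh0] rhom_add[OF rhom_sh0] map_fls_comp rhom_0 rhom_mero_shift
        rhom_mero_const mero_shift_const)
  show ?thesis by (simp add: sh_def ev_def fps_eq_iff 0)
qed

lemma sh_cq: "sh a (cq x) = cq (mero_shift a x)"
  by (simp add: sh_def cq_def fps_map_const rhom_sh0 map_fls_qpow rhom_mero_shift)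

subsection \<open>Words acting on loops\<close>

text \<open>The integer argument is the degree in the loop parameter.\<close>

type_synonym 'n loop = "int \<Rightarrow> 'n dynfun fps"

text \<open>Multiplication by \<open>c\<close> precedes the translation. In a product the weight of
  the left factor is therefore translated back past the right factor, which gives
  \<open>sh (- t) c * d\<close> in \<open>hop_mult\<close>.\<close>

definition op :: "complex^'n^dynvar \<Rightarrow> 'n::finite dynfun fps \<Rightarrow> int \<Rightarrow> 'n loop \<Rightarrow> 'n loop"
  where "op a c n v = (\<lambda>k. sh a (c * v (k - n)))"

text \<open>The weight may depend on the degree \<open>k\<close>, because the derivation acts as
  multiplication by \<open>- k\<close>.\<close>

definition monop :: "('n::finite loop \<Rightarrow> 'n loop) \<Rightarrow> bool"
  where "monop T \<longleftrightarrow> (\<exists>a n c. a \<in> dyn_space \<and> (\<forall>v k. T v k = sh a (c k * v (k - n))))"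

lemma monop_op: "a \<in> dyn_space \<Longrightarrow> monop (op a c n)"
  unfolding monop_def op_def by (intro exI[of _ a] exI[of _ n] exI[of _ "\<lambda>_. c"]) auto

lemma monop_id: "monop (\<lambda>v. v)"
  unfolding monop_def using zero_in_dyn by (intro exI[of _ 0] exI[of _ "\<lambda>_. 1"]) (auto simp: sh_0)

lemma monop_comp:
  assumes "monop S" "monop T" shows "monop (\<lambda>v. S (T v))"
proof -
  obtain a n c where S: "a \<in> dyn_space" "\<And>v k. S v k = sh a (c k * v (k - n))"
    using assms(1) unfolding monop_def by blast
  obtain b m d where T: "b \<in> dyn_space" "\<And>v k. T v k = sh b (d k * v (k - m))"
    using assms(2) unfolding monop_def by blast
  have "S (T v) k = sh (a + b) ((sh (- b) (c k) * d (k - n)) * v (k - (n + m)))" for v k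
    by (simp add: S T sh_hom sh_inverse mult.assoc flip: sh_sh) (simp add: algebra_simps)
  then show ?thesis
    unfolding monop_def using dyn_add[OF S(1) T(1)]
    by (intro exI[of _ "a + b"] exI[of _ "n + m"] exI[of _ "\<lambda>k. sh (- b) (c k) * d (k - n)"]) auto
qed

lemma sh_psum:
  assumes "psummable x" shows "psummable (\<lambda>r. sh a (x r))" "sh a (psum x) = psum (\<lambda>r. sh a (x r))"
  using fps_map_psum[OF rhom_sh0 assms, of a] by (simp_all add: sh_def)

lemma monop_psum:
  assumes T: "monop T" and x: "\<And>k. psummable (\<lambda>r. x r k)"
  shows "psummable (\<lambda>r. T (x r) k)" "T (\<lambda>k. psum (\<lambda>r. x r k)) k = psum (\<lambda>r. T (x r) k)"
proof -
  obtain a n c where S: "a \<in> dyn_space" "\<And>v k. T v k = sh a (c k * v (k - n))"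
    using T unfolding monop_def by blast
  show "psummable (\<lambda>r. T (x r) k)"
    unfolding S(2) by (intro sh_psum psum_mult_left x)
  show "T (\<lambda>k. psum (\<lambda>r. x r k)) k = psum (\<lambda>r. T (x r) k)"
    unfolding S(2) psum_mult_left(2)[OF x, symmetric] by (rule sh_psum(2)[OF psum_mult_left(1)[OF x]])
qed

lemma monop_linear:
  assumes T: "monop T"
  shows "T (\<lambda>k. u k + v k) k = T u k + T v k" "sh' = ev y \<Longrightarrow> T (\<lambda>k. sh' * v k) k = sh' * T v k" "T (\<lambda>_. 0) k = 0"
proof -
  obtain a n c where S: "a \<in> dyn_space" "\<And>v k. T v k = sh a (c k * v (k - n))"
    using T unfolding monop_def by blast
  show "T (\<lambda>k. u k + v k) k = T u k + T v k" "T (\<lambda>_. 0) k = 0" by (simp_all add: S sh_hom distrib_left)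
  show "T (\<lambda>k. sh' * v k) k = sh' * T v k" if "sh' = ev y"
    by (simp add: that S sh_hom sh_ev mult.left_commute)
qed

context
  fixes L :: "'n::finite dynfun gen \<Rightarrow> 'n loop \<Rightarrow> 'n loop"
  assumes L: "\<And>g. monop (L g)"
begin

fun wact :: "'n dynfun gen fmon \<Rightarrow> 'n loop \<Rightarrow> 'n loop"
  where "wact (Fmon w) v = foldr L w v"

lemma monop_wact: "monop (wact w)"
proof (cases w)
  case (Fmon u)
  have "monop (wact (Fmon u))"
  proof (induction u)
    case Nil
    have "wact (Fmon []) = (\<lambda>v. v)" by (simp add: fun_eq_iff)
    then show ?case by (simp only: monop_id)
  next
    case (Cons g u)
    have "wact (Fmon (g # u)) = (\<lambda>v. L g (wact (Fmon u) v))" by (simp add: fun_eq_iff)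
    then show ?case by (simp only: monop_comp[OF L Cons.IH])
  qed
  then show ?thesis by (simp add: Fmon)
qed

lemma wact_add: "wact (u + w) v = wact u (wact w v)"
  by (cases u; cases w) simp

lemma wact_0: "wact 0 v = v" by (simp add: zero_fmon_def)

definition act0 :: "('n dynfun gen fmon \<Rightarrow>\<^sub>0 scal) \<Rightarrow> 'n loop \<Rightarrow> 'n loop"
  where "act0 x v k = pm_lin (\<lambda>w c. fps_const (ev0 c) * wact w v k) x"

lemma act0_simps:
  "act0 0 v k = 0" "act0 (x + y) v k = act0 x v k + act0 y v k"
  "act0 (Poly_Mapping.single w c) v k = fps_const (ev0 c) * wact w v k"
proof -
  show "act0 (x + y) v k = act0 x v k + act0 y v k"
    unfolding act0_def by (rule pm_lin_add) (simp_all add: ev0_simps distrib_right flip: fps_const_add)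
qed (simp_all add: act0_def pm_lin_0 pm_lin_single ev0_simps)

lemma fps_const_ev0: "fps_const (ev0 c) = ev (fps_const c)"
  by (simp add: ev_def fps_map_const rhom_ev0)

text \<open>Continuity of the action of a single coefficient. It lets one power series act on the
  result of another, which is an infinite sum.\<close>

lemma act0_psum:
  assumes x: "\<And>k. psummable (\<lambda>r. x r k)"
  shows "psummable (\<lambda>r. act0 a (x r) k) \<and> act0 a (\<lambda>k. psum (\<lambda>r. x r k)) k = psum (\<lambda>r. act0 a (x r) k)"
proof -
  have single: "psummable (\<lambda>r. act0 (Poly_Mapping.single w c) (x r) k)"
    "act0 (Poly_Mapping.single w c) (\<lambda>k. psum (\<lambda>r. x r k)) k = psum (\<lambda>r. act0 (Poly_Mapping.single w c) (x r) k)" for w c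
    unfolding act0_simps using monop_psum[OF monop_wact x, of w] by (simp_all add: psum_mult_left)
  have *: "psummable (\<lambda>r. act0 (\<Sum>w\<in>S. Poly_Mapping.single w (f w)) (x r) k) \<and>
    act0 (\<Sum>w\<in>S. Poly_Mapping.single w (f w)) (\<lambda>k. psum (\<lambda>r. x r k)) k = psum (\<lambda>r. act0 (\<Sum>w\<in>S. Poly_Mapping.single w (f w)) (x r) k)" for S f
  proof (induction S rule: infinite_finite_induct)
    case (insert w S)
    then show ?case using single by (simp add: act0_simps(2) psum_add)
  qed (use psum_sum[of "{}" "\<lambda>_. 0"] in \<open>simp_all add: act0_simps\<close>)
  show ?thesis
    using *[where S = "Poly_Mapping.keys a" and f = "poly_mapping.lookup a"]
    by (simp only: poly_mapping_sum_single[of a, symmetric])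
qed

lemma act0_ev: "act0 a (\<lambda>k. ev y * v k) k = ev y * act0 a v k"
  by (rule pm_additive_eqI[of "\<lambda>a. act0 a (\<lambda>k. ev y * v k) k"])
    (simp_all add: act0_simps distrib_left monop_linear(2)[OF monop_wact refl] mult.left_commute)

lemma act0_lin: "act0 a (\<lambda>k. u k + v k) k = act0 a u k + act0 a v k" "act0 a (\<lambda>_. 0) k = 0"
  by (rule pm_additive_eqI[of "\<lambda>a. act0 a (\<lambda>k. u k + v k) k"],
      simp_all add: act0_simps distrib_left monop_linear(1,3)[OF monop_wact],
      rule pm_additive_eqI[of "\<lambda>a. act0 a (\<lambda>_. 0) k"],
      simp_all add: act0_simps distrib_left monop_linear(1,3)[OF monop_wact])

lemma act0_mult: "act0 (x * y) v k = act0 x (act0 y v) k"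
proof -
  have 1: "act0 (Poly_Mapping.single w c * y) v k = act0 (Poly_Mapping.single w c) (act0 y v) k" for w c y
  proof (rule pm_additive_eqI[of "\<lambda>y. act0 (Poly_Mapping.single w c * y) v k"])
    show "act0 (Poly_Mapping.single w c) (act0 0 v) k = 0"
    proof -
      have "act0 0 v = (\<lambda>_. 0)" by (simp add: fun_eq_iff act0_simps)
      then show ?thesis by (simp only: act0_lin(2))
    qed
    show "act0 (Poly_Mapping.single w c) (act0 (x + y) v) k =
      act0 (Poly_Mapping.single w c) (act0 x v) k + act0 (Poly_Mapping.single w c) (act0 y v) k" for x y
    proof -
      have "act0 (x + y) v = (\<lambda>k. act0 x v k + act0 y v k)" by (simp add: fun_eq_iff act0_simps)
      then show ?thesis by (simp add: act0_lin)
    qed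
    show "act0 (Poly_Mapping.single w c * Poly_Mapping.single u d) v k =
      act0 (Poly_Mapping.single w c) (act0 (Poly_Mapping.single u d) v) k" for u d
    proof -
      have "act0 (Poly_Mapping.single u d) v = (\<lambda>k. ev (fps_const d) * wact u v k)"
        by (simp add: fun_eq_iff act0_simps fps_const_ev0)
      then have e: "act0 (Poly_Mapping.single w c) (act0 (Poly_Mapping.single u d) v) k =
        ev (fps_const d) * act0 (Poly_Mapping.single w c) (wact u v) k"
        by (simp only: act0_ev)
      have "ev (fps_const (c * d)) = (ev (fps_const c) * ev (fps_const d) :: 'n dynfun fps)"
        by (simp flip: ev_hom(4))
      then show ?thesis
        unfolding e by (simp add: mult_single act0_simps(3) wact_add fps_const_ev0 mult_ac)
    qed
  qed (simp_all add: act0_simps distrib_left)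
  show ?thesis
    by (rule pm_additive_eqI[of "\<lambda>x. act0 (x * y) v k"]) (simp_all add: act0_simps(1,2) distrib_right 1)
qed

definition act :: "'n alg \<Rightarrow> 'n loop \<Rightarrow> 'n loop"
  where "act a v k = psum (\<lambda>n. fps_X ^ n * act0 (fps_nth a n) v k)"

lemma act_nth: "fps_nth (act a v k) i = (\<Sum>n\<le>i. fps_nth (act0 (fps_nth a n) v k) (i - n))"
proof -
  have "fps_nth (act a v k) i = (\<Sum>n\<in>{..i}. fps_nth (fps_X ^ n * act0 (fps_nth a n) v k) i)"
    unfolding act_def by (rule psum_nth) (auto simp: fps_X_power_mult_nth)
  also have "\<dots> = (\<Sum>n\<le>i. fps_nth (act0 (fps_nth a n) v k) (i - n))"
    by (rule sum.cong) (auto simp: fps_X_power_mult_nth)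
  finally show ?thesis .
qed

lemma act_add: "act (a + b) v k = act a v k + act b v k"
  by (rule fps_ext) (simp add: act_nth act0_simps sum.distrib)

lemma act_0: "act 0 v k = 0" by (rule fps_ext) (simp add: act_nth act0_simps)

lemma act_uminus: "act (- a) v k = - act a v k"
  using act_add[of a "- a" v k] by (simp add: act_0 eq_neg_iff_add_eq_0 add.commute)

lemma act_diff: "act (a - b) v k = act a v k - act b v k"
  using act_add[of a "- b"] by (simp add: act_uminus)

lemma act_const: "act (fps_const x) v k = act0 x v k"
proof -
  have "act (fps_const x) v k = (\<Sum>n\<in>{0}. fps_X ^ n * act0 (fps_nth (fps_const x) n) v k)"
    unfolding act_def by (rule psum_sum) (auto simp: act0_simps)
  then show ?thesis by simp
qed

lemma act_letter: "act (letter g) v k = L g v k"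
  by (simp add: letter_def act_const act0_simps rhom_1[OF rhom_ev0])

lemma act_1: "act 1 v k = v k"
  using act_const[of 1 v k] act0_simps(3)[of 0 1 v k] by (simp add: rhom_1[OF rhom_ev0] wact_0)

text \<open>Both sides are sums over pairs \<open>(i, m)\<close> of powers of \<open>p\<close>,
  grouped along antidiagonals on the left and along rows on the right.\<close>

lemma act_mult: "act (a * b) v k = act a (act b v) k"
proof -
  let ?y = "\<lambda>(i, m). fps_X ^ (i + m) * act0 (fps_nth a i) (act0 (fps_nth b m) v) k"
  have sy: "psummable ?y"
  proof (rule psummableI_finite[where S = "\<lambda>j. {..j} \<times> {..j}"])
    fix j and r :: "nat \<times> nat" assume "r \<notin> {..j} \<times> {..j}"
    then show "fps_nth (?y r) j = 0" by (cases r) (auto simp: fps_X_power_mult_nth)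
  qed simp
  have "act (a * b) v k = psum (\<lambda>n. \<Sum>i\<le>n. ?y (i, n - i))"
    unfolding act_def
  proof (rule arg_cong[where f = psum], rule ext)
    fix n :: nat
    have "act0 (\<Sum>i\<le>n. f i) v k = (\<Sum>i\<le>n. act0 (f i) v k)" for f
      by (rule additive_sum[of "\<lambda>x. act0 x v k"]) (simp_all add: act0_simps)
    then show "fps_X ^ n * act0 (fps_nth (a * b) n) v k = (\<Sum>i\<le>n. ?y (i, n - i))"
      by (simp add: fps_mult_nth atLeast0AtMost act0_mult sum_distrib_left)
  qed
  also have "\<dots> = psum ?y" by (rule psum_diag(2)[OF sy])
  also have "\<dots> = psum (\<lambda>i. psum (\<lambda>m. ?y (i, m)))" by (rule psum_Sigma(3)[OF sy, symmetric])
  also have "\<dots> = act a (act b v) k"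
    unfolding act_def[of a]
  proof (rule arg_cong[where f = psum], rule ext)
    fix i :: nat
    let ?z = "\<lambda>m k. ev (nome ^ m) * act0 (fps_nth b m) v k"
    have z: "act b v = (\<lambda>k. psum (\<lambda>m. ?z m k))" by (simp add: fun_eq_iff act_def ev_hom ev_nome)
    have sz: "psummable (\<lambda>m. ?z m k)" for k by (simp add: ev_hom ev_nome psummable_X)
    have "psum (\<lambda>m. ?y (i, m)) = psum (\<lambda>m. fps_X ^ i * act0 (fps_nth a i) (?z m) k)"
      unfolding act0_ev by (simp add: ev_hom ev_nome power_add mult.assoc)
    also have "\<dots> = fps_X ^ i * psum (\<lambda>m. act0 (fps_nth a i) (?z m) k)"
      by (rule psum_mult_left(2)[OF conjunct1[OF act0_psum[of "\<lambda>m. ?z m", OF sz]]])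
    also have "\<dots> = fps_X ^ i * act0 (fps_nth a i) (act b v) k"
      unfolding z by (simp only: conjunct2[OF act0_psum[of "\<lambda>m. ?z m", OF sz]])
    finally show "psum (\<lambda>m. ?y (i, m)) = fps_X ^ i * act0 (fps_nth a i) (act b v) k" .
  qed
  finally show ?thesis .
qed

lemma act_coe: "act (coe y) v k = ev y * v k"
proof -
  have "act (coe y) v k = psum (\<lambda>n. (fps_X ^ n * fps_const (fps_nth (ev y) n)) * v k)"
    unfolding act_def by (simp add: coe_def act0_simps wact_0 ev_def mult.assoc)
  also have "\<dots> = ev y * v k" by (simp add: psum_mult_right psum_const_X)
  finally show ?thesis .
qed

lemma act_psum:
  assumes x: "psummable x"
  shows "psummable (\<lambda>r. act (x r) v k)" "act (psum x) v k = psum (\<lambda>r. act (x r) v k)"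
proof -
  let ?S = "\<lambda>n. {r. \<exists>k\<le>n. fps_nth (x r) k \<noteq> 0}"
  have fin: "finite (?S n)" for n by (rule psummable_finite_le[OF x])
  have zero: "fps_nth (act (x r) v k) i = 0" if "r \<notin> ?S i" for r i
    using that by (simp add: act_nth act0_simps)
  show "psummable (\<lambda>r. act (x r) v k)" by (rule psummableI_finite[where S = ?S]) (simp_all add: fin zero)
  show "act (psum x) v k = psum (\<lambda>r. act (x r) v k)"
  proof (rule fps_ext)
    fix i
    have add: "act0 (\<Sum>r\<in>?S i. f r) v k = (\<Sum>r\<in>?S i. act0 (f r) v k)" for f
      by (rule additive_sum[of "\<lambda>x. act0 x v k"]) (simp_all add: act0_simps)
    have "fps_nth (psum x) n = (\<Sum>r\<in>?S i. fps_nth (x r) n)" if "n \<le> i" for n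
      by (rule psum_nth[OF fin]) (use that in auto)
    then have "fps_nth (act (psum x) v k) i = (\<Sum>n\<le>i. \<Sum>r\<in>?S i. fps_nth (act0 (fps_nth (x r) n) v k) (i - n))"
      by (simp add: act_nth add fps_sum_nth)
    also have "\<dots> = (\<Sum>r\<in>?S i. \<Sum>n\<le>i. fps_nth (act0 (fps_nth (x r) n) v k) (i - n))"
      by (rule sum.swap)
    also have "\<dots> = (\<Sum>r\<in>?S i. fps_nth (act (x r) v k) i)" by (simp add: act_nth)
    also have "\<dots> = fps_nth (psum (\<lambda>r. act (x r) v k)) i"
      by (rule psum_nth[symmetric, OF fin zero])
    finally show "fps_nth (act (psum x) v k) i = fps_nth (psum (\<lambda>r. act (x r) v k)) i" .
  qed
qed

text \<open>As \<open>p\<close> acts injectively, the cancellation of powers of \<open>p\<close> in the relators does no harm.\<close>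

lemma uqp_ideal_act:
  assumes rel: "\<And>u w v k. uqp_rel u w \<Longrightarrow> act u v k = act w v k" and a: "a \<in> uqp_ideal"
  shows "act a v k = 0"
proof -
  let ?J = "{a. \<forall>v k. act a v k = 0}"
  have "is_ideal ?J"
    unfolding is_ideal_def
  proof (intro conjI ballI allI)
    fix a x assume "a \<in> ?J"
    then have "act a = (\<lambda>_ _. 0)" by (simp add: fun_eq_iff)
    moreover have "act x (\<lambda>_. 0) k = 0" for k
      by (rule fps_ext) (simp add: act_nth act0_lin)
    ultimately show "x * a \<in> ?J" "a * x \<in> ?J" by (simp_all add: act_mult)
  qed (simp_all add: act_0 act_add)
  moreover have "closed ?J"
    unfolding closed_sequential_limits
  proof (intro allI impI, elim conjE)
    fix x l assume x: "\<forall>n. x n \<in> ?J" "x \<longlonglongrightarrow> l"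
    have "fps_nth (act l v k) i = 0" for v k i
    proof -
      have "\<forall>\<^sub>F n in sequentially. \<forall>j\<in>{..i}. fps_nth (x n) j = fps_nth l j"
        using x(2) by (subst eventually_ball_finite_distrib) (auto simp: tendsto_fps_iff)
      from eventually_happens'[OF sequentially_bot this]
      obtain n where "\<forall>j\<in>{..i}. fps_nth (x n) j = fps_nth l j" ..
      then have "fps_nth (act l v k) i = fps_nth (act (x n) v k) i" by (simp add: act_nth)
      then show ?thesis using x(1) by simp
    qed
    then show "l \<in> ?J" by (simp add: fps_eq_iff)
  qed
  moreover have "uqp_relators \<subseteq> ?J"
  proof
    fix y :: "'n alg" assume "y \<in> uqp_relators"
    then obtain n u w where uw: "uqp_rel u w" "coe nome ^ n * y = u - w" by (auto simp: uqp_relators_def)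
    have "fps_X ^ n * act y v k = 0" for v k
    proof -
      have "act (coe (nome ^ n) * y) v k = fps_X ^ n * act y v k"
        by (simp add: act_mult act_coe ev_hom ev_nome)
      then show ?thesis using uw rel by (simp add: coe_hom act_diff)
    qed
    then show "y \<in> ?J" by simp
  qed
  ultimately have "uqp_ideal \<subseteq> ?J" by (rule uqp_ideal_minimal)
  then show ?thesis using a by blast
qed

subsection \<open>Homogeneous operators\<close>

text \<open>Most relations are compared through the three data of a weighted shift, namely
  translation, degree and weight; by \<open>hop_eq\<close> their agreement suffices.\<close>

definition hop :: "'n alg \<Rightarrow> complex^'n^dynvar \<Rightarrow> int \<Rightarrow> 'n dynfun fps \<Rightarrow> bool"
  where "hop a s n c \<longleftrightarrow> s \<in> dyn_space \<and> (\<forall>v. act a v = op s c n v)"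

lemma hop_mult: "hop a s m c \<Longrightarrow> hop b t n d \<Longrightarrow> hop (a * b) (s + t) (m + n) (sh (- t) c * d)"
  unfolding hop_def
  by (auto simp: fun_eq_iff act_mult op_def dyn_add sh_hom sh_inverse mult.assoc diff_diff_eq simp flip: sh_sh)

lemma hop_coe: "hop a s n c \<Longrightarrow> hop (coe y * a) s n (ev y * c)"
  unfolding hop_def by (auto simp: fun_eq_iff act_mult act_coe op_def sh_hom sh_ev mult.assoc)

lemma hop_add: "hop a s n c \<Longrightarrow> hop b s n d \<Longrightarrow> hop (a + b) s n (c + d)"
  unfolding hop_def by (auto simp: fun_eq_iff act_add op_def sh_hom distrib_right)

lemma hop_uminus: "hop a s n c \<Longrightarrow> hop (- a) s n (- c)"
  unfolding hop_def by (auto simp: fun_eq_iff act_uminus op_def sh_hom)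

lemma hop_diff: "hop a s n c \<Longrightarrow> hop b s n d \<Longrightarrow> hop (a - b) s n (c - d)"
  using hop_add[OF _ hop_uminus] by fastforce

lemma hop_0: "s \<in> dyn_space \<Longrightarrow> hop 0 s n 0"
  unfolding hop_def by (simp add: fun_eq_iff act_0 op_def sh_hom)

lemma hop_1: "hop 1 0 0 1"
  unfolding hop_def by (simp add: fun_eq_iff act_1 op_def sh_0 zero_in_dyn)

lemma hop_psum:
  assumes x: "psummable x" and h: "\<And>r. hop (x r) s n (c r)" and s: "s \<in> dyn_space"
  shows "psummable c" "hop (psum x) s n (psum c)"
proof -
  \<comment> \<open>On the unit loop in degree 0 the operator shows its weight in degree
    \<open>n\<close>, so the weights inherit summability.\<close>
  let ?v = "\<lambda>k :: int. if k = 0 then 1 else (0 :: 'n dynfun fps)"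
  have "sh (- s) (act (x r) ?v n) = c r" for r
    using h[of r] s by (simp add: hop_def op_def sh_inverse)
  then show sc: "psummable c" using sh_psum(1)[OF act_psum(1)[OF x], of "- s" ?v n] by simp
  show "hop (psum x) s n (psum c)"
    unfolding hop_def
  proof (intro conjI allI s ext)
    fix v k
    have "act (psum x) v k = psum (\<lambda>r. op s (c r) n v k)"
      using h by (simp add: act_psum[OF x] hop_def)
    also have "\<dots> = op s (psum c) n v k"
      unfolding op_def using psum_mult_right[OF sc, of "v (k - n)"] sh_psum by metis
    finally show "act (psum x) v k = op s (psum c) n v k" .
  qed
qed

lemma hop_eq: "hop a s n c \<Longrightarrow> hop b s n c \<Longrightarrow> act a v k = act b v k"
  by (simp add: hop_def)

lemma hop_letter: "L g = op s c n \<Longrightarrow> s \<in> dyn_space \<Longrightarrow> hop (letter g) s n c"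
  by (auto simp: hop_def fun_eq_iff act_letter)

text \<open>The condition \<open>d1 + d2 = 0\<close> keeps the total degree, so multiplication by a
  structure function affects the weight only.\<close>

lemma hop_act2:
  assumes s: "s \<in> dyn_space" and h: "\<And>a b. hop (\<Phi> a b) s (a + b) (C a b)" and d: "d1 + d2 = 0"
    and x: "psummable (\<lambda>n. coe (fps_nth Y n) * \<Phi> (a - int n * d1) (b - int n * d2))"
  shows "psummable (\<lambda>n. ev (fps_nth Y n) * C (a - int n * d1) (b - int n * d2))"
    "hop (act2 Y (d1, d2) \<Phi> a b) s (a + b) (psum (\<lambda>n. ev (fps_nth Y n) * C (a - int n * d1) (b - int n * d2)))"
proof -
  have e: "(a - int n * d1) + (b - int n * d2) = a + b" for n
  proof -
    have "int n * d1 + int n * d2 = 0" using d by (simp flip: distrib_left)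
    then show ?thesis by linarith
  qed
  have hn: "hop (coe (fps_nth Y n) * \<Phi> (a - int n * d1) (b - int n * d2)) s (a + b)
      (ev (fps_nth Y n) * C (a - int n * d1) (b - int n * d2))" for n
    using hop_coe[OF h, of "fps_nth Y n" "a - int n * d1" "b - int n * d2"] unfolding e .
  show "psummable (\<lambda>n. ev (fps_nth Y n) * C (a - int n * d1) (b - int n * d2))"
    by (rule hop_psum(1)[OF x hn s])
  show "hop (act2 Y (d1, d2) \<Phi> a b) s (a + b) (psum (\<lambda>n. ev (fps_nth Y n) * C (a - int n * d1) (b - int n * d2)))"
    unfolding act2_def using hop_psum(2)[OF x hn s] by (simp add: psum_suminf[OF x])
qed

end

section \<open>Currents supported at one point\<close>

lemma fps_const_cq: "cq x = fps_const (qpow x)" by (simp add: cq_def)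

lemma cq_nonzero: "cq x \<noteq> 0" by (simp add: cq_def qpow_nonzero)

lemma cq_inj: "cq x = cq y \<longleftrightarrow> x = y" by (simp add: cq_def qpow_inj)

lemma cq_power: "cq x ^ n = cq (of_nat n * x)"
  by (induction n) (simp_all add: cq_0 algebra_simps flip: cq_add)

lemma cdiv_fps_map: "rhom h \<Longrightarrow> cdiv d F \<Longrightarrow> cdiv d (fps_map (fps_map h) F)"
  by (simp add: cdiv_def rhom_0)

lemma psummable_coe_cdiv:
  fixes x :: "nat \<Rightarrow> 'n::finite alg"
  assumes "cdiv d Y" shows "psummable (\<lambda>n. coe (fps_nth Y n) * x n)"
proof (rule psummableI_finite[where S = "\<lambda>i. {..i + d}"])
  fix i n assume "n \<notin> {..i + d}"
  then have "fps_nth (coe (fps_nth Y n) :: 'n alg) j = 0" if "j \<le> i" for j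
    using assms that by (simp add: coe_def cdiv_def)
  then show "fps_nth (coe (fps_nth Y n) * x n) i = 0"
    by (simp add: fps_mult_nth)
qed simp

definition evs :: "scal fps fps \<Rightarrow> 'n::finite dynfun fps fps"
  where "evs = fps_map ev"

definition is_nome :: "scal fps \<Rightarrow> bool"
  where "is_nome t \<longleftrightarrow> t = nome \<or> t = nome_star"

lemma is_nomeD: "is_nome t \<Longrightarrow> ev t = fps_X" "is_nome t \<Longrightarrow> fps_nth t 0 = 0"
  by (auto simp: is_nome_def ev_nome ev_nome_star) (auto simp: nome_def nome_star_def)

lemma evs_poch: "is_nome t \<Longrightarrow> evs (poch a t) = poch (ev a) fps_X"
  by (simp add: evs_def ev_def fps_map_poch rhom_ev0 is_nomeD(1)[unfolded ev_def])

lemma rhom_evs: "rhom evs" unfolding evs_def by (rule rhom_fps_map[OF rhom_ev])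

lemma evs_qfrac:
  assumes "is_nome t"
  shows "poch (ev b) fps_X * evs (qfrac a b t) = poch (ev a) fps_X"
  unfolding evs_poch[OF assms, symmetric] rhom_mult[OF rhom_evs, symmetric]
  by (simp add: qfrac_poch is_nomeD(2)[OF assms])

lemma cdiv_evs: "cdiv d Y \<Longrightarrow> cdiv d (evs Y)"
  unfolding evs_def ev_def by (rule cdiv_fps_map[OF rhom_ev0])

lemma seval_qfrac:
  assumes t: "is_nome t" and b: "fps_nth b 0 = 0"
  shows "qp (ev b * x) * seval (evs (qfrac a b t)) x = qp (ev a * x)"
proof -
  have "cdiv 0 (poch (ev b) fps_X)" by (rule cdiv_poch0) (simp_all add: ev_def b rhom_0[OF rhom_ev0])
  then have "seval (poch (ev b) fps_X * evs (qfrac a b t)) x = seval (poch (ev b) fps_X) x * seval (evs (qfrac a b t)) x"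
    by (rule seval_mult[OF _ cdiv_evs[OF qfrac_cdiv(1)]]) (simp_all add: is_nomeD t b)
  then show ?thesis by (simp add: evs_qfrac t seval_poch)
qed

lemma qp_X_nonzero: "qp (fps_X * a) \<noteq> (0 :: 'a::comm_ring_1 fps)"
  using qp_nth_0[of "fps_X * a"] by auto

lemma seval_qfrac1:
  assumes t: "is_nome t"
  shows "qp (fps_X * cq (of_int n + d)) * seval (evs (qfrac (qmon m 0) (t * qmon n 0) t)) (cq d) = qp (cq (of_int m + d))"
  using seval_qfrac[OF t, of "t * qmon n 0" "cq d" "qmon m 0"] is_nomeD(2)[OF t]
  by (simp add: is_nomeD(1)[OF t] ev_hom ev_qmon cq_add mult.assoc)

lemma seval_qfrac0:
  assumes t: "is_nome t"
  shows "qp (fps_X * cq (of_int n + d)) * seval (evs (qfrac (t * qmon m 0) (t * qmon n 0) t)) (cq d) = qp (fps_X * cq (of_int m + d))"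
  using seval_qfrac[OF t, of "t * qmon n 0" "cq d" "t * qmon m 0"] is_nomeD(2)[OF t]
  by (simp add: is_nomeD(1)[OF t] ev_hom ev_qmon cq_add mult.assoc)

text \<open>Separates the one factor of the numerator without a power of \<open>p\<close>. The
  exchange relation of neighbours is thereby expressed through the series \<open>A\<close> of the
  Serre relation.\<close>

lemma seval_qfrac10:
  assumes t: "is_nome t"
  shows "seval (evs (qfrac (qmon m 0) (t * qmon n 0) t)) (cq d) =
    (1 - cq (of_int m + d)) * seval (evs (qfrac (t * qmon m 0) (t * qmon n 0) t)) (cq d)"
proof -
  have "qp (fps_X * cq (of_int n + d)) * seval (evs (qfrac (qmon m 0) (t * qmon n 0) t)) (cq d) =
    (1 - cq (of_int m + d)) * qp (fps_X * cq (of_int m + d))"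
    unfolding seval_qfrac1[OF t] by (subst qp_rec) (simp add: mult.commute)
  also have "\<dots> = qp (fps_X * cq (of_int n + d)) * ((1 - cq (of_int m + d)) * seval (evs (qfrac (t * qmon m 0) (t * qmon n 0) t)) (cq d))"
    by (simp add: seval_qfrac0[OF t, symmetric] mult_ac)
  finally show ?thesis by (simp add: qp_X_nonzero)
qed

lemma ev_nth_evs: "ev (fps_nth Y n) = fps_nth (evs Y) n" by (simp add: evs_def)

lemma mult_rearrange: "(a * b) * (c * d) = a * c * (b * (d :: 'c::ab_semigroup_mult))"
  by (simp only: ac_simps)

lemma mero_shift_lincomb:
  "mero_shift s (- (of_int a * x)) = - (of_int a * mero_shift s x)"
  "mero_shift s (- (of_int a * x + of_int b * y)) = - (of_int a * mero_shift s x + of_int b * mero_shift s y)"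
  by (simp_all add: rhom_uminus[OF rhom_mero_shift] rhom_add[OF rhom_mero_shift] rhom_mult[OF rhom_mero_shift] rhom_of_int[OF rhom_mero_shift]
      rhom_diff[OF rhom_mero_shift])

text \<open>After multiplication by \<open>r z - u\<close> the two hypotheses express all three
  terms through \<open>M2\<close>, and the total coefficient of \<open>M2\<close> is
  \<open>(1 - r r') z = 0\<close>.\<close>

lemma serre_identity:
  fixes r r' z u M1 M2 M3 :: "'c::idom"
  assumes "r * r' = 1" and nz: "r * z - u \<noteq> 0"
    and "(r * r * z - r' * u) * M2 = (r * z - u) * M1"
    and "(z - r' * u) * M3 = (r' * z - u) * M2"
  shows "M1 - (r + r') * M2 + M3 = 0"
proof -
  have "(r * z - u) * M3 = r * ((z - r' * u) * M3)"
  proof -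
    have "r * ((z - r' * u) * M3) = (r * z - (r * r') * u) * M3" by (simp add: algebra_simps)
    then show ?thesis unfolding assms(1) mult_1_left by (rule sym)
  qed
  also have "\<dots> = ((r * r') * z - r * u) * M2" unfolding assms(4) by (simp add: algebra_simps)
  finally have 3: "(r * z - u) * M3 = (z - r * u) * M2" using assms(1) by simp
  have "(r * z - u) * (M1 - (r + r') * M2 + M3) = (r * z - u) * M1 - (r + r') * (r * z - u) * M2 + (r * z - u) * M3"
    by (simp add: algebra_simps)
  also have "\<dots> = (r * r * z - r' * u - (r + r') * (r * z - u) + z - r * u) * M2"
    unfolding 3 assms(3)[symmetric] by (simp add: algebra_simps)
  also have "r * r * z - r' * u - (r + r') * (r * z - u) + z - r * u = (1 - r * r') * z"
    by (simp add: algebra_simps)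
  finally show ?thesis using assms(1) nz by simp
qed

context
  fixes L :: "'n::finite dynfun gen \<Rightarrow> 'n loop \<Rightarrow> 'n loop"
  assumes L: "\<And>g. monop (L g)"
begin

text \<open>\<open>X(z)\<close> acts as a multiple of the delta function at \<open>z = q^x\<close>
  followed by translation by \<open>s\<close>: its coefficient at \<open>z^a\<close> is
  \<open>C q^(-a x)\<close>. \<open>hexp2\<close> and \<open>hexp3\<close> are the analogues with
  two and three variables.\<close>

definition hexp1 :: "(int \<Rightarrow> 'n alg) \<Rightarrow> complex^'n^dynvar \<Rightarrow> 'n dynfun fps \<Rightarrow> (dynvar, 'n) mero \<Rightarrow> bool"
  where "hexp1 X s C x \<longleftrightarrow> (\<forall>a. hop L (X a) s a (C * cq (- (of_int a * x))))"

definition hexp2 :: "(int \<Rightarrow> int \<Rightarrow> 'n alg) \<Rightarrow> complex^'n^dynvar \<Rightarrow> 'n dynfun fps \<Rightarrow>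
    (dynvar, 'n) mero \<Rightarrow> (dynvar, 'n) mero \<Rightarrow> bool"
  where "hexp2 \<Phi> s C x y \<longleftrightarrow> (\<forall>a b. hop L (\<Phi> a b) s (a + b) (C * cq (- (of_int a * x + of_int b * y))))"

definition hexp3 :: "(int \<Rightarrow> int \<Rightarrow> int \<Rightarrow> 'n alg) \<Rightarrow> complex^'n^dynvar \<Rightarrow> 'n dynfun fps \<Rightarrow>
    (dynvar, 'n) mero \<Rightarrow> (dynvar, 'n) mero \<Rightarrow> (dynvar, 'n) mero \<Rightarrow> bool"
  where "hexp3 \<Phi> s C x y z \<longleftrightarrow> (\<forall>a b c. hop L (\<Phi> a b c) s (a + b + c)
    (C * cq (- (of_int a * x + of_int b * y + of_int c * z))))"

text \<open>The support of the left current is moved by the translation of the right one, so the two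
  orders of a product may be supported at different points.\<close>

lemma hexp2_mult:
  assumes X: "hexp1 X s C x" and Y: "hexp1 Y t D y"
  shows "hexp2 (\<lambda>a b. X a * Y b) (s + t) (sh (- t) C * D) (mero_shift (- t) x) y"
  unfolding hexp2_def
proof (intro allI)
  fix a b
  have "hop L (X a * Y b) (s + t) (a + b) (sh (- t) (C * cq (- (of_int a * x))) * (D * cq (- (of_int b * y))))"
    using X Y unfolding hexp1_def by (intro hop_mult[OF L]) auto
  moreover have "sh (- t) (C * cq (- (of_int a * x))) * (D * cq (- (of_int b * y))) =
      sh (- t) C * D * cq (- (of_int a * mero_shift (- t) x + of_int b * y))"
    unfolding sh_hom(4) sh_cq mero_shift_lincomb(1) minus_add_distrib cq_add[of "- (of_int a * mero_shift (- t) x)"] by (rule mult_rearrange)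
  ultimately show "hop L (X a * Y b) (s + t) (a + b) (sh (- t) C * D * cq (- (of_int a * mero_shift (- t) x + of_int b * y)))"
    by simp
qed

lemma hexp3_mult:
  assumes X: "hexp2 X s C x y" and Y: "hexp1 Y t D z"
  shows "hexp3 (\<lambda>a b c. X a b * Y c) (s + t) (sh (- t) C * D) (mero_shift (- t) x) (mero_shift (- t) y) z"
  unfolding hexp3_def
proof (intro allI)
  fix a b c
  have "hop L (X a b * Y c) (s + t) (a + b + c) (sh (- t) (C * cq (- (of_int a * x + of_int b * y))) * (D * cq (- (of_int c * z))))"
    using X Y unfolding hexp1_def hexp2_def by (intro hop_mult[OF L]) auto
  moreover have "sh (- t) (C * cq (- (of_int a * x + of_int b * y))) * (D * cq (- (of_int c * z))) =
      sh (- t) C * D * (cq (- (of_int a * mero_shift (- t) x + of_int b * mero_shift (- t) y)) * cq (- (of_int c * z)))"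
    unfolding sh_hom(4) sh_cq mero_shift_lincomb(2) by (rule mult_rearrange)
  ultimately show "hop L (X a b * Y c) (s + t) (a + b + c)
      (sh (- t) C * D * cq (- (of_int a * mero_shift (- t) x + of_int b * mero_shift (- t) y + of_int c * z)))"
    unfolding minus_add_distrib[of _ "of_int c * z"] cq_add[of _ "- (of_int c * z)"] by (simp only:)
qed

text \<open>Multiplying a delta function by a series evaluates the series at the support; the value
  exists since \<open>Y\<close> is \<open>cdiv\<close>.\<close>

lemma hexp2_act:
  assumes \<Phi>: "hexp2 \<Phi> s C x y" and Y: "cdiv e Y" and d: "d1 + d2 = 0" and s: "s \<in> dyn_space"
  shows "hexp2 (act2 Y (d1, d2) \<Phi>) s (C * seval (evs Y) (cq (of_int d1 * x + of_int d2 * y))) x y"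
  unfolding hexp2_def
proof (intro allI)
  fix a b
  let ?C = "\<lambda>a b :: int. C * cq (- (of_int a * x + of_int b * y))"
  have "hop L (act2 Y (d1, d2) \<Phi> a b) s (a + b) (psum (\<lambda>n. ev (fps_nth Y n) * ?C (a - int n * d1) (b - int n * d2)))"
    using \<Phi> unfolding hexp2_def
    by (intro hop_act2[OF L s _ d psummable_coe_cdiv[OF Y]]) auto
  also have "(\<lambda>n. ev (fps_nth Y n) * ?C (a - int n * d1) (b - int n * d2)) =
    (\<lambda>n. ?C a b * (fps_nth (evs Y) n * cq (of_int d1 * x + of_int d2 * y) ^ n))"
  proof
    fix n
    have e: "- (of_int (a - int n * d1) * x + of_int (b - int n * d2) * y) =
        - (of_int a * x + of_int b * y) + of_nat n * (of_int d1 * x + of_int d2 * y)"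
      by (simp add: algebra_simps)
    show "ev (fps_nth Y n) * ?C (a - int n * d1) (b - int n * d2) =
      ?C a b * (fps_nth (evs Y) n * cq (of_int d1 * x + of_int d2 * y) ^ n)"
      unfolding e cq_add[of "- (of_int a * x + of_int b * y)"] cq_power ev_nth_evs by (simp only: mult_ac)
  qed
  also have "psum \<dots> = ?C a b * seval (evs Y) (cq (of_int d1 * x + of_int d2 * y))"
    unfolding seval_def by (rule psum_mult_left(2)[OF psummable_cdiv[OF cdiv_evs[OF Y]]])
  finally show "hop L (act2 Y (d1, d2) \<Phi> a b) s (a + b)
      (C * seval (evs Y) (cq (of_int d1 * x + of_int d2 * y)) * cq (- (of_int a * x + of_int b * y)))"
    by (simp only: mult_ac)
qed

lemma hexp3_act:
  assumes \<Phi>: "hexp3 \<Phi> s C x y z" and Y: "cdiv e Y" and d: "d1 + d2 + d3 = 0" and s: "s \<in> dyn_space"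
  shows "hexp3 (act3 Y (d1, d2, d3) \<Phi>) s (C * seval (evs Y) (cq (of_int d1 * x + of_int d2 * y + of_int d3 * z))) x y z"
  unfolding hexp3_def
proof (intro allI)
  fix a b c
  let ?C = "\<lambda>a b c :: int. C * cq (- (of_int a * x + of_int b * y + of_int c * z))"
  let ?t = "of_int d1 * x + of_int d2 * y + of_int d3 * z"
  let ?\<Phi> = "\<lambda>n. \<Phi> (a - int n * d1) (b - int n * d2) (c - int n * d3)"
  have x: "psummable (\<lambda>n. coe (fps_nth Y n) * ?\<Phi> n)" by (rule psummable_coe_cdiv[OF Y])
  have hn: "hop L (coe (fps_nth Y n) * ?\<Phi> n) s (a + b + c) (?C a b c * (fps_nth (evs Y) n * cq ?t ^ n))" for n
  proof -
    have "int n * d1 + int n * d2 + int n * d3 = 0" using d by (simp flip: distrib_left)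
    then have deg: "(a - int n * d1) + (b - int n * d2) + (c - int n * d3) = a + b + c" by linarith
    have e: "- (of_int (a - int n * d1) * x + of_int (b - int n * d2) * y + of_int (c - int n * d3) * z) =
        - (of_int a * x + of_int b * y + of_int c * z) + of_nat n * ?t"
      by (simp add: algebra_simps)
    have "hop L (?\<Phi> n) s (a + b + c) (?C (a - int n * d1) (b - int n * d2) (c - int n * d3))"
      using \<Phi> unfolding hexp3_def deg[symmetric] by blast
    then have "hop L (coe (fps_nth Y n) * ?\<Phi> n) s (a + b + c)
        (ev (fps_nth Y n) * ?C (a - int n * d1) (b - int n * d2) (c - int n * d3))"
      by (rule hop_coe[OF L])
    then show ?thesis unfolding e cq_add[of "- (of_int a * x + of_int b * y + of_int c * z)"] cq_power ev_nth_evs by (simp only: mult_ac)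
  qed
  have "hop L (psum (\<lambda>n. coe (fps_nth Y n) * ?\<Phi> n)) s (a + b + c) (psum (\<lambda>n. ?C a b c * (fps_nth (evs Y) n * cq ?t ^ n)))"
    by (rule hop_psum(2)[OF L x hn s])
  also have "psum (\<lambda>n. ?C a b c * (fps_nth (evs Y) n * cq ?t ^ n)) = ?C a b c * seval (evs Y) (cq ?t)"
    unfolding seval_def by (rule psum_mult_left(2)[OF psummable_cdiv[OF cdiv_evs[OF Y]]])
  finally show "hop L (act3 Y (d1, d2, d3) \<Phi> a b c) s (a + b + c)
      (C * seval (evs Y) (cq ?t) * cq (- (of_int a * x + of_int b * y + of_int c * z)))"
    unfolding act3_def prod.case psum_suminf[OF x] by (simp only: mult_ac)
qed

lemma hexp2_act':
  assumes "hexp2 \<Phi> s C x y" "cdiv e Y" "s \<in> dyn_space" "d1 + d2 = 0" "of_int d1 * x + of_int d2 * y = u"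
  shows "hexp2 (act2 Y (d1, d2) \<Phi>) s (C * seval (evs Y) (cq u)) x y"
  using hexp2_act[OF assms(1,2,4,3)] unfolding assms(5) .

lemma hexp3_act':
  assumes "hexp3 \<Phi> s C x y z" "cdiv e Y" "s \<in> dyn_space" "d1 + d2 + d3 = 0" "of_int d1 * x + of_int d2 * y + of_int d3 * z = u"
  shows "hexp3 (act3 Y (d1, d2, d3) \<Phi>) s (C * seval (evs Y) (cq u)) x y z"
  using hexp3_act[OF assms(1,2,4,3)] unfolding assms(5) .

lemma hexp3_add: "hexp3 \<Phi> s C x y z \<Longrightarrow> hexp3 \<Psi> s D x y z \<Longrightarrow> hexp3 (\<lambda>a b c. \<Phi> a b c + \<Psi> a b c) s (C + D) x y z"
  unfolding hexp3_def distrib_right by (intro allI hop_add[OF L]) (simp_all only: simp_thms)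

lemma hexp3_diff: "hexp3 \<Phi> s C x y z \<Longrightarrow> hexp3 \<Psi> s D x y z \<Longrightarrow> hexp3 (\<lambda>a b c. \<Phi> a b c - \<Psi> a b c) s (C - D) x y z"
  unfolding hexp3_def left_diff_distrib by (intro allI hop_diff[OF L]) (simp_all only: simp_thms)

lemma hexp3_coe: "hexp3 \<Phi> s C x y z \<Longrightarrow> hexp3 (\<lambda>a b c. coe r * \<Phi> a b c) s (ev r * C) x y z"
  unfolding hexp3_def mult.assoc[of "ev r"] by (intro allI hop_coe[OF L]) (simp_all only: simp_thms)

lemma hexp2_swap:
  assumes "hexp2 \<Phi> s C x y" shows "hexp2 (\<lambda>a b. \<Phi> b a) s C y x"
proof -
  have \<Phi>: "hop L (\<Phi> a b) s n (C * cq u)" if "n = a + b" "u = - (of_int a * x + of_int b * y)" for a b n u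
    using assms unfolding that hexp2_def by blast
  show ?thesis unfolding hexp2_def by (intro allI \<Phi>) simp_all
qed

lemma hexp3_perm:
  assumes "hexp3 \<Phi> s C x y z"
  shows "hexp3 (\<lambda>a b c. \<Phi> c a b) s C y z x" "hexp3 (\<lambda>a b c. \<Phi> a c b) s C x z y"
proof -
  have \<Phi>: "hop L (\<Phi> a b c) s n (C * cq u)"
    if "n = a + b + c" "u = - (of_int a * x + of_int b * y + of_int c * z)" for a b c n u
    using assms unfolding that hexp3_def by blast
  show "hexp3 (\<lambda>a b c. \<Phi> c a b) s C y z x" "hexp3 (\<lambda>a b c. \<Phi> a c b) s C x z y"
    unfolding hexp3_def by (intro allI \<Phi>; simp)+
qed

lemma hexp2D: "hexp2 \<Phi> s C x y \<Longrightarrow> hop L (\<Phi> a b) s (a + b) (C * cq (- (of_int a * x + of_int b * y)))"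
  unfolding hexp2_def by blast

lemma hop_zero_act: "hop L a s n 0 \<Longrightarrow> act L a v k = 0"
  unfolding hop_def[OF L] by (simp add: op_def sh_hom)

lemma hexp2_zero: "hexp2 \<Phi> s 0 x y \<Longrightarrow> act L (\<Phi> a b) v k = 0"
  by (drule hexp2D[of _ _ _ _ _ a b]) (simp add: hop_zero_act)

lemma hexp2_eq:
  assumes "hexp2 \<Phi> s C x y" "hexp2 \<Psi> s D x y"
    and "C * cq (- (of_int a * x + of_int b * y)) = D * cq (- (of_int a' * x + of_int b' * y))" "a + b = a' + b'"
  shows "act L (\<Phi> a b) v k = act L (\<Psi> a' b') v k"
proof -
  have "hop L (\<Phi> a b) s (a + b) (C * cq (- (of_int a * x + of_int b * y)))"
    "hop L (\<Psi> a' b') s (a + b) (C * cq (- (of_int a * x + of_int b * y)))"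
    using assms unfolding hexp2_def by metis+
  then show ?thesis by (rule hop_eq[OF L])
qed

subsection \<open>Exchange relations\<close>

text \<open>
  The family \<open>X j\<close> stands for \<open>e\<^sub>j\<close> with \<open>\<sigma> = 1\<close>, and for \<open>f\<^sub>j\<close> with \<open>\<sigma> = -1\<close>: the relations for \<open>f\<close>
  are those for \<open>e\<close> with \<open>q\<close> replaced by \<open>q\<^sup>-\<^sup>1\<close>.
\<close>

context
  fixes X :: "nat \<Rightarrow> int \<Rightarrow> 'n alg" and w :: "nat \<Rightarrow> complex^'n^dynvar" and C :: "nat \<Rightarrow> 'n dynfun fps"
    and x :: "nat \<Rightarrow> (dynvar, 'n) mero" and \<sigma> :: int and t :: "scal fps" and R :: "nat set"
  assumes X: "\<And>j. j \<in> R \<Longrightarrow> hexp1 (X j) (w j) (C j) (x j)"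
    and w: "\<And>j. w j \<in> dyn_space"
    and wx: "\<And>j k. j \<in> R \<Longrightarrow> k \<in> R \<Longrightarrow> mero_shift (- w j) (x k) = x k + (if j = k then 2 * of_int \<sigma> else 0)"
    and t: "is_nome t" and \<sigma>: "\<sigma> = 1 \<or> \<sigma> = - 1"
    and ex: "\<And>i. i \<in> R \<Longrightarrow> Suc i \<in> R \<Longrightarrow>
      (cq (x i) - cq (x (Suc i) - of_int \<sigma>)) * seval (evs (qfrac (t * qmon (- \<sigma>) 0) (t * qmon \<sigma> 0) t)) (cq (x (Suc i) - x i)) * (sh (- w (Suc i)) (C i) * C (Suc i)) =
      (cq (x i - of_int \<sigma>) - cq (x (Suc i))) * seval (evs (qfrac (t * qmon (- \<sigma>) 0) (t * qmon \<sigma> 0) t)) (cq (x i - x (Suc i))) * (sh (- w i) (C (Suc i)) * C i)"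
    and far: "\<And>i j. i \<in> R \<Longrightarrow> j \<in> R \<Longrightarrow> \<bar>int i - int j\<bar> > 1 \<Longrightarrow> sh (- w j) (C i) = C i"
begin

lemma exch_hexp: "i \<in> R \<Longrightarrow> j \<in> R \<Longrightarrow>
    hexp2 (ordered (X i) (X j)) (w i + w j) (sh (- w j) (C i) * C j) (x i + (if j = i then 2 * of_int \<sigma> else 0)) (x j)"
  using hexp2_mult[OF X X, of i j] by (simp add: ordered_def[abs_def] wx)

lemma exch_hexp': "i \<in> R \<Longrightarrow> j \<in> R \<Longrightarrow>
    hexp2 (swapped (X i) (X j)) (w i + w j) (sh (- w i) (C j) * C i) (x i) (x j + (if i = j then 2 * of_int \<sigma> else 0))"
  using hexp2_swap[OF hexp2_mult[OF X X, of j i]] by (simp add: swapped_def[abs_def] wx add.commute[of "w i"])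

text \<open>Both sides vanish. On the left the support has
  \<open>z\<^sub>2/z\<^sub>1 = q^(-2\<sigma>)\<close>, on the right
  \<open>z\<^sub>1/z\<^sub>2\<close> has this value, and there the numerator becomes
  \<open>(1; p)\<^sub>\<infinity> = 0\<close>.\<close>

lemma exch_same:
  assumes j: "j \<in> R"
  shows "act L (act2 (qfrac (qmon (2 * \<sigma>) 0) (t * qmon (- 2 * \<sigma>) 0) t) z21 (ordered (X j) (X j)) (a - 1) b) v k =
    act L (- act2 (qfrac (qmon (2 * \<sigma>) 0) (t * qmon (- 2 * \<sigma>) 0) t) z12 (swapped (X j) (X j)) a (b - 1)) v k"
proof -
  let ?Y = "qfrac (qmon (2 * \<sigma>) 0) (t * qmon (- 2 * \<sigma>) 0) t"
  have Y: "cdiv 1 ?Y" by (rule qfrac_cdiv(1)) (simp_all add: is_nomeD t)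
  have z: "seval (evs ?Y) (cq (- 2 * of_int \<sigma>)) = (0 :: 'n dynfun fps)"
    using seval_qfrac1[OF t, of "- 2 * \<sigma>" "- 2 * of_int \<sigma> :: (dynvar, 'n) mero" "2 * \<sigma>"] by (simp add: cq_0 qp_1 qp_X_nonzero)
  have d: "w j + w j \<in> dyn_space" by (intro dyn_add w)
  have "hexp2 (act2 ?Y z21 (ordered (X j) (X j))) (w j + w j)
      (sh (- w j) (C j) * C j * seval (evs ?Y) (cq (- 2 * of_int \<sigma>))) (x j + 2 * of_int \<sigma>) (x j)"
    unfolding z21_def by (rule hexp2_act'[OF exch_hexp[OF j j, unfolded if_P[OF refl]] Y d]) simp_all
  then have 1: "act L (act2 ?Y z21 (ordered (X j) (X j)) (a - 1) b) v k = 0" for a b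
    unfolding z mult_zero_right by (rule hexp2_zero)
  have "hexp2 (act2 ?Y z12 (swapped (X j) (X j))) (w j + w j)
      (sh (- w j) (C j) * C j * seval (evs ?Y) (cq (- 2 * of_int \<sigma>))) (x j) (x j + 2 * of_int \<sigma>)"
    unfolding z12_def by (rule hexp2_act'[OF exch_hexp'[OF j j, unfolded if_P[OF refl]] Y d]) simp_all
  then have 2: "act L (act2 ?Y z12 (swapped (X j) (X j)) a b) v k = 0" for a b
    unfolding z mult_zero_right by (rule hexp2_zero)
  show ?thesis by (simp only: 1 2 act_uminus[OF L] minus_zero)
qed

text \<open>Neighbours do not move each other's support, so both orders live at the point
  \<open>(x j, x (Suc j))\<close> and only the weights have to be compared; that comparison is the
  hypothesis \<open>ex\<close>.\<close>

lemma exch_next: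
  assumes j: "j \<in> R" "Suc j \<in> R"
  shows "act L (act2 (qfrac (qmon (- \<sigma>) 0) (t * qmon \<sigma> 0) t) z21 (ordered (X j) (X (Suc j))) (a - 1) b) v k =
    act L (- act2 (qfrac (qmon (- \<sigma>) 0) (t * qmon \<sigma> 0) t) z12 (swapped (X j) (X (Suc j))) a (b - 1)) v k"
proof -
  let ?Y = "qfrac (qmon (- \<sigma>) 0) (t * qmon \<sigma> 0) t" and ?A = "qfrac (t * qmon (- \<sigma>) 0) (t * qmon \<sigma> 0) t"
  let ?i = "Suc j"
  have Y: "cdiv 1 ?Y" by (rule qfrac_cdiv(1)) (simp_all add: is_nomeD t)
  have d: "w j + w ?i \<in> dyn_space" by (intro dyn_add w)
  define S where "S = seval (evs ?A) (cq (x ?i - x j))"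
  define T where "T = seval (evs ?A) (cq (x j - x ?i))"
  define D where "D = sh (- w ?i) (C j) * C ?i"
  define E where "E = sh (- w j) (C ?i) * C j"
  have ex': "(cq (x j) - cq (x ?i - of_int \<sigma>)) * S * D = (cq (x j - of_int \<sigma>) - cq (x ?i)) * T * E"
    using ex[OF j] by (simp only: S_def T_def D_def E_def)
  have o: "hexp2 (ordered (X j) (X ?i)) (w j + w ?i) D (x j) (x ?i)"
    using exch_hexp[OF j] by (simp add: D_def)
  have s: "hexp2 (swapped (X j) (X ?i)) (w j + w ?i) E (x j) (x ?i)"
    using exch_hexp'[OF j] by (simp add: E_def)
  have e1: "of_int (- \<sigma>) + (y - y') = y - y' - of_int \<sigma>" for y y' :: "(dynvar, 'n) mero" by simp
  have 1: "hop L (act2 ?Y z21 (ordered (X j) (X ?i)) (a - 1) b) (w j + w ?i) (a - 1 + b)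
      (D * ((1 - cq (x ?i - x j - of_int \<sigma>)) * S) * cq (- (of_int (a - 1) * x j + of_int b * x ?i)))"
  proof -
    have "hexp2 (act2 ?Y z21 (ordered (X j) (X ?i))) (w j + w ?i) (D * seval (evs ?Y) (cq (x ?i - x j))) (x j) (x ?i)"
      unfolding z21_def by (rule hexp2_act'[OF o Y d]) simp_all
    from hexp2D[OF this, of "a - 1" b] show ?thesis unfolding seval_qfrac10[OF t] e1 S_def[symmetric] .
  qed
  have 2: "hop L (act2 ?Y z12 (swapped (X j) (X ?i)) a (b - 1)) (w j + w ?i) (a + (b - 1))
      (E * ((1 - cq (x j - x ?i - of_int \<sigma>)) * T) * cq (- (of_int a * x j + of_int (b - 1) * x ?i)))"
  proof -
    have "hexp2 (act2 ?Y z12 (swapped (X j) (X ?i))) (w j + w ?i) (E * seval (evs ?Y) (cq (x j - x ?i))) (x j) (x ?i)"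
      unfolding z12_def by (rule hexp2_act'[OF s Y d]) simp_all
    from hexp2D[OF this, of a "b - 1"] show ?thesis unfolding seval_qfrac10[OF t] e1 T_def[symmetric] .
  qed
  define Q where "Q = cq (- (of_int a * x j + of_int b * x ?i))"
  \<comment> \<open>The prefactors \<open>z\<^sub>1\<close> and \<open>z\<^sub>2\<close>, that is
    the shifts \<open>a - 1\<close> and \<open>b - 1\<close>, turn into their values at the support;
    this produces the linear factors of \<open>ex\<close>.\<close>
  have q: "(1 - cq (y - y' - of_int \<sigma>)) * cq u = (cq y' - cq (y - of_int \<sigma>)) * Q"
    if "u = y' + - (of_int a * x j + of_int b * x ?i)" for y y' u
  proof -
    have u: "cq u = cq y' * Q" unfolding that cq_add Q_def by (rule refl)
    have "cq (y - of_int \<sigma>) = cq (y - y' - of_int \<sigma> + y')" by (simp add: algebra_simps)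
    then have "cq (y - of_int \<sigma>) = cq (y - y' - of_int \<sigma>) * cq y'" unfolding cq_add .
    then show ?thesis unfolding u by (simp add: left_diff_distrib mult.assoc)
  qed
  have q1: "(1 - cq (x ?i - x j - of_int \<sigma>)) * cq (- (of_int (a - 1) * x j + of_int b * x ?i)) = (cq (x j) - cq (x ?i - of_int \<sigma>)) * Q"
    by (rule q) (simp add: algebra_simps)
  have "(1 - cq (x j - x ?i - of_int \<sigma>)) * cq (- (of_int a * x j + of_int (b - 1) * x ?i)) = (cq (x ?i) - cq (x j - of_int \<sigma>)) * Q"
    by (rule q) (simp add: algebra_simps)
  then have q2: "(1 - cq (x j - x ?i - of_int \<sigma>)) * cq (- (of_int a * x j + of_int (b - 1) * x ?i)) = - ((cq (x j - of_int \<sigma>) - cq (x ?i)) * Q)"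
    by (simp only: minus_mult_left minus_diff_eq)
  have "D * ((1 - cq (x ?i - x j - of_int \<sigma>)) * S) * cq (- (of_int (a - 1) * x j + of_int b * x ?i)) =
      ((1 - cq (x ?i - x j - of_int \<sigma>)) * cq (- (of_int (a - 1) * x j + of_int b * x ?i))) * S * D" by (simp only: mult_ac)
  also have "\<dots> = ((cq (x j) - cq (x ?i - of_int \<sigma>)) * S * D) * Q" unfolding q1 by (simp only: mult_ac)
  also have "\<dots> = - (((1 - cq (x j - x ?i - of_int \<sigma>)) * cq (- (of_int a * x j + of_int (b - 1) * x ?i))) * T * E)"
    unfolding ex' q2 mult_minus_left minus_minus by (simp only: mult_ac)
  also have "\<dots> = - (E * ((1 - cq (x j - x ?i - of_int \<sigma>)) * T) * cq (- (of_int a * x j + of_int (b - 1) * x ?i)))"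
    by (simp only: mult_ac)
  finally have e: "D * ((1 - cq (x ?i - x j - of_int \<sigma>)) * S) * cq (- (of_int (a - 1) * x j + of_int b * x ?i)) =
    - (E * ((1 - cq (x j - x ?i - of_int \<sigma>)) * T) * cq (- (of_int a * x j + of_int (b - 1) * x ?i)))" .
  have "a - 1 + b = a + (b - 1)" by simp
  then show ?thesis using 1 by (intro hop_eq[OF L _ hop_uminus[OF L 2]]) (simp only: e)
qed

lemma exch_far:
  assumes j: "i \<in> R" "j \<in> R" "\<bar>int i - int j\<bar> > 1"
  shows "act L (X i a * X j b) v k = act L (X j b * X i a) v k"
proof -
  have "i \<noteq> j" using j by auto
  have "hexp2 (ordered (X i) (X j)) (w i + w j) (C i * C j) (x i) (x j)"
    using exch_hexp[OF j(1,2)] \<open>i \<noteq> j\<close> by (simp add: far[OF j(1,2,3)])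
  moreover have "hexp2 (swapped (X i) (X j)) (w i + w j) (C i * C j) (x i) (x j)"
    using exch_hexp'[OF j(1,2)] \<open>i \<noteq> j\<close> far[OF j(2,1)] j(3) by (simp add: abs_minus_commute mult.commute)
  ultimately have "act L (ordered (X i) (X j) a b) v k = act L (swapped (X i) (X j) a b) v k"
    by (rule hexp2_eq) (rule refl)+
  then show ?thesis by (simp add: ordered_def swapped_def)
qed

lemma exch_adj:
  assumes "i \<in> R" "j \<in> R" "\<bar>int i - int j\<bar> = 1"
  shows "(cq (x i) - cq (x j - of_int \<sigma>)) * seval (evs (qfrac (t * qmon (- \<sigma>) 0) (t * qmon \<sigma> 0) t)) (cq (x j - x i)) * (sh (- w j) (C i) * C j) =
      (cq (x i - of_int \<sigma>) - cq (x j)) * seval (evs (qfrac (t * qmon (- \<sigma>) 0) (t * qmon \<sigma> 0) t)) (cq (x i - x j)) * (sh (- w i) (C j) * C i)"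
proof -
  consider "j = Suc i" | "i = Suc j" using assms(3) by linarith
  then show ?thesis
  proof cases
    case 1
    show ?thesis unfolding 1 by (rule ex) (use assms 1 in simp_all)
  next
    case 2
    define S where "S = seval (evs (qfrac (t * qmon (- \<sigma>) 0) (t * qmon \<sigma> 0) t)) (cq (x i - x j))"
    define T where "T = seval (evs (qfrac (t * qmon (- \<sigma>) 0) (t * qmon \<sigma> 0) t)) (cq (x j - x i))"
    define D where "D = sh (- w i) (C j) * C i"
    define E where "E = sh (- w j) (C i) * C j"
    have "(cq (x j) - cq (x i - of_int \<sigma>)) * S * D = (cq (x j - of_int \<sigma>) - cq (x i)) * T * E"
      using ex[of j] assms(1,2) by (simp only: 2 S_def T_def D_def E_def)
    then have "(cq (x i) - cq (x j - of_int \<sigma>)) * T * E = (cq (x i - of_int \<sigma>) - cq (x j)) * S * D"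
      by (simp add: algebra_simps)
    then show ?thesis by (simp only: S_def T_def D_def E_def)
  qed
qed

lemma sh_seval_A:
  assumes "cdiv e Y" shows "sh a (seval (evs Y) (cq y)) = seval (evs Y) (cq (mero_shift a y))"
proof -
  have "sh a (seval (evs Y) (cq y)) = psum (\<lambda>n. sh a (fps_nth (evs Y) n * cq y ^ n))"
    unfolding seval_def by (rule sh_psum(2)[OF psummable_cdiv[OF cdiv_evs[OF assms]]])
  then show ?thesis by (simp add: seval_def sh_hom sh_cq evs_def sh_ev)
qed

text \<open>All three orders are supported at the same point, with \<open>x i + 2\<sigma>\<close>,
  \<open>x i\<close> and \<open>x j\<close> as exponents. So the structure functions become numbers,
  and the three weights are related by the exchange identity of \<open>i\<close> and
  \<open>j\<close> and by a translate of it. The bracket vanishes already before symmetrisation in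
  \<open>z\<^sub>1\<close> and \<open>z\<^sub>2\<close>, whatever the value of the
  prefactor.\<close>

lemma exch_serre:
  assumes ij: "i \<in> R" "j \<in> R" "\<bar>int i - int j\<bar> = 1"
  shows "act L (serre (qfrac (t * qmon (2 * \<sigma>) 0) (t * qmon (- 2 * \<sigma>) 0) t)
      (qfrac (t * qmon (- \<sigma>) 0) (t * qmon \<sigma> 0) t) (X i) (X j) a b c) v k = 0"
proof -
  let ?G = "qfrac (t * qmon (2 * \<sigma>) 0) (t * qmon (- 2 * \<sigma>) 0) t" and ?A = "qfrac (t * qmon (- \<sigma>) 0) (t * qmon \<sigma> 0) t"
  have G: "cdiv 0 ?G" and A: "cdiv 0 ?A" by (rule qfrac_cdiv(2); simp add: is_nomeD t)+
  have neq: "i \<noteq> j" using ij by auto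
  note d = dyn_add[OF dyn_add[OF w w] w]
  let ?s = "w i + w j + w i"
  define x1 where "x1 = x i + 2 * of_int \<sigma>"
  define C1 where "C1 = sh (- w i) (sh (- w i) (C j) * C i) * C i"
  define C2 where "C2 = sh (- w i) (sh (- w j) (C i) * C j) * C i"
  define C3 where "C3 = sh (- w j) (sh (- w i) (C i) * C i) * C j"
  have wx': "mero_shift (- w i) (x i) = x1" "mero_shift (- w i) (x j) = x j" "mero_shift (- w j) (x i) = x i"
    "mero_shift (- w j) x1 = x1"
    using ij neq by (simp_all add: wx x1_def rhom_add[OF rhom_mero_shift] rhom_mult[OF rhom_mero_shift]
        rhom_of_int[OF rhom_mero_shift] rhom_of_nat[OF rhom_mero_shift, of _ 2, simplified])
  note Xi = X[OF ij(1)] and Xj = X[OF ij(2)]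
  have s1: "w j + w i + w i = ?s" and s3: "w i + w i + w j = ?s" by (simp_all only: add_ac)
  have "hexp3 (\<lambda>c a b. X j c * X i a * X i b) (w j + w i + w i) C1 (x j) x1 (x i)"
    using hexp3_mult[OF hexp2_mult[OF Xj Xi] Xi] unfolding wx' C1_def .
  note 1 = hexp3_perm(1)[OF this[unfolded s1]]
  have "hexp3 (\<lambda>a c b. X i a * X j c * X i b) (w i + w j + w i) C2 x1 (x j) (x i)"
    using hexp3_mult[OF hexp2_mult[OF Xi Xj] Xi] unfolding wx' C2_def .
  note 2 = hexp3_perm(2)[OF this]
  have "hexp3 (\<lambda>a b c. X i a * X i b * X j c) (w i + w i + w j) C3 x1 (x i) (x j)"
    using hexp3_mult[OF hexp2_mult[OF Xi Xi] Xj] unfolding wx' C3_def .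
  note 3 = this[unfolded s3]
  define A1 where "A1 = seval (evs ?A) (cq (x1 - x j))"
  define A1' where "A1' = seval (evs ?A) (cq (x j - x1))"
  define A2 where "A2 = seval (evs ?A) (cq (x i - x j))"
  define A2' where "A2' = seval (evs ?A) (cq (x j - x i))"
  have a1: "hexp3 (act3 ?A (1, 0, -1) (act3 ?A (0, 1, -1) (\<lambda>a b c. X j c * X i a * X i b))) ?s (C1 * A2 * A1) x1 (x i) (x j)"
    unfolding A1_def A2_def by (intro hexp3_act'[OF hexp3_act'[OF 1 A d] A d]) (simp_all add: cq_add)
  have a2: "hexp3 (act3 ?A (-1, 0, 1) (act3 ?A (0, 1, -1) (\<lambda>a b c. X i a * X j c * X i b))) ?s (C2 * A2 * A1') x1 (x i) (x j)"
    unfolding A1'_def A2_def by (intro hexp3_act'[OF hexp3_act'[OF 2 A d] A d]) (simp_all add: cq_add)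
  have a3: "hexp3 (act3 ?A (-1, 0, 1) (act3 ?A (0, -1, 1) (\<lambda>a b c. X i a * X i b * X j c))) ?s (C3 * A2' * A1') x1 (x i) (x j)"
    unfolding A1'_def A2'_def by (intro hexp3_act'[OF hexp3_act'[OF 3 A d] A d]) (simp_all add: cq_add)
  define r where "r = (cq (of_int \<sigma>) :: 'n dynfun fps)"
  define r' where "r' = (cq (- of_int \<sigma>) :: 'n dynfun fps)"
  define z where "z = cq (x i)"
  define u where "u = cq (x j)"
  define S where "S = sh (- w j) (C i) * C j"
  define T where "T = sh (- w i) (C j) * C i"
  have rr: "r * r' = 1" by (simp add: r_def r'_def cq_minus)
  have q2: "ev (qmon 1 0 + qmon (-1) 0) = r + r'"
    using \<sigma> by (auto simp: ev_hom ev_qmon r_def r'_def)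
  have cqs: "cq (x j - of_int \<sigma>) = r' * u" "cq (x i - of_int \<sigma>) = r' * z" "cq x1 = r * r * z" "cq (x1 - of_int \<sigma>) = r * z"
    by (simp_all add: r_def r'_def z_def u_def x1_def flip: cq_add) (simp_all add: algebra_simps)
  have E0: "(z - r' * u) * A2' * S = (r' * z - u) * A2 * T"
    using exch_adj[OF ij] by (simp only: cqs A2_def A2'_def S_def T_def z_def[symmetric] u_def[symmetric])
  have shs: "sh (- w i) r' = r'" "sh (- w i) u = u" "sh (- w i) z = r * (r * z)"
    unfolding r'_def u_def z_def sh_cq wx' by (simp_all add: rhom_uminus rhom_of_int rhom_mero_shift cqs(3)[unfolded z_def] mult.assoc)
  have shA: "sh (- w i) A2' = A1'" "sh (- w i) A2 = A1"
    unfolding A2_def A2'_def A1_def A1'_def sh_seval_A[OF A] rhom_diff[OF rhom_mero_shift] wx' by (rule refl)+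
  have rz: "r' * (r * (r * z)) = r * z" using rr by (simp add: mult.assoc[symmetric] mult.commute[of r'])
  \<comment> \<open>The exchange identity \<open>E0\<close> translated past the remaining
    \<open>X i\<close>, which moves \<open>x i\<close> to \<open>x1\<close> and fixes
    \<open>x j\<close>.\<close>
  have "sh (- w i) ((z - r' * u) * A2' * S) = sh (- w i) ((r' * z - u) * A2 * T)"
    unfolding E0 by (rule refl)
  then have E1: "(r * r * z - r' * u) * A1' * sh (- w i) S = (r * z - u) * A1 * sh (- w i) T"
    unfolding sh_hom(4,5) shs shA rz mult.assoc[of r r z] .
  have SS: "sh (- w i) (sh (- w j) (C i)) = sh (- w j) (sh (- w i) (C i))"
    by (simp add: sh_sh dyn_uminus w add.commute)
  have C: "C1 = sh (- w i) T * C i" "C2 = sh (- w i) S * C i"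
    "C3 = sh (- w j) (sh (- w i) (C i)) * S" "C2 = sh (- w j) (sh (- w i) (C i)) * T"
    unfolding C1_def C2_def C3_def S_def T_def sh_hom(4) SS by (simp_all only: mult_ac)
  have "C1 * A2 * A1 - (r + r') * (C2 * A2 * A1') + C3 * A2' * A1' = 0"
  proof (rule serre_identity[OF rr])
    \<comment> \<open>Translation by \<open>- w i\<close> adds \<open>2\<sigma>\<close> to the left
      side and leaves \<open>x j\<close> fixed, so the two sides cannot be equal.\<close>
    have "x i + of_int \<sigma> \<noteq> x j"
    proof
      assume e: "x i + of_int \<sigma> = x j"
      have "x1 + of_int \<sigma> = mero_shift (- w i) (x i + of_int \<sigma>)"
        by (simp add: rhom_add[OF rhom_mero_shift] rhom_of_int[OF rhom_mero_shift] wx'(1))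
      also have "\<dots> = x j" unfolding e by (rule wx'(2))
      finally have "x j + 2 * of_int \<sigma> = x j" unfolding x1_def e[symmetric] by (simp add: add_ac)
      then show False using \<sigma> by auto
    qed
    then have "cq (of_int \<sigma> + x i) \<noteq> cq (x j)" unfolding cq_inj by (simp only: add.commute not_False_eq_True)
    then show "r * z - u \<noteq> 0" unfolding cq_add r_def z_def u_def by simp
    have "(r * r * z - r' * u) * (C2 * A2 * A1') = ((r * r * z - r' * u) * A1' * sh (- w i) S) * (C i * A2)"
      unfolding C(2) by (simp only: mult_ac)
    also have "\<dots> = (r * z - u) * (C1 * A2 * A1)" unfolding E1 C(1) by (simp only: mult_ac)
    finally show "(r * r * z - r' * u) * (C2 * A2 * A1') = (r * z - u) * (C1 * A2 * A1)" .
    have "(z - r' * u) * (C3 * A2' * A1') = ((z - r' * u) * A2' * S) * (sh (- w j) (sh (- w i) (C i)) * A1')"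
      unfolding C(3) by (simp only: mult_ac)
    also have "\<dots> = (r' * z - u) * (C2 * A2 * A1')" unfolding E0 C(4) by (simp only: mult_ac)
    finally show "(z - r' * u) * (C3 * A2' * A1') = (r' * z - u) * (C2 * A2 * A1')" .
  qed
  then have zero: "C1 * A2 * A1 - (r + r') * (C2 * A2 * A1') + C3 * A2' * A1' = 0" .
  have "hexp3 (serre ?G ?A (X i) (X j)) ?s ((C1 * A2 * A1 - ev (qmon 1 0 + qmon (-1) 0) * (C2 * A2 * A1') + C3 * A2' * A1') *
      seval (evs ?G) (cq (x i - x1))) x1 (x i) (x j)"
    unfolding serre_def
    by (rule hexp3_act'[OF hexp3_add[OF hexp3_diff[OF a1 hexp3_coe[OF a2]] a3] G d]) simp_all
  then have "hexp3 (serre ?G ?A (X i) (X j)) ?s 0 x1 (x i) (x j)"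
    unfolding q2 zero mult_zero_left .
  then have "hop L (serre ?G ?A (X i) (X j) a b c) ?s (a + b + c) (0 * cq (- (of_int a * x1 + of_int b * x i + of_int c * x j)))"
    unfolding hexp3_def by blast
  then show ?thesis unfolding mult_zero_left by (rule hop_zero_act)
qed

end

end

section \<open>Products of theta functions\<close>

subsection \<open>Evaluation\<close>

lemma ann_coeff_z_mult:
  fixes G :: "'a::comm_ring_1 fps fps"
  shows "psummable (\<lambda>i. fps_nth U i * ann_coeff G (n - int i))"
    "ann_coeff (ann_z U * G) n = psum (\<lambda>i. fps_nth U i * ann_coeff G (n - int i))"
proof -
  let ?f = "\<lambda>r. ann_coeff (ann_z U) r * ann_coeff G (n - r)"
  have z: "?f r = 0" if "r \<notin> range int" for r
  proof -
    have "\<not> r \<ge> 0" using that by (metis rangeI zero_le_imp_eq_int)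
    then show ?thesis by (simp add: ann_coeff_z)
  qed
  have e: "(\<lambda>i. ?f (int i)) = (\<lambda>i. fps_nth U i * ann_coeff G (n - int i))"
    by (simp add: ann_coeff_z)
  have i: "inj int" by (simp add: inj_def)
  show "psummable (\<lambda>i. fps_nth U i * ann_coeff G (n - int i))"
    unfolding e[symmetric] using psum_inj(1)[of int ?f, OF i z] ann_coeff_mult(1)[of "ann_z U" G n] by blast
  show "ann_coeff (ann_z U * G) n = psum (\<lambda>i. fps_nth U i * ann_coeff G (n - int i))"
    unfolding e[symmetric] ann_coeff_mult(2)[symmetric] by (rule psum_inj(2)[of int ?f, OF i z, symmetric])
qed

lemma ann_coeff_y_mult:
  fixes G :: "'a::comm_ring_1 fps fps"
  shows "ann_coeff (ann_y V * G) n = psum (\<lambda>i. fps_nth (fps_dilate fps_X V) i * ann_coeff G (n + int i))"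
proof -
  let ?f = "\<lambda>r. ann_coeff (ann_y V) r * ann_coeff G (n - r)"
  have z: "?f r = 0" if "r \<notin> range (\<lambda>i. - int i)" for r
  proof -
    have "r = - int (nat (- r))" if "r \<le> 0" using that by simp
    then have "\<not> r \<le> 0" using that by blast
    then show ?thesis by (simp add: ann_coeff_y)
  qed
  have e: "(\<lambda>i. ?f (- int i)) = (\<lambda>i. fps_nth (fps_dilate fps_X V) i * ann_coeff G (n + int i))"
    by (simp add: ann_coeff_y fps_dilate_def)
  show ?thesis
    unfolding e[symmetric] ann_coeff_mult(2)[symmetric] by (rule psum_inj(2)[of "\<lambda>i. - int i" ?f, OF _ z, symmetric]) (simp add: inj_def)
qed

text \<open>Evaluation at a unit \<open>z = c\<close>: the part in \<open>z\<close> takes its value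
  at \<open>c\<close>, the part in \<open>p/z\<close> its value at \<open>p/c\<close>, written as a
  dilation by \<open>p\<close> evaluated at \<open>1/c\<close>. Fubini is applied along
  \<open>n = i - j\<close>.\<close>

lemma ann_coeff_seval:
  fixes c :: "'a::field" and U V :: "'a fps fps"
  assumes U: "cdiv e U" and c: "c \<noteq> 0"
  shows "psum (\<lambda>n. ann_coeff (ann_z U * ann_y V) n * fps_const (c powi n)) =
    seval U (fps_const c) * seval (fps_dilate fps_X V) (fps_const (inverse c))"
proof -
  let ?u = "\<lambda>i. fps_nth U i * fps_const c ^ i" and ?v = "\<lambda>j. fps_nth (fps_dilate fps_X V) j * fps_const (inverse c) ^ j"
  let ?f = "\<lambda>(i, j). ?u i * ?v j"
  let ?h = "\<lambda>(i, j). (int i - int j, i :: nat)"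
  let ?g = "\<lambda>(n, i). if n \<le> int i then ?f (i, nat (int i - n)) else 0"
  have su: "psummable ?u" by (rule psummable_cdiv[OF U])
  have sv: "psummable ?v" by (rule psummable_cdiv[OF cdiv_dil]) simp
  have sf: "psummable ?f"
  proof (rule psummableI_finite[where S = "\<lambda>k. {..k + e} \<times> {..k}"])
    fix k and r :: "nat \<times> nat" assume r: "r \<notin> {..k + e} \<times> {..k}"
    obtain i j where ij: "r = (i, j)" by (cases r)
    have zero: "fps_nth (?u i) l * fps_nth (?v j) (k - l) = 0" if "l \<le> k" for l
    proof (cases "i \<le> k + e")
      case False
      then have "fps_nth (fps_nth U i) m = 0" if "m \<le> k" for m using U that by (simp add: cdiv_def)
      then have "fps_nth (?u i) l = 0" using \<open>l \<le> k\<close> by (simp add: fps_mult_nth)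
      then show ?thesis by simp
    next
      case True
      then have "j > k" using r ij by auto
      then have "fps_nth (fps_nth (fps_dilate fps_X V) j) m = 0" if "m \<le> k" for m
        using that by (simp add: fps_dilate_def fps_X_power_mult_nth)
      then have "fps_nth (?v j) (k - l) = 0" by (simp add: fps_mult_nth)
      then show ?thesis by simp
    qed
    show "fps_nth (?f r) k = 0"
      unfolding ij prod.case fps_mult_nth[of "?u i" "?v j"] by (intro sum.neutral ballI zero) simp
  qed simp
  have inj: "inj ?h" by (auto simp: inj_def)
  have gh: "(\<lambda>r. ?g (?h r)) = ?f" by (auto simp: fun_eq_iff)
  have g0: "?g s = 0" if s: "s \<notin> range ?h" for s
  proof (cases s)
    case (Pair n i)
    have "\<not> n \<le> int i"
    proof
      assume "n \<le> int i"
      then have "s = ?h (i, nat (int i - n))" by (simp add: Pair)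
      then show False using s by blast
    qed
    then show ?thesis by (simp add: Pair)
  qed
  have sg: "psummable ?g" using psum_inj(1)[of ?h ?g, OF inj g0] sf unfolding gh by blast
  have "psum ?g = psum ?f" using psum_inj(2)[of ?h ?g, OF inj g0] unfolding gh by simp
  moreover have "psum ?g = psum (\<lambda>n. psum (\<lambda>i. ?g (n, i)))" by (rule psum_Sigma(3)[OF sg, symmetric])
  moreover have "psum (\<lambda>i. ?g (n, i)) = ann_coeff (ann_z U * ann_y V) n * fps_const (c powi n)" for n
  proof -
    have "?g (n, i) = fps_nth U i * ann_coeff (ann_y V) (n - int i) * fps_const (c powi n)" for i
    proof (cases "n \<le> int i")
      case True
      define j where "j = nat (int i - n)"
      have n: "n = int i - int j" using True by (simp add: j_def)
      have "c powi n = c ^ i * inverse c ^ j"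
        using c by (simp add: n power_int_diff power_int_of_nat field_simps power_inverse)
      then have "fps_const (c powi n) = fps_const c ^ i * fps_const (inverse c) ^ j"
        by (simp only: fps_const_power fps_const_mult)
      then show ?thesis using True by (simp add: ann_coeff_y n fps_dilate_def mult_ac)
    qed (simp add: ann_coeff_y)
    then show ?thesis
      unfolding ann_coeff_z_mult(2) using psum_mult_right[OF ann_coeff_z_mult(1)[of U "ann_y V" n]] by simp
  qed
  moreover have "psum ?f = psum (\<lambda>i. psum (\<lambda>j. ?f (i, j)))" by (rule psum_Sigma(3)[OF sf, symmetric])
  moreover have "\<dots> = seval U (fps_const c) * seval (fps_dilate fps_X V) (fps_const (inverse c))"
    unfolding seval_def prod.case using psum_mult_left(2)[OF sv] psum_mult_right(2)[OF su] by simp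
  ultimately show ?thesis by (simp only:)
qed

text \<open>\<open>V\<close> and \<open>V'\<close> have the same differences \<open>x\<close>;
  modulo each power of \<open>p\<close> one vanishes far to the left and the other far to the right.
  So their constant difference is the total sum. Applied to two expansions of one function, it
  yields a residue.\<close>

lemma psum_telescope:
  fixes V V' x :: "int \<Rightarrow> 'a::ring_1 fps"
  assumes x: "\<And>n. V n - V (n - 1) = x n" "\<And>n. V' n - V' (n - 1) = x n"
    and lo: "\<And>n k. n < - int k \<Longrightarrow> fps_nth (V n) k = 0" and hi: "\<And>n k. n > int k + 1 \<Longrightarrow> fps_nth (V' n) k = 0"
  shows "psum x = V m - V' m"
proof -
  have inv: "V n - V' n = V m - V' m" for n m
  proof -
    have step: "V n - V' n = V (n - 1) - V' (n - 1)" for n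
      using x(1)[of n, folded x(2)[of n]] by (simp add: algebra_simps)
    have "V (m + int i) - V' (m + int i) = V m - V' m" for m i
    proof (induction i)
      case (Suc i)
      then show ?case using step[of "m + int (Suc i)"] by simp
    qed simp
    from this[of "min n m" "nat (n - min n m)"] this[of "min n m" "nat (m - min n m)"] show ?thesis by simp
  qed
  have tele: "sum x {a<..a + int i} = V (a + int i) - V a" for a i
  proof (induction i)
    case (Suc i)
    have "{a<..a + int (Suc i)} = insert (a + int (Suc i)) {a<..a + int i}" by auto
    then show ?case using Suc x(1)[of "a + int (Suc i)"] by (simp add: diff_eq_eq)
  qed simp
  show ?thesis
  proof (rule fps_ext)
    fix k
    \<comment> \<open>At order \<open>p^k\<close>, \<open>V\<close> vanishes at \<open>?a\<close>
      and \<open>V'\<close> at \<open>?b\<close>, and no member outside this window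
      contributes.\<close>
    let ?a = "- int k - 1" and ?b = "int k + 2"
    have ab: "?b = ?a + int (2 * k + 3)" by simp
    have "fps_nth (psum x) k = (\<Sum>n\<in>{?a<..?b}. fps_nth (x n) k)"
    proof (rule psum_nth)
      fix n assume "n \<notin> {?a<..?b}"
      then consider "n < - int k" | "n - 1 > int k + 1" by force
      then show "fps_nth (x n) k = 0"
      proof cases
        case 1
        then show ?thesis by (simp add: lo flip: x(1))
      next
        case 2
        then show ?thesis by (simp add: hi flip: x(2))
      qed
    qed simp
    also have "\<dots> = fps_nth (V ?b - V ?a) k"
      unfolding fps_sum_nth[symmetric] ab tele by (rule refl)
    also have "\<dots> = fps_nth (V ?b - V' ?b) k" by (simp add: lo hi)
    also have "\<dots> = fps_nth (V m - V' m) k" by (simp only: inv[of ?b m])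
    finally show "fps_nth (psum x) k = fps_nth (V m - V' m) k" .
  qed
qed

subsection \<open>Theta functions\<close>

definition lin :: "'a::comm_ring_1 \<Rightarrow> 'a fps fps"
  where "lin a = 1 - fps_const (fps_const a) * fps_X"

definition pz :: "'a::comm_ring_1 \<Rightarrow> 'a fps fps"
  where "pz a = poch (fps_const a) fps_X"

text \<open>The product \<open>pz a\<close> without its first factor, that is
  \<open>(a p z; p)\<^sub>\<infinity>\<close>.\<close>

definition pz1 :: "'a::comm_ring_1 \<Rightarrow> 'a fps fps"
  where "pz1 a = fps_dilate fps_X (pz a)"

text \<open>\<open>(a z; p)\<^sub>\<infinity> (p / (a z); p)\<^sub>\<infinity>\<close> as a function of \<open>z\<close>, and its value at \<open>z = 1\<close>\<close>

definition thz :: "'a::field \<Rightarrow> 'a fps fps"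
  where "thz a = ann_z (pz a) * ann_y (pz (inverse a))"

definition theta :: "'a::field \<Rightarrow> 'a fps"
  where "theta a = qp (fps_const a) * qp (fps_X * fps_const (inverse a))"

lemma pz_rec: "pz a = lin a * pz1 a"
proof -
  have "fps_dilate fps_X (poch (fps_const a) fps_X) = poch (fps_const a * fps_X) fps_X" by (rule dil_poch) simp
  then show ?thesis using poch_rec[of fps_X "fps_const a"] unfolding pz_def pz1_def lin_def by simp
qed

lemma ann_nth_0:
  "fps_nth (fps_nth (ann_z U) 0) 0 = fps_nth (fps_nth U 0) 0"
  "fps_nth (fps_nth (ann_y U) 0) 0 = fps_nth (fps_nth U 0) 0"
  by (simp_all add: ann_z_def ann_y_def ann_swap_def)

lemma pz_nth_0: "fps_nth (pz a) 0 = 1" "fps_nth (pz1 a) 0 = 1"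
  by (simp_all add: pz_def pz1_def poch_nth_0 fps_dilate_def)

lemma ann_z_lin: "ann_z (lin a) = lin a"
proof (rule fps_ext, rule fps_ext)
  fix m n
  show "fps_nth (fps_nth (ann_z (lin a)) m) n = fps_nth (fps_nth (lin a) m) n"
    by (cases n; cases "m - n") (auto simp: ann_z_def lin_def fps_X_def)
qed

lemma ann_coeff_lin: "ann_coeff (lin a * G) n = ann_coeff G n - fps_const a * ann_coeff G (n - 1)"
proof -
  have "lin a * G = G - fps_const (fps_const a) * (fps_X * G)"
    by (simp add: lin_def left_diff_distrib mult.assoc)
  then show ?thesis by (simp add: ann_coeff_diff ann_coeff_const ann_coeff_X)
qed

lemma ann_coeff_lin2:
  "ann_coeff (lin a * (lin b * G)) n =
    ann_coeff G n - (fps_const a + fps_const b) * ann_coeff G (n - 1) + fps_const a * fps_const b * ann_coeff G (n - 2)"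
proof -
  have "x - B * y - A * (y - B * z) = x - (A + B) * y + A * B * z" for x y z A B :: "'a fps"
    by (simp add: algebra_simps)
  moreover have "n - 1 - 1 = n - 2" by simp
  ultimately show ?thesis unfolding ann_coeff_lin by (simp only:)
qed

lemma dil_const: "fps_dilate c (fps_const a) = fps_const a"
  by (auto simp: fps_dilate_def fps_eq_iff)

lemma seval_const: "seval (fps_const a) t = a"
proof -
  have "seval (fps_const a) t = (\<Sum>n\<in>{0}. fps_nth (fps_const a) n * t ^ n)"
    unfolding seval_def by (rule psum_sum) auto
  then show ?thesis by simp
qed

lemma cdiv_lin': "cdiv 1 (lin a)" unfolding lin_def by (rule cdiv_lin)

lemma seval_pz1: "seval (pz1 a) (fps_const c) = qp (fps_X * fps_const (a * c))"
proof -
  have "pz1 a = poch (fps_const a * fps_X) fps_X" by (simp add: pz1_def pz_def dil_poch)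
  then show ?thesis by (simp add: seval_poch mult_ac flip: fps_const_mult)
qed

lemma theta_rec: "theta a = (1 - fps_const a) * (qp (fps_X * fps_const a) * qp (fps_X * fps_const (inverse a)))"
  unfolding theta_def by (subst qp_rec) (simp add: mult_ac)

text \<open>A quadratic recursion read in the opposite direction has its roots inverted; used to
  compare the two expansions, whose exponents run in opposite directions.\<close>

lemma quadratic_reciprocal:
  fixes p q P Q x y z :: "'a::comm_ring_1"
  assumes "p * P = 1" "q * Q = 1"
  shows "p * q * (x - (P + Q) * y + P * Q * z) = z - (p + q) * y + p * q * x"
proof -
  have "p * q * (x - (P + Q) * y + P * Q * z) = p * P * (q * Q) * z - (q * (p * P) + p * (q * Q)) * y + p * q * x"
    by (simp add: algebra_simps)
  then show ?thesis unfolding assms by (simp add: add.commute)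
qed

text \<open>
  The function \<open>\<psi>(z) = \<omega> \<theta>(az) \<theta>(bz) / (\<theta>(z/c) \<theta>(z/d))\<close> satisfies \<open>\<psi>(z) = abcd \<psi>(pz)\<close>; so the two sides of the
  difference are expansions of \<open>\<psi>\<close> on both sides of its poles \<open>c\<close> and \<open>d\<close>, and it is a sum of two
  residues. These are obtained by applying \<open>1 - z/c\<close> and \<open>1 - z/d\<close>, one after the other, to the difference.
\<close>

lemma theta_quotient_difference:
  fixes a b c d \<omega> :: "'a::field"
  assumes nz: "a \<noteq> 0" "b \<noteq> 0" "c \<noteq> 0" "d \<noteq> 0"
    and \<Psi>: "\<Psi> * (thz (inverse c) * thz (inverse d)) = fps_const (fps_const \<omega>) * (thz a * thz b)"
  defines "\<Delta> n \<equiv> fps_const (a * b * c * d) * ann_coeff (ann_swap \<Psi>) (- n) - ann_coeff \<Psi> n"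
    and "\<kappa> \<equiv> qp fps_X ^ 2 * (qp (fps_X * fps_const (c / d)) * qp (fps_X * fps_const (d / c)))"
  shows "\<kappa> * ((fps_const d - fps_const c) * \<Delta> n) =
    fps_const \<omega> * (fps_const (c * d powi (- n)) * (theta (a * d) * theta (b * d)) -
      fps_const (d * c powi (- n)) * (theta (a * c) * theta (b * c)))"
proof -
  \<comment> \<open>\<open>U\<close> in \<open>z\<close> and \<open>V\<close> in \<open>p/z\<close>
    are the two halves of \<open>\<Psi>\<close>. Replacing the variable by its multiple by
    \<open>p\<close> gives \<open>U1\<close> and \<open>V1\<close>, which are \<open>cdiv 0\<close>
    and can be evaluated at units.\<close>
  define U where "U = fps_quot (fps_const (fps_const \<omega>) * (pz a * pz b)) (pz (inverse c) * pz (inverse d))"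
  define V where "V = fps_quot (pz (inverse a) * pz (inverse b)) (pz c * pz d)"
  define U1 where "U1 = fps_dilate fps_X U"
  define V1 where "V1 = fps_dilate fps_X V"
  have U: "pz (inverse c) * pz (inverse d) * U = fps_const (fps_const \<omega>) * (pz a * pz b)"
    unfolding U_def by (rule fps_quot_mult) (simp add: pz_nth_0)
  have V: "pz c * pz d * V = pz (inverse a) * pz (inverse b)"
    unfolding V_def by (rule fps_quot_mult) (simp add: pz_nth_0)
  have U1: "pz1 (inverse c) * pz1 (inverse d) * U1 = fps_const (fps_const \<omega>) * (pz1 a * pz1 b)"
    using arg_cong[OF U, of "fps_dilate fps_X"] by (simp add: dil_mult pz1_def U1_def dil_const)
  have V1: "pz1 c * pz1 d * V1 = pz1 (inverse a) * pz1 (inverse b)"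
    using arg_cong[OF V, of "fps_dilate fps_X"] by (simp add: dil_mult pz1_def V1_def)
  have az: "ann_z (fps_const (fps_const \<omega>)) = fps_const (fps_const \<omega>)" "ann_y (fps_const (fps_const \<omega>)) = fps_const (fps_const \<omega>)"
    "ann_swap (fps_const (fps_const \<omega>)) = fps_const (fps_const \<omega>)"
    by (auto simp: fps_eq_iff ann_z_def ann_y_def ann_swap_def)
  \<comment> \<open>The linear factors cancel the poles at \<open>c\<close> and \<open>d\<close>.
    What remains is the same series for both expansions, as \<open>\<xi>u\<close> and
    \<open>\<xi>w\<close> show.\<close>
  have 1: "lin (inverse c) * (lin (inverse d) * \<Psi>) = ann_z (lin a * (lin b * U1)) * ann_y V"
  proof -
    let ?D = "ann_z (pz1 (inverse c) * pz1 (inverse d)) * ann_y (pz c * pz d)"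
    have "lin (inverse c) * (lin (inverse d) * \<Psi>) * ?D = \<Psi> * (thz (inverse c) * thz (inverse d))"
      using nz by (simp add: thz_def pz_rec[of "inverse c"] pz_rec[of "inverse d"] ann_z_mult ann_y_mult ann_z_lin mult_ac)
    also have "\<dots> = ann_z (lin a * (lin b * (fps_const (fps_const \<omega>) * (pz1 a * pz1 b)))) * ann_y (pz (inverse a) * pz (inverse b))"
      unfolding \<Psi> by (simp add: thz_def pz_rec[of a] pz_rec[of b] ann_z_mult ann_y_mult ann_z_lin az mult_ac)
    also have "\<dots> = ann_z (lin a * (lin b * U1)) * ann_y V * ?D"
      unfolding U1[symmetric] V[symmetric] by (simp add: ann_z_mult ann_y_mult mult_ac)
    finally have e: "lin (inverse c) * (lin (inverse d) * \<Psi>) * ?D = ann_z (lin a * (lin b * U1)) * ann_y V * ?D" .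
    have "fps_nth (fps_nth ?D 0) 0 \<noteq> 0" by (simp add: ann_nth_0 pz_nth_0)
    then have nD: "?D \<noteq> 0" by auto
    from e show ?thesis unfolding mult_right_cancel[OF nD] .
  qed
  have 2: "lin c * (lin d * ann_swap \<Psi>) = lin (inverse a) * (lin (inverse b) * (ann_y U * ann_z V1))"
  proof -
    let ?D = "ann_y (pz (inverse c) * pz (inverse d)) * ann_z (pz1 c * pz1 d)"
    have "lin c * (lin d * ann_swap \<Psi>) * ?D = ann_swap (\<Psi> * (thz (inverse c) * thz (inverse d)))"
      using nz by (simp add: thz_def ann_swap_mult ann_swap_z ann_swap_y pz_rec[of c] pz_rec[of d] ann_z_mult ann_y_mult ann_z_lin mult_ac)
    also have "\<dots> = ann_y (fps_const (fps_const \<omega>) * (pz a * pz b)) * ann_z (lin (inverse a) * (lin (inverse b) * (pz1 (inverse a) * pz1 (inverse b))))"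
      unfolding \<Psi> by (simp add: thz_def ann_swap_mult ann_swap_z ann_swap_y pz_rec[of "inverse a"] pz_rec[of "inverse b"] ann_z_mult ann_y_mult ann_z_lin az mult_ac)
    also have "\<dots> = lin (inverse a) * (lin (inverse b) * (ann_y U * ann_z V1)) * ?D"
      unfolding U[symmetric] V1[symmetric] by (simp add: ann_z_mult ann_y_mult ann_z_lin mult_ac)
    finally have e: "lin c * (lin d * ann_swap \<Psi>) * ?D = lin (inverse a) * (lin (inverse b) * (ann_y U * ann_z V1)) * ?D" .
    have "fps_nth (fps_nth ?D 0) 0 \<noteq> 0" by (simp add: ann_nth_0 pz_nth_0)
    then have nD: "?D \<noteq> 0" by auto
    from e show ?thesis unfolding mult_right_cancel[OF nD] .
  qed
  define u where "u n = ann_coeff \<Psi> n" for n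
  define w where "w n = fps_const (a * b * c * d) * ann_coeff (ann_swap \<Psi>) (- n)" for n
  define E where "E n = ann_coeff (ann_z U1 * ann_y V) n" for n
  define \<xi> where "\<xi> n = ann_coeff (ann_z (lin a * (lin b * U1)) * ann_y V) n" for n
  define ka kb kc kd where k_def: "ka = fps_const a" "kb = fps_const b" "kc = fps_const c" "kd = fps_const d"
  define kA kB kC kD where K_def: "kA = fps_const (inverse a)" "kB = fps_const (inverse b)" "kC = fps_const (inverse c)" "kD = fps_const (inverse d)"
  have kK: "ka * kA = 1" "kb * kB = 1" "kc * kC = 1" "kd * kD = 1"
    using nz by (simp_all add: k_def K_def)
  have \<xi>E: "\<xi> n = E n - (ka + kb) * E (n - 1) + ka * kb * E (n - 2)" for n
    unfolding \<xi>_def E_def ann_z_mult ann_z_lin mult.assoc ann_coeff_lin2 k_def by (rule refl)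
  have \<xi>u: "\<xi> n = u n - (kC + kD) * u (n - 1) + kC * kD * u (n - 2)" for n
    unfolding \<xi>_def 1[symmetric] u_def ann_coeff_lin2 K_def by (rule refl)
  \<comment> \<open>Seen from the other region: \<open>z \<mapsto> p/z\<close> turns 2 into a
    recursion with inverted roots, and the multiplier \<open>a b c d\<close> normalises it to the
    recursion of \<open>\<xi>u\<close>.\<close>
  have \<xi>w: "\<xi> n = w n - (kC + kD) * w (n - 1) + kC * kD * w (n - 2)" for n
  proof -
    define F where "F m = ann_coeff (ann_swap \<Psi>) m" for m
    have E': "ann_coeff (ann_y U * ann_z V1) m = E (- m)" for m
      unfolding E_def U1_def V1_def using ann_coeff_dil[of U V "- m"] by simp
    have "ann_coeff (lin c * (lin d * ann_swap \<Psi>)) (2 - n) = ann_coeff (lin (inverse a) * (lin (inverse b) * (ann_y U * ann_z V1))) (2 - n)"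
      by (simp only: 2)
    then have F: "F (2 - n) - (kc + kd) * F (1 - n) + kc * kd * F (- n) = E (n - 2) - (kA + kB) * E (n - 1) + kA * kB * E n"
      unfolding ann_coeff_lin2 E' F_def k_def K_def by (simp add: algebra_simps)
    have w: "w n = ka * kb * kc * kd * F (- n)" "w (n - 1) = ka * kb * kc * kd * F (1 - n)" "w (n - 2) = ka * kb * kc * kd * F (2 - n)"
      by (simp_all add: w_def F_def k_def)
    have "\<xi> n = ka * kb * (E (n - 2) - (kA + kB) * E (n - 1) + kA * kB * E n)"
      unfolding \<xi>E by (rule quadratic_reciprocal[OF kK(1,2), symmetric])
    also have "\<dots> = ka * kb * (kc * kd * (F (- n) - (kC + kD) * F (1 - n) + kC * kD * F (2 - n)))"
      unfolding F[symmetric] quadratic_reciprocal[OF kK(3,4)] by (rule refl)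
    also have "\<dots> = w n - (kC + kD) * w (n - 1) + kC * kD * w (n - 2)"
      unfolding w by (simp add: algebra_simps)
    finally show ?thesis .
  qed
  have small: "fps_nth (u n) k = 0" if "n + int k < 0" for n k using that by (simp add: u_def ann_coeff_def)
  have small': "fps_nth (w n) k = 0" if "n > int k" for n k using that by (simp add: w_def ann_coeff_def)
  \<comment> \<open>Applying \<open>1 - z/y\<close> to the difference leaves a multiple of the delta
    function at \<open>x\<close>. Its coefficient, found by telescoping, is up to sign the value at
    \<open>x\<close> of the series with both poles cleared.\<close>
  have res: "\<Delta> m - fps_const (inverse y) * \<Delta> (m - 1) = - (fps_const (x powi (- m)) * psum (\<lambda>n. \<xi> n * fps_const (x powi n)))"
    if xy: "x = c \<and> y = d \<or> x = d \<and> y = c" for x y m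
  proof -
    have x: "x \<noteq> 0" using xy nz by auto
    define W where "W v n = (v n - fps_const (inverse y) * v (n - 1)) * fps_const (x powi n)" for v n
    have W: "W v n - W v (n - 1) = \<xi> n * fps_const (x powi n)"
      if "\<xi> n = v n - (kC + kD) * v (n - 1) + kC * kD * v (n - 2)" for v n
    proof -
      have "x powi (n - 1) = inverse x * x powi n" using x by (simp add: power_int_diff divide_inverse mult.commute)
      then have e: "fps_const (x powi (n - 1)) = fps_const (inverse x) * fps_const (x powi n)" by simp
      have CD: "kC + kD = fps_const (inverse x) + fps_const (inverse y)" "kC * kD = fps_const (inverse x) * fps_const (inverse y)"
        using xy unfolding K_def by (auto simp only: add.commute mult.commute)
      have n: "n - 1 - 1 = n - 2" by simp
      have "(p - Y * p') * Z - (p' - Y * p'') * (X * Z) = (p - (X + Y) * p' + X * Y * p'') * Z" for p p' p'' X Y Z :: "'a fps"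
        by (simp add: algebra_simps)
      then show ?thesis unfolding W_def e that CD n .
    qed
    have "psum (\<lambda>n. \<xi> n * fps_const (x powi n)) = W u m - W w m"
    proof (rule psum_telescope)
      show "W u n - W u (n - 1) = \<xi> n * fps_const (x powi n)" "W w n - W w (n - 1) = \<xi> n * fps_const (x powi n)" for n
        by (rule W[OF \<xi>u], rule W[OF \<xi>w])
      show "fps_nth (W u n) k = 0" if "n < - int k" for n k
        using that by (simp add: W_def small)
      show "fps_nth (W w n) k = 0" if "n > int k + 1" for n k
        using that by (simp add: W_def small')
    qed
    also have "\<dots> = - ((\<Delta> m - fps_const (inverse y) * \<Delta> (m - 1)) * fps_const (x powi m))"
    proof -
      have D: "\<Delta> m = w m - u m" for m by (simp add: \<Delta>_def w_def u_def)
      show ?thesis unfolding W_def D by (simp add: algebra_simps)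
    qed
    finally have "fps_const (x powi (- m)) * psum (\<lambda>n. \<xi> n * fps_const (x powi n)) =
        - ((\<Delta> m - fps_const (inverse y) * \<Delta> (m - 1)) * (fps_const (x powi m) * fps_const (x powi (- m))))"
      by (simp only: mult_minus_right mult_ac)
    moreover have "fps_const (x powi m) * fps_const (x powi (- m)) = 1"
      using x by (simp add: power_int_minus)
    ultimately show ?thesis by (simp only: mult_1_right minus_minus)
  qed
  \<comment> \<open>At \<open>c\<close> and at \<open>d\<close> alike, the denominator without its
    vanishing linear factors takes the value \<open>\<kappa>\<close>.\<close>
  have ev: "\<kappa> * psum (\<lambda>n. \<xi> n * fps_const (x powi n)) = fps_const \<omega> * (theta (a * x) * theta (b * x))"
    if xy: "x = c \<and> y = d \<or> x = d \<and> y = c" for x y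
  proof -
    have x: "x \<noteq> 0" using xy nz by auto
    have c1: "cdiv 0 U1" "cdiv 0 V1" by (simp_all add: U1_def V1_def cdiv_dil)
    have cp: "cdiv 0 (pz1 e)" for e by (simp add: pz1_def cdiv_dil)
    have cpp: "cdiv 0 (pz1 e * pz1 f)" for e f using cdiv_mult[OF cp cp, of e f] by simp
    have cc: "cdiv 0 (fps_const (fps_const \<omega>))" by (simp add: cdiv_def)
    define S where "S = seval U1 (fps_const x)"
    define T where "T = seval V1 (fps_const (inverse x))"
    have S: "qp (fps_X * fps_const (inverse c * x)) * qp (fps_X * fps_const (inverse d * x)) * S =
        fps_const \<omega> * (qp (fps_X * fps_const (a * x)) * qp (fps_X * fps_const (b * x)))"
      using arg_cong[OF U1, of "\<lambda>F. seval F (fps_const x)"]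
      by (simp add: seval_mult[OF cpp c1(1)] seval_mult[OF cc cpp] seval_mult[OF cp cp] seval_pz1 S_def seval_const)
    have T: "qp (fps_X * fps_const (c * inverse x)) * qp (fps_X * fps_const (d * inverse x)) * T =
        qp (fps_X * fps_const (inverse a * inverse x)) * qp (fps_X * fps_const (inverse b * inverse x))"
      using arg_cong[OF V1, of "\<lambda>F. seval F (fps_const (inverse x))"]
      by (simp only: seval_mult[OF cpp c1(2)] seval_mult[OF cp cp] seval_pz1 T_def)
    have k: "\<kappa> = qp (fps_X * fps_const (inverse c * x)) * qp (fps_X * fps_const (inverse d * x)) *
        (qp (fps_X * fps_const (c * inverse x)) * qp (fps_X * fps_const (d * inverse x)))"
      using xy nz by (auto simp: \<kappa>_def power2_eq_square divide_inverse mult_ac)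
    have l: "seval (lin e) (fps_const x) = 1 - fps_const (e * x)" for e
      by (simp add: lin_def seval_lin)
    have "psum (\<lambda>n. \<xi> n * fps_const (x powi n)) = seval (lin a * (lin b * U1)) (fps_const x) * T"
      unfolding \<xi>_def T_def V1_def
      by (rule ann_coeff_seval[OF cdiv_mult[OF cdiv_lin' cdiv_mult[OF cdiv_lin' c1(1)]] x])
    also have "\<dots> = (1 - fps_const (a * x)) * (1 - fps_const (b * x)) * S * T"
      by (simp only: seval_mult[OF cdiv_lin' cdiv_mult[OF cdiv_lin' c1(1)]] seval_mult[OF cdiv_lin' c1(1)] l S_def mult.assoc)
    finally have "\<kappa> * psum (\<lambda>n. \<xi> n * fps_const (x powi n)) = (1 - fps_const (a * x)) * (1 - fps_const (b * x)) *
        ((qp (fps_X * fps_const (inverse c * x)) * qp (fps_X * fps_const (inverse d * x)) * S) *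
         (qp (fps_X * fps_const (c * inverse x)) * qp (fps_X * fps_const (d * inverse x)) * T))"
      unfolding k by (simp only: mult_ac)
    also have "\<dots> = fps_const \<omega> * (theta (a * x) * theta (b * x))"
      unfolding S T theta_rec inverse_mult_distrib by (simp only: mult_ac)
    finally show ?thesis .
  qed
  define A where "A = psum (\<lambda>n. \<xi> n * fps_const (c powi n))"
  define B where "B = psum (\<lambda>n. \<xi> n * fps_const (d powi n))"
  have A: "\<Delta> n - fps_const (inverse d) * \<Delta> (n - 1) = - (fps_const (c powi (- n)) * A)" unfolding A_def by (rule res) simp
  have B: "\<Delta> n - fps_const (inverse c) * \<Delta> (n - 1) = - (fps_const (d powi (- n)) * B)" unfolding B_def by (rule res) simp
  \<comment> \<open>Eliminates \<open>\<Delta> (n - 1)\<close> from the two first-order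
    equations.\<close>
  have "(fps_const d - fps_const c) * \<Delta> n = fps_const d * (\<Delta> n - fps_const (inverse d) * \<Delta> (n - 1)) -
      fps_const c * (\<Delta> n - fps_const (inverse c) * \<Delta> (n - 1))"
  proof -
    have "(D - C) * p = D * (p - D' * p') - C * (p - C' * p')" if "D * D' = 1" "C * C' = 1" for p p' D C D' C' :: "'a fps"
    proof -
      have "D * (p - D' * p') - C * (p - C' * p') = (D - C) * p - (D * D') * p' + (C * C') * p'"
        by (simp add: algebra_simps)
      then show ?thesis unfolding that by simp
    qed
    from this[OF kK(4,3)] show ?thesis unfolding k_def K_def .
  qed
  also have "\<dots> = fps_const (c * d powi (- n)) * B - fps_const (d * c powi (- n)) * A"
    unfolding A B by (simp add: mult.assoc[symmetric])
  finally have e: "\<kappa> * ((fps_const d - fps_const c) * \<Delta> n) = fps_const (c * d powi (- n)) * (\<kappa> * B) - fps_const (d * c powi (- n)) * (\<kappa> * A)"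
    by (simp only: right_diff_distrib mult_ac)
  have kA: "\<kappa> * A = fps_const \<omega> * (theta (a * c) * theta (b * c))" unfolding A_def by (rule ev[of c d]) simp
  have kB: "\<kappa> * B = fps_const \<omega> * (theta (a * d) * theta (b * d))" unfolding B_def by (rule ev[of d c]) simp
  have "\<kappa> * ((fps_const d - fps_const c) * \<Delta> n) = fps_const (c * d powi (- n)) * (fps_const \<omega> * (theta (a * d) * theta (b * d))) -
      fps_const (d * c powi (- n)) * (fps_const \<omega> * (theta (a * c) * theta (b * c)))" unfolding e kA kB by (rule refl)
  then show ?thesis by (simp only: right_diff_distrib mult_ac)
qed

section \<open>A representation\<close>

subsection \<open>Weights and shifts\<close>

lemma idx_bij: "bij_betw (idx :: nat \<Rightarrow> 'n::finite) {1..CARD('n)} UNIV"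
proof -
  obtain h :: "nat \<Rightarrow> 'n" where "bij_betw h {1..CARD('n)} UNIV"
    using ex_bij_betw_nat_finite_1[OF finite, of "UNIV :: 'n set"] by blast
  then show ?thesis unfolding idx_def by (rule someI[of "\<lambda>f. bij_betw f {1..CARD('n)} UNIV"])
qed

lemma idx_eq: "k \<in> {1..CARD('n)} \<Longrightarrow> l \<in> {1..CARD('n)} \<Longrightarrow> (idx k = (idx l :: 'n::finite)) = (k = l)"
proof -
  have "inj_on (idx :: nat \<Rightarrow> 'n) {1..CARD('n)}" using idx_bij by (rule bij_betw_imp_inj_on)
  then show "k \<in> {1..CARD('n)} \<Longrightarrow> l \<in> {1..CARD('n)} \<Longrightarrow> (idx k = (idx l :: 'n::finite)) = (k = l)"
    by (rule inj_on_eq_iff)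
qed

lemma bil_eps_alpha:
  assumes "k \<in> {1..CARD('n)}" "i \<in> {1..<CARD('n)}"
  shows "bil (eps k :: complex^'n::finite) (alpha i) = (if k = i then 1 else 0) - (if k = Suc i then 1 else 0)"
proof -
  have "bil (eps k :: complex^'n) (eps l) = (if k = l then 1 else 0) - 1 / of_nat CARD('n)" if "l \<in> {1..CARD('n)}" for l
  proof -
    have "bil (eps k :: complex^'n) (eps l) = (eps k :: complex^'n) $ idx l"
      using bil_eps_bar[OF eps_zsum, of k "idx l :: 'n"] by (simp only: eps_def[of l])
    also have "\<dots> = (if idx l = (idx k :: 'n) then 1 else 0) - 1 / of_nat CARD('n)"
      by (simp add: eps_def eps_bar_def axis_def)
    finally show ?thesis unfolding idx_eq[OF that assms(1)] by (simp only: eq_commute)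
  qed
  then show ?thesis using assms(2) by (simp add: alpha_def bil_diff)
qed

text \<open>Coordinates \<open>s_j\<close> adapted to the shifts: within the ranges used, only
  \<open>e_j\<close> and \<open>f_j\<close> move \<open>s_j\<close>, by one unit in opposite
  directions, and the \<open>k_l\<close> move none of them.\<close>

definition sw :: "nat \<Rightarrow> (dynvar, 'n::finite) mero"
  where "sw j = h_fun (\<Sum>k\<in>{1..j}. eps k)"

lemma h_fun_add: "h_fun (u + v) = h_fun u + h_fun v"
  by (simp add: h_fun_def Ph_fun_def P_fun_def mero_lin_add)

lemma h_eps: "l \<ge> 1 \<Longrightarrow> h_fun (eps l) = sw l - sw (l - 1)"
  by (cases l) (simp_all add: sw_def h_fun_add)

definition vE :: "nat \<Rightarrow> complex^'n::finite^dynvar"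
  where "vE j = (\<chi> b. if b = P_var then alpha j else 0)"

definition vF :: "nat \<Rightarrow> complex^'n::finite^dynvar"
  where "vF j = (\<chi> b. if b = P_var then 0 else alpha j)"

definition vK :: "nat \<Rightarrow> complex^'n::finite^dynvar"
  where "vK l = (\<chi> b. eps l)"

lemma zero_zsum: "0 \<in> zsum" by (simp add: zsum_def)

lemma v_dyn: "vE j \<in> dyn_space" "vF j \<in> dyn_space" "vK j \<in> dyn_space"
  by (simp_all add: vE_def vF_def vK_def dyn_space_def alpha_zsum eps_zsum zero_zsum)

lemmas v_dyn' = v_dyn[THEN dyn_uminus]

lemma v_nth: "vE j $ P_var = alpha j" "vE j $ P_plus_h = 0" "vF j $ P_var = 0" "vF j $ P_plus_h = alpha j" "vK l $ b = eps l"
  by (simp_all add: vE_def vF_def vK_def)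

lemma vK_alpha: "vK j - vK (Suc j) = vE j + vF j"
  by (auto simp: vE_def vF_def vK_def alpha_def vec_eq_iff)

lemma mero_shift_h:
  "a \<in> dyn_space \<Longrightarrow> mero_shift a (h_fun u) = h_fun u + mero_const (bil u (a $ P_plus_h - a $ P_var))"
  by (simp add: h_fun_def Ph_fun_def P_fun_def rhom_diff[OF rhom_mero_shift] mero_shift_lin bil_diff rhom_diff[OF rhom_mero_const])

lemma sw_alpha:
  assumes "j \<le> CARD('n)" "i \<in> {1..<CARD('n)}"
  shows "bil (\<Sum>k\<in>{1..j}. eps k :: complex^'n::finite) (alpha i) = (if j = i then 1 else 0)"
proof -
  have "bil (\<Sum>k\<in>{1..j}. eps k :: complex^'n::finite) (alpha i) = (\<Sum>k\<in>{1..j}. (if k = i then 1 else 0) - (if k = Suc i then 1 else 0))"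
    unfolding bil_sum using assms by (intro sum.cong) (auto simp: bil_eps_alpha)
  then show ?thesis using assms(2) by (auto simp: sum_subtractf)
qed

lemma shift_sw:
  assumes "j \<le> CARD('n)" "i \<in> {1..<CARD('n)}"
  shows "mero_shift (- vE i) (sw j :: (dynvar, 'n::finite) mero) = sw j + (if j = i then 1 else 0)"
    "mero_shift (- vF i) (sw j :: (dynvar, 'n) mero) = sw j - (if j = i then 1 else 0)"
  using assms by (simp_all add: sw_def mero_shift_h v_dyn' v_nth bil_uminus sw_alpha rhom_0[OF rhom_mero_const] rhom_1[OF rhom_mero_const]
      rhom_uminus[OF rhom_mero_const] del: One_nat_def)

text \<open>\<open>P + h\<close> and \<open>P\<close> are translated by the same vector, so
  \<open>h\<close> is unchanged.\<close>

lemma shift_sw_K: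
  "mero_shift (vK l) (sw j) = sw j" "mero_shift (- vK l) (sw j) = sw j"
  by (simp_all add: sw_def mero_shift_h v_dyn v_dyn' v_nth bil_0 rhom_0[OF rhom_mero_const])

lemmas mshift_hom = rhom_0[OF rhom_mero_shift] rhom_1[OF rhom_mero_shift] rhom_add[OF rhom_mero_shift] rhom_mult[OF rhom_mero_shift]
  rhom_diff[OF rhom_mero_shift] rhom_uminus[OF rhom_mero_shift] rhom_of_int[OF rhom_mero_shift] rhom_of_nat[OF rhom_mero_shift]

lemma mshift_numeral: "mero_shift a (numeral n) = numeral n"
  using rhom_of_nat[OF rhom_mero_shift, of a "numeral n"] by simp

subsection \<open>Structure functions\<close>

lemma qpow_inverse: "inverse (qpow x) = qpow (- x)"
  by (rule inverse_unique) (simp add: qpow_0 flip: qpow_add)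

definition th :: "(dynvar, 'n::finite) mero \<Rightarrow> 'n dynfun fps"
  where "th x = theta (qpow x)"

lemma th_cq: "th x = qp (cq x) * qp (fps_X * cq (- x))"
  by (simp add: th_def theta_def qpow_inverse cq_def)

lemma th_rec: "th x = (1 - cq x) * (qp (fps_X * cq x) * qp (fps_X * cq (- x)))"
  by (simp add: th_def theta_rec qpow_inverse cq_def)

lemma th_uminus: "th (- x) = - cq (- x) * th x"
proof -
  have "1 - cq (- x) = - cq (- x) * (1 - cq x)"
    using cq_minus[of x] by (simp add: right_diff_distrib mult.commute)
  then show ?thesis unfolding th_rec minus_minus by (simp add: mult_ac)
qed

text \<open>With \<open>u = d - 1/2\<close> this is \<open>q^(-u) \<theta>(q^(2u))\<close> up to the
  constant \<open>q^(-1/2)\<close>, a theta function normalised to be odd in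
  \<open>u\<close>.\<close>

definition An :: "(dynvar, 'n::finite) mero \<Rightarrow> 'n dynfun fps"
  where "An d = cq (- d) * th (2 * d - 1)"

lemma sh_qp: "sh a (qp x) = qp (sh a x)"
  unfolding sh_def by (rule fps_map_qp) (rule rhom_sh0)

lemma sh_An: "sh a (An d) = An (mero_shift a d)"
  by (simp add: An_def th_cq sh_hom sh_cq sh_qp sh_X mshift_hom mshift_numeral)

text \<open>The constant \<open>\<kappa>\<close> of \<open>theta_quotient_difference\<close> for two
  poles with quotient \<open>q^2\<close>.\<close>

definition kap :: "'n::finite dynfun fps"
  where "kap = qp fps_X ^ 2 * (qp (fps_X * cq 2) * qp (fps_X * cq (- 2)))"

text \<open>The commutator involves only products of a weight of \<open>e_j\<close> with a weight of
  \<open>f_j\<close>, so one constant can normalise it. Of the two factors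
  \<open>q - q^(-1)\<close>, one comes from the difference of the poles in
  \<open>Gs_difference\<close>, the other from the denominator in the commutation relation.\<close>

definition gam :: "'n::finite dynfun fps"
  where "gam = cq 1 * inverse (kap * (cq 1 - cq (- 1)) ^ 2)"

lemma gam_kap: "gam * (kap * (cq 1 - cq (- 1)) ^ 2) = cq 1"
proof -
  have "fps_nth (cq 1 - cq (- 1) :: 'a dynfun fps) 0 \<noteq> 0"
    by (simp add: cq_def qpow_inj)
  then have "fps_nth (kap * (cq 1 - cq (- 1)) ^ 2 :: 'a dynfun fps) 0 \<noteq> 0"
    by (simp add: kap_def qp_nth_0 power2_eq_square)
  then have "inverse (kap * (cq 1 - cq (- 1)) ^ 2) * (kap * (cq 1 - cq (- 1)) ^ 2) = (1 :: 'a dynfun fps)"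
    by (rule inverse_mult_eq_1)
  then show ?thesis by (simp add: gam_def mult.assoc)
qed

lemma sh_gam: "sh a gam = gam"
proof -
  let ?D = "kap * (cq 1 - cq (- 1)) ^ 2 :: 'a dynfun fps"
  have "sh a ?D = ?D"
    by (simp add: kap_def sh_hom sh_qp sh_X sh_cq mshift_hom mshift_numeral)
  then have "sh a gam * ?D = sh a (gam * ?D)" by (simp only: sh_hom)
  also have "\<dots> = gam * ?D" unfolding gam_kap by (simp add: sh_cq mshift_hom)
  finally have e: "sh a gam * ?D = gam * ?D" .
  have "gam * ?D \<noteq> 0" unfolding gam_kap by (rule cq_nonzero)
  then have "?D \<noteq> 0" by auto
  with e show ?thesis by simp
qed

text \<open>
  The identities behind the relations between neighbouring \<open>e\<^sub>j\<close>, and between neighbouring \<open>f\<^sub>j\<close>; both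
  sides are a common multiple of two infinite products.
\<close>

lemma An_exchange:
  fixes d :: "(dynvar, 'n::finite) mero"
  assumes t: "is_nome t"
  shows "(1 - cq (2 * d - 1)) * seval (evs (qfrac (t * qmon (- 1) 0) (t * qmon 1 0) t)) (cq (2 * d)) * An (d + 1) =
      (cq (- 1) - cq (2 * d)) * seval (evs (qfrac (t * qmon (- 1) 0) (t * qmon 1 0) t)) (cq (- (2 * d))) * An d"
    and "(1 - cq (2 * d + 1)) * seval (evs (qfrac (t * qmon 1 0) (t * qmon (- 1) 0) t)) (cq (2 * d)) * An d =
      (cq 1 - cq (2 * d)) * seval (evs (qfrac (t * qmon 1 0) (t * qmon (- 1) 0) t)) (cq (- (2 * d))) * An (d + 1)"
proof -
  define Q D r r' :: "'n dynfun fps" where "Q = cq (2 * d)" and "D = cq (- d)" and "r = cq 1" and "r' = cq (- 1)"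
  define a b a' b' :: "'n dynfun fps" where
    "a = qp (fps_X * cq (2 * d + 1))" and "b = qp (fps_X * cq (2 * d - 1))" and
    "a' = qp (fps_X * cq (- (2 * d) - 1))" and "b' = qp (fps_X * cq (- (2 * d) + 1))"
  have rr: "r * r' = 1" by (simp add: r_def r'_def cq_minus)
  have q: "cq (2 * d - 1) = r' * Q" "cq (2 * d + 1) = r * Q" "cq (- (d + 1)) = D * r'"
    by (simp_all add: r_def r'_def Q_def D_def add.commute flip: cq_add)
  have A0: "An d = D * ((1 - r' * Q) * (b * b'))"
    unfolding An_def th_rec D_def b_def b'_def q[symmetric] by (simp add: add.commute)
  have n: "2 * (d + 1) - 1 = 2 * d + 1" "- (2 * d + 1) = - (2 * d) - 1" by simp_all
  have A1: "An (d + 1) = D * r' * ((1 - r * Q) * (a * a'))"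
    unfolding An_def th_rec n q a_def a'_def by (rule refl)
  have o: "of_int (- 1) + 2 * d = 2 * d - 1" "of_int 1 + 2 * d = 2 * d + 1"
    "of_int (- 1) + - (2 * d) = - (2 * d) - 1" "of_int 1 + - (2 * d) = - (2 * d) + 1" by simp_all
  define S T where "S = seval (evs (qfrac (t * qmon (- 1) 0) (t * qmon 1 0) t)) (cq (2 * d))"
    and "T = seval (evs (qfrac (t * qmon (- 1) 0) (t * qmon 1 0) t)) (cq (- (2 * d)))"
  have S: "a * S = b" and T: "b' * T = a'"
    using seval_qfrac0[OF t, of 1 "2 * d" "- 1"] seval_qfrac0[OF t, of 1 "- (2 * d)" "- 1"]
    unfolding o S_def T_def a_def b_def a'_def b'_def by simp_all
  have "(1 - r' * Q) * S * (D * r' * ((1 - r * Q) * (a * a'))) = D * r' * ((1 - r' * Q) * (1 - r * Q)) * ((a * S) * a')"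
    by (simp only: mult_ac)
  also have "\<dots> = r' * (1 - r * Q) * T * (D * ((1 - r' * Q) * (b * b')))"
    unfolding S T[symmetric] by (simp only: mult_ac)
  also have "r' * (1 - r * Q) = r' - r * r' * Q" by (simp add: right_diff_distrib mult_ac)
  finally show "(1 - cq (2 * d - 1)) * seval (evs (qfrac (t * qmon (- 1) 0) (t * qmon 1 0) t)) (cq (2 * d)) * An (d + 1) =
      (cq (- 1) - cq (2 * d)) * seval (evs (qfrac (t * qmon (- 1) 0) (t * qmon 1 0) t)) (cq (- (2 * d))) * An d"
    unfolding S_def[symmetric] T_def[symmetric] unfolding A0 A1 q Q_def[symmetric] r'_def[symmetric] rr mult_1_left .
  define S' T' where "S' = seval (evs (qfrac (t * qmon 1 0) (t * qmon (- 1) 0) t)) (cq (2 * d))"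
    and "T' = seval (evs (qfrac (t * qmon 1 0) (t * qmon (- 1) 0) t)) (cq (- (2 * d)))"
  have S': "b * S' = a" and T': "a' * T' = b'"
    using seval_qfrac0[OF t, of "- 1" "2 * d" 1] seval_qfrac0[OF t, of "- 1" "- (2 * d)" 1]
    unfolding o S'_def T'_def a_def b_def a'_def b'_def by simp_all
  have "(1 - r * Q) * S' * (D * ((1 - r' * Q) * (b * b'))) = D * ((1 - r' * Q) * (1 - r * Q)) * ((b * S') * b')"
    by (simp only: mult_ac)
  also have "\<dots> = (1 - r' * Q) * T' * (D * ((1 - r * Q) * (a * a')))"
    unfolding S' T'[symmetric] by (simp only: mult_ac)
  also have "\<dots> = (r * (r' * (1 - r' * Q))) * T' * (D * ((1 - r * Q) * (a * a')))"
    unfolding mult.assoc[of r r', symmetric] rr by simp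
  also have "\<dots> = (r - r * r' * Q) * T' * (D * r' * ((1 - r * Q) * (a * a')))"
    by (simp add: algebra_simps)
  finally show "(1 - cq (2 * d + 1)) * seval (evs (qfrac (t * qmon 1 0) (t * qmon (- 1) 0) t)) (cq (2 * d)) * An d =
      (cq 1 - cq (2 * d)) * seval (evs (qfrac (t * qmon 1 0) (t * qmon (- 1) 0) t)) (cq (- (2 * d))) * An (d + 1)"
    unfolding S'_def[symmetric] T'_def[symmetric] unfolding A0 A1 q Q_def[symmetric] r_def[symmetric] rr mult_1_left .
qed

subsection \<open>Currents \<open>k\<^sub>l\<close>\<close>

text \<open>The constant term of \<open>thz a\<close> in \<open>z\<close> is itself a power series
  with constant term 1, hence a unit, and its inverse is the starting value.\<close>

definition thI :: "'a::field \<Rightarrow> 'a fps fps"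
  where "thI a = fps_right_inverse (thz a) (inverse (fps_nth (thz a) 0))"

lemma thz_nth_0: "fps_nth (fps_nth (thz a) 0) 0 = 1"
  by (simp add: thz_def ann_nth_0 pz_nth_0)

lemma thz_nonzero: "thz a \<noteq> 0" using thz_nth_0[of a] by auto

lemma thz_thI: "thz a * thI a = 1"
  unfolding thI_def by (rule fps_right_inverse) (simp add: inverse_mult_eq_1' thz_nth_0)

definition ash :: "complex^'n^dynvar \<Rightarrow> 'n::finite dynfun fps fps \<Rightarrow> 'n dynfun fps fps"
  where "ash a = fps_map (sh a)"

lemma rhom_ash: "rhom (ash a)" unfolding ash_def by (rule rhom_fps_map[OF rhom_sh])

lemma sh_nth: "fps_nth (sh a x) n = map_fls (mero_shift a) (fps_nth x n)" by (simp add: sh_def)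

lemma sh_ann:
  "sh a (ann_coeff G n) = ann_coeff (ash a G) n" "sh a (ann_red G n) = ann_red (ash a G) n"
  by (simp_all add: fps_eq_iff sh_nth ann_coeff_def ann_red_def ash_def rhom_0[OF rhom_sh0])

lemma ash_ann: "ash a (ann_z U) = ann_z (ash a U)" "ash a (ann_y U) = ann_y (ash a U)"
  by (simp_all add: fps_eq_iff sh_nth ann_z_def ann_y_def ann_swap_def ash_def rhom_0[OF rhom_sh0])

lemma ash_pz: "ash a (pz (qpow x)) = pz (qpow (mero_shift a x))"
proof -
  have "ash a (pz (qpow x)) = poch (sh a (fps_const (qpow x))) (sh a fps_X)"
    unfolding ash_def sh_def pz_def by (rule fps_map_poch) (rule rhom_sh0)
  then show ?thesis by (simp add: sh_X pz_def sh_cq flip: cq_def)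
qed

lemma ash_thz: "ash a (thz (qpow x)) = thz (qpow (mero_shift a x))"
  by (simp add: thz_def rhom_mult[OF rhom_ash] ash_ann qpow_inverse ash_pz mshift_hom)

lemma ash_thI: "ash a (thI (qpow x)) = thI (qpow (mero_shift a x))"
proof -
  let ?t = "thz (qpow (mero_shift a x))"
  have "?t * ash a (thI (qpow x)) = ash a (thz (qpow x) * thI (qpow x))"
    unfolding rhom_mult[OF rhom_ash] ash_thz by (rule refl)
  also have "\<dots> = ?t * thI (qpow (mero_shift a x))"
    unfolding thz_thI by (rule rhom_1[OF rhom_ash])
  finally show ?thesis unfolding mult_left_cancel[OF thz_nonzero] .
qed

definition Cc :: "(dynvar, 'n::finite) mero \<Rightarrow> 'n dynfun fps fps"
  where "Cc x = fps_const (cq x)"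

lemma Cc_add: "Cc (x + y) = Cc x * Cc y" by (simp add: Cc_def cq_add)

lemma Cc_0: "Cc 0 = 1" by (simp add: Cc_def cq_0)

lemma ash_Cc: "ash a (Cc x) = Cc (mero_shift a x)"
  by (simp add: ash_def Cc_def fps_map_const rhom_sh sh_cq)

lemma ann_coeff_Cc: "ann_coeff (Cc x * G) n = cq x * ann_coeff G n"
  unfolding Cc_def cq_def by (rule ann_coeff_const)

text \<open>With \<open>s_j\<close> for \<open>sw j\<close>, the current \<open>k_l(z)\<close> is
  \<open>q^(s_(l-1) - s_l) \<theta>(q^(l+1-2s_(l-1)) z) / \<theta>(q^(l-2s_l) z)\<close>. Numerator
  and denominator contain one coordinate each, so \<open>e_j\<close> and \<open>f_j\<close> move the
  denominator of \<open>k_j\<close> and the numerator of \<open>k_(j+1)\<close>, as the exchange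
  relations require.\<close>

definition Gs :: "nat \<Rightarrow> 'n::finite dynfun fps fps"
  where "Gs l = Cc (sw (l - 1) - sw l) * (thz (qpow (of_nat l + 1 - 2 * sw (l - 1))) * thI (qpow (of_nat l - 2 * sw l)))"

definition GsI :: "nat \<Rightarrow> 'n::finite dynfun fps fps"
  where "GsI l = Cc (sw l - sw (l - 1)) * (thz (qpow (of_nat l - 2 * sw l)) * thI (qpow (of_nat l + 1 - 2 * sw (l - 1))))"

lemma Gs_GsI: "Gs l * GsI l = 1"
proof -
  have "Gs l * GsI l = Cc ((sw (l - 1) - sw l) + (sw l - sw (l - 1))) *
      ((thz (qpow (of_nat l + 1 - 2 * sw (l - 1))) * thI (qpow (of_nat l + 1 - 2 * sw (l - 1)))) *
       (thz (qpow (of_nat l - 2 * sw l)) * thI (qpow (of_nat l - 2 * sw l))))"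
    unfolding Gs_def GsI_def Cc_add by (simp only: mult_ac)
  then show ?thesis unfolding thz_thI by (simp add: Cc_0)
qed

lemma ash_Gs:
  "ash a (Gs l) = Cc (mero_shift a (sw (l - 1)) - mero_shift a (sw l)) *
    (thz (qpow (of_nat l + 1 - 2 * mero_shift a (sw (l - 1)))) * thI (qpow (of_nat l - 2 * mero_shift a (sw l))))"
  "ash a (GsI l) = Cc (mero_shift a (sw l) - mero_shift a (sw (l - 1))) *
    (thz (qpow (of_nat l - 2 * mero_shift a (sw l))) * thI (qpow (of_nat l + 1 - 2 * mero_shift a (sw (l - 1)))))"
  unfolding Gs_def GsI_def rhom_mult[OF rhom_ash] ash_Cc ash_thz ash_thI mshift_hom mshift_numeral by (rule refl)+

lemma ash_Gs_K:
  "ash (vK m) (Gs l) = Gs l" "ash (- vK m) (Gs l) = Gs l" "ash (vK m) (GsI l) = GsI l" "ash (- vK m) (GsI l) = GsI l"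
  unfolding ash_Gs shift_sw_K by (simp_all only: Gs_def GsI_def)

subsection \<open>The action of the generators\<close>

text \<open>The weight of \<open>e_j\<close> depends on \<open>s_(j+1) - s_j\<close>, that of
  \<open>f_j\<close> on \<open>s_j - s_(j-1)\<close>. With this distribution the two orders of
  \<open>e_i\<close> and \<open>f_j\<close> have equal weights when
  \<open>i \<noteq> j\<close>.\<close>

definition Ce :: "nat \<Rightarrow> 'n::finite dynfun fps"
  where "Ce j = (if j \<in> {1..<CARD('n)} then An (sw (Suc j) - sw j) else 0)"

definition Cf :: "nat \<Rightarrow> 'n::finite dynfun fps"
  where "Cf j = (if j \<in> {1..<CARD('n)} then gam * An (sw j - sw (j - 1)) else 0)"

definition Ck :: "nat \<Rightarrow> int \<Rightarrow> 'n::finite dynfun fps"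
  where "Ck l n = (if l \<in> {1..CARD('n)} then ann_red (Gs l) n else 0)"

definition CkI :: "nat \<Rightarrow> int \<Rightarrow> 'n::finite dynfun fps"
  where "CkI l n = (if l \<in> {1..CARD('n)} then ann_red (GsI l) n else 0)"

definition xe :: "nat \<Rightarrow> (dynvar, 'n::finite) mero" where "xe j = 2 * sw j"

text \<open>The offset 2 makes \<open>e_j\<close> and \<open>f_j\<close> meet: in
  \<open>e_j f_j\<close> both are supported at the exponent \<open>xf j\<close>, in
  \<open>f_j e_j\<close> both at \<open>xe j\<close>, because each moves \<open>s_j\<close> by
  1.\<close>

definition xf :: "nat \<Rightarrow> (dynvar, 'n::finite) mero" where "xf j = 2 * sw j - 2"

definition Lrep :: "'n::finite dynfun gen \<Rightarrow> 'n loop \<Rightarrow> 'n loop"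
  where "Lrep g = (case g of
      Fun f \<Rightarrow> op 0 (fps_const f) 0
    | Egen j m \<Rightarrow> op (vE j) (Ce j * cq (- (of_int (- m) * xe j))) (- m)
    | Fgen j m \<Rightarrow> op (vF j) (Cf j * cq (- (of_int (- m) * xf j))) (- m)
    | Kgen l m \<Rightarrow> op (vK l) (Ck l (- m)) (- m)
    | Kinv l m \<Rightarrow> op (- vK l) (CkI l (- m)) (- m)
    | Dgen \<Rightarrow> (\<lambda>v k. of_int (- k) * v k))"

lemma monop_Lrep: "monop (Lrep g)"
proof (cases g)
  case Dgen
  then show ?thesis
    unfolding monop_def Lrep_def using zero_in_dyn
    by (intro exI[of _ 0] exI[of _ "\<lambda>k. of_int (- k)"]) (auto simp: sh_0)
qed (simp_all add: Lrep_def monop_op zero_in_dyn v_dyn v_dyn')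

abbreviation (input) "hopr \<equiv> hop Lrep"
abbreviation (input) "actr \<equiv> act Lrep"

lemmas hopr_mult = hop_mult[OF monop_Lrep] and hopr_coe = hop_coe[OF monop_Lrep] and hopr_eq = hop_eq[OF monop_Lrep]
  and hopr_psum = hop_psum[OF monop_Lrep] and hopr_act2 = hop_act2[OF monop_Lrep] and hopr_letter = hop_letter[OF monop_Lrep]
  and hopr_zero = hop_zero_act[OF monop_Lrep] and hopr_diff = hop_diff[OF monop_Lrep] and hopr_1 = hop_1[OF monop_Lrep]
  and hopr_def = hop_def[OF monop_Lrep] and hopr_0 = hop_0[OF monop_Lrep] and actr_mult = act_mult[OF monop_Lrep]
  and actr_coe = act_coe[OF monop_Lrep] and actr_letter = act_letter[OF monop_Lrep] and actr_diff = act_diff[OF monop_Lrep]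
  and actr_0 = act_0[OF monop_Lrep] and actr_add = act_add[OF monop_Lrep]

lemma hopr_fn: "hopr (fn f) 0 0 (fps_const f)"
  unfolding fn_def by (rule hopr_letter) (simp_all add: Lrep_def zero_in_dyn)

lemma hopr_e: "hopr (e_cur j a) (vE j) a (Ce j * cq (- (of_int a * xe j)))"
  unfolding e_cur_def by (rule hopr_letter) (simp_all add: Lrep_def v_dyn)

lemma hopr_f: "hopr (f_cur j a) (vF j) a (Cf j * cq (- (of_int a * xf j)))"
  unfolding f_cur_def by (rule hopr_letter) (simp_all add: Lrep_def v_dyn)

lemma hopr_Kgen: "hopr (letter (Kgen l (- n))) (vK l) n (Ck l n)"
  by (rule hopr_letter) (simp_all add: Lrep_def v_dyn)

lemma hopr_Kinv: "hopr (letter (Kinv l (- n))) (- vK l) n (CkI l n)"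
  by (rule hopr_letter) (simp_all add: Lrep_def v_dyn')

lemma hopr_k: "hopr (kplus l n) (vK l) n (fps_X ^ nat (- n) * Ck l n)"
  using hopr_coe[OF hopr_Kgen, of "nome ^ nat (- n)"] by (simp add: kplus_def ev_hom ev_nome)

lemma hopr_k':
  assumes "l \<in> {1..CARD('n)}"
  shows "hopr (kplus l n :: 'n::finite alg) (vK l) n (ann_coeff (Gs l) n)"
    "hopr (kplus_inv l n :: 'n alg) (- vK l) n (ann_coeff (GsI l) n)"
proof -
  have "hopr (kplus l n :: 'n alg) (vK l) n (fps_X ^ nat (- n) * Ck l n)" by (rule hopr_k)
  then show "hopr (kplus l n :: 'n alg) (vK l) n (ann_coeff (Gs l) n)"
    unfolding Ck_def if_P[OF assms] ann_coeff_red .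
  have "hopr (kplus_inv l n :: 'n alg) (- vK l) n (ev (nome ^ nat (- n)) * CkI l n)"
    unfolding kplus_inv_def by (rule hopr_coe[OF hopr_Kinv])
  then show "hopr (kplus_inv l n :: 'n alg) (- vK l) n (ann_coeff (GsI l) n)"
    unfolding CkI_def if_P[OF assms] ann_coeff_red ev_hom ev_nome .
qed

lemma actr_D: "actr (letter Dgen) v k = of_int (- k) * v k"
  unfolding actr_letter by (simp add: Lrep_def)

lemma coe_of_int: "coe (of_int m) = of_int m"
  using rhom_of_int[OF rhom_coe] .

lemma actr_of_int: "actr (of_int m * x) v k = of_int m * actr x v k"
  unfolding coe_of_int[symmetric] actr_mult actr_coe rhom_of_int[OF rhom_ev] by (rule refl)

lemma hopr_D:
  assumes "hopr x s n c"
  shows "actr (letter Dgen * x - x * letter Dgen) v k = actr (- of_int n * x) v k"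
proof -
  have x: "actr x v k = sh s (c * v (k - n))" for v k using assms by (simp add: hopr_def op_def)
  have m: "- of_int n * x = of_int (- n) * x" by simp
  have shi: "sh s (of_int m) = of_int m" for m by (rule rhom_of_int[OF rhom_sh])
  have e: "actr (- of_int n * x) v k = of_int (- n) * actr x v k" unfolding m by (rule actr_of_int)
  have "actr (letter Dgen * x - x * letter Dgen) v k = of_int (- k) * sh s (c * v (k - n)) - sh s (c * (of_int (- (k - n)) * v (k - n)))"
    unfolding actr_diff actr_mult actr_D x by (rule refl)
  also have "\<dots> = of_int (- n) * sh s (c * v (k - n))"
    unfolding sh_hom(4) shi by (simp add: algebra_simps)
  finally show ?thesis unfolding e x .
qed

text \<open>Functions act by multiplication, so carrying one past a weighted shift translates its
  argument back by that shift.\<close>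

lemma hopr_fn_at:
  assumes x: "hopr x s n c" and g: "shift1 (- (s $ b)) g = g'"
  shows "actr (fn_at b g * x) v k = actr (x * fn_at b g') v k"
proof -
  have s: "- s \<in> dyn_space" using x unfolding hopr_def by (blast intro: dyn_uminus)
  let ?c = "fps_const (map_fls (mero_at b) g') :: 'a dynfun fps"
  have e: "sh (- s) (fps_const (map_fls (mero_at b) g)) = ?c"
    unfolding g[symmetric] sh_def shift1_def
    by (simp add: fps_map_const rhom_sh0 map_fls_comp rhom_0 rhom_mero_shift rhom_mero_at mero_shift_at[OF s])
  have "hopr (fn_at b g * x) (0 + s) (0 + n) (?c * c)"
    using hopr_mult[OF hopr_fn[of "map_fls (mero_at b) g"] x] unfolding fn_at_def e .
  moreover have "hopr (x * fn_at b g') (s + 0) (n + 0) (c * ?c)"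
    using hopr_mult[OF x hopr_fn] by (simp add: fn_at_def sh_0)
  ultimately show ?thesis by (intro hopr_eq) (simp_all add: mult.commute)
qed

subsection \<open>Relations between the \<open>e\<^sub>j\<close> and \<open>f\<^sub>j\<close>\<close>

lemma Ce_eq: "j \<in> {1..<CARD('n)} \<Longrightarrow> (Ce j :: 'n::finite dynfun fps) = An (sw (Suc j) - sw j)"
  and Cf_eq: "j \<in> {1..<CARD('n)} \<Longrightarrow> (Cf j :: 'n::finite dynfun fps) = gam * An (sw j - sw (j - 1))"
  by (simp_all add: Ce_def Cf_def)

lemma sh_Ce_Cf:
  assumes i: "i \<in> {1..<CARD('n)}" and j: "j \<in> {1..<CARD('n)}"
  shows "sh (- vE j) (Ce i :: 'n::finite dynfun fps) =
      An ((sw (Suc i) + (if Suc i = j then 1 else 0)) - (sw i + (if i = j then 1 else 0)))"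
    "sh (- vF j) (Ce i :: 'n dynfun fps) =
      An ((sw (Suc i) - (if Suc i = j then 1 else 0)) - (sw i - (if i = j then 1 else 0)))"
    "sh (- vE j) (Cf i :: 'n dynfun fps) =
      gam * An ((sw i + (if i = j then 1 else 0)) - (sw (i - 1) + (if i - 1 = j then 1 else 0)))"
    "sh (- vF j) (Cf i :: 'n dynfun fps) =
      gam * An ((sw i - (if i = j then 1 else 0)) - (sw (i - 1) - (if i - 1 = j then 1 else 0)))"
proof -
  have r: "Suc i \<le> CARD('n)" "i \<le> CARD('n)" "i - 1 \<le> CARD('n)" using i by auto
  note s = r[THEN shift_sw(1)[OF _ j]] r[THEN shift_sw(2)[OF _ j]]
  show "sh (- vE j) (Ce i :: 'n dynfun fps) =
      An ((sw (Suc i) + (if Suc i = j then 1 else 0)) - (sw i + (if i = j then 1 else 0)))"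
    "sh (- vF j) (Ce i :: 'n dynfun fps) =
      An ((sw (Suc i) - (if Suc i = j then 1 else 0)) - (sw i - (if i = j then 1 else 0)))"
    "sh (- vE j) (Cf i :: 'n dynfun fps) =
      gam * An ((sw i + (if i = j then 1 else 0)) - (sw (i - 1) + (if i - 1 = j then 1 else 0)))"
    "sh (- vF j) (Cf i :: 'n dynfun fps) =
      gam * An ((sw i - (if i = j then 1 else 0)) - (sw (i - 1) - (if i - 1 = j then 1 else 0)))"
    unfolding Ce_eq[OF i] Cf_eq[OF i] sh_hom(4) sh_gam sh_An mshift_hom(5) s by (rule refl)+
qed

lemma shift_x:
  assumes k: "k \<in> {1..<CARD('n)}" and j: "j \<in> {1..<CARD('n)}"
  shows "mero_shift (- vE j) (xe k :: (dynvar, 'n::finite) mero) = xe k + (if j = k then 2 else 0)"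
    "mero_shift (- vF j) (xe k :: (dynvar, 'n) mero) = xe k - (if j = k then 2 else 0)"
    "mero_shift (- vE j) (xf k :: (dynvar, 'n) mero) = xf k + (if j = k then 2 else 0)"
    "mero_shift (- vF j) (xf k :: (dynvar, 'n) mero) = xf k - (if j = k then 2 else 0)"
proof -
  have r: "k \<le> CARD('n)" using k by auto
  show "mero_shift (- vE j) (xe k :: (dynvar, 'n::finite) mero) = xe k + (if j = k then 2 else 0)"
    "mero_shift (- vF j) (xe k :: (dynvar, 'n) mero) = xe k - (if j = k then 2 else 0)"
    "mero_shift (- vE j) (xf k :: (dynvar, 'n) mero) = xf k + (if j = k then 2 else 0)"
    "mero_shift (- vF j) (xf k :: (dynvar, 'n) mero) = xf k - (if j = k then 2 else 0)"
    unfolding xe_def xf_def mshift_hom(4,5) mshift_numeral shift_sw[OF r j] by (simp_all add: algebra_simps)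
qed

lemma e_hexp: "hexp1 Lrep (e_cur j) (vE j) (Ce j) (xe j)" and f_hexp: "hexp1 Lrep (f_cur j) (vF j) (Cf j) (xf j)"
  unfolding hexp1_def[OF monop_Lrep] by (intro allI hopr_e hopr_f)+

lemma e_wx:
  assumes "\<sigma> = 1" "j \<in> {1..<CARD('n)}" "k \<in> {1..<CARD('n)}"
  shows "mero_shift (- vE j) (xe k :: (dynvar, 'n::finite) mero) = xe k + (if j = k then 2 * of_int \<sigma> else 0)"
  unfolding shift_x(1)[OF assms(3,2)] assms(1) by simp

lemma f_wx:
  assumes "\<sigma> = - 1" "j \<in> {1..<CARD('n)}" "k \<in> {1..<CARD('n)}"
  shows "mero_shift (- vF j) (xf k :: (dynvar, 'n::finite) mero) = xf k + (if j = k then 2 * of_int \<sigma> else 0)"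
  unfolding shift_x(4)[OF assms(3,2)] assms(1) by simp

lemma e_far:
  assumes "i \<in> {1..<CARD('n)}" "j \<in> {1..<CARD('n)}" "\<bar>int i - int j\<bar> > 1"
  shows "sh (- vE j) (Ce i :: 'n::finite dynfun fps) = Ce i"
proof -
  have "Suc i \<noteq> j" "i \<noteq> j" using assms(3) by auto
  then show ?thesis unfolding sh_Ce_Cf(1)[OF assms(1,2)] unfolding Ce_eq[OF assms(1)] by simp
qed

lemma f_far:
  assumes "i \<in> {1..<CARD('n)}" "j \<in> {1..<CARD('n)}" "\<bar>int i - int j\<bar> > 1"
  shows "sh (- vF j) (Cf i :: 'n::finite dynfun fps) = Cf i"
proof -
  have "i - 1 \<noteq> j" "i \<noteq> j" using assms(1,3) by auto
  then show ?thesis unfolding sh_Ce_Cf(4)[OF assms(1,2)] unfolding Cf_eq[OF assms(1)] by simp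
qed

lemma e_ex:
  assumes \<sigma>: "\<sigma> = 1" and t: "is_nome t" and i: "i \<in> {1..<CARD('n)}" "Suc i \<in> {1..<CARD('n)}"
  shows "(cq (xe i) - cq (xe (Suc i) - of_int \<sigma>)) * seval (evs (qfrac (t * qmon (- \<sigma>) 0) (t * qmon \<sigma> 0) t)) (cq (xe (Suc i) - xe i)) *
      (sh (- vE (Suc i)) (Ce i) * Ce (Suc i)) =
    (cq (xe i - of_int \<sigma>) - cq (xe (Suc i))) * seval (evs (qfrac (t * qmon (- \<sigma>) 0) (t * qmon \<sigma> 0) t)) (cq (xe i - xe (Suc i))) *
      (sh (- vE i) (Ce (Suc i)) * (Ce i :: 'n::finite dynfun fps))"
proof -
  define d where "d = sw (Suc i) - (sw i :: (dynvar, 'n) mero)"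
  have x: "xe (Suc i) - xe i = 2 * d" "xe i - xe (Suc i) = - (2 * d)" "xe (Suc i) = xe i + 2 * d"
    "xe (Suc i) - 1 = xe i + (2 * d - 1)" "xe i - 1 = xe i + - 1"
    by (simp_all add: xe_def d_def algebra_simps)
  have s: "sh (- vE (Suc i)) (Ce i :: 'n dynfun fps) = An (d + 1)" "sh (- vE i) (Ce (Suc i) :: 'n dynfun fps) = Ce (Suc i)" "Ce i = An d"
    unfolding sh_Ce_Cf(1)[OF i] sh_Ce_Cf(1)[OF i(2,1)] unfolding Ce_eq[OF i(1)] Ce_eq[OF i(2)] d_def by (simp_all add: algebra_simps)
  define S where "S = seval (evs (qfrac (t * qmon (- 1) 0) (t * qmon 1 0) t)) (cq (2 * d))"
  define T where "T = seval (evs (qfrac (t * qmon (- 1) 0) (t * qmon 1 0) t)) (cq (- (2 * d)))"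
  have "(cq (xe i) - cq (xe i) * cq (2 * d - 1)) * S * (An (d + 1) * Ce (Suc i)) =
      cq (xe i) * Ce (Suc i) * ((1 - cq (2 * d - 1)) * S * An (d + 1))" by (simp add: algebra_simps)
  also have "\<dots> = cq (xe i) * Ce (Suc i) * ((cq (- 1) - cq (2 * d)) * T * An d)"
    unfolding S_def T_def An_exchange(1)[OF t] by (rule refl)
  also have "\<dots> = (cq (xe i) * cq (- 1) - cq (xe i) * cq (2 * d)) * T * (Ce (Suc i) * An d)" by (simp add: algebra_simps)
  finally show ?thesis
    unfolding \<sigma> of_int_1 s(1,2) x(1,2) unfolding S_def[symmetric] T_def[symmetric] x(4,5) unfolding x(3) cq_add[of "xe i"] s(3) .
qed

lemma f_ex:
  assumes \<sigma>: "\<sigma> = - 1" and t: "is_nome t" and i: "i \<in> {1..<CARD('n)}" "Suc i \<in> {1..<CARD('n)}"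
  shows "(cq (xf i) - cq (xf (Suc i) - of_int \<sigma>)) * seval (evs (qfrac (t * qmon (- \<sigma>) 0) (t * qmon \<sigma> 0) t)) (cq (xf (Suc i) - xf i)) *
      (sh (- vF (Suc i)) (Cf i) * Cf (Suc i)) =
    (cq (xf i - of_int \<sigma>) - cq (xf (Suc i))) * seval (evs (qfrac (t * qmon (- \<sigma>) 0) (t * qmon \<sigma> 0) t)) (cq (xf i - xf (Suc i))) *
      (sh (- vF i) (Cf (Suc i)) * (Cf i :: 'n::finite dynfun fps))"
proof -
  define d where "d = sw (Suc i) - (sw i :: (dynvar, 'n) mero)"
  have x: "xf (Suc i) - xf i = 2 * d" "xf i - xf (Suc i) = - (2 * d)" "xf (Suc i) = xf i + 2 * d"
    "xf (Suc i) - - 1 = xf i + (2 * d + 1)" "xf i - - 1 = xf i + 1"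
    by (simp_all add: xf_def d_def algebra_simps)
  have ne: "i - 1 \<noteq> Suc i" by auto
  have s: "sh (- vF (Suc i)) (Cf i :: 'n dynfun fps) = Cf i" "sh (- vF i) (Cf (Suc i) :: 'n dynfun fps) = gam * An (d + 1)"
      "Cf (Suc i) = gam * An d"
    unfolding sh_Ce_Cf(4)[OF i] sh_Ce_Cf(4)[OF i(2,1)] unfolding Cf_eq[OF i(1)] Cf_eq[OF i(2)] d_def using i ne by (simp_all add: algebra_simps)
  have n: "of_int (- 1) = (- 1 :: (dynvar, 'n) mero)" "- (- 1) = (1 :: int)" by simp_all
  define S where "S = seval (evs (qfrac (t * qmon 1 0) (t * qmon (- 1) 0) t)) (cq (2 * d))"
  define T where "T = seval (evs (qfrac (t * qmon 1 0) (t * qmon (- 1) 0) t)) (cq (- (2 * d)))"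
  have "(cq (xf i) - cq (xf i) * cq (2 * d + 1)) * S * (Cf i * (gam * An d)) =
      cq (xf i) * Cf i * gam * ((1 - cq (2 * d + 1)) * S * An d)" by (simp add: algebra_simps)
  also have "\<dots> = cq (xf i) * Cf i * gam * ((cq 1 - cq (2 * d)) * T * An (d + 1))"
    unfolding S_def T_def An_exchange(2)[OF t] by (rule refl)
  also have "\<dots> = (cq (xf i) * cq 1 - cq (xf i) * cq (2 * d)) * T * (gam * An (d + 1) * Cf i)" by (simp add: algebra_simps)
  finally show ?thesis
    unfolding \<sigma> n s(1,2) x(1,2) unfolding S_def[symmetric] T_def[symmetric] x(4,5) unfolding x(3) cq_add[of "xf i"] s(3) .
qed

section \<open>Relations among the \<open>e_j\<close>, among the \<open>f_j\<close>, and between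
  different \<open>e_i\<close> and \<open>f_j\<close>\<close>

lemma nomes: "is_nome nome" "is_nome nome_star" by (simp_all add: is_nome_def)

text \<open>Instances of the exchange relations: \<open>\<sigma> = 1\<close> with base
  \<open>p\<^sup>*\<close> for \<open>e\<close>, and \<open>\<sigma> = -1\<close> with base
  \<open>p\<close> for \<open>f\<close>.\<close>

lemmas e_fam = monop_Lrep e_hexp v_dyn(1) e_wx[OF refl] nomes(2) disjI1[OF refl] e_ex[OF refl nomes(2)] e_far
lemmas f_fam = monop_Lrep f_hexp v_dyn(2) f_wx[OF refl] nomes(1) disjI2[OF refl] f_ex[OF refl nomes(1)] f_far

lemmas minus_simps = minus_minus mult_minus_right mult_minus_left mult_1_right

lemma rel_e_e: "j \<in> {1..<CARD('n)} \<Longrightarrow> actr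
    (act2 (qfrac (qmon 2 0) (nome_star * qmon (-2) 0) nome_star) z21 (ordered (e_cur j) (e_cur j)) (a - 1) b) v k =
    actr (- act2 (qfrac (qmon 2 0) (nome_star * qmon (-2) 0) nome_star) z12 (swapped (e_cur j) (e_cur j)) a (b - 1) :: 'n::finite alg) v k"
  by (rule exch_same[OF e_fam, unfolded minus_simps])

lemma rel_e_e': "j \<in> {1..<CARD('n)} \<Longrightarrow> Suc j \<in> {1..<CARD('n)} \<Longrightarrow> actr
    (act2 (qfrac (qmon (-1) 0) (nome_star * qmon 1 0) nome_star) z21 (ordered (e_cur j) (e_cur (Suc j))) (a - 1) b) v k =
    actr (- act2 (qfrac (qmon (-1) 0) (nome_star * qmon 1 0) nome_star) z12 (swapped (e_cur j) (e_cur (Suc j))) a (b - 1) :: 'n::finite alg) v k"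
  by (rule exch_next[OF e_fam, unfolded minus_simps])

lemma rel_f_f: "j \<in> {1..<CARD('n)} \<Longrightarrow> actr
    (act2 (qfrac (qmon (-2) 0) (nome * qmon 2 0) nome) z21 (ordered (f_cur j) (f_cur j)) (a - 1) b) v k =
    actr (- act2 (qfrac (qmon (-2) 0) (nome * qmon 2 0) nome) z12 (swapped (f_cur j) (f_cur j)) a (b - 1) :: 'n::finite alg) v k"
  by (rule exch_same[OF f_fam, unfolded minus_simps])

lemma rel_f_f': "j \<in> {1..<CARD('n)} \<Longrightarrow> Suc j \<in> {1..<CARD('n)} \<Longrightarrow> actr
    (act2 (qfrac (qmon 1 0) (nome * qmon (-1) 0) nome) z21 (ordered (f_cur j) (f_cur (Suc j))) (a - 1) b) v k =
    actr (- act2 (qfrac (qmon 1 0) (nome * qmon (-1) 0) nome) z12 (swapped (f_cur j) (f_cur (Suc j))) a (b - 1) :: 'n::finite alg) v k"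
  by (rule exch_next[OF f_fam, unfolded minus_simps])

lemma rel_serre_e: "i \<in> {1..<CARD('n)} \<Longrightarrow> j \<in> {1..<CARD('n)} \<Longrightarrow> \<bar>int i - int j\<bar> = 1 \<Longrightarrow> actr
    (serre (qfrac (nome_star * qmon 2 0) (nome_star * qmon (-2) 0) nome_star)
      (qfrac (nome_star * qmon (-1) 0) (nome_star * qmon 1 0) nome_star) (e_cur i) (e_cur j) a b c :: 'n::finite alg) v k = 0"
  by (rule exch_serre[OF e_fam, unfolded minus_simps])

lemma rel_serre_f: "i \<in> {1..<CARD('n)} \<Longrightarrow> j \<in> {1..<CARD('n)} \<Longrightarrow> \<bar>int i - int j\<bar> = 1 \<Longrightarrow> actr
    (serre (qfrac (nome * qmon (-2) 0) (nome * qmon 2 0) nome)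
      (qfrac (nome * qmon 1 0) (nome * qmon (-1) 0) nome) (f_cur i) (f_cur j) a b c :: 'n::finite alg) v k = 0"
  by (rule exch_serre[OF f_fam, unfolded minus_simps])

lemma hopr_mult_zero:
  assumes "hopr x s m 0" "hopr y t n d"
  shows "actr (x * y) v k = 0" "actr (y * x) v k = 0"
proof -
  have "hopr (x * y) (s + t) (m + n) 0" "hopr (y * x) (t + s) (n + m) 0"
    using hopr_mult[OF assms] hopr_mult[OF assms(2,1)] unfolding sh_hom(1) mult_zero_left mult_zero_right .
  then show "actr (x * y) v k = 0" "actr (y * x) v k = 0" by (auto intro: hopr_zero)
qed

lemma hopr_range:
  "j \<notin> {1..<CARD('n)} \<Longrightarrow> hopr (e_cur j a :: 'n::finite alg) (vE j) a 0"
  "j \<notin> {1..<CARD('n)} \<Longrightarrow> hopr (f_cur j a :: 'n alg) (vF j) a 0"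
  "j \<notin> {1..CARD('n)} \<Longrightarrow> hopr (letter (Kgen j (- a)) :: 'n alg) (vK j) a 0"
  "j \<notin> {1..CARD('n)} \<Longrightarrow> hopr (letter (Kinv j (- a)) :: 'n alg) (- vK j) a 0"
  "j \<notin> {1..CARD('n)} \<Longrightarrow> hopr (kplus j a :: 'n alg) (vK j) a 0"
proof -
  have h: "hopr (e_cur j a :: 'n alg) (vE j) a (Ce j * cq (- (of_int a * xe j)))"
    "hopr (f_cur j a :: 'n alg) (vF j) a (Cf j * cq (- (of_int a * xf j)))"
    "hopr (letter (Kgen j (- a)) :: 'n alg) (vK j) a (Ck j a)"
    "hopr (letter (Kinv j (- a)) :: 'n alg) (- vK j) a (CkI j a)"
    "hopr (kplus j a :: 'n alg) (vK j) a (fps_X ^ nat (- a) * Ck j a)"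
    by (rule hopr_e hopr_f hopr_Kgen hopr_Kinv hopr_k)+
  show "hopr (e_cur j a :: 'n alg) (vE j) a 0" "hopr (f_cur j a :: 'n alg) (vF j) a 0" if "j \<notin> {1..<CARD('n)}"
    using h(1,2) unfolding Ce_def Cf_def if_not_P[OF that] mult_zero_left .
  show "hopr (letter (Kgen j (- a)) :: 'n alg) (vK j) a 0" "hopr (letter (Kinv j (- a)) :: 'n alg) (- vK j) a 0"
    "hopr (kplus j a :: 'n alg) (vK j) a 0" if "j \<notin> {1..CARD('n)}"
    using h(3-5) unfolding Ck_def CkI_def if_not_P[OF that] mult_zero_right .
qed

lemma rel_e_e_comm:
  assumes "\<bar>int j - int l\<bar> > 1"
  shows "actr (e_cur j a * e_cur l b :: 'n::finite alg) v k = actr (e_cur l b * e_cur j a) v k"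
proof (cases "j \<in> {1..<CARD('n)} \<and> l \<in> {1..<CARD('n)}")
  case True
  then have j: "j \<in> {1..<CARD('n)}" and l: "l \<in> {1..<CARD('n)}" by blast+
  show ?thesis by (rule exch_far[OF e_fam j l assms])
next
  case False
  then consider "j \<notin> {1..<CARD('n)}" | "l \<notin> {1..<CARD('n)}" by blast
  then show ?thesis
  proof cases
    case 1
    show ?thesis unfolding hopr_mult_zero[OF hopr_range(1)[OF 1] hopr_e] by (rule refl)
  next
    case 2
    show ?thesis unfolding hopr_mult_zero[OF hopr_range(1)[OF 2] hopr_e] by (rule refl)
  qed
qed

lemma rel_f_f_comm:
  assumes "\<bar>int j - int l\<bar> > 1"
  shows "actr (f_cur j a * f_cur l b :: 'n::finite alg) v k = actr (f_cur l b * f_cur j a) v k"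
proof (cases "j \<in> {1..<CARD('n)} \<and> l \<in> {1..<CARD('n)}")
  case True
  then have j: "j \<in> {1..<CARD('n)}" and l: "l \<in> {1..<CARD('n)}" by blast+
  show ?thesis by (rule exch_far[OF f_fam j l assms])
next
  case False
  then consider "j \<notin> {1..<CARD('n)}" | "l \<notin> {1..<CARD('n)}" by blast
  then show ?thesis
  proof cases
    case 1
    show ?thesis unfolding hopr_mult_zero[OF hopr_range(2)[OF 1] hopr_f] by (rule refl)
  next
    case 2
    show ?thesis unfolding hopr_mult_zero[OF hopr_range(2)[OF 2] hopr_f] by (rule refl)
  qed
qed

lemma hopr_ef:
  assumes i: "i \<in> {1..<CARD('n)}" and j: "j \<in> {1..<CARD('n)}"
  shows "hopr (e_cur i a * f_cur j b :: 'n::finite alg) (vE i + vF j) (a + b)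
      (An ((sw (Suc i) - (if Suc i = j then 1 else 0)) - (sw i - (if i = j then 1 else 0))) *
        cq (- (of_int a * (xe i - (if j = i then 2 else 0)))) * (gam * An (sw j - sw (j - 1)) * cq (- (of_int b * xf j))))"
    "hopr (f_cur j b * e_cur i a :: 'n alg) (vE i + vF j) (a + b)
      (gam * An ((sw j + (if j = i then 1 else 0)) - (sw (j - 1) + (if j - 1 = i then 1 else 0))) *
        cq (- (of_int b * (xf j + (if i = j then 2 else 0)))) * (An (sw (Suc i) - sw i) * cq (- (of_int a * xe i))))"
proof -
  have e: "hopr (e_cur i a :: 'n alg) (vE i) a (Ce i * cq (- (of_int a * xe i)))"
    and f: "hopr (f_cur j b :: 'n alg) (vF j) b (Cf j * cq (- (of_int b * xf j)))"
    by (rule hopr_e hopr_f)+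
  show "hopr (e_cur i a * f_cur j b :: 'n::finite alg) (vE i + vF j) (a + b)
      (An ((sw (Suc i) - (if Suc i = j then 1 else 0)) - (sw i - (if i = j then 1 else 0))) *
        cq (- (of_int a * (xe i - (if j = i then 2 else 0)))) * (gam * An (sw j - sw (j - 1)) * cq (- (of_int b * xf j))))"
    using hopr_mult[OF e f]
    unfolding sh_hom(4) sh_cq mshift_hom(4,6,7) shift_x(2)[OF i j] sh_Ce_Cf(2)[OF i j] unfolding Cf_eq[OF j] .
  show "hopr (f_cur j b * e_cur i a :: 'n alg) (vE i + vF j) (a + b)
      (gam * An ((sw j + (if j = i then 1 else 0)) - (sw (j - 1) + (if j - 1 = i then 1 else 0))) *
        cq (- (of_int b * (xf j + (if i = j then 2 else 0)))) * (An (sw (Suc i) - sw i) * cq (- (of_int a * xe i))))"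
    using hopr_mult[OF f e]
    unfolding sh_hom(4) sh_cq mshift_hom(4,6,7) shift_x(3)[OF j i] sh_Ce_Cf(3)[OF j i] unfolding Ce_eq[OF i] add.commute[of "vF j"] add.commute[of b] .
qed

lemma rel_e_f_neq:
  assumes i: "i \<in> {1..<CARD('n)}" and j: "j \<in> {1..<CARD('n)}" and "i \<noteq> j"
  shows "actr (e_cur i a * f_cur j b - f_cur j b * e_cur i a :: 'n::finite alg) v k = 0"
proof -
  have "An ((sw (Suc i) - (if Suc i = j then 1 else 0)) - (sw i - (if i = j then 1 else 0))) *
        cq (- (of_int a * (xe i - (if j = i then 2 else 0)))) * (gam * An (sw j - sw (j - 1)) * cq (- (of_int b * xf j))) =
      gam * An ((sw j + (if j = i then 1 else 0)) - (sw (j - 1) + (if j - 1 = i then 1 else 0))) *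
        cq (- (of_int b * (xf j + (if i = j then 2 else 0)))) * (An (sw (Suc i) - sw i) * (cq (- (of_int a * xe i)) :: 'n dynfun fps))"
  \<comment> \<open>If \<open>j = i + 1\<close>, both weights contain \<open>s_j - s_i\<close>. In
    one order \<open>f_j\<close> lowers \<open>s_j\<close>, in the other \<open>e_i\<close> raises
    \<open>s_i\<close>, and either way the difference falls by 1 in one of the two weights.\<close>
  proof (cases "Suc i = j")
    case True
    then have "j - 1 = i" by auto
    then show ?thesis using True by (simp add: diff_diff_eq mult_ac add.commute)
  next
    case False
    then have "j - 1 \<noteq> i" using j by auto
    then show ?thesis using False assms(3) by (simp add: mult_ac)
  qed
  note hopr_eq[OF hopr_ef(1)[OF i j, of a b, unfolded this] hopr_ef(2)[OF i j], of v k]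
  then show ?thesis unfolding actr_diff by simp
qed

subsection \<open>Functions and inverse currents\<close>

lemma rel_fn:
  "actr (fn (f + g)) v k = actr (fn f + fn g) v k"
  "actr (fn (f * g)) v k = actr (fn f * fn g) v k"
  "actr (fn (map_fls mero_const a)) v k = actr (coe (fps_const (Poly_Mapping.single 0 a))) v k"
proof -
  have fn: "actr (fn f) v k = fps_const f * v k" for f v k
    using hopr_fn[of f] by (simp add: hopr_def op_def sh_0)
  show "actr (fn (f + g)) v k = actr (fn f + fn g) v k"
    by (simp add: fn actr_add distrib_right flip: fps_const_add)
  show "actr (fn (f * g)) v k = actr (fn f * fn g) v k"
    by (simp add: fn actr_mult mult.assoc flip: fps_const_mult)
  show "actr (fn (map_fls mero_const a)) v k = actr (coe (fps_const (Poly_Mapping.single 0 a))) v k"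
    by (simp add: fn actr_coe ev_def fps_map_const rhom_ev0 ev0_simps)
qed

lemma hopr_cur_prod:
  assumes X: "\<And>r. hopr (X r) s r (c r)" and Y: "\<And>r. hopr (Y r) t r (d r)" and x: "psummable (\<lambda>r. X r * Y (n - r))"
  shows "hopr (cur_prod X Y n) (s + t) n (psum (\<lambda>r. sh (- t) (c r) * d (n - r)))"
proof -
  have h: "hopr (X r * Y (n - r)) (s + t) n (sh (- t) (c r) * d (n - r))" for r
    using hopr_mult[OF X[of r] Y[of "n - r"]] by simp
  have "s + t \<in> dyn_space" using h unfolding hopr_def by blast
  from hopr_psum(2)[OF x h this] show ?thesis
    unfolding cur_prod_def int_suminf_psum[OF x] .
qed

lemma hopr_kk_inv:
  assumes j: "j \<in> {1..CARD('n)}" and l: "l \<in> {1..CARD('n)}"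
  shows "hopr (cur_prod (kplus j) (kplus_inv l) n :: 'n::finite alg) (vK j + - vK l) n (ann_coeff (Gs j * GsI l) n)"
    "hopr (cur_prod (kplus_inv l) (kplus j) n :: 'n::finite alg) (- vK l + vK j) n (ann_coeff (GsI l * Gs j) n)"
proof -
  have 1: "psummable (\<lambda>r. kplus j r * kplus_inv l (n - r) :: 'n alg)" "psummable (\<lambda>r. kplus_inv l r * kplus j (n - r) :: 'n alg)"
    unfolding kplus_coeff kplus_inv_coeff by (rule ann_coeff_mult(1))+
  show "hopr (cur_prod (kplus j) (kplus_inv l) n :: 'n::finite alg) (vK j + - vK l) n (ann_coeff (Gs j * GsI l) n)"
    using hopr_cur_prod[OF hopr_k'(1)[OF j] hopr_k'(2)[OF l] 1(1)]
    unfolding sh_ann minus_minus ash_Gs_K ann_coeff_mult(2) .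
  show "hopr (cur_prod (kplus_inv l) (kplus j) n :: 'n::finite alg) (- vK l + vK j) n (ann_coeff (GsI l * Gs j) n)"
    using hopr_cur_prod[OF hopr_k'(2)[OF l] hopr_k'(1)[OF j] 1(2)]
    unfolding sh_ann ash_Gs_K ann_coeff_mult(2) .
qed

lemma hopr_if_1: "hopr (if n = 0 then 1 else 0) 0 n (if n = 0 then 1 else 0)"
  using hopr_1 hopr_0[OF zero_in_dyn] by (cases "n = 0") simp_all

lemma rel_kk_inv:
  assumes "l \<in> {1..CARD('n)}"
  shows "actr (cur_prod (kplus l) (kplus_inv l) n) v k = actr (if n = 0 then 1 else (0 :: 'n::finite alg)) v k"
    "actr (cur_prod (kplus_inv l) (kplus l) n) v k = actr (if n = 0 then 1 else (0 :: 'n alg)) v k"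
proof -
  have G: "Gs l * GsI l = (1 :: 'n dynfun fps fps)" "GsI l * Gs l = (1 :: 'n dynfun fps fps)"
    by (simp_all only: Gs_GsI mult.commute[of "GsI l"])
  show "actr (cur_prod (kplus l) (kplus_inv l) n) v k = actr (if n = 0 then 1 else (0 :: 'n alg)) v k"
    using hopr_kk_inv(1)[OF assms assms, of n, unfolded G ann_coeff_1 right_minus] hopr_if_1 by (rule hopr_eq)
  show "actr (cur_prod (kplus_inv l) (kplus l) n) v k = actr (if n = 0 then 1 else (0 :: 'n alg)) v k"
    using hopr_kk_inv(2)[OF assms assms, of n, unfolded G ann_coeff_1 left_minus] hopr_if_1 by (rule hopr_eq)
qed

text \<open>\<open>Gs l\<close> contains only \<open>s_(l-1)\<close> and \<open>s_l\<close>, which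
  \<open>e_j\<close> and \<open>f_j\<close> fix when \<open>j\<close> is neither index; out of range
  one of the operators is zero.\<close>

lemma rel_k_comm:
  assumes "l \<noteq> j" "l \<noteq> Suc j"
  shows "actr (kplus l a * e_cur j b :: 'n::finite alg) v k = actr (e_cur j b * kplus l a) v k"
    "actr (kplus l a * f_cur j b :: 'n alg) v k = actr (f_cur j b * kplus l a) v k"
proof -
  let ?P = "l \<in> {1..CARD('n)} \<and> j \<in> {1..<CARD('n)}"
  have "actr (kplus l a * e_cur j b :: 'n alg) v k = actr (e_cur j b * kplus l a) v k \<and>
    actr (kplus l a * f_cur j b :: 'n alg) v k = actr (f_cur j b * kplus l a) v k"
  proof (cases ?P)
    case True
    then have l: "l \<in> {1..CARD('n)}" and j: "j \<in> {1..<CARD('n)}" and r: "l \<le> CARD('n)" "l - 1 \<le> CARD('n)" by auto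
    have n: "l \<noteq> j" "l - 1 \<noteq> j" using assms l by auto
    have s: "mero_shift (- vE j) (sw l) = (sw l :: (dynvar, 'n) mero)" "mero_shift (- vE j) (sw (l - 1)) = (sw (l - 1) :: (dynvar, 'n) mero)"
      "mero_shift (- vF j) (sw l) = (sw l :: (dynvar, 'n) mero)" "mero_shift (- vF j) (sw (l - 1)) = (sw (l - 1) :: (dynvar, 'n) mero)"
      unfolding shift_sw[OF r(1) j] shift_sw[OF r(2) j] using n by simp_all
    have G: "ash (- vE j) (Gs l) = (Gs l :: 'n dynfun fps fps)" "ash (- vF j) (Gs l) = (Gs l :: 'n dynfun fps fps)"
      unfolding ash_Gs s by (simp_all only: Gs_def)
    have C: "sh (- vK l) (Ce j) = (Ce j :: 'n dynfun fps)" "sh (- vK l) (Cf j) = (Cf j :: 'n dynfun fps)"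
      unfolding Ce_eq[OF j] Cf_eq[OF j] by (simp_all add: sh_hom sh_gam sh_An mshift_hom shift_sw_K)
    have x: "mero_shift (- vK l) (xe j) = (xe j :: (dynvar, 'n) mero)" "mero_shift (- vK l) (xf j) = (xf j :: (dynvar, 'n) mero)"
      by (simp_all add: xe_def xf_def mshift_hom mshift_numeral shift_sw_K)
    note k = hopr_k'(1)[OF l, of a]
    have e: "hopr (e_cur j b :: 'n alg) (vE j) b (Ce j * cq (- (of_int b * xe j)))"
      and f: "hopr (f_cur j b :: 'n alg) (vF j) b (Cf j * cq (- (of_int b * xf j)))"
      by (rule hopr_e hopr_f)+
    have 1: "hopr (kplus l a * e_cur j b :: 'n alg) (vK l + vE j) (a + b) (ann_coeff (Gs l) a * (Ce j * cq (- (of_int b * xe j))))"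
      "hopr (kplus l a * f_cur j b :: 'n alg) (vK l + vF j) (a + b) (ann_coeff (Gs l) a * (Cf j * cq (- (of_int b * xf j))))"
      using hopr_mult[OF k e] hopr_mult[OF k f] unfolding sh_ann G .
    have 2: "hopr (e_cur j b * kplus l a :: 'n alg) (vE j + vK l) (b + a) (Ce j * cq (- (of_int b * xe j)) * ann_coeff (Gs l) a)"
      "hopr (f_cur j b * kplus l a :: 'n alg) (vF j + vK l) (b + a) (Cf j * cq (- (of_int b * xf j)) * ann_coeff (Gs l) a)"
      using hopr_mult[OF e k] hopr_mult[OF f k] unfolding sh_hom(4) sh_cq mshift_hom(4,6,7) C x .
    show ?thesis
      using hopr_eq[OF 1(1) 2(1)[unfolded add.commute[of "vE j"] add.commute[of b] mult.commute[of _ "ann_coeff (Gs l) a"]]]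
        hopr_eq[OF 1(2) 2(2)[unfolded add.commute[of "vF j"] add.commute[of b] mult.commute[of _ "ann_coeff (Gs l) a"]]] by blast
  next
    case False
    then consider "l \<notin> {1..CARD('n)}" | "j \<notin> {1..<CARD('n)}" by blast
    then show ?thesis
    proof cases
      case 1
      show ?thesis unfolding hopr_mult_zero[OF hopr_range(5)[OF 1] hopr_e] hopr_mult_zero[OF hopr_range(5)[OF 1] hopr_f] by simp
    next
      case 2
      show ?thesis unfolding hopr_mult_zero[OF hopr_range(1)[OF 2] hopr_k] hopr_mult_zero[OF hopr_range(2)[OF 2] hopr_k] by simp
    qed
  qed
  then show "actr (kplus l a * e_cur j b :: 'n alg) v k = actr (e_cur j b * kplus l a) v k"
    "actr (kplus l a * f_cur j b :: 'n alg) v k = actr (f_cur j b * kplus l a) v k" by blast+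
qed

subsection \<open>The scalar factors at \<open>c = 0\<close>\<close>

lemma fps_prod_nth_0: "fps_nth (\<Prod>n\<in>S. v n) 0 = (\<Prod>n\<in>S. fps_nth (v n) 0)"
  by (induction S rule: infinite_finite_induct) simp_all

lemma plim_nth_0: "(\<And>n. fps_nth (v n) 0 = 1) \<Longrightarrow> fps_nth (plim v) 0 = 1"
  by (rule fps_ext) (simp add: plim_def fps_prod_nth_0 del: prod.lessThan_Suc)

definition euler_scal :: "nat \<Rightarrow> scal fps fps"
  where "euler_scal N = Abs_fps (\<lambda>k. fps_const (Poly_Mapping.single 0 (fps_nth (euler_ser (qpow (of_nat (2 * N)))) k)))"

lemma euler_scal_nth_0: "fps_nth (euler_scal N) 0 = 1"
  by (simp add: euler_scal_def euler_ser_def)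

lemma qpoch2_ser_plim:
  assumes t: "fps_nth t 0 = 0"
  shows "qpoch2_ser N a t = plim (\<lambda>n. fps_dilate (a * t ^ n) (euler_scal N))"
proof -
  have "agree n (fps_dilate (a * t ^ n) (euler_scal N)) 1" for n
    unfolding agree_def
  proof (intro allI impI)
    fix k i assume i: "i < n"
    show "fps_nth (fps_nth (fps_dilate (a * t ^ n) (euler_scal N)) k) i = fps_nth (fps_nth 1 k) i"
    proof (cases k)
      case 0
      then show ?thesis by (simp add: fps_dilate_def euler_scal_nth_0)
    next
      case (Suc m)
      have "fps_nth (fps_dilate (a * t ^ n) (euler_scal N)) k = (a * (a * t ^ n) ^ m * fps_nth (euler_scal N) k) * t ^ n"
        by (simp add: Suc fps_dilate_def mult_ac)
      then have "fps_nth (fps_nth (fps_dilate (a * t ^ n) (euler_scal N)) k) i = 0"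
        using power_nth_eq_0[OF t i] by simp
      then show ?thesis by (simp add: Suc)
    qed
  qed
  then show ?thesis unfolding qpoch2_ser_def euler_scal_def[symmetric] by (rule coeff_lim_plim)
qed

lemma evs_dil: "evs (fps_dilate c U) = fps_dilate (ev c) (evs U)"
  by (simp add: evs_def fps_eq_iff fps_dilate_def ev_hom)

lemma evs_qpoch2_ser:
  assumes t: "is_nome t"
  shows "evs (qpoch2_ser N a t) = plim (\<lambda>n. fps_dilate (ev a * fps_X ^ n) (evs (euler_scal N)))"
  unfolding qpoch2_ser_plim[OF is_nomeD(2)[OF t]] evs_def ev_def fps_map_plim[OF rhom_ev0]
  by (simp add: evs_dil[unfolded evs_def ev_def] ev_hom[unfolded ev_def] is_nomeD(1)[OF t, unfolded ev_def])

lemma qpoch2_ser_nth_0: "fps_nth t 0 = 0 \<Longrightarrow> fps_nth (qpoch2_ser N a t) 0 = 1"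
  unfolding qpoch2_ser_plim by (rule plim_nth_0) (simp add: fps_dilate_def euler_scal_nth_0)

lemma evs_one:
  assumes "fps_nth F 0 = 1" shows "evs F \<noteq> (0 :: 'n::finite dynfun fps fps)"
proof -
  have "fps_nth (evs F) 0 = (1 :: 'n dynfun fps)"
    unfolding ev_nth_evs[symmetric] assms by (rule ev_hom)
  then show ?thesis by auto
qed

text \<open>Once starred and unstarred products agree, numerator and denominator of
  \<open>rho\<close> consist of the same four products.\<close>

lemma evs_rho: "evs (rho N) = (1 :: 'n::finite dynfun fps fps)"
proof -
  have star: "evs (qpoch2_ser N a nome_star) = (evs (qpoch2_ser N a nome) :: 'n dynfun fps fps)" for a
    by (simp add: evs_qpoch2_ser nomes)
  have nth: "fps_nth (qpoch2_ser N a nome) 0 = 1" "fps_nth (qpoch2_ser N a nome_star) 0 = 1" for a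
    by (simp_all add: qpoch2_ser_nth_0 is_nomeD(2)[OF nomes(1)] is_nomeD(2)[OF nomes(2)])
  define u where "u = qpoch2_ser N (qmon 2 0) nome_star * qpoch2_ser N (qmon (2 * int N - 2) 0) nome_star *
     qpoch2_ser N (qmon 0 0) nome * qpoch2_ser N (qmon (2 * int N) 0) nome"
  define v where "v = qpoch2_ser N (qmon 0 0) nome_star * qpoch2_ser N (qmon (2 * int N) 0) nome_star *
     qpoch2_ser N (qmon 2 0) nome * qpoch2_ser N (qmon (2 * int N - 2) 0) nome"
  have v0: "fps_nth v 0 = 1" by (simp add: v_def nth)
  have "evs v * evs (rho N) = (evs u :: 'n dynfun fps fps)"
    unfolding rhom_mult[OF rhom_evs, symmetric] rho_def u_def[symmetric] v_def[symmetric] fps_quot_mult[OF v0] by (rule refl)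
  also have "evs u = evs v * (1 :: 'n dynfun fps fps)"
    unfolding u_def v_def rhom_mult[OF rhom_evs] star mult_1_right by (simp only: mult_ac)
  finally show ?thesis unfolding mult_left_cancel[OF evs_one[OF v0]] .
qed

lemma poch_nonzero: "poch a fps_X \<noteq> 0"
  using poch_nth_0[of fps_X a] by auto

text \<open>For the additional factors in the relation of \<open>k_j\<close> and \<open>k_l\<close>
  with \<open>j < l\<close>: a quotient with base \<open>p\<^sup>*\<close> and one with base
  \<open>p\<close>, inverse to each other once the bases agree.\<close>

lemma evs_qfrac_cancel:
  assumes "is_nome t" "is_nome t'" "ev a = (ev b' :: 'n::finite dynfun fps)" "ev b = (ev a' :: 'n dynfun fps)"
  shows "evs (qfrac a b t * qfrac a' b' t') = (1 :: 'n dynfun fps fps)"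
proof -
  have "poch (ev b) fps_X * evs (qfrac a b t) * (poch (ev b') fps_X * evs (qfrac a' b' t')) = poch (ev b :: 'n dynfun fps) fps_X * poch (ev b') fps_X * 1"
    unfolding evs_qfrac[OF assms(1)] evs_qfrac[OF assms(2)] unfolding assms(3,4) by (simp add: mult.commute)
  then have "poch (ev b) fps_X * poch (ev b') fps_X * evs (qfrac a b t * qfrac a' b' t') = poch (ev b :: 'n dynfun fps) fps_X * poch (ev b') fps_X * 1"
    unfolding rhom_mult[OF rhom_evs] by (simp only: mult_ac)
  moreover have "poch (ev b :: 'n dynfun fps) fps_X * poch (ev b') fps_X \<noteq> 0" by (simp add: poch_nonzero)
  ultimately show ?thesis by simp
qed

lemma ev_qpoch:
  assumes t: "is_nome t"
  shows "fps_nth (ev (qpoch a t)) i = fps_nth (\<Prod>n<Suc i. 1 - ev a * fps_X ^ n) i"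
    "fps_nth a 0 = 0 \<Longrightarrow> fps_nth (qpoch a t) 0 = 1"
proof -
  have stable: "fps_nth (\<Prod>n<m. 1 - a * t ^ n) i = fps_nth (\<Prod>n<Suc i. 1 - a * t ^ n) i" if "m \<ge> Suc i" for m i
    using that
  proof (induction m rule: dec_induct)
    case (step m)
    have "fps_nth ((\<Prod>n<m. 1 - a * t ^ n) * a * t ^ m) i = 0"
      by (rule power_nth_eq_0[OF is_nomeD(2)[OF t]]) (use step in simp)
    then show ?case using step by (simp add: right_diff_distrib mult.assoc)
  qed simp
  have "(\<lambda>m. \<Prod>n<m. 1 - a * t ^ n) \<longlonglongrightarrow> Abs_fps (\<lambda>i. fps_nth (\<Prod>n<Suc i. 1 - a * t ^ n) i)"
    unfolding tendsto_fps_iff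
  proof
    fix i
    show "\<forall>\<^sub>F m in sequentially. fps_nth (\<Prod>n<m. 1 - a * t ^ n) i = fps_nth (Abs_fps (\<lambda>i. fps_nth (\<Prod>n<Suc i. 1 - a * t ^ n) i)) i"
      unfolding fps_nth_Abs_fps by (rule eventually_sequentiallyI[of "Suc i"]) (rule stable)
  qed
  then have lim: "qpoch a t = Abs_fps (\<lambda>i. fps_nth (\<Prod>n<Suc i. 1 - a * t ^ n) i)"
    unfolding qpoch_def by (rule limI)
  have "fps_nth (ev (qpoch a t)) i = fps_nth (ev (\<Prod>n<Suc i. 1 - a * t ^ n)) i"
    by (simp add: lim ev_def)
  also have "ev (\<Prod>n<Suc i. 1 - a * t ^ n) = (\<Prod>n<Suc i. 1 - ev a * fps_X ^ n)"
    by (simp only: rhom_prod[OF rhom_ev] ev_hom is_nomeD(1)[OF t])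
  finally show "fps_nth (ev (qpoch a t)) i = fps_nth (\<Prod>n<Suc i. 1 - ev a * fps_X ^ n) i" .
  show "fps_nth (qpoch a t) 0 = 1" if "fps_nth a 0 = 0" by (simp add: lim that)
qed

lemma ev_kappa: "ev kappa = (1 :: 'n::finite dynfun fps)"
proof -
  have n0: "fps_nth nome 0 = 0" "fps_nth nome_star 0 = 0" by (rule is_nomeD(2)[OF nomes(1)], rule is_nomeD(2)[OF nomes(2)])
  have star: "ev (qpoch (nome_star * x) nome_star) = (ev (qpoch (nome * x) nome) :: 'n dynfun fps)" for x
    by (rule fps_ext) (simp only: ev_qpoch(1)[OF nomes(1)] ev_qpoch(1)[OF nomes(2)] ev_hom ev_nome ev_nome_star)
  let ?u = "qpoch nome nome * qpoch (nome_star * qmon 2 0) nome_star" and ?v = "qpoch nome_star nome_star * qpoch (nome * qmon 2 0) nome"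
  have v0: "fps_nth ?v 0 = 1" using n0 by (simp add: ev_qpoch(2)[OF nomes(1)] ev_qpoch(2)[OF nomes(2)])
  have "ev ?v * ev kappa = (ev ?u :: 'n dynfun fps)"
    unfolding ev_hom(4)[symmetric, of _ kappa] unfolding kappa_def fps_quot_mult[OF v0] by (rule refl)
  also have "ev ?u = ev ?v * (1 :: 'n dynfun fps)"
    using star[of 1] star[of "qmon 2 0"] by (simp add: ev_hom)
  finally have e: "ev ?v * ev kappa = ev ?v * (1 :: 'n dynfun fps)" .
  have "fps_nth (ev ?v :: 'n dynfun fps) 0 = ev0 (fps_nth ?v 0)" by (simp only: ev_def fps_map_nth)
  then have "ev ?v \<noteq> (0 :: 'n dynfun fps)" unfolding v0 rhom_1[OF rhom_ev0] by auto
  with e show ?thesis by simp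
qed

subsection \<open>Relations with the \<open>k\<^sub>l\<close>\<close>

lemma psummable_power:
  "(\<And>i. finite {r. f r \<le> i}) \<Longrightarrow> psummable (\<lambda>r. fps_X ^ f r * (y r :: 'a::ring_1 fps))"
  by (rule psummableI_finite[where S = "\<lambda>i. {r. f r \<le> i}"]) (auto simp: fps_X_power_mult_nth)

lemma fps_X_power_comm: "x * fps_X ^ m = fps_X ^ m * (x :: 'a::ring_1 fps)"
  by (simp add: fps_mult_fps_X_power_commute)

text \<open>Convergence comes from the power of \<open>p\<close> that the coefficients of
  \<open>k\<^sup>+\<close> at negative powers of \<open>z\<close> carry, so nothing is asked of the
  structure function.\<close>

lemma psummable_k:
  fixes x y :: "nat \<Rightarrow> 'n::finite alg"
  shows "psummable (\<lambda>n. coe (r n) * (x n * kplus l (b - int n)))"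
proof -
  have "coe (r n) * (x n * kplus l (b - int n)) = fps_X ^ nat (- (b - int n)) * (coe (r n) * (x n * letter (Kgen l (- (b - int n)))))" for n
  proof -
    have "kplus l (b - int n) = fps_X ^ nat (- (b - int n)) * (letter (Kgen l (- (b - int n))) :: 'n alg)"
      by (simp only: kplus_def coe_hom coe_nome)
    then show ?thesis by (simp only: mult.assoc[symmetric] fps_X_power_comm)
  qed
  moreover have "finite {n. nat (- (b - int n)) \<le> i}" for i
    by (rule finite_subset[of _ "{..nat b + i}"]) auto
  ultimately show ?thesis by (simp only: psummable_power)
qed

lemma hopr_act2_one:
  fixes C :: "int \<Rightarrow> int \<Rightarrow> 'n::finite dynfun fps"
  assumes Y: "evs Y = (1 :: 'n dynfun fps fps)" and s: "s \<in> dyn_space" and h: "\<And>a b. hopr (\<Phi> a b) s (a + b) (C a b)" and d: "d1 + d2 = 0"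
    and x: "psummable (\<lambda>n. coe (fps_nth Y n) * \<Phi> (a - int n * d1) (b - int n * d2))"
  shows "hopr (act2 Y (d1, d2) \<Phi> a b) s (a + b) (C a b)"
proof -
  have "psum (\<lambda>n. ev (fps_nth Y n) * C (a - int n * d1) (b - int n * d2)) =
      (\<Sum>n\<in>{0}. ev (fps_nth Y n) * C (a - int n * d1) (b - int n * d2))"
    by (rule psum_sum) (auto simp: ev_nth_evs Y)
  then show ?thesis using hopr_act2(2)[OF s h d x] by (simp add: ev_nth_evs Y)
qed

text \<open>Both structure functions reduce to 1, and every \<open>Gs\<close> is invariant under the
  translations \<open>vK\<close>, so the operators commute.\<close>

lemma rel_k_k:
  assumes j: "j \<in> {1..CARD('n)}" and l: "l \<in> {1..CARD('n)}" and Y: "evs Y = (1 :: 'n dynfun fps fps)" "evs Y' = (1 :: 'n dynfun fps fps)"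
  shows "actr (act2 Y z21 (ordered (kplus j) (kplus l)) a b) v k = actr (act2 Y' z12 (swapped (kplus j) (kplus l)) a b :: 'n::finite alg) v k"
proof -
  have d: "vK j + vK l \<in> dyn_space" by (intro dyn_add v_dyn)
  have o: "hopr (ordered (kplus j) (kplus l) a b :: 'n alg) (vK j + vK l) (a + b) (ann_coeff (Gs j) a * ann_coeff (Gs l) b)" for a b
    using hopr_mult[OF hopr_k'(1)[OF j] hopr_k'(1)[OF l], of a b] unfolding ordered_def sh_ann ash_Gs_K .
  have s: "hopr (swapped (kplus j) (kplus l) a b :: 'n alg) (vK j + vK l) (a + b) (ann_coeff (Gs j) a * ann_coeff (Gs l) b)" for a b
    using hopr_mult[OF hopr_k'(1)[OF l] hopr_k'(1)[OF j], of b a]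
    unfolding swapped_def sh_ann ash_Gs_K add.commute[of "vK l"] add.commute[of b] mult.commute[of "ann_coeff (Gs l) b"] .
  have "hopr (act2 Y z21 (ordered (kplus j) (kplus l)) a b :: 'n alg) (vK j + vK l) (a + b) (ann_coeff (Gs j) a * ann_coeff (Gs l) b)"
    unfolding z21_def using psummable_k by (intro hopr_act2_one[OF Y(1) d o]) (simp_all add: ordered_def)
  moreover have "hopr (act2 Y' z12 (swapped (kplus j) (kplus l)) a b :: 'n alg) (vK j + vK l) (a + b) (ann_coeff (Gs j) a * ann_coeff (Gs l) b)"
    unfolding z12_def using psummable_k by (intro hopr_act2_one[OF Y(2) d s]) (simp_all add: swapped_def)
  ultimately show ?thesis by (rule hopr_eq)
qed

lemma poch_pz: "poch (cq x) fps_X = pz (qpow x)" "poch (fps_X * cq x) fps_X = pz1 (qpow x)"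
  by (simp_all add: pz_def pz1_def cq_def dil_poch mult.commute)

lemma dil_poch_X: "fps_dilate c (poch a fps_X) = poch (a * c) fps_X" by (simp add: dil_poch)

text \<open>As \<open>X\<close> is supported at \<open>z\<^sub>2 = q^x\<close>, the relation
  concerns series in \<open>z\<^sub>1\<close> alone. The left structure function becomes a quotient
  in \<open>p/z\<^sub>1\<close>, the right one a quotient in \<open>z\<^sub>1\<close>. The
  conditions on \<open>m1\<close> and \<open>m2\<close> make these the two halves of a quotient of
  theta functions, and the relation turns into \<open>th\<close>, the behaviour of
  \<open>Gs l\<close> under the translation of \<open>X\<close>.\<close>

lemma rel_k_X:
  fixes X :: "int \<Rightarrow> 'n::finite alg"
  assumes l: "l \<in> {1..CARD('n)}" and X: "\<And>b. hopr (X b) s b (C * cq (- (of_int b * x)))" and s: "s \<in> dyn_space" and t: "is_nome t"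
    and inv: "sh (- vK l) C = C" "mero_shift (- vK l) x = x" and m: "m1 = - n2" "m2 = - n1"
    and th: "thz (qpow (of_int n2 - x)) * ash (- s) (Gs l) = Cc (of_int e) * (thz (qpow (of_int n1 - x)) * Gs l)"
  shows "actr (act2 (qfrac (t * qmon m1 i1) (t * qmon m2 i2) t) z21 (ordered (kplus l) X) a b) v k =
    actr (coe (qmon e 0) * act2 (qfrac (qmon n1 i3) (qmon n2 i4) t) z12 (swapped (kplus l) X) a b) v k"
proof -
  let ?Y = "qfrac (t * qmon m1 i1) (t * qmon m2 i2) t" and ?Z = "qfrac (qmon n1 i3) (qmon n2 i4) t"
  define G' where "G' = ash (- s) (Gs l)"
  define W where "W = fps_dilate (cq (- x)) (evs ?Z)"
  define V where "V = fps_quot (pz (qpow (x - of_int n2))) (pz (qpow (x - of_int n1)))"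
  have cqx: "cq (of_int n) * cq (- x) = cq (of_int n - x)" for n by (simp flip: cq_add)
  have cqx': "cq (- of_int n) * cq x = cq (x - of_int n)" for n by (simp add: add.commute flip: cq_add)
  have W: "pz (qpow (of_int n2 - x)) * W = pz (qpow (of_int n1 - x))"
  proof -
    have "poch (ev (qmon n2 i4)) fps_X * evs ?Z = (poch (ev (qmon n1 i3)) fps_X :: 'n dynfun fps fps)"
      by (rule evs_qfrac[OF t])
    then have "fps_dilate (cq (- x)) (poch (cq (of_int n2)) fps_X * evs ?Z) = fps_dilate (cq (- x)) (poch (cq (of_int n1)) fps_X)"
      by (simp add: ev_qmon)
    then show ?thesis unfolding dil_mult dil_poch_X cqx unfolding poch_pz W_def .
  qed
  have V: "pz (qpow (x - of_int n1)) * V = pz (qpow (x - of_int n2))"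
    unfolding V_def by (rule fps_quot_mult) (rule pz_nth_0)
  \<comment> \<open>The left structure function at \<open>z\<^sub>2 = q^x\<close>, as a series in
    \<open>1/z\<^sub>1\<close>, is \<open>V\<close> at \<open>p/z\<^sub>1\<close>.\<close>
  have V1: "fps_dilate fps_X V = fps_dilate (cq x) (evs ?Y)"
  proof -
    have "poch (ev (t * qmon m2 i2)) fps_X * evs ?Y = (poch (ev (t * qmon m1 i1)) fps_X :: 'n dynfun fps fps)"
      by (rule evs_qfrac[OF t])
    then have "fps_dilate (cq x) (poch (fps_X * cq (- of_int n1)) fps_X * evs ?Y) = fps_dilate (cq x) (poch (fps_X * cq (- of_int n2)) fps_X)"
      by (simp add: ev_qmon ev_hom is_nomeD(1)[OF t] m)
    then have "pz1 (qpow (x - of_int n1)) * fps_dilate (cq x) (evs ?Y) = pz1 (qpow (x - of_int n2))"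
      unfolding dil_mult dil_poch_X mult.assoc[of fps_X] cqx' unfolding poch_pz .
    also have "\<dots> = pz1 (qpow (x - of_int n1)) * fps_dilate fps_X V"
      unfolding pz1_def V[symmetric] dil_mult by (rule refl)
    finally have e: "pz1 (qpow (x - of_int n1)) * fps_dilate (cq x) (evs ?Y) = pz1 (qpow (x - of_int n1)) * fps_dilate fps_X V" .
    have "pz1 (qpow (x - of_int n1)) \<noteq> 0" using pz_nth_0(2)[of "qpow (x - of_int n1)"] by auto
    with e show ?thesis by simp
  qed
  have key: "ann_y V * G' = Cc (of_int e) * (ann_z W * Gs l)"
  proof -
    \<comment> \<open>Multiplication by the two denominators completes \<open>V\<close> and
      \<open>W\<close> to theta functions.\<close>
    let ?D = "ann_y (pz (qpow (x - of_int n1))) * ann_z (pz (qpow (of_int n2 - x)))"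
    have i: "inverse (qpow (of_int n - x)) = qpow (x - of_int n)" for n by (simp add: qpow_inverse)
    have "?D * (ann_y V * G') = thz (qpow (of_int n2 - x)) * G'"
      unfolding thz_def i V[symmetric] ann_y_mult by (simp only: mult_ac)
    also have "\<dots> = Cc (of_int e) * (thz (qpow (of_int n1 - x)) * Gs l)" unfolding G'_def by (rule th)
    also have "\<dots> = ?D * (Cc (of_int e) * (ann_z W * Gs l))"
      unfolding thz_def i W[symmetric] ann_z_mult by (simp only: mult_ac)
    finally have e: "?D * (ann_y V * G') = ?D * (Cc (of_int e) * (ann_z W * Gs l))" .
    have "fps_nth (fps_nth ?D 0) 0 \<noteq> 0" by (simp add: ann_nth_0 pz_nth_0)
    then have nD: "?D \<noteq> 0" by auto
    from e show ?thesis unfolding mult_left_cancel[OF nD] .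
  qed
  have d: "vK l + s \<in> dyn_space" by (intro dyn_add v_dyn s)
  have o: "hopr (ordered (kplus l) X a b) (vK l + s) (a + b) (ann_coeff G' a * (C * cq (- (of_int b * x))))" for a b
    using hopr_mult[OF hopr_k'(1)[OF l] X, of a b] unfolding ordered_def sh_ann G'_def .
  have w: "hopr (swapped (kplus l) X a b) (vK l + s) (a + b) (C * cq (- (of_int b * x)) * ann_coeff (Gs l) a)" for a b
    using hopr_mult[OF X hopr_k'(1)[OF l], of b a]
    unfolding swapped_def sh_hom(4) sh_cq mshift_hom(4,6,7) inv add.commute[of s] add.commute[of b] .
  let ?B = "C * cq (- (of_int b * x))"
  have 1: "hopr (act2 ?Y z21 (ordered (kplus l) X) a b) (vK l + s) (a + b) (?B * ann_coeff (ann_y V * G') a)"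
  proof -
    have c: "cdiv 0 ?Y" by (rule qfrac_cdiv(2)) (simp_all add: is_nomeD(2)[OF t])
    have e: "ev (fps_nth ?Y n) * (ann_coeff G' (a - int n * - 1) * (C * cq (- (of_int (b - int n * 1) * x)))) =
        ?B * (fps_nth (fps_dilate fps_X V) n * ann_coeff G' (a + int n))" for n
    proof -
      have "- (of_int (b - int n * 1) * x) = - (of_int b * x) + of_nat n * x" by (simp add: algebra_simps)
      then have "cq (- (of_int (b - int n * 1) * x)) = cq (- (of_int b * x)) * cq x ^ n" by (simp only: cq_add cq_power)
      then show ?thesis unfolding V1 by (simp add: fps_dilate_def ev_nth_evs mult_ac)
    qed
    have p: "psummable (\<lambda>n. fps_nth (fps_dilate fps_X V) n * ann_coeff G' (a + int n))"
      by (rule psummable_cdiv[OF cdiv_dil]) simp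
    have "hopr (act2 ?Y (- 1, 1) (ordered (kplus l) X) a b) (vK l + s) (a + b)
        (psum (\<lambda>n. ev (fps_nth ?Y n) * (ann_coeff G' (a - int n * - 1) * (C * cq (- (of_int (b - int n * 1) * x))))))"
      by (rule hopr_act2(2)[OF d o _ psummable_coe_cdiv[OF c]]) simp
    then show ?thesis unfolding e psum_mult_left(2)[OF p] ann_coeff_y_mult z21_def .
  qed
  have 2: "hopr (act2 ?Z z12 (swapped (kplus l) X) a b) (vK l + s) (a + b) (?B * ann_coeff (ann_z W * Gs l) a)"
  proof -
    have e: "ev (fps_nth ?Z n) * (C * cq (- (of_int (b - int n * - 1) * x)) * ann_coeff (Gs l) (a - int n * 1)) =
        ?B * (fps_nth W n * ann_coeff (Gs l) (a - int n))" for n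
    proof -
      have "- (of_int (b - int n * - 1) * x) = - (of_int b * x) + of_nat n * (- x)" by (simp add: algebra_simps)
      then have "cq (- (of_int (b - int n * - 1) * x)) = cq (- (of_int b * x)) * cq (- x) ^ n" by (simp only: cq_add cq_power)
      then show ?thesis unfolding W_def by (simp add: fps_dilate_def ev_nth_evs mult_ac)
    qed
    have p: "psummable (\<lambda>n. coe (fps_nth ?Z n) * swapped (kplus l) X (a - int n * 1) (b - int n * - 1))"
      unfolding swapped_def using psummable_k[of "fps_nth ?Z" "\<lambda>n. X (b - int n * - 1)" l a] by simp
    have "hopr (act2 ?Z (1, - 1) (swapped (kplus l) X) a b) (vK l + s) (a + b)
        (psum (\<lambda>n. ev (fps_nth ?Z n) * (C * cq (- (of_int (b - int n * - 1) * x)) * ann_coeff (Gs l) (a - int n * 1))))"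
      by (rule hopr_act2(2)[OF d w _ p]) simp
    then show ?thesis unfolding e psum_mult_left(2)[OF ann_coeff_z_mult(1)] ann_coeff_z_mult(2) z12_def .
  qed
  have e: "?B * ann_coeff (ann_y V * G') a = ev (qmon e 0) * (?B * ann_coeff (ann_z W * Gs l) a)"
    unfolding key ann_coeff_Cc ev_qmon by (simp only: mult_ac)
  show ?thesis by (rule hopr_eq[OF 1[unfolded e] hopr_coe[OF 2]])
qed

text \<open>For \<open>k_j\<close>, whose denominator is the part moved by \<open>e_j\<close> and
  \<open>f_j\<close>; \<open>th_num\<close> serves for \<open>k_(j+1)\<close>, where the numerator
  is moved. The theta function in \<open>T\<close> stays fixed.\<close>

lemma th_den: "thz (qpow u) * (Cc (c + e) * (T * thI (qpow u))) = Cc e * (thz (qpow u0) * (Cc c * (T * thI (qpow u0))))"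
proof -
  have "thz (qpow u) * (Cc (c + e) * (T * thI (qpow u))) = (thz (qpow u) * thI (qpow u)) * (Cc c * Cc e * T)"
    unfolding Cc_add by (simp only: mult_ac)
  also have "\<dots> = (thz (qpow u0) * thI (qpow u0)) * (Cc c * Cc e * T)" unfolding thz_thI by (rule refl)
  finally show ?thesis by (simp only: mult_ac)
qed

lemma th_num: "thz (qpow u) * (Cc (c + e) * (thz (qpow u0) * T)) = Cc e * (thz (qpow u0) * (Cc c * (thz (qpow u) * T)))"
  unfolding Cc_add by (simp only: mult_ac)

lemma K_inv:
  "sh (- vK l) (Ce j) = Ce j" "sh (- vK l) (Cf j) = Cf j"
  "mero_shift (- vK l) (xe j) = xe j" "mero_shift (- vK l) (xf j) = xf j"
  by (simp_all add: Ce_def Cf_def xe_def xf_def sh_hom sh_gam sh_An mshift_hom mshift_numeral shift_sw_K)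

lemma rel_k_e_f:
  assumes j: "j \<in> {1..<CARD('n)}"
  shows "actr (act2 (qfrac (nome_star * qmon (2 - int j) 2) (nome_star * qmon (- int j) 2) nome_star)
      z21 (ordered (kplus j) (e_cur j)) a b) v k =
    actr (coe (qmon (-1) 0) * act2 (qfrac (qmon (int j) (-2)) (qmon (int j - 2) (-2)) nome_star)
      z12 (swapped (kplus j) (e_cur j)) a b :: 'n::finite alg) v k"
  "actr (act2 (qfrac (nome_star * qmon (- 2 - int j) 2) (nome_star * qmon (- int j) 2) nome_star)
      z21 (ordered (kplus (Suc j)) (e_cur j)) a b) v k =
    actr (coe (qmon 1 0) * act2 (qfrac (qmon (int j) (-2)) (qmon (int j + 2) (-2)) nome_star)
      z12 (swapped (kplus (Suc j)) (e_cur j)) a b :: 'n alg) v k"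
  "actr (act2 (qfrac (nome * qmon (- int j) 0) (nome * qmon (2 - int j) 0) nome)
      z21 (ordered (kplus j) (f_cur j)) a b) v k =
    actr (coe (qmon 1 0) * act2 (qfrac (qmon (int j - 2) 0) (qmon (int j) 0) nome)
      z12 (swapped (kplus j) (f_cur j)) a b :: 'n alg) v k"
  "actr (act2 (qfrac (nome * qmon (- int j) 0) (nome * qmon (- 2 - int j) 0) nome)
      z21 (ordered (kplus (Suc j)) (f_cur j)) a b) v k =
    actr (coe (qmon (-1) 0) * act2 (qfrac (qmon (2 + int j) 0) (qmon (int j) 0) nome)
      z12 (swapped (kplus (Suc j)) (f_cur j)) a b :: 'n alg) v k"
proof -
  have l: "j \<in> {1..CARD('n)}" "Suc j \<in> {1..CARD('n)}" and r: "j \<le> CARD('n)" "j - 1 \<le> CARD('n)" "Suc j \<le> CARD('n)" using j by auto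
  note sw = r[THEN shift_sw(1)[OF _ j]] r[THEN shift_sw(2)[OF _ j]]
  have ne: "(j - 1 = j) = False" "(Suc j = j) = False" "(j = j) = True" "Suc j - 1 = j" using j by auto
  note G = ash_Gs(1)[of _ j] ash_Gs(1)[of _ "Suc j"]
  show "actr (act2 (qfrac (nome_star * qmon (2 - int j) 2) (nome_star * qmon (- int j) 2) nome_star)
      z21 (ordered (kplus j) (e_cur j)) a b) v k =
    actr (coe (qmon (-1) 0) * act2 (qfrac (qmon (int j) (-2)) (qmon (int j - 2) (-2)) nome_star)
      z12 (swapped (kplus j) (e_cur j)) a b :: 'n::finite alg) v k"
  proof (rule rel_k_X[OF l(1) hopr_e v_dyn(1) nomes(2) K_inv(1,3)])
    have e: "of_int (int j - 2) - xe j = of_nat j - 2 * (sw j + 1 :: (dynvar, 'n) mero)" "of_int (int j) - xe j = of_nat j - 2 * (sw j :: (dynvar, 'n) mero)"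
      "sw (j - 1) + 0 - (sw j + 1) = sw (j - 1) - sw j + (of_int (- 1) :: (dynvar, 'n) mero)" by (simp_all add: xe_def algebra_simps)
    show "thz (qpow (of_int (int j - 2) - xe j)) * ash (- vE j) (Gs j) =
        Cc (of_int (- 1)) * (thz (qpow (of_int (int j) - xe j)) * (Gs j :: 'n dynfun fps fps))"
      unfolding G sw ne if_True if_False e unfolding Gs_def add_0_right by (rule th_den)
  qed simp_all
  show "actr (act2 (qfrac (nome_star * qmon (- 2 - int j) 2) (nome_star * qmon (- int j) 2) nome_star)
      z21 (ordered (kplus (Suc j)) (e_cur j)) a b) v k =
    actr (coe (qmon 1 0) * act2 (qfrac (qmon (int j) (-2)) (qmon (int j + 2) (-2)) nome_star)
      z12 (swapped (kplus (Suc j)) (e_cur j)) a b :: 'n alg) v k"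
  proof (rule rel_k_X[OF l(2) hopr_e v_dyn(1) nomes(2) K_inv(1,3)])
    have e: "of_int (int j + 2) - xe j = of_nat (Suc j) + 1 - 2 * (sw j :: (dynvar, 'n) mero)" "of_int (int j) - xe j = of_nat (Suc j) + 1 - 2 * (sw j + 1 :: (dynvar, 'n) mero)"
      "sw j + 1 - (sw (Suc j) + 0) = sw j - sw (Suc j) + (of_int 1 :: (dynvar, 'n) mero)" by (simp_all add: xe_def algebra_simps)
    show "thz (qpow (of_int (int j + 2) - xe j)) * ash (- vE j) (Gs (Suc j)) =
        Cc (of_int 1) * (thz (qpow (of_int (int j) - xe j)) * (Gs (Suc j) :: 'n dynfun fps fps))"
      unfolding G ne(4) sw ne if_True if_False e unfolding Gs_def add_0_right ne by (rule th_num)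
  qed simp_all
  show "actr (act2 (qfrac (nome * qmon (- int j) 0) (nome * qmon (2 - int j) 0) nome)
      z21 (ordered (kplus j) (f_cur j)) a b) v k =
    actr (coe (qmon 1 0) * act2 (qfrac (qmon (int j - 2) 0) (qmon (int j) 0) nome)
      z12 (swapped (kplus j) (f_cur j)) a b :: 'n alg) v k"
  proof (rule rel_k_X[OF l(1) hopr_f v_dyn(2) nomes(1) K_inv(2,4)])
    have e: "of_int (int j) - xf j = of_nat j - 2 * (sw j - 1 :: (dynvar, 'n) mero)" "of_int (int j - 2) - xf j = of_nat j - 2 * (sw j :: (dynvar, 'n) mero)"
      "sw (j - 1) - 0 - (sw j - 1) = sw (j - 1) - sw j + (of_int 1 :: (dynvar, 'n) mero)" by (simp_all add: xf_def algebra_simps)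
    show "thz (qpow (of_int (int j) - xf j)) * ash (- vF j) (Gs j) =
        Cc (of_int 1) * (thz (qpow (of_int (int j - 2) - xf j)) * (Gs j :: 'n dynfun fps fps))"
      unfolding G sw ne if_True if_False e unfolding Gs_def diff_0_right by (rule th_den)
  qed simp_all
  show "actr (act2 (qfrac (nome * qmon (- int j) 0) (nome * qmon (- 2 - int j) 0) nome)
      z21 (ordered (kplus (Suc j)) (f_cur j)) a b) v k =
    actr (coe (qmon (-1) 0) * act2 (qfrac (qmon (2 + int j) 0) (qmon (int j) 0) nome)
      z12 (swapped (kplus (Suc j)) (f_cur j)) a b :: 'n alg) v k"
  proof (rule rel_k_X[OF l(2) hopr_f v_dyn(2) nomes(1) K_inv(2,4)])
    have e: "of_int (int j) - xf j = of_nat (Suc j) + 1 - 2 * (sw j :: (dynvar, 'n) mero)" "of_int (2 + int j) - xf j = of_nat (Suc j) + 1 - 2 * (sw j - 1 :: (dynvar, 'n) mero)"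
      "sw j - 1 - (sw (Suc j) - 0) = sw j - sw (Suc j) + (of_int (- 1) :: (dynvar, 'n) mero)" by (simp_all add: xf_def algebra_simps)
    show "thz (qpow (of_int (int j) - xf j)) * ash (- vF j) (Gs (Suc j)) =
        Cc (of_int (- 1)) * (thz (qpow (of_int (2 + int j) - xf j)) * (Gs (Suc j) :: 'n dynfun fps fps))"
      unfolding G ne(4) sw ne if_True if_False e unfolding Gs_def diff_0_right ne by (rule th_num)
  qed simp_all
qed

subsection \<open>The commutator of \<open>e\<^sub>j\<close> and \<open>f\<^sub>j\<close>\<close>

lemma qpow_powi: "qpow x powi m = qpow (of_int m * x)"
proof -
  have n: "qpow x ^ k = qpow (of_nat k * x)" for k :: nat and x
    by (induction k) (simp_all add: qpow_0 distrib_right flip: qpow_add)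
  show ?thesis
  proof (cases "m \<ge> 0")
    case True
    then show ?thesis using n[of x "nat m"] by (simp add: power_int_def)
  next
    case False
    then show ?thesis using n[of "- x" "nat (- m)"] by (simp add: power_int_def qpow_inverse)
  qed
qed

lemma th_An: "th (2 * d - 1) = cq d * An d"
  using cq_minus[of d] by (simp add: An_def mult.assoc[symmetric])

lemma ann_coeff_minus_sum:
  fixes G H :: "'a::comm_ring_1 fps fps"
  shows "psum (\<lambda>r. ann_coeff (ann_swap G) (- r) * ann_coeff (ann_swap H) (- (n - r))) = ann_coeff (ann_swap (G * H)) (- n)"
    "psummable (\<lambda>r. ann_coeff (ann_swap G) (- r) * ann_coeff (ann_swap H) (- (n - r)))"
proof -
  let ?f = "\<lambda>s. ann_coeff (ann_swap G) s * ann_coeff (ann_swap H) (- n - s)"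
  have b: "bij (uminus :: int \<Rightarrow> int)" by (rule bij_uminus)
  have e: "(\<lambda>r. ?f (- r)) = (\<lambda>r. ann_coeff (ann_swap G) (- r) * ann_coeff (ann_swap H) (- (n - r)))"
    by (simp add: fun_eq_iff)
  show "psum (\<lambda>r. ann_coeff (ann_swap G) (- r) * ann_coeff (ann_swap H) (- (n - r))) = ann_coeff (ann_swap (G * H)) (- n)"
    using psum_reindex(2)[OF b, of ?f] unfolding e ann_coeff_mult(2) ann_swap_mult .
  show "psummable (\<lambda>r. ann_coeff (ann_swap G) (- r) * ann_coeff (ann_swap H) (- (n - r)))"
    using psum_reindex(1)[OF b, of ?f] ann_coeff_mult(1)[of "ann_swap G" "ann_swap H" "- n"] unfolding e by blast
qed

lemma sh_cq_h: "sh (- vK l) (cq (2 * h_fun u)) = cq (2 * h_fun u)" "sh (vK l) (cq (2 * h_fun u)) = cq (2 * h_fun u)"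
  by (simp_all add: sh_cq mshift_hom mshift_numeral mero_shift_h v_dyn v_dyn' v_nth bil_0 rhom_0[OF rhom_mero_const])

text \<open>At \<open>c = 0\<close> the coefficient of \<open>k\<^sup>-\<close> at
  \<open>z^n\<close> carries \<open>p^max(0,n)\<close> where \<open>k\<^sup>+\<close> carries
  \<open>p^max(0,-n)\<close>. This is the coefficient of \<open>ann_swap\<close> at
  \<open>-n\<close>, so the quotient is the same function expanded in the other region.\<close>

lemma hopr_kminus:
  assumes j: "j \<in> {1..CARD('n)}" and l: "l \<in> {1..CARD('n)}"
  shows "hopr (cur_prod (kminus j) (kminus_inv l) n :: 'n::finite alg) (vK j + - vK l) n
    (cq (2 * h_fun (eps j) - 2 * h_fun (eps l)) * ann_coeff (ann_swap (Gs j * GsI l)) (- n))"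
proof -
  let ?hj = "cq (2 * h_fun (eps j)) :: 'n dynfun fps" and ?hl = "cq (- (2 * h_fun (eps l))) :: 'n dynfun fps"
  define c where "c r = ?hj * ann_coeff (ann_swap (Gs j)) (- r)" for r
  define d where "d r = ann_coeff (ann_swap (GsI l)) (- r) * ?hl" for r
  have evq: "ev (nome ^ nat r * qmon 0 (- 2 * r)) = (fps_X ^ nat r :: 'n dynfun fps)" for r
    by (simp add: ev_hom ev_nome ev_qmon cq_0)
  have K: "hopr (kminus j r :: 'n alg) (vK j) r (c r)" for r
  proof -
    have "hopr (fn (qpow (2 * h_fun (eps j))) * (coe (nome ^ nat r * qmon 0 (- 2 * r)) * letter (Kgen j (- r))) :: 'n alg)
        (0 + vK j) (0 + r) (sh (- vK j) (fps_const (qpow (2 * h_fun (eps j)))) * (ev (nome ^ nat r * qmon 0 (- 2 * r)) * Ck j r))"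
      by (rule hopr_mult[OF hopr_fn hopr_coe[OF hopr_Kgen]])
    then show ?thesis
      unfolding kminus_def c_def mult.assoc[of "fn _"] evq fps_const_cq[symmetric] sh_cq_h ann_coeff_swap minus_minus
      by (simp only: Ck_def if_P[OF j] add_0_left)
  qed
  have L: "hopr (kminus_inv l r :: 'n alg) (- vK l) r (d r)" for r
  proof -
    have "hopr (coe (nome ^ nat r * qmon 0 (- 2 * r)) * letter (Kinv l (- r)) * fn (qpow (- (2 * h_fun (eps l)))) :: 'n alg)
        (- vK l + 0) (r + 0) (sh (- 0) (ev (nome ^ nat r * qmon 0 (- 2 * r)) * CkI l r) * fps_const (qpow (- (2 * h_fun (eps l)))))"
      by (rule hopr_mult[OF hopr_coe[OF hopr_Kinv] hopr_fn])
    then show ?thesis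
      unfolding kminus_inv_def d_def evq fps_const_cq[symmetric] ann_coeff_swap minus_minus
      by (simp only: CkI_def if_P[OF l] add_0_right minus_zero sh_0)
  qed
  have x: "psummable (\<lambda>r. kminus j r * kminus_inv l (n - r) :: 'n alg)"
  proof -
    define u where "u r = fn (qpow (2 * h_fun (eps j))) * coe (qmon 0 (- 2 * r)) * (letter (Kgen j (- r)) :: 'n alg)" for r
    define w where "w r = coe (qmon 0 (- 2 * r)) * letter (Kinv l (- r)) * (fn (qpow (- (2 * h_fun (eps l)))) :: 'n alg)" for r
    have u: "kminus j r = fps_X ^ nat r * u r" for r
      unfolding kminus_def u_def coe_hom coe_nome by (simp only: mult.assoc[symmetric] fps_X_power_comm[of "fn _"])
    have w: "kminus_inv l r = fps_X ^ nat r * w r" for r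
      unfolding kminus_inv_def w_def coe_hom coe_nome by (simp only: mult.assoc)
    have "kminus j r * kminus_inv l (n - r) = fps_X ^ (nat r + nat (n - r)) * (u r * w (n - r))" for r
    proof -
      have "kminus j r * kminus_inv l (n - r) = fps_X ^ nat r * (u r * fps_X ^ nat (n - r)) * w (n - r)"
        unfolding u w by (simp only: mult.assoc)
      also have "\<dots> = fps_X ^ nat r * (fps_X ^ nat (n - r) * u r) * w (n - r)" by (simp only: fps_X_power_comm[of "u r"])
      finally show ?thesis by (simp only: power_add mult.assoc)
    qed
    moreover have "finite {r. nat r + nat (n - r) \<le> i}" for i
      by (rule finite_subset[of _ "{n - int i..int i}"]) auto
    ultimately show ?thesis by (simp only: psummable_power)
  qed
  have "psum (\<lambda>r. sh (- (- vK l)) (c r) * d (n - r)) =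
      psum (\<lambda>r. ?hj * ?hl * (ann_coeff (ann_swap (Gs j)) (- r) * ann_coeff (ann_swap (GsI l)) (- (n - r))))"
  proof (rule arg_cong[where f = psum], rule ext)
    fix r
    have "sh (vK l) (ann_coeff (ann_swap (Gs j :: 'n dynfun fps fps)) (- r)) = ann_coeff (ann_swap (Gs j)) (- r)"
      unfolding ann_coeff_swap sh_hom(4,6) sh_X sh_ann ash_Gs_K by (rule refl)
    then show "sh (- (- vK l)) (c r) * d (n - r) =
        ?hj * ?hl * (ann_coeff (ann_swap (Gs j)) (- r) * ann_coeff (ann_swap (GsI l)) (- (n - r)))"
      unfolding c_def d_def minus_minus sh_hom(4) sh_cq_h by (simp only: mult_ac)
  qed
  also have "\<dots> = ?hj * ?hl * ann_coeff (ann_swap (Gs j * GsI l)) (- n)"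
    unfolding ann_coeff_minus_sum(1)[symmetric] by (rule psum_mult_left(2)[OF ann_coeff_minus_sum(2)])
  also have "?hj * ?hl = cq (2 * h_fun (eps j) - 2 * h_fun (eps l))" by (simp flip: cq_add)
  finally have e: "psum (\<lambda>r. sh (- (- vK l)) (c r) * d (n - r)) =
      cq (2 * h_fun (eps j) - 2 * h_fun (eps l)) * ann_coeff (ann_swap (Gs j * GsI l)) (- n)" .
  show ?thesis using hopr_cur_prod[OF K L x] unfolding e .
qed

text \<open>The choice of \<open>gam\<close> makes both sides of the commutation relation agree.\<close>

lemma Gs_difference:
  fixes n :: int
  assumes j: "j \<ge> 1"
  defines "h \<equiv> sw j - sw (j - 1)" and "h' \<equiv> sw (Suc j) - (sw j :: (dynvar, 'n::finite) mero)"
  defines "\<Delta> \<equiv> cq (2 * h - 2 * h') * ann_coeff (ann_swap (Gs j * GsI (Suc j))) (- n) - ann_coeff (Gs j * GsI (Suc j)) n"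
  shows "(cq 1 - cq (- 1)) * (gam * (An (h' + 1) * An h * cq (- (of_int n * xf j)) - An (h + 1) * An h' * cq (- (of_int n * xe j)))) =
    cq (- (of_nat j * of_int n)) * \<Delta>"
proof -
  \<comment> \<open>\<open>q^c\<close> and \<open>q^d\<close> are poles of
    \<open>k_j k_(j+1)^(-1)\<close> in \<open>z\<close>, while \<open>\<alpha>\<close> and
    \<open>\<beta>\<close> come from its two numerator theta functions. The powers of
    \<open>q^j\<close> cancel against the argument \<open>q^(-j) z\<close> in the
    commutator.\<close>
  define \<alpha> where "\<alpha> = of_nat j + 1 - 2 * (sw (j - 1) :: (dynvar, 'n) mero)"
  define \<beta> where "\<beta> = of_nat j + 1 - 2 * (sw (Suc j) :: (dynvar, 'n) mero)"
  define c where "c = 2 * sw j - (of_nat j :: (dynvar, 'n) mero)"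
  define d where "d = c - 2"
  let ?\<Psi> = "Gs j * GsI (Suc j) :: 'n dynfun fps fps"
  have k: "kap = qp fps_X ^ 2 * (qp (fps_X * fps_const (qpow c / qpow d)) * qp (fps_X * fps_const (qpow d / qpow c)))"
    by (simp add: kap_def d_def cq_def divide_inverse qpow_inverse flip: qpow_add)
  have G: "Gs j = Cc (- h) * (thz (qpow \<alpha>) * thI (qpow (- c)))"
    by (simp add: Gs_def \<alpha>_def c_def h_def)
  have H: "GsI (Suc j) = Cc h' * (thz (qpow \<beta>) * thI (qpow (- d)))"
    by (simp add: GsI_def \<beta>_def c_def d_def h'_def algebra_simps)
  have "?\<Psi> * (thz (qpow (- c)) * thz (qpow (- d))) = Cc (- h) * Cc h' * (thz (qpow \<alpha>) * thz (qpow \<beta>)) *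
      ((thz (qpow (- c)) * thI (qpow (- c))) * (thz (qpow (- d)) * thI (qpow (- d))))"
    unfolding G H by (simp only: mult_ac)
  also have "\<dots> = fps_const (fps_const (qpow (h' - h))) * (thz (qpow \<alpha>) * thz (qpow \<beta>))"
    unfolding thz_thI by (simp add: Cc_def cq_def flip: qpow_add)
  finally have \<Psi>: "?\<Psi> * (thz (inverse (qpow c)) * thz (inverse (qpow d))) = fps_const (fps_const (qpow (h' - h))) * (thz (qpow \<alpha>) * thz (qpow \<beta>))"
    unfolding qpow_inverse .
  \<comment> \<open>The quasi-period multiplier is \<open>q^(2h - 2h')\<close>, exactly the factor
    carried by \<open>k\<^sup>-\<close>; the other sums give the arguments of the weights of
    \<open>e_j\<close> and \<open>f_j\<close>.\<close>
  have sum: "\<alpha> + \<beta> + c + d = 2 * h - 2 * h'" "\<alpha> + d = 2 * h - 1" "\<beta> + d = - (2 * (h' + 1) - 1)"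
    "\<alpha> + c = 2 * (h + 1) - 1" "\<beta> + c = - (2 * h' - 1)"
    by (simp_all add: \<alpha>_def \<beta>_def c_def d_def h_def h'_def algebra_simps)
  have th: "th (\<alpha> + d) * th (\<beta> + d) = - cq (h - h') * (An h * An (h' + 1))"
    "th (\<alpha> + c) * th (\<beta> + c) = - cq (h - h' + 2) * (An (h + 1) * An h')"
  proof -
    have "cq h * (cq (- (2 * (h' + 1) - 1)) * cq (h' + 1)) = cq (h - h')"
      "cq (h + 1) * (cq (- (2 * h' - 1)) * cq h') = cq (h - h' + 2)"
      unfolding cq_add[symmetric] by (rule arg_cong[where f = cq], simp add: algebra_simps)+
    note q = this[symmetric]
    show "th (\<alpha> + d) * th (\<beta> + d) = - cq (h - h') * (An h * An (h' + 1))"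
      "th (\<alpha> + c) * th (\<beta> + c) = - cq (h - h' + 2) * (An (h + 1) * An h')"
      unfolding sum th_uminus th_An q by (simp_all add: mult_ac)
  qed
  have main: "kap * ((cq d - cq c) * \<Delta>) = cq (h' - h) *
      (cq (c + of_int (- n) * d) * (th (\<alpha> + d) * th (\<beta> + d)) - cq (d + of_int (- n) * c) * (th (\<alpha> + c) * th (\<beta> + c)))"
    using theta_quotient_difference[OF qpow_nonzero qpow_nonzero qpow_nonzero qpow_nonzero \<Psi>, of n]
    unfolding qpow_powi qpow_add[symmetric] sum(1) cq_def[symmetric] th_def[symmetric] \<Delta>_def[symmetric] k[symmetric] .
  define B where "B = An h * An (h' + 1) * cq (- (of_int n * d)) - An (h + 1) * An h' * cq (- (of_int n * c))"
  have q: "cq (h' - h) * (cq (c + of_int (- n) * d) * cq (h - h')) = cq c * cq (- (of_int n * d))"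
    "cq (h' - h) * (cq (d + of_int (- n) * c) * cq (h - h' + 2)) = cq c * cq (- (of_int n * c))"
    unfolding cq_add[symmetric] by (rule arg_cong[where f = cq], simp add: d_def algebra_simps)+
  have "kap * ((cq d - cq c) * \<Delta>) =
      - (cq (h' - h) * (cq (c + of_int (- n) * d) * cq (h - h')) * (An h * An (h' + 1)) -
         cq (h' - h) * (cq (d + of_int (- n) * c) * cq (h - h' + 2)) * (An (h + 1) * An h'))"
    unfolding main th by (simp add: algebra_simps)
  also have "\<dots> = - (cq c * B)" unfolding q B_def by (simp add: algebra_simps)
  finally have e1: "kap * ((cq d - cq c) * \<Delta>) = - (cq c * B)" .
  define E where "E = cq 1 - (cq (- 1) :: 'n dynfun fps)"
  have dc: "cq d - cq c = - (cq c * (cq (- 1) * E))"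
  proof -
    have "cq d = cq c * (cq (- 1) * cq (- 1))" unfolding cq_add[symmetric] by (rule arg_cong[where f = cq]) (simp add: d_def)
    moreover have "cq (- 1) * cq 1 = (1 :: 'n dynfun fps)" using cq_minus[of 1] by (simp add: mult.commute)
    ultimately show ?thesis by (simp add: E_def right_diff_distrib)
  qed
  have "cq c * (kap * (cq (- 1) * E) * \<Delta>) = cq c * B"
    using e1 unfolding dc by (simp add: mult_ac)
  then have B: "B = kap * (cq (- 1) * E) * \<Delta>" by (simp add: cq_nonzero)
  have g: "gam * kap * E ^ 2 * cq (- 1) = 1"
  proof -
    have "gam * kap * E ^ 2 * cq (- 1) = gam * (kap * (cq 1 - cq (- 1)) ^ 2) * cq (- 1)" by (simp only: E_def mult.assoc)
    then show ?thesis unfolding gam_kap cq_minus .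
  qed
  define J where "J = cq (- (of_nat j * of_int n) :: (dynvar, 'n) mero)"
  have x: "cq (- (of_int n * xf j)) = J * cq (- (of_int n * d))" "cq (- (of_int n * xe j)) = J * cq (- (of_int n * c))"
    unfolding J_def cq_add[symmetric] by (rule arg_cong[where f = cq], simp add: xf_def xe_def c_def d_def algebra_simps)+
  have "E * (gam * (An (h' + 1) * An h * cq (- (of_int n * xf j)) - An (h + 1) * An h' * cq (- (of_int n * xe j)))) = E * (gam * (J * B))"
    unfolding x B_def by (simp add: algebra_simps)
  also have "\<dots> = (gam * kap * E ^ 2 * cq (- 1)) * (J * \<Delta>)"
    unfolding B power2_eq_square by (simp only: mult_ac)
  finally show ?thesis unfolding g mult_1_left unfolding E_def J_def .
qed

lemma hopr_coe':
  assumes "hopr x s n c" "ev y = e" shows "hopr (coe y * x) s n (e * c)"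
  using hopr_coe[OF assms(1), of y] unfolding assms(2) .

text \<open>After the rescaling by \<open>q^j\<close>, the two products on the left are delta
  functions at the two poles of \<open>k_j k_(j+1)^(-1)\<close>, and the right side is the
  difference of its two expansions; \<open>Gs_difference\<close> matches the residues.\<close>

lemma rel_e_f:
  assumes j: "j \<in> {1..<CARD('n)}"
  shows "actr (e_cur j a * f_cur j b - f_cur j b * e_cur j a) v k =
    actr (coe (fps_const (Poly_Mapping.single 0 (1 / (qpow 1 - qpow (-1)))) * kappa) *
       (coe (qmon (- int j * (a + b)) (2 * b)) * cur_prod (kminus j) (kminus_inv (Suc j)) (a + b)
        - coe (qmon (- int j * (a + b)) (2 * a)) * cur_prod (kplus j) (kplus_inv (Suc j)) (a + b)) :: 'n::finite alg) v k"
proof -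
  define n where "n = a + b"
  define h where "h = sw j - (sw (j - 1) :: (dynvar, 'n) mero)"
  define h' where "h' = sw (Suc j) - (sw j :: (dynvar, 'n) mero)"
  define \<Delta> where "\<Delta> = cq (2 * h - 2 * h') * ann_coeff (ann_swap (Gs j * GsI (Suc j))) (- n) - ann_coeff (Gs j * GsI (Suc j) :: 'n dynfun fps fps) n"
  have j1: "j \<ge> 1" and jr: "j \<in> {1..CARD('n)}" "Suc j \<in> {1..CARD('n)}" using j by auto
  have hh: "h_fun (eps j) = h" "h_fun (eps (Suc j)) = h'"
    using h_eps[of j] h_eps[of "Suc j"] j1 by (simp_all add: h_def h'_def)
  let ?E = "cq 1 - cq (- 1) :: 'n dynfun fps"
  define \<delta> where "\<delta> = (ev (fps_const (Poly_Mapping.single 0 (1 / (qpow 1 - qpow (-1)))) * kappa) :: 'n dynfun fps)"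
  have \<delta>: "\<delta> * ?E = 1"
  proof -
    have nz: "qpow 1 - qpow (- 1) \<noteq> (0 :: complex fls)" by (simp add: qpow_inj)
    have E: "?E = fps_const (map_fls mero_const (qpow 1 - qpow (- 1)))"
      by (simp add: cq_def rhom_diff[OF rhom_mc] map_fls_qpow rhom_mero_const rhom_1[OF rhom_mero_const] rhom_uminus[OF rhom_mero_const])
    have D: "\<delta> = fps_const (map_fls mero_const (1 / (qpow 1 - qpow (- 1))))"
      by (simp add: \<delta>_def ev_hom ev_kappa) (simp add: ev_def fps_map_const rhom_ev0 ev0_simps)
    have "\<delta> * ?E = fps_const (map_fls mero_const (1 / (qpow 1 - qpow (- 1)) * (qpow 1 - qpow (- 1))))"
      unfolding E D fps_const_mult rhom_mult[OF rhom_mc] by (rule refl)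
    then show ?thesis using nz by (simp add: rhom_1[OF rhom_mc])
  qed
  have s: "vK j + - vK (Suc j) = vE j + (vF j :: complex^'n^dynvar)" using vK_alpha[of j] by simp
  have r: "hopr (e_cur j a * f_cur j b - f_cur j b * e_cur j a :: 'n alg) (vE j + vF j) n
      (gam * (An (h' + 1) * An h * cq (- (of_int n * xf j)) - An (h + 1) * An h' * cq (- (of_int n * xe j))))"
  proof -
    have ne: "(Suc j = j) = False" "(j = j) = True" "(j - 1 = j) = False" using j1 by auto
    have x: "xe j - 2 = (xf j :: (dynvar, 'n) mero)" "xf j + 2 = (xe j :: (dynvar, 'n) mero)" by (simp_all add: xe_def xf_def)
    have hs: "sw (Suc j) - 0 - (sw j - 1) = h' + 1" "sw j + 1 - (sw (j - 1) + 0) = h + 1"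
      by (simp_all add: h_def h'_def)
    have q: "cq (- (of_int a * y)) * cq (- (of_int b * y)) = cq (- (of_int n * y))" for y :: "(dynvar, 'n) mero"
      unfolding cq_add[symmetric] by (rule arg_cong[where f = cq]) (simp add: n_def algebra_simps)
    have "hopr (e_cur j a * f_cur j b - f_cur j b * e_cur j a :: 'n alg) (vE j + vF j) n
      (An (h' + 1) * cq (- (of_int a * xf j)) * (gam * An h * cq (- (of_int b * xf j))) -
       gam * An (h + 1) * cq (- (of_int b * xe j)) * (An h' * cq (- (of_int a * xe j))))"
      using hopr_diff[OF hopr_ef(1)[OF j j, of a b] hopr_ef(2)[OF j j, of b a]]
      unfolding ne if_True if_False x hs h_def[symmetric] h'_def[symmetric] n_def[symmetric] .
    moreover have "An (h' + 1) * cq (- (of_int a * xf j)) * (gam * An h * cq (- (of_int b * xf j))) -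
       gam * An (h + 1) * cq (- (of_int b * xe j)) * (An h' * cq (- (of_int a * xe j))) =
      gam * (An (h' + 1) * An h * cq (- (of_int n * xf j)) - An (h + 1) * An h' * cq (- (of_int n * xe j)))"
      unfolding q[symmetric] by (simp add: algebra_simps)
    ultimately show ?thesis by (simp only:)
  qed
  have l: "hopr (coe (fps_const (Poly_Mapping.single 0 (1 / (qpow 1 - qpow (-1)))) * kappa) *
       (coe (qmon (- int j * n) (2 * b)) * cur_prod (kminus j) (kminus_inv (Suc j)) n
        - coe (qmon (- int j * n) (2 * a)) * cur_prod (kplus j) (kplus_inv (Suc j)) n) :: 'n alg) (vE j + vF j) n
      (\<delta> * (cq (of_int (- int j * n)) * (cq (2 * h - 2 * h') * ann_coeff (ann_swap (Gs j * GsI (Suc j))) (- n)) -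
        cq (of_int (- int j * n)) * ann_coeff (Gs j * GsI (Suc j)) n))"
    using hopr_coe'[OF hopr_diff[OF hopr_coe'[OF hopr_kminus[OF jr] ev_qmon] hopr_coe'[OF hopr_kk_inv(1)[OF jr] ev_qmon]] \<delta>_def[symmetric]]
    unfolding hh s .
  have gd: "?E * (gam * (An (h' + 1) * An h * cq (- (of_int n * xf j)) - An (h + 1) * An h' * cq (- (of_int n * xe j)))) =
      cq (- (of_nat j * of_int n)) * \<Delta>"
    unfolding h_def h'_def \<Delta>_def by (rule Gs_difference[OF j1])
  have "of_int (- int j * n) = - (of_nat j * of_int n :: (dynvar, 'n) mero)" by simp
  then have "\<delta> * (cq (of_int (- int j * n)) * (cq (2 * h - 2 * h') * ann_coeff (ann_swap (Gs j * GsI (Suc j))) (- n)) -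
        cq (of_int (- int j * n)) * ann_coeff (Gs j * GsI (Suc j)) n) = \<delta> * (cq (- (of_nat j * of_int n)) * \<Delta>)"
    unfolding \<Delta>_def by (simp only: right_diff_distrib)
  also have "\<dots> = \<delta> * (?E * (gam * (An (h' + 1) * An h * cq (- (of_int n * xf j)) - An (h + 1) * An h' * cq (- (of_int n * xe j)))))"
    unfolding gd by (rule refl)
  also have "\<dots> = gam * (An (h' + 1) * An h * cq (- (of_int n * xf j)) - An (h + 1) * An h' * cq (- (of_int n * xe j)))"
    unfolding mult.assoc[of \<delta>, symmetric] \<delta> by simp
  finally have e: "\<delta> * (cq (of_int (- int j * n)) * (cq (2 * h - 2 * h') * ann_coeff (ann_swap (Gs j * GsI (Suc j))) (- n)) -
        cq (of_int (- int j * n)) * ann_coeff (Gs j * GsI (Suc j)) n) =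
      gam * (An (h' + 1) * An h * cq (- (of_int n * xf j)) - An (h + 1) * An h' * cq (- (of_int n * xe j)))" .
  show ?thesis
    using hopr_eq[OF r l[unfolded e]] unfolding n_def .
qed

subsection \<open>All relations\<close>

lemma rel_act:
  fixes u w :: "'n::finite alg"
  assumes "uqp_rel u w" shows "actr u v k = actr w v k"
  using assms
proof (induction rule: uqp_rel.induct)
  case (e_range j m)
  show ?case using hopr_zero[OF hopr_range(1)[OF e_range], of "- m"] by (simp add: e_cur_def actr_0)
next
  case (f_range j m)
  show ?case using hopr_zero[OF hopr_range(2)[OF f_range], of "- m"] by (simp add: f_cur_def actr_0)
next
  case (k_range l m)
  show ?case using hopr_zero[OF hopr_range(3)[OF k_range], of "- m"] by (simp add: actr_0)
next
  case (kinv_range l m)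
  show ?case using hopr_zero[OF hopr_range(4)[OF kinv_range], of "- m"] by (simp add: actr_0)
next
  case fn_add
  show ?case by (rule rel_fn)
next
  case fn_mult
  show ?case by (rule rel_fn)
next
  case fn_const
  show ?case by (rule rel_fn)
next
  case (kk_inv l n)
  then show ?case by (rule rel_kk_inv)
next
  case (inv_kk l n)
  then show ?case by (rule rel_kk_inv)
next
  case (Ph_e g j n)
  show ?case unfolding fn_Ph_at by (rule hopr_fn_at[OF hopr_e]) (simp add: v_nth shift1_0)
next
  case (P_e g j n)
  show ?case unfolding fn_P_at by (rule hopr_fn_at[OF hopr_e]) (simp add: v_nth res_P_Qel alpha_zsum)
next
  case (Ph_f g j n)
  show ?case unfolding fn_Ph_at by (rule hopr_fn_at[OF hopr_f]) (simp add: v_nth res_Ph_hstar_el alpha_zsum)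
next
  case (P_f g j n)
  show ?case unfolding fn_P_at by (rule hopr_fn_at[OF hopr_f]) (simp add: v_nth shift1_0)
next
  case (P_k g l n)
  show ?case unfolding fn_P_at by (rule hopr_fn_at[OF hopr_k]) (simp add: v_nth res_P_Qel eps_zsum)
next
  case (Ph_k g l n)
  show ?case unfolding fn_Ph_at by (rule hopr_fn_at[OF hopr_k]) (simp add: v_nth res_P_Qel eps_zsum)
next
  case (d_fn g)
  have "actr (letter Dgen * fn g - fn g * letter Dgen) v k = actr (- of_int 0 * fn g) v k"
    by (rule hopr_D[OF hopr_fn])
  then show ?case by (simp add: actr_diff actr_0)
next
  case d_e
  show ?case by (rule hopr_D[OF hopr_e])
next
  case d_f
  show ?case by (rule hopr_D[OF hopr_f])
next
  case d_k
  show ?case by (rule hopr_D[OF hopr_k])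
next
  case (k_k l a b)
  show ?case by (rule rel_k_k[OF k_k k_k evs_rho evs_rho])
next
  case (k_k' j l a b)
  have j: "j \<in> {1..CARD('n)}" "l \<in> {1..CARD('n)}" using k_k' by auto
  have c: "evs (qfrac nome_star (nome_star * qmon 2 0) nome_star * qfrac (nome * qmon 2 0) nome nome) = (1 :: 'n dynfun fps fps)"
    "evs (qfrac (qmon (-2) 0) 1 nome_star * qfrac 1 (qmon (-2) 0) nome) = (1 :: 'n dynfun fps fps)"
    by (rule evs_qfrac_cancel[OF nomes(2,1)]; simp add: ev_hom ev_nome ev_nome_star)+
  show ?case
    by (rule rel_k_k[OF j]) (simp_all only: rhom_mult[OF rhom_evs, of "rho _"] evs_rho c mult_1_right)
next
  case k_e
  then show ?case by (rule rel_k_e_f)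
next
  case k_e'
  then show ?case by (rule rel_k_e_f)
next
  case k_f
  then show ?case by (rule rel_k_e_f)
next
  case k_f'
  then show ?case by (rule rel_k_e_f)
next
  case k_e_comm
  then show ?case by (rule rel_k_comm)
next
  case k_f_comm
  then show ?case by (rule rel_k_comm)
next
  case e_e
  then show ?case by (rule rel_e_e)
next
  case e_e'
  then show ?case by (rule rel_e_e')
next
  case f_f
  then show ?case by (rule rel_f_f)
next
  case f_f'
  then show ?case by (rule rel_f_f')
next
  case e_e_comm
  then show ?case by (rule rel_e_e_comm)
next
  case f_f_comm
  then show ?case by (rule rel_f_f_comm)
next
  case (e_f i j a b)
  show ?case
  proof (cases "i = j")
    case True
    show ?thesis unfolding True if_P[OF refl] by (rule rel_e_f[OF e_f(2)])
  next
    case False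
    show ?thesis unfolding if_not_P[OF False] actr_0 by (rule rel_e_f_neq[OF e_f False])
  qed
next
  case (serre_e i j S a b c)
  show ?case unfolding serre_e(4) actr_add rel_serre_e[OF serre_e(1-3)] actr_0 by simp
next
  case (serre_f i j S a b c)
  show ?case unfolding serre_f(4) actr_add rel_serre_f[OF serre_f(1-3)] actr_0 by simp
qed

text \<open>On the constant loop 1 the moment map of \<open>f\<close> returns \<open>f\<close>
  itself, evaluated at the chosen dynamical variables: functions act by multiplication and both
  nomes act as \<open>p\<close>. Evaluation at one set of variables is injective, being a
  homomorphism of fields.\<close>

lemma mom_inj:
  assumes "mom b f \<in> uqp_ideal" shows "f = (0 :: 'n::finite momfun)"
proof -
  let ?g = "fps_map (map_fls (mero_at b)) f :: 'n dynfun fps"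
  let ?x = "\<lambda>n. fn_at b (fps_nth f n) * (coe (mnome b ^ n) :: 'n alg)"
  have fn: "actr (fn h) v k = fps_const h * v k" for h :: "'n dynfun" and v k
    using hopr_fn[of h] by (simp add: hopr_def op_def sh_0)
  have "ev (mnome b) = (fps_X :: 'n dynfun fps)"
    by (cases b) (simp_all add: mnome_def ev_nome ev_nome_star)
  then have x: "actr (?x n) (\<lambda>_. 1) 0 = fps_X ^ n * fps_const (fps_nth ?g n)" for n
    by (simp add: fn_at_def actr_mult fn actr_coe ev_hom mult.commute)
  have "actr (mom b f) (\<lambda>_. 1) 0 = psum (\<lambda>n. actr (?x n) (\<lambda>_. 1) 0)"
    unfolding mom_def by (rule act_psum(2)[OF monop_Lrep psummable_mom])
  also have "\<dots> = ?g" unfolding x by (rule psum_const_X(2))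
  finally have "?g = 0" using uqp_ideal_act[OF monop_Lrep rel_act assms, of "\<lambda>_. 1" 0] by simp
  then have "map_fls (mero_at b) (fps_nth f n) = (0 :: 'n dynfun)" for n
    by (metis fps_map_nth fps_zero_nth)
  then show ?thesis by (simp add: fps_eq_iff rhom_eq_0[OF rhom_at])
qed

theorem proposition4p3:
  assumes "2 \<le> CARD('n::finite)"
  shows "adic_H_algebra (uqp :: (complex fls, 'n alg set) module) (to_uqp (coe nome))
    Hstar res_Ph res_P uqp_comp mom_const mom_shift mu_l mu_r"
  by (rule adic_H_algebra_uqp) (rule mom_inj)

end
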